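(* Let $A$ be a recursive subhomogeneous algebra with total space $X$, and with topological dimension function $d \colon X \to \mathbf{N} \cup \{0\}$. Let $p, e, f, q \in M_\infty(A)$ be projections. (1) If for every $x \in X$, either $\mathrm{ev}_x(q) = 0$ or $\mathrm{rank}(\mathrm{ev}_x(p)) - \mathrm{rank}(\mathrm{ev}_x(q)) \geq \frac{1}{2}[d(x) - 1]$, then $q \precsim p$. (2) If $e \oplus q \sim f \oplus q$ and $\mathrm{rank}(\mathrm{ev}_x(e)) \geq \frac{1}{2} d(x)$ for every $x \in X$, then $e \sim f$.
   Context: Homomorphisms of C*-algebras are *-homomorphisms, and $M_n = M_n(\mathbf{C})$. Recursive subhomogeneous algebras. The class is defined recursively: (i) if $X$ is a compact Hausdorff space and $n \geq 1$, then $C(X, M_n)$ is a recursive subhomogeneous algebra; (ii) if $A$ is a recursive subhomogeneous algebra, $X$ is compact Hausdorff, $X^{(0)} \subset X$ is closed (possibly empty), $\varphi \colon A \to C(X^{(0)}, M_n)$ is any unital homomorphism and $\rho \colon C(X, M_n) \to C(X^{(0)}, M_n)$ is restriction, then the pullback $A \oplus_{C(X^{(0)}, M_n)} C(X, M_n) = \{(a,f) \in A \oplus C(X, M_n) : \varphi(a) = \rho(f)\}$ is a recursive subhomogeneous algebra. The zero algebra is also allowed. Every such algebra $R$ comes with a given decomposition as an iterated pullback: compact Hausdorff spaces $X_0, \dots, X_l$, positive integers $n(0), \dots, n(l)$, closed subsets $X_k^{(0)} \subset X_k$ ($1 \leq k \leq l$), $C_k = C(X_k, M_{n(k)})$, $C_k^{(0)}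 = C(X_k^{(0)}, M_{n(k)})$, with $R^{(0)} = C_0$, $R^{(k)} = R^{(k-1)} \oplus_{C_k^{(0)}} C_k$ formed using a unital homomorphism $R^{(k-1)} \to C_k^{(0)}$ and the restriction map $C_k \to C_k^{(0)}$, and $R = R^{(l)}$. Its total space is $X = \coprod_{k=0}^l X_k$. Its topological dimension function is $d(x) = \dim(X_k)$ (covering dimension, here finite) for $x \in X_k$. Forgetting the pullback conditions embeds $R$ in $\bigoplus_{k=0}^l C(X_k, M_{n(k)})$, and for $x \in X_k$ the evaluation map $\mathrm{ev}_x \colon R \to M_{n(k)}$ is the restriction to $R$ of evaluation at $x$ on the summand $C(X_k, M_{n(k)})$. $M_\infty(A)$ is the algebraic direct limit of the $M_n(A)$ under $a \mapsto a \oplus 0$, and $\mathrm{ev}_x$ is extended entrywise to $M_\infty(A)$. For projections, $p \sim q$ is Murray-von Neumann equivalence, $q \precsim p$ means that $q$ is Murray-von Neumann equivalent to a subprojection of $p$, and $e \oplus q$ is the block diagonal sum (both taken in $M_\infty(A)$). *)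

theory Defs
  imports
    "HOL-Analysis.T1_Spaces"
    "Jordan_Normal_Form.Schur_Decomposition"
    "Jordan_Normal_Form.DL_Rank"
begin

section \<open>Covering dimension\<close>

text \<open>Lebesgue covering dimension, by finite open covers (the customary form for normal spaces).
  The library's \<open>dim_le\<close> is the small inductive dimension, which may differ from it on
  non-metrizable compact Hausdorff spaces.\<close>

definition covering_dim_le :: "'x topology \<Rightarrow> nat \<Rightarrow> bool" where
  "covering_dim_le X d \<longleftrightarrow>
    (\<forall>\<U>. finite \<U> \<and> (\<forall>U\<in>\<U>. openin X U) \<and> \<Union>\<U> = topspace X \<longrightarrow>
      (\<exists>\<V>. finite \<V> \<and> (\<forall>V\<in>\<V>. openin X V) \<and> \<Union>\<V> = topspace X \<and>
           (\<forall>V\<in>\<V>. \<exists>U\<in>\<U>. V \<subseteq> U) \<and>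
           (\<forall>x\<in>topspace X. card {V\<in>\<V>. x \<in> V} \<le> d + 1)))"

definition finite_covering_dim :: "'x topology \<Rightarrow> bool" where
  "finite_covering_dim X \<longleftrightarrow> (\<exists>d. covering_dim_le X d)"

text \<open>Meaningful when the dimension is finite. The empty space gets the value 0 instead of
  \<open>-1\<close>; the dimension function of an algebra is evaluated at points only, so this plays no role.\<close>

definition covering_dim :: "'x topology \<Rightarrow> nat" where
  "covering_dim X = (LEAST d. covering_dim_le X d)"


section \<open>Star algebras\<close>

record 'b star_algebra = "(complex, 'b) module" +
  star :: "'b \<Rightarrow> 'b"

definition unital_star_hom :: "'a star_algebra \<Rightarrow> 'b star_algebra \<Rightarrow> ('a \<Rightarrow> 'b) \<Rightarrow> bool" where
  "unital_star_hom A B \<phi> \<longleftrightarrow>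
     \<phi> \<in> Ring.ring_hom A B \<and>
     (\<forall>c. \<forall>a\<in>carrier A. \<phi> (c \<odot>\<^bsub>A\<^esub> a) = c \<odot>\<^bsub>B\<^esub> \<phi> a) \<and>
     (\<forall>a\<in>carrier A. \<phi> (star A a) = star B (\<phi> a))"

text \<open>\<open>C(X, M\<^sub>n)\<close>. Functions are extensional (\<open>undefined\<close> off the space), so that HOL equality is
  equality of functions on \<open>X\<close>; continuity is entrywise.\<close>

definition cont_matrix_algebra :: "'x topology \<Rightarrow> nat \<Rightarrow> ('x \<Rightarrow> complex mat) star_algebra" where
  "cont_matrix_algebra X n =
    \<lparr> carrier = {f \<in> topspace X \<rightarrow>\<^sub>E carrier_mat n n.
                  \<forall>i<n. \<forall>j<n. continuous_map X euclidean (\<lambda>x. f x $$ (i, j))},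
      monoid.mult = (\<lambda>f g. \<lambda>x\<in>topspace X. f x * g x),
      one = (\<lambda>x\<in>topspace X. 1\<^sub>m n),
      zero = (\<lambda>x\<in>topspace X. 0\<^sub>m n n),
      add = (\<lambda>f g. \<lambda>x\<in>topspace X. f x + g x),
      module.smult = (\<lambda>c f. \<lambda>x\<in>topspace X. c \<cdot>\<^sub>m f x),
      star = (\<lambda>f. \<lambda>x\<in>topspace X. mat_adjoint (f x)) \<rparr>"


section \<open>Recursive subhomogeneous algebras\<close>

text \<open>A decomposition, with \<open>rsh_length = l\<close>, \<open>rsh_space k = X\<^sub>k\<close>, \<open>rsh_size k = n(k)\<close>,
  \<open>rsh_bdry k = X\<^sub>k\<^sup>(\<^sup>0\<^sup>)\<close> and \<open>rsh_attach k\<close> the unital homomorphism from the stage before \<open>k\<close> to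
  \<open>C(X\<^sub>k\<^sup>(\<^sup>0\<^sup>), M\<^bsub>n(k)\<^esub>)\<close>; the last two are used for \<open>1 \<le> k \<le> l\<close> only.
  All spaces live on one type, which is no restriction as finitely many
  spaces embed in the sum of their underlying types.\<close>

record 'x rsh_data =
  rsh_length :: nat
  rsh_space :: "nat \<Rightarrow> 'x topology"
  rsh_size :: "nat \<Rightarrow> nat"
  rsh_bdry :: "nat \<Rightarrow> 'x set"
  rsh_attach :: "nat \<Rightarrow> (nat \<Rightarrow> 'x \<Rightarrow> complex mat) \<Rightarrow> 'x \<Rightarrow> complex mat"

definition rsh_summand :: "'x rsh_data \<Rightarrow> nat \<Rightarrow> ('x \<Rightarrow> complex mat) star_algebra" where
  "rsh_summand D k = cont_matrix_algebra (rsh_space D k) (rsh_size D k)"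

definition rsh_bdry_algebra :: "'x rsh_data \<Rightarrow> nat \<Rightarrow> ('x \<Rightarrow> complex mat) star_algebra" where
  "rsh_bdry_algebra D k =
     cont_matrix_algebra (subtopology (rsh_space D k) (rsh_bdry D k)) (rsh_size D k)"

text \<open>An element of the \<open>k\<close>-th stage is the tuple of its components in the summands \<open>0, ..., k\<close>
  (and \<open>undefined\<close> at larger indices); a pair \<open>(a, f)\<close> in the pullback is the tuple \<open>a(Suc k := f)\<close>.\<close>

primrec rsh_stage_carrier :: "'x rsh_data \<Rightarrow> nat \<Rightarrow> (nat \<Rightarrow> 'x \<Rightarrow> complex mat) set" where
  "rsh_stage_carrier D 0 = (\<Pi>\<^sub>E j\<in>{..0}. carrier (rsh_summand D j))"
| "rsh_stage_carrier D (Suc k) =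
     {a(Suc k := f) | a f. a \<in> rsh_stage_carrier D k \<and> f \<in> carrier (rsh_summand D (Suc k)) \<and>
        rsh_attach D (Suc k) a = restrict f (rsh_bdry D (Suc k))}"

definition rsh_stage :: "'x rsh_data \<Rightarrow> nat \<Rightarrow> (nat \<Rightarrow> 'x \<Rightarrow> complex mat) star_algebra" where
  "rsh_stage D k =
    \<lparr> carrier = rsh_stage_carrier D k,
      monoid.mult = (\<lambda>a b. \<lambda>j\<in>{..k}. a j \<otimes>\<^bsub>rsh_summand D j\<^esub> b j),
      one = (\<lambda>j\<in>{..k}. \<one>\<^bsub>rsh_summand D j\<^esub>),
      zero = (\<lambda>j\<in>{..k}. \<zero>\<^bsub>rsh_summand D j\<^esub>),
      add = (\<lambda>a b. \<lambda>j\<in>{..k}. a j \<oplus>\<^bsub>rsh_summand D j\<^esub> b j),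
      module.smult = (\<lambda>c a. \<lambda>j\<in>{..k}. c \<odot>\<^bsub>rsh_summand D j\<^esub> a j),
      star = (\<lambda>a. \<lambda>j\<in>{..k}. star (rsh_summand D j) (a j)) \<rparr>"

text \<open>The spaces may be empty, so the zero algebra is included (length 0 over the empty space).\<close>

definition rsh_decomposition :: "'x rsh_data \<Rightarrow> bool" where
  "rsh_decomposition D \<longleftrightarrow>
     (\<forall>k\<le>rsh_length D.
        compact_space (rsh_space D k) \<and> Hausdorff_space (rsh_space D k) \<and> 1 \<le> rsh_size D k) \<and>
     (\<forall>k<rsh_length D.
        closedin (rsh_space D (Suc k)) (rsh_bdry D (Suc k)) \<and>
        unital_star_hom (rsh_stage D k) (rsh_bdry_algebra D (Suc k)) (rsh_attach D (Suc k)))"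

definition rsh_algebra :: "'x rsh_data \<Rightarrow> (nat \<Rightarrow> 'x \<Rightarrow> complex mat) star_algebra" where
  "rsh_algebra D = rsh_stage D (rsh_length D)"

definition rsh_total_space :: "'x rsh_data \<Rightarrow> (nat \<times> 'x) set" where
  "rsh_total_space D = (SIGMA k:{..rsh_length D}. topspace (rsh_space D k))"

definition rsh_topdim :: "'x rsh_data \<Rightarrow> nat \<times> 'x \<Rightarrow> nat" where
  "rsh_topdim D x = covering_dim (rsh_space D (fst x))"

definition rsh_ev :: "nat \<times> 'x \<Rightarrow> (nat \<Rightarrow> 'x \<Rightarrow> complex mat) \<Rightarrow> complex mat" where
  "rsh_ev x a = a (fst x) (snd x)"


section \<open>Matrices over a star algebra\<close>

text \<open>The direct limit \<open>M\<^sub>\<infinity>(A)\<close> consists of the infinite matrices with finite support; \<open>M\<^sub>m(A)\<close> is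
  identified with its image, the matrices vanishing outside the upper left \<open>m \<times> m\<close> corner.\<close>

definition matrices :: "'b star_algebra \<Rightarrow> nat \<Rightarrow> (nat \<Rightarrow> nat \<Rightarrow> 'b) set" where
  "matrices A m =
     {a. (\<forall>i j. a i j \<in> carrier A) \<and> (\<forall>i j. m \<le> i \<or> m \<le> j \<longrightarrow> a i j = \<zero>\<^bsub>A\<^esub>)}"

definition matrices_inf :: "'b star_algebra \<Rightarrow> (nat \<Rightarrow> nat \<Rightarrow> 'b) set" where
  "matrices_inf A = (\<Union>m. matrices A m)"

text \<open>Restricting to nonzero terms makes the sum finite for finitely supported matrices.\<close>

definition minf_mult ::
  "'b star_algebra \<Rightarrow> (nat \<Rightarrow> nat \<Rightarrow> 'b) \<Rightarrow> (nat \<Rightarrow> nat \<Rightarrow> 'b) \<Rightarrow> nat \<Rightarrow> nat \<Rightarrow> 'b" where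
  "minf_mult A a b =
     (\<lambda>i j. \<Oplus>\<^bsub>A\<^esub>r\<in>{r. a i r \<otimes>\<^bsub>A\<^esub> b r j \<noteq> \<zero>\<^bsub>A\<^esub>}. a i r \<otimes>\<^bsub>A\<^esub> b r j)"

definition minf_star :: "'b star_algebra \<Rightarrow> (nat \<Rightarrow> nat \<Rightarrow> 'b) \<Rightarrow> nat \<Rightarrow> nat \<Rightarrow> 'b" where
  "minf_star A a = (\<lambda>i j. star A (a j i))"

definition is_projection :: "'b star_algebra \<Rightarrow> (nat \<Rightarrow> nat \<Rightarrow> 'b) \<Rightarrow> bool" where
  "is_projection A p \<longleftrightarrow> p \<in> matrices_inf A \<and> minf_mult A p p = p \<and> minf_star A p = p"

definition mvn_equiv ::
  "'b star_algebra \<Rightarrow> (nat \<Rightarrow> nat \<Rightarrow> 'b) \<Rightarrow> (nat \<Rightarrow> nat \<Rightarrow> 'b) \<Rightarrow> bool" where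
  "mvn_equiv A p q \<longleftrightarrow>
     (\<exists>v\<in>matrices_inf A. minf_mult A (minf_star A v) v = p \<and> minf_mult A v (minf_star A v) = q)"

definition subprojection ::
  "'b star_algebra \<Rightarrow> (nat \<Rightarrow> nat \<Rightarrow> 'b) \<Rightarrow> (nat \<Rightarrow> nat \<Rightarrow> 'b) \<Rightarrow> bool" where
  "subprojection A r p \<longleftrightarrow> is_projection A r \<and> minf_mult A p r = r"

definition mvn_subequiv ::
  "'b star_algebra \<Rightarrow> (nat \<Rightarrow> nat \<Rightarrow> 'b) \<Rightarrow> (nat \<Rightarrow> nat \<Rightarrow> 'b) \<Rightarrow> bool" where
  "mvn_subequiv A q p \<longleftrightarrow> (\<exists>r. subprojection A r p \<and> mvn_equiv A q r)"

text \<open>Block diagonal sum of \<open>a \<in> M\<^sub>m(A)\<close> and \<open>b \<in> M\<^sub>\<infinity>(A)\<close>. It depends on \<open>m\<close>, and for \<open>a \<in> M\<^sub>\<infinity>(A)\<close>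
  it is well defined up to Murray-von Neumann equivalence only.\<close>

definition block_sum ::
  "'b star_algebra \<Rightarrow> nat \<Rightarrow> (nat \<Rightarrow> nat \<Rightarrow> 'b) \<Rightarrow> (nat \<Rightarrow> nat \<Rightarrow> 'b) \<Rightarrow> nat \<Rightarrow> nat \<Rightarrow> 'b" where
  "block_sum A m a b = (\<lambda>i j.
     if i < m \<and> j < m then a i j
     else if m \<le> i \<and> m \<le> j then b (i - m) (j - m)
     else \<zero>\<^bsub>A\<^esub>)"

definition rsh_ev_inf ::
  "nat \<times> 'x \<Rightarrow> (nat \<Rightarrow> nat \<Rightarrow> nat \<Rightarrow> 'x \<Rightarrow> complex mat) \<Rightarrow> nat \<Rightarrow> nat \<Rightarrow> complex mat" where
  "rsh_ev_inf x a = (\<lambda>i j. rsh_ev x (a i j))"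

text \<open>Rank of an element \<open>b\<close> of \<open>M\<^sub>\<infinity>(M\<^sub>n)\<close>: the rank of the complex \<open>mn \<times> mn\<close> matrix with blocks
  \<open>b i j\<close>, where \<open>b \<in> M\<^sub>m(M\<^sub>n)\<close>. Enlarging \<open>m\<close> adds zero rows and columns, so the choice of the
  least \<open>m\<close> is immaterial.\<close>

definition minf_rank :: "nat \<Rightarrow> (nat \<Rightarrow> nat \<Rightarrow> complex mat) \<Rightarrow> nat" where
  "minf_rank n b =
     (let m = (LEAST m. \<forall>i j. m \<le> i \<or> m \<le> j \<longrightarrow> b i j = 0\<^sub>m n n)
      in vec_space.rank (m * n)
           (mat (m * n) (m * n) (\<lambda>(r, s). b (r div n) (s div n) $$ (r mod n, s mod n))))"

definition rsh_rank ::
  "'x rsh_data \<Rightarrow> nat \<times> 'x \<Rightarrow> (nat \<Rightarrow> nat \<Rightarrow> nat \<Rightarrow> 'x \<Rightarrow> complex mat) \<Rightarrow> nat" where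
  "rsh_rank D x p = minf_rank (rsh_size D (fst x)) (rsh_ev_inf x p)"

definition rsh_ev_zero ::
  "'x rsh_data \<Rightarrow> nat \<times> 'x \<Rightarrow> (nat \<Rightarrow> nat \<Rightarrow> nat \<Rightarrow> 'x \<Rightarrow> complex mat) \<Rightarrow> bool" where
  "rsh_ev_zero D x p \<longleftrightarrow>
     rsh_ev_inf x p = (\<lambda>i j. 0\<^sub>m (rsh_size D (fst x)) (rsh_size D (fst x)))"

end

theory Submission
  imports Defs "HOL-Analysis.Urysohn" "HOL-Analysis.Lipschitz"
begin

text \<open>A matrix over a recursive subhomogeneous algebra is a family of continuous matrix-valued functions on
  the spaces \<open>X\<^sub>k\<close>, whose values on the boundary \<open>X\<^sub>k\<^sup>(\<^sup>0\<^sup>)\<close> are prescribed, through the attaching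
  homomorphism, by the components before the \<open>k\<close>-th. So both assertions are proved by induction over the stages,
  and each step is a relative problem over a single compact Hausdorff space: something given on a closed
  subset has to be extended.

  \<^bold>\<open>Comparison.\<close> An isometry from \<open>q\<close> into \<open>p\<close> is extended from the boundary (\<open>extend_isometry\<close>). Locally \<open>q\<close> has an
  orthonormal frame, and the images of its vectors are extended one by one, each as a unit vector in the
  complement of those already extended. If the complement has rank \<open>r\<close>, this amounts to
  extending a map into the sphere of real dimension \<open>2 r - 1\<close>, which is possible if the covering dimension \<open>d\<close> is
  less than \<open>2 r\<close>: a map into \<open>\<real>\<^sup>M\<close> from a space of dimension less than \<open>M\<close> can be perturbed so as not to
  vanish (\<open>nonvanishing_approximation\<close>), by moving finitely many of its values into general position. The smallest
  rank that occurs is \<open>rank p - rank q + 1\<close>, which explains the bound \<open>(d - 1) / 2\<close>.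

  \<^bold>\<open>Cancellation.\<close> An equivalence \<open>w\<close> of \<open>e \<oplus> q\<close> with \<open>f \<oplus> q\<close> maps the first copy of \<open>q\<close> somewhere into \<open>f \<oplus> q\<close>; if it can be
  rotated there onto the second copy, \<open>w\<close> becomes an equivalence of the complements \<open>e\<close> and \<open>f\<close>. So two isometries \<open>t\<close>
  and \<open>s\<close> into the same projection \<open>F\<close> have to be carried to each other by a unitary of \<open>F\<close> over the whole algebra, when the
  complement of their ranges has rank at least \<open>d / 2\<close>. Unitaries need not lift through surjections, but
  Cayley transforms of skew-adjoint elements do, since skew-adjoint elements do; so the unitary is sought
  as a product of Cayley transforms. Over a single space, with \<open>t = s\<close> on a closed subset, the frame of the
  source is again moved vector by vector (\<open>move_isometry\<close>). One Cayley transform, depending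
  continuously on the data, rotates a unit vector to any other unit vector that is not antipodal to it.
  The vector \<open>\<eta>\<close> to be moved may be antipodal to its target \<open>\<zeta>\<close> somewhere; but \<open>- \<zeta>\<close> is one point in a
  sphere, and general position moves a small perturbation of \<open>\<eta>\<close> away from it (\<open>move_vector_framed\<close>), so that two rotations
  suffice. In the induction over the stages (\<open>stage_move\<close>) the parameters of the unitary found so far are extended
  from the boundary, and the remaining discrepancy vanishes there.

  Ranks are computed as traces (\<open>rank_eq_tr\<close>) when the hypotheses are compared with those of the extension theorems.\<close>

section \<open>General position\<close>

text \<open>Elimination of the last unknown with the help of one equation in which it occurs, if there is one,
  leaves one equation and one unknown less.\<close>

lemma underdetermined_system:
  fixes y :: "'i \<Rightarrow> nat \<Rightarrow> real"
  assumes "finite S" "card S < M"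
  shows "\<exists>l. (\<exists>j<M. l j \<noteq> 0) \<and> (\<forall>i\<in>S. (\<Sum>j<M. l j * y i j) = 0)"
  using assms
proof (induction M arbitrary: S y)
  case 0
  then show ?case by simp
next
  case (Suc M)
  show ?case
  proof (cases "\<forall>i\<in>S. y i M = 0")
    case True
    have "(\<Sum>j<Suc M. (if j = M then 1 else 0) * y i j) = 0" if "i \<in> S" for i
      using True that by simp
    then show ?thesis by (intro exI[of _ "\<lambda>j. if j = M then 1 else 0"]) auto
  next
    case False
    then obtain i0 where i0: "i0 \<in> S" "y i0 M \<noteq> 0" by auto
    have "card (S - {i0}) < M" "finite (S - {i0})"
      using Suc.prems i0 card_gt_0_iff[of S] by (auto simp: card_Diff_singleton_if)
    from Suc.IH[OF this(2,1), of "\<lambda>i j. y i j - y i M / y i0 M * y i0 j"]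
    obtain l where l: "\<exists>j<M. l j \<noteq> 0"
      "\<And>i. i \<in> S - {i0} \<Longrightarrow> (\<Sum>j<M. l j * (y i j - y i M / y i0 M * y i0 j)) = 0" by blast
    define A where "A = (\<Sum>j<M. l j * y i0 j)"
    define l' where "l' = l(M := - A / y i0 M)"
    have eq: "(\<Sum>j<Suc M. l' j * y i j) = (\<Sum>j<M. l j * y i j) - A / y i0 M * y i M" for i
      by (simp add: l'_def)
    have "(\<Sum>j<Suc M. l' j * y i j) = 0" if "i \<in> S" for i
    proof (cases "i = i0")
      case True
      then show ?thesis using eq[of i] i0 by (simp add: A_def)
    next
      case False
      have "(\<Sum>j<M. l j * (y i j - y i M / y i0 M * y i0 j)) = (\<Sum>j<M. l j * y i j) - y i M / y i0 M * A"
        unfolding A_def by (simp add: sum_subtractf sum_distrib_left algebra_simps)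
      then show ?thesis using eq[of i] l(2)[of i] that False by simp
    qed
    moreover have "\<exists>j<Suc M. l' j \<noteq> 0" using l(1) by (auto simp: l'_def intro: less_SucI)
    ultimately show ?thesis by blast
  qed
qed

text \<open>Along the curve \<open>t \<mapsto> a + (t, t\<^sup>2, \<dots>, t\<^sup>M)\<close> every nonzero linear form \<open>l\<close> becomes a nonzero
  polynomial in \<open>t\<close>, because its coefficients reappear as those of distinct powers of \<open>t\<close>. So only
  finitely many parameters are bad for one of the forms in \<open>L\<close>, and a small good one exists.\<close>

lemma point_off_hyperplanes:
  fixes a :: "nat \<Rightarrow> real"
  assumes "finite L" "\<And>l. l \<in> L \<Longrightarrow> \<exists>j<M. l j \<noteq> 0" "\<epsilon> > 0"
  shows "\<exists>z. (\<forall>j<M. \<bar>z j - a j\<bar> \<le> \<epsilon>) \<and> (\<forall>l\<in>L. (\<Sum>j<M. l j * z j) \<noteq> 0)"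
proof -
  define P where "P l = [:\<Sum>j<M. l j * a j:] + (\<Sum>j<M. monom (l j) (Suc j))" for l :: "nat \<Rightarrow> real"
  have P0: "P l \<noteq> 0" if lL: "l \<in> L" for l
  proof -
    obtain j where j: "j < M" "l j \<noteq> 0" using assms(2)[OF lL] by blast
    have "coeff (P l) (Suc j) = l j"
      using j by (simp add: P_def coeff_sum if_distrib cong: if_cong)
    then show ?thesis using j by auto
  qed
  have "finite (\<Union>l\<in>L. {t. poly (P l) t = 0})"
    using assms(1) P0 poly_roots_finite by auto
  moreover have "infinite {0<..<min \<epsilon> 1}" using assms(3) by simp
  ultimately obtain t where t: "t \<in> {0<..<min \<epsilon> 1}" "t \<notin> (\<Union>l\<in>L. {t. poly (P l) t = 0})"
    by (meson finite_subset subsetI)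
  show ?thesis
  proof (intro exI conjI allI ballI impI)
    fix j
    have "t ^ Suc j \<le> t ^ 1" using t by (intro power_decreasing) auto
    also have "t ^ 1 \<le> \<epsilon>" using t by simp
    finally have "\<bar>t ^ Suc j\<bar> \<le> \<epsilon>" using t by (subst abs_of_nonneg) auto
    then show "\<bar>(a j + t ^ Suc j) - a j\<bar> \<le> \<epsilon>" by simp
  next
    fix l assume "l \<in> L"
    have "poly (P l) t = (\<Sum>j<M. l j * (a j + t ^ Suc j))"
      by (simp add: P_def poly_sum poly_monom sum.distrib algebra_simps)
    then show "(\<Sum>j<M. l j * (a j + t ^ Suc j)) \<noteq> 0" using t \<open>l \<in> L\<close> by auto
  qed
qed

text \<open>The rows of \<open>y\<close> are points of \<open>\<real>\<^sup>M\<close>, of which any \<open>M\<close> or fewer are linearly independent. They are chosen one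
  after another: for every set \<open>S\<close> of fewer than \<open>M\<close> earlier points there is a hyperplane through \<open>0\<close>
  containing \<open>S\<close>, and the new point is taken off these finitely many hyperplanes. A linear relation
  between it and \<open>S\<close> is then impossible.\<close>

lemma general_position:
  fixes a :: "nat \<Rightarrow> nat \<Rightarrow> real"
  assumes "\<epsilon> > 0"
  shows "\<exists>y. (\<forall>i<n. \<forall>j<M. \<bar>y i j - a i j\<bar> \<le> \<epsilon>) \<and>
    (\<forall>T c. T \<subseteq> {..<n} \<and> T \<noteq> {} \<and> card T \<le> M \<and> (\<forall>i\<in>T. c i \<noteq> (0::real)) \<longrightarrow>
       (\<exists>j<M. (\<Sum>i\<in>T. c i * y i j) \<noteq> 0))"
proof (induction n)
  case 0
  then show ?case by auto
next
  case (Suc n)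
  obtain y where y0: "(\<forall>i<n. \<forall>j<M. \<bar>y i j - a i j\<bar> \<le> \<epsilon>) \<and>
    (\<forall>T c. T \<subseteq> {..<n} \<and> T \<noteq> {} \<and> card T \<le> M \<and> (\<forall>i\<in>T. c i \<noteq> (0::real)) \<longrightarrow>
       (\<exists>j<M. (\<Sum>i\<in>T. c i * y i j) \<noteq> 0))"
    using Suc.IH by (elim exE) (rule that)
  have y1: "\<bar>y i j - a i j\<bar> \<le> \<epsilon>" if "i < n" "j < M" for i j using y0 that by simp
  have y2: "\<exists>j<M. (\<Sum>i\<in>T. c i * y i j) \<noteq> 0"
    if "T \<subseteq> {..<n}" "T \<noteq> {}" "card T \<le> M" "\<forall>i\<in>T. c i \<noteq> (0::real)" for T c
    by (rule y0[THEN conjunct2, rule_format]) (use that in simp)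
  define \<S> where "\<S> = {S. S \<subseteq> {..<n} \<and> card S < M}"
  have "\<forall>S\<in>\<S>. \<exists>l. (\<exists>j<M. l j \<noteq> 0) \<and> (\<forall>i\<in>S. (\<Sum>j<M. l j * y i j) = 0)"
    unfolding \<S>_def by (auto intro!: underdetermined_system finite_subset[OF _ finite_lessThan])
  then obtain l where l: "\<And>S. S \<in> \<S> \<Longrightarrow> \<exists>j<M. l S j \<noteq> 0"
    "\<And>S i. S \<in> \<S> \<Longrightarrow> i \<in> S \<Longrightarrow> (\<Sum>j<M. l S j * y i j) = 0" by metis
  have "finite (l ` \<S>)" unfolding \<S>_def by simp
  then have "\<exists>z. (\<forall>j<M. \<bar>z j - a n j\<bar> \<le> \<epsilon>) \<and> (\<forall>k\<in>l ` \<S>. (\<Sum>j<M. k j * z j) \<noteq> 0)"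
    using l(1) assms by (intro point_off_hyperplanes) auto
  then obtain z where z: "\<And>j. j < M \<Longrightarrow> \<bar>z j - a n j\<bar> \<le> \<epsilon>"
    "\<And>S. S \<in> \<S> \<Longrightarrow> (\<Sum>j<M. l S j * z j) \<noteq> 0" by auto
  define y' where "y' = y(n := z)"
  have "\<exists>j<M. (\<Sum>i\<in>T. c i * y' i j) \<noteq> 0"
    if T: "T \<subseteq> {..<Suc n}" "T \<noteq> {}" "card T \<le> M" "\<forall>i\<in>T. c i \<noteq> (0::real)" for T c
  proof (cases "n \<in> T")
    case False
    then have "T \<subseteq> {..<n}" using T(1) less_Suc_eq by auto
    moreover have "(\<Sum>i\<in>T. c i * y' i j) = (\<Sum>i\<in>T. c i * y i j)" for j
      using False by (intro sum.cong) (auto simp: y'_def)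
    ultimately show ?thesis using y2[of T c] T by auto
  next
    case True
    define S where "S = T - {n}"
    have finT: "finite T" using T(1) finite_subset by blast
    then have "card S < M" using card_Suc_Diff1[OF finT True] T(3) by (simp add: S_def)
    then have S: "S \<in> \<S>" using T(1) by (auto simp: S_def \<S>_def less_Suc_eq)
    show ?thesis
    proof (rule ccontr)
      assume "\<not> ?thesis"
      then have 0: "(\<Sum>i\<in>T. c i * y' i j) = 0" if "j < M" for j using that by auto
      have "0 = (\<Sum>j<M. l S j * (\<Sum>i\<in>T. c i * y' i j))" using 0 by simp
      also have "\<dots> = (\<Sum>i\<in>T. c i * (\<Sum>j<M. l S j * y' i j))"
        by (subst sum_distrib_left, subst sum.swap) (simp add: sum_distrib_left algebra_simps)
      also have "\<dots> = c n * (\<Sum>j<M. l S j * z j) + (\<Sum>i\<in>S. c i * (\<Sum>j<M. l S j * y i j))"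
        unfolding S_def by (subst sum.remove[OF finT True]) (auto simp: y'_def intro!: sum.cong)
      also have "\<dots> = c n * (\<Sum>j<M. l S j * z j)" using l(2)[OF S] by simp
      finally show False using z(2)[OF S] T(4) True by auto
    qed
  qed
  moreover have "\<forall>i<Suc n. \<forall>j<M. \<bar>y' i j - a i j\<bar> \<le> \<epsilon>"
    using y1 z(1) by (auto simp: y'_def less_Suc_eq)
  ultimately show ?case by (intro exI[of _ y']) auto
qed

section \<open>Nonvanishing functions on spaces of small dimension\<close>

lemma compact_Hausdorff_normal:
  assumes "compact_space X" "Hausdorff_space X"
  shows "normal_space X"
  by (rule compact_Hausdorff_or_regular_imp_normal_space) (use assms in auto)

lemma compact_space_finite_subcover:
  assumes "compact_space X" "\<forall>x\<in>topspace X. openin X (U x) \<and> x \<in> U x"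
  shows "\<exists>F. finite F \<and> F \<subseteq> topspace X \<and> topspace X = (\<Union>x\<in>F. U x)"
proof -
  have "\<exists>\<F>. finite \<F> \<and> \<F> \<subseteq> U ` topspace X \<and> topspace X \<subseteq> \<Union>\<F>"
    using assms by (intro compactinD) (auto simp: compact_space_def)
  then obtain \<F> where \<F>: "finite \<F>" "\<F> \<subseteq> U ` topspace X" "topspace X \<subseteq> \<Union>\<F>" by blast
  obtain F where F: "finite F" "F \<subseteq> topspace X" "\<F> = U ` F"
    using finite_subset_image[OF \<F>(1,2)] by blast
  have "topspace X = (\<Union>x\<in>F. U x)"
    using F \<F>(3) assms(2) openin_subset by blast
  then show ?thesis using F by blast
qed

lemma Urysohn_bump:
  assumes "normal_space X" "closedin X Z" "openin X W" "Z \<subseteq> W"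
  shows "\<exists>h. continuous_map X euclideanreal h \<and> (\<forall>x\<in>topspace X. 0 \<le> h x \<and> h x \<le> 1) \<and>
    (\<forall>x\<in>Z. h x = 0) \<and> (\<forall>x\<in>topspace X - W. h x = 1)"
proof -
  have "closedin X (topspace X - W)" "disjnt Z (topspace X - W)"
    using assms by (auto simp: disjnt_def)
  from Urysohn_lemma[OF assms(1,2) this, of 0 1]
  obtain f where f: "continuous_map X (top_of_set {0..1::real}) f" "f ` Z \<subseteq> {0}" "f ` (topspace X - W) \<subseteq> {1}"
    by auto
  have "continuous_map X euclideanreal f" "\<forall>x\<in>topspace X. 0 \<le> f x \<and> f x \<le> 1"
    using f(1) by (auto simp: continuous_map_in_subtopology Pi_iff)
  then show ?thesis using f(2,3) by blast
qed

text \<open>The partition is indexed by the given cover, so that bounds on the multiplicity of the cover bound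
  the number of nonzero summands. To this end the bump functions belonging to a finite subcover are
  grouped according to the member of \<open>\<V>\<close> that carries them.\<close>

lemma finite_partition_of_unity:
  assumes "compact_space X" "Hausdorff_space X"
    and "finite \<V>" "\<And>V. V \<in> \<V> \<Longrightarrow> openin X V" "\<Union>\<V> = topspace X"
  shows "\<exists>\<phi>. (\<forall>V\<in>\<V>. continuous_map X euclideanreal (\<phi> V)) \<and>
    (\<forall>V\<in>\<V>. \<forall>x\<in>topspace X. 0 \<le> \<phi> V x \<and> (x \<notin> V \<longrightarrow> \<phi> V x = 0)) \<and>
    (\<forall>x\<in>topspace X. (\<Sum>V\<in>\<V>. \<phi> V x) = (1::real))"
proof -
  have norm: "normal_space X" by (rule compact_Hausdorff_normal[OF assms(1,2)])
  have "\<forall>x\<in>topspace X. \<exists>V h. V \<in> \<V> \<and> x \<in> V \<and> continuous_map X euclideanreal h \<and>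
     (\<forall>y\<in>topspace X. 0 \<le> h y \<and> (y \<notin> V \<longrightarrow> h y = 0)) \<and> h x > (0::real)"
  proof
    fix x assume x: "x \<in> topspace X"
    then obtain V where V: "V \<in> \<V>" "x \<in> V" using assms(5) by blast
    have "closedin X {x}" using assms(2) x by (simp add: closedin_Hausdorff_sing_eq)
    then have "\<exists>h. continuous_map X euclideanreal h \<and> (\<forall>x\<in>topspace X. 0 \<le> h x \<and> h x \<le> 1) \<and>
      (\<forall>y\<in>{x}. h y = 0) \<and> (\<forall>x\<in>topspace X - V. h x = 1)"
      using V assms(4) by (intro Urysohn_bump norm) auto
    then obtain h where "continuous_map X euclideanreal h" "\<forall>x\<in>topspace X. 0 \<le> h x \<and> h x \<le> 1"
       "h x = 0" "\<forall>x\<in>topspace X - V. h x = 1" by auto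
    then show "\<exists>V h. V \<in> \<V> \<and> x \<in> V \<and> continuous_map X euclideanreal h \<and>
     (\<forall>y\<in>topspace X. 0 \<le> h y \<and> (y \<notin> V \<longrightarrow> h y = 0)) \<and> h x > (0::real)"
      using V by (intro exI[of _ V] exI[of _ "\<lambda>y. 1 - h y"]) (auto intro!: continuous_intros)
  qed
  from bchoice[OF this] obtain V where "\<forall>x\<in>topspace X. \<exists>h. V x \<in> \<V> \<and> x \<in> V x \<and>
     continuous_map X euclideanreal h \<and> (\<forall>y\<in>topspace X. 0 \<le> h y \<and> (y \<notin> V x \<longrightarrow> h y = 0)) \<and> h x > (0::real)" ..
  from bchoice[OF this] obtain h where Vh0: "\<forall>x\<in>topspace X. V x \<in> \<V> \<and> x \<in> V x \<and>
     continuous_map X euclideanreal (h x) \<and> (\<forall>y\<in>topspace X. 0 \<le> h x y \<and> (y \<notin> V x \<longrightarrow> h x y = 0)) \<and>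
     h x x > (0::real)" ..
  have Vh: "\<And>x. x \<in> topspace X \<Longrightarrow> V x \<in> \<V>"
    "\<And>x. x \<in> topspace X \<Longrightarrow> continuous_map X euclideanreal (h x)"
    "\<And>x y. x \<in> topspace X \<Longrightarrow> y \<in> topspace X \<Longrightarrow> 0 \<le> h x y"
    "\<And>x y. x \<in> topspace X \<Longrightarrow> y \<in> topspace X \<Longrightarrow> y \<notin> V x \<Longrightarrow> h x y = (0::real)"
    "\<And>x. x \<in> topspace X \<Longrightarrow> h x x > 0" using Vh0 by simp_all
  have "openin X {y \<in> topspace X. h x y \<in> {0<..}}" if "x \<in> topspace X" for x
    using openin_continuous_map_preimage[OF Vh(2)[OF that], of "{0<..}"] by simp
  then have "\<exists>F. finite F \<and> F \<subseteq> topspace X \<and> topspace X = (\<Union>x\<in>F. {y \<in> topspace X. h x y \<in> {0<..}})"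
    using Vh(5) by (intro compact_space_finite_subcover assms(1)) auto
  then obtain F where F: "finite F" "F \<subseteq> topspace X" "topspace X = (\<Union>x\<in>F. {y \<in> topspace X. h x y \<in> {0<..}})"
    by (elim exE conjE) (rule that)
  define \<psi> where "\<psi> U y = (\<Sum>x | x \<in> F \<and> V x = U. h x y)" for U y
  have \<psi>c: "continuous_map X euclideanreal (\<psi> U)" for U
    unfolding \<psi>_def using Vh(2) F by (intro continuous_map_sum) auto
  have \<psi>0: "0 \<le> \<psi> U y" if "y \<in> topspace X" for U y
    unfolding \<psi>_def using Vh(3) F that by (intro sum_nonneg) auto
  have \<psi>z: "\<psi> U y = 0" if "y \<in> topspace X" "y \<notin> U" for U y
    unfolding \<psi>_def using Vh(4) F that by (intro sum.neutral) auto
  define s where "s y = (\<Sum>U\<in>\<V>. \<psi> U y)" for y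
  have spos: "s y > 0" if y: "y \<in> topspace X" for y
  proof -
    obtain x where x: "x \<in> F" "h x y > 0" using F(3) y by auto
    have "0 < \<psi> (V x) y"
      unfolding \<psi>_def using x F Vh(3) y by (intro sum_pos2[of _ x]) auto
    then show ?thesis unfolding s_def
      using Vh(1) x F \<psi>0 y assms(3) by (intro sum_pos2[of _ "V x"]) auto
  qed
  have sc: "continuous_map X euclideanreal s"
    unfolding s_def using assms(3) \<psi>c by (intro continuous_map_sum) auto
  have "continuous_map X euclideanreal (\<lambda>y. \<psi> U y / s y)" for U
    using \<psi>c sc spos by (intro continuous_map_real_divide) (auto dest: spos)
  moreover have "(\<Sum>V\<in>\<V>. \<psi> V y / s y) = 1" if "y \<in> topspace X" for y
    using spos[OF that] by (simp add: s_def flip: sum_divide_distrib)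
  ultimately show ?thesis
    using \<psi>0 spos \<psi>z by (intro exI[of _ "\<lambda>U y. \<psi> U y / s y"]) (auto simp: less_imp_le)
qed

text \<open>This is where the covering dimension is used. On the members of a fine cover of multiplicity at most
  \<open>d + 1 \<le> M\<close> the map \<open>(c 0, \<dots>, c (M - 1))\<close> is nearly constant; its values there are moved into general
  position and interpolated by a partition of unity. The value of the interpolation at \<open>x\<close> is a
  convex combination of at most \<open>M\<close> points in general position, hence not \<open>0\<close>.\<close>

lemma nonvanishing_approximation:
  fixes c :: "nat \<Rightarrow> 'x \<Rightarrow> real"
  assumes X: "compact_space X" "Hausdorff_space X" and dim: "covering_dim_le X d" "d < M"
    and c: "\<forall>j<M. continuous_map X euclideanreal (c j)" and "\<epsilon> > 0"
  shows "\<exists>c'. (\<forall>j<M. continuous_map X euclideanreal (c' j)) \<and>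
    (\<forall>j<M. \<forall>x\<in>topspace X. \<bar>c' j x - c j x\<bar> \<le> \<epsilon>) \<and> (\<forall>x\<in>topspace X. \<exists>j<M. c' j x \<noteq> 0)"
proof -
  define U where "U x = {y \<in> topspace X. \<forall>j<M. \<bar>c j y - c j x\<bar> < \<epsilon>/2}" for x
  have Uop: "openin X (U x)" for x
  proof -
    have eq: "U x = (\<Inter>j\<in>{..<M}. {y \<in> topspace X. c j y \<in> ball (c j x) (\<epsilon>/2)}) \<inter> topspace X"
      by (auto simp: U_def dist_real_def abs_minus_commute)
    have "openin X {y \<in> topspace X. c j y \<in> ball (c j x) (\<epsilon>/2)}" if "j \<in> {..<M}" for j
      using that c by (intro openin_continuous_map_preimage) auto
    then show ?thesis unfolding eq by (intro openin_INT finite_lessThan)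
  qed
  have Ux: "x \<in> U x" if "x \<in> topspace X" for x using that \<open>\<epsilon> > 0\<close> by (auto simp: U_def)
  have "\<forall>x\<in>topspace X. openin X (U x) \<and> x \<in> U x" using Uop Ux by simp
  then obtain F where F: "finite F" "F \<subseteq> topspace X" "topspace X = (\<Union>x\<in>F. U x)"
    using compact_space_finite_subcover[OF X(1)] by meson
  have "\<exists>\<V>. finite \<V> \<and> (\<forall>V\<in>\<V>. openin X V) \<and> \<Union>\<V> = topspace X \<and>
      (\<forall>V\<in>\<V>. \<exists>W\<in>U ` F. V \<subseteq> W) \<and> (\<forall>x\<in>topspace X. card {V\<in>\<V>. x \<in> V} \<le> d + 1)"
    using F Uop by (intro dim(1)[unfolded covering_dim_le_def, rule_format]) auto
  then obtain \<V> where \<V>: "finite \<V>" "\<forall>V\<in>\<V>. openin X V" "\<Union>\<V> = topspace X"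
    "\<forall>V\<in>\<V>. \<exists>W\<in>U ` F. V \<subseteq> W" "\<forall>x\<in>topspace X. card {V\<in>\<V>. x \<in> V} \<le> d + 1"
    by (elim exE conjE) (rule that)
  have "\<forall>V\<in>\<V>. \<exists>x. V \<subseteq> U x" using \<V>(4) by blast
  from bchoice[OF this] obtain z where z: "\<forall>V\<in>\<V>. V \<subseteq> U (z V)" ..
  have "\<exists>\<phi>. (\<forall>V\<in>\<V>. continuous_map X euclideanreal (\<phi> V)) \<and>
    (\<forall>V\<in>\<V>. \<forall>x\<in>topspace X. 0 \<le> \<phi> V x \<and> (x \<notin> V \<longrightarrow> \<phi> V x = 0)) \<and>
    (\<forall>x\<in>topspace X. (\<Sum>V\<in>\<V>. \<phi> V x) = (1::real))"
    using \<V>(2,3) by (intro finite_partition_of_unity[OF X \<V>(1)]) auto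
  then obtain \<phi> where \<phi>0: "\<forall>V\<in>\<V>. continuous_map X euclideanreal (\<phi> V)"
    "\<forall>V\<in>\<V>. \<forall>x\<in>topspace X. 0 \<le> \<phi> V x \<and> (x \<notin> V \<longrightarrow> \<phi> V x = 0)"
    "\<forall>x\<in>topspace X. (\<Sum>V\<in>\<V>. \<phi> V x) = (1::real)" by (elim exE conjE) (rule that)
  have \<phi>: "\<And>V. V \<in> \<V> \<Longrightarrow> continuous_map X euclideanreal (\<phi> V)"
    "\<And>V x. V \<in> \<V> \<Longrightarrow> x \<in> topspace X \<Longrightarrow> 0 \<le> \<phi> V x"
    "\<And>V x. V \<in> \<V> \<Longrightarrow> x \<in> topspace X \<Longrightarrow> x \<notin> V \<Longrightarrow> \<phi> V x = 0"
    "\<And>x. x \<in> topspace X \<Longrightarrow> (\<Sum>V\<in>\<V>. \<phi> V x) = 1" using \<phi>0 by simp_all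
  obtain h n where h: "bij_betw h {..<n::nat} \<V>"
    using ex_bij_betw_nat_finite[OF \<V>(1)] by (auto simp: atLeast0LessThan)
  have "\<epsilon>/2 > 0" using \<open>\<epsilon> > 0\<close> by simp
  from general_position[OF this, of n M "\<lambda>i j. c j (z (h i))"]
  obtain y where y0: "(\<forall>i<n. \<forall>j<M. \<bar>y i j - c j (z (h i))\<bar> \<le> \<epsilon>/2) \<and>
    (\<forall>T b. T \<subseteq> {..<n} \<and> T \<noteq> {} \<and> card T \<le> M \<and> (\<forall>i\<in>T. b i \<noteq> (0::real)) \<longrightarrow>
       (\<exists>j<M. (\<Sum>i\<in>T. b i * y i j) \<noteq> 0))"
    by (elim exE) (rule that)
  have hV: "h i \<in> \<V>" if "i < n" for i using h that bij_betwE by blast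
  have sum1: "(\<Sum>i<n. \<phi> (h i) x) = 1" if "x \<in> topspace X" for x
    using \<phi>(4)[OF that] sum.reindex_bij_betw[OF h, of "\<lambda>V. \<phi> V x"] by simp
  define c' where "c' j x = (\<Sum>i<n. \<phi> (h i) x * y i j)" for j x
  show ?thesis
  proof (intro exI[of _ c'] conjI allI impI ballI)
    show "continuous_map X euclideanreal (c' j)" for j
      unfolding c'_def using \<phi>(1) hV by (intro continuous_intros) auto
  next
    fix j x assume j: "j < M" and x: "x \<in> topspace X"
    have "c' j x - c j x = (\<Sum>i<n. \<phi> (h i) x * (y i j - c j x))"
      using sum1[OF x] by (simp add: c'_def right_diff_distrib sum_subtractf flip: sum_distrib_right)
    also have "\<bar>\<dots>\<bar> \<le> (\<Sum>i<n. \<phi> (h i) x * \<epsilon>)"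
    proof (rule order_trans[OF sum_abs], rule sum_mono)
      fix i assume i: "i \<in> {..<n}"
      show "\<bar>\<phi> (h i) x * (y i j - c j x)\<bar> \<le> \<phi> (h i) x * \<epsilon>"
      proof (cases "x \<in> h i")
        case True
        then have "\<bar>c j x - c j (z (h i))\<bar> < \<epsilon>/2" using bspec[OF z hV[of i]] i j by (auto simp: U_def)
        moreover have "\<bar>y i j - c j (z (h i))\<bar> \<le> \<epsilon>/2" using y0 i j by auto
        ultimately have "\<bar>y i j - c j x\<bar> \<le> \<epsilon>" by linarith
        then show ?thesis using \<phi>(2)[OF hV x, of i] i by (auto simp: abs_mult intro: mult_left_mono)
      next
        case False
        then show ?thesis using \<phi>(3)[OF hV x, of i] i by auto
      qed
    qed
    also have "\<dots> = \<epsilon>" using sum1[OF x] by (simp flip: sum_distrib_right)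
    finally show "\<bar>c' j x - c j x\<bar> \<le> \<epsilon>" .
  next
    fix x assume x: "x \<in> topspace X"
    define T where "T = {i. i < n \<and> \<phi> (h i) x \<noteq> 0}"
    have "h ` T \<subseteq> {V\<in>\<V>. x \<in> V}" using \<phi>(3) x hV by (auto simp: T_def)
    moreover have "inj_on h T" using h by (auto simp: T_def bij_betw_def inj_on_def)
    ultimately have "card T \<le> card {V\<in>\<V>. x \<in> V}" using \<V>(1) by (intro card_inj_on_le) auto
    then have "card T \<le> M" using \<V>(5) x dim(2) by fastforce
    moreover have "T \<noteq> {}"
    proof
      assume "T = {}"
      then have "(\<Sum>i<n. \<phi> (h i) x) = 0" by (intro sum.neutral) (auto simp: T_def)
      then show False using sum1[OF x] by simp
    qed
    ultimately have "\<exists>j<M. (\<Sum>i\<in>T. \<phi> (h i) x * y i j) \<noteq> 0"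
      by (intro y0[THEN conjunct2, rule_format]) (auto simp: T_def)
    then obtain j where "j < M" "(\<Sum>i\<in>T. \<phi> (h i) x * y i j) \<noteq> 0" by blast
    moreover have "c' j x = (\<Sum>i\<in>T. \<phi> (h i) x * y i j)"
      unfolding c'_def by (intro sum.mono_neutral_right) (auto simp: T_def)
    ultimately show "\<exists>j<M. c' j x \<noteq> 0" by auto
  qed
qed

text \<open>Interpolation, by a Urysohn function, between \<open>c\<close> near \<open>Z\<close> and a nonvanishing approximation of \<open>c\<close>
  outside \<open>W\<close>.\<close>

lemma nonvanishing_approximation_rel:
  fixes c :: "nat \<Rightarrow> 'x \<Rightarrow> real"
  assumes X: "compact_space X" "Hausdorff_space X" and dim: "covering_dim_le X d" "d < M"
    and c: "\<forall>j<M. continuous_map X euclideanreal (c j)" and "\<epsilon> > 0"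
    and Z: "closedin X Z" "openin X W" "Z \<subseteq> W"
  shows "\<exists>c'. (\<forall>j<M. continuous_map X euclideanreal (c' j)) \<and>
    (\<forall>j<M. \<forall>x\<in>topspace X. \<bar>c' j x - c j x\<bar> \<le> \<epsilon>) \<and> (\<forall>j<M. \<forall>x\<in>Z. c' j x = c j x) \<and>
    (\<forall>x\<in>topspace X - W. \<exists>j<M. c' j x \<noteq> 0)"
proof -
  obtain b where b: "\<forall>j<M. continuous_map X euclideanreal (b j)"
    "\<forall>j<M. \<forall>x\<in>topspace X. \<bar>b j x - c j x\<bar> \<le> \<epsilon>"
    "\<forall>x\<in>topspace X. \<exists>j<M. b j x \<noteq> 0"
    using nonvanishing_approximation[OF X dim c \<open>\<epsilon> > 0\<close>] by (elim exE conjE) (rule that)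
  obtain h where h: "continuous_map X euclideanreal h" "\<forall>x\<in>topspace X. 0 \<le> h x \<and> h x \<le> 1"
    "\<forall>x\<in>Z. h x = 0" "\<forall>x\<in>topspace X - W. h x = 1"
    using Urysohn_bump[OF compact_Hausdorff_normal[OF X] Z] by (elim exE conjE) (rule that)
  define c' where "c' j x = c j x + h x * (b j x - c j x)" for j x
  have "continuous_map X euclideanreal (c' j)" if "j < M" for j
    unfolding c'_def using b(1) c h(1) that by (intro continuous_intros) auto
  moreover have "\<bar>c' j x - c j x\<bar> \<le> \<epsilon>" if j: "j < M" and x: "x \<in> topspace X" for j x
  proof -
    have "\<bar>h x * (b j x - c j x)\<bar> \<le> 1 * \<epsilon>"
      unfolding abs_mult using h(2) b(2) j x by (intro mult_mono) auto
    then show ?thesis by (simp add: c'_def)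
  qed
  moreover have "\<exists>j<M. c' j x \<noteq> 0" if "x \<in> topspace X - W" for x
    using b(3) h(4) that by (auto simp: c'_def)
  ultimately show ?thesis using h(3) by (intro exI[of _ c']) (auto simp: c'_def)
qed

text \<open>Maps from a closed subset into the sphere \<open>S\<^bsup>M-1\<^esup>\<close> extend if the dimension of the space is less than
  \<open>M\<close>. A Tietze extension may vanish, but not on the neighbourhood \<open>W\<close> of \<open>Z\<close> where its squared norm
  exceeds \<open>1/2\<close>; a perturbation relative to \<open>Z\<close> removes the zeros outside \<open>W\<close>. Normalization is left
  for later, since it is done in a vector bundle.\<close>

lemma sphere_valued_extension:
  fixes c :: "nat \<Rightarrow> 'x \<Rightarrow> real"
  assumes X: "compact_space X" "Hausdorff_space X" and dim: "covering_dim_le X d" "d < M"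
    and Z: "closedin X Z"
    and c: "\<And>j. j < M \<Longrightarrow> continuous_map (subtopology X Z) euclideanreal (c j)"
    and unit: "\<And>x. x \<in> Z \<Longrightarrow> (\<Sum>j<M. (c j x)\<^sup>2) = 1"
  shows "\<exists>c'. (\<forall>j<M. continuous_map X euclideanreal (c' j)) \<and> (\<forall>j<M. \<forall>x\<in>Z. c' j x = c j x) \<and>
    (\<forall>x\<in>topspace X. \<exists>j<M. c' j x \<noteq> 0)"
proof -
  have norm: "normal_space X" by (rule compact_Hausdorff_normal[OF X])
  have "\<forall>j\<in>{..<M}. \<exists>g. continuous_map X euclideanreal g \<and> (\<forall>x\<in>Z. g x = c j x)"
  proof
    fix j assume "j \<in> {..<M}"
    then have cj: "continuous_map (subtopology X Z) euclideanreal (c j)" using c by simp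
    obtain g where "continuous_map X euclideanreal g" "\<And>x. x \<in> Z \<Longrightarrow> g x = c j x"
      using Tietze_extension_realinterval[OF norm Z is_interval_univ _ cj] by auto
    then show "\<exists>g. continuous_map X euclideanreal g \<and> (\<forall>x\<in>Z. g x = c j x)" by blast
  qed
  from bchoice[OF this] obtain g where
    g0: "\<forall>j\<in>{..<M}. continuous_map X euclideanreal (g j) \<and> (\<forall>x\<in>Z. g j x = c j x)" ..
  then have g: "\<forall>j<M. continuous_map X euclideanreal (g j)"
    "\<And>j x. j < M \<Longrightarrow> x \<in> Z \<Longrightarrow> g j x = c j x" by simp_all
  define W where "W = {x \<in> topspace X. (\<Sum>j<M. (g j x)\<^sup>2) \<in> {1/2<..}}"
  have cs: "continuous_map X euclideanreal (\<lambda>x. \<Sum>j<M. (g j x)\<^sup>2)"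
    using g(1) by (intro continuous_intros) auto
  have W: "openin X W" unfolding W_def using openin_continuous_map_preimage[OF cs, of "{1/2<..}"] by simp
  have ZW: "Z \<subseteq> W" using g(2) unit closedin_subset[OF Z] by (auto simp: W_def)
  \<comment> \<open>a perturbation by \<open>1 / (2 M)\<close> is too small to create zeros in \<open>W\<close>: at a zero, the squared norm of
     \<open>g\<close> would be at most \<open>1/2\<close>\<close>
  have "M > 0" using dim by simp
  then have M0: "1 / (2 * real M) > 0" by simp
  obtain c' where c': "\<forall>j<M. continuous_map X euclideanreal (c' j)"
    "\<forall>j<M. \<forall>x\<in>topspace X. \<bar>c' j x - g j x\<bar> \<le> 1 / (2 * real M)"
    "\<forall>j<M. \<forall>x\<in>Z. c' j x = g j x" "\<forall>x\<in>topspace X - W. \<exists>j<M. c' j x \<noteq> 0"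
    using nonvanishing_approximation_rel[OF X dim g(1) M0 Z W ZW] by (elim exE conjE) (rule that)
  have "\<exists>j<M. c' j x \<noteq> 0" if x: "x \<in> topspace X" for x
  proof (rule ccontr)
    assume n: "\<not> ?thesis"
    then have "x \<in> W" using c'(4) x by blast
    have "(g j x)\<^sup>2 \<le> 1 / (2 * real M)" if "j < M" for j
    proof -
      have "\<bar>g j x\<bar> \<le> 1 / (2 * real M)" using c'(2) x n that by force
      then have "\<bar>g j x\<bar>\<^sup>2 \<le> 1 / (2 * real M) * 1"
        unfolding power2_eq_square using \<open>M > 0\<close>
        by (intro mult_mono) (auto intro: order_trans[of _ "1 / (2 * real M)"])
      then show ?thesis by simp
    qed
    then have "(\<Sum>j<M. (g j x)\<^sup>2) \<le> real M * (1 / (2 * real M))"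
      using sum_bounded_above[of "{..<M}" "\<lambda>j. (g j x)\<^sup>2" "1 / (2 * real M)"] by simp
    then show False using \<open>x \<in> W\<close> \<open>M > 0\<close> by (simp add: W_def)
  qed
  then show ?thesis using c' g by (intro exI[of _ c']) auto
qed

text \<open>An open cover of \<open>K\<close> extends to one of \<open>X\<close> by adding the complement of \<open>K\<close>.\<close>

lemma covering_dim_le_closedin:
  assumes "covering_dim_le X d" "closedin X K"
  shows "covering_dim_le (subtopology X K) d"
  unfolding covering_dim_le_def
proof (intro allI impI)
  fix \<U> assume "finite \<U> \<and> (\<forall>U\<in>\<U>. openin (subtopology X K) U) \<and> \<Union>\<U> = topspace (subtopology X K)"
  then have \<U>: "finite \<U>" "\<And>U. U \<in> \<U> \<Longrightarrow> openin (subtopology X K) U" "\<Union>\<U> = topspace X \<inter> K" by auto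
  have KX: "K \<subseteq> topspace X" using assms(2) closedin_subset by blast
  have "\<forall>U\<in>\<U>. \<exists>O'. openin X O' \<and> U = O' \<inter> K" using \<U>(2) unfolding openin_subtopology by blast
  from bchoice[OF this] obtain O' where O0: "\<forall>U\<in>\<U>. openin X (O' U) \<and> U = O' U \<inter> K" ..
  then have O: "\<And>U. U \<in> \<U> \<Longrightarrow> openin X (O' U)" "\<And>U. U \<in> \<U> \<Longrightarrow> U = O' U \<inter> K" by blast+
  define \<W> where "\<W> = insert (topspace X - K) (O' ` \<U>)"
  have "finite \<W>" "\<forall>W\<in>\<W>. openin X W" using \<U>(1) O(1) assms(2) by (auto simp: \<W>_def)
  moreover have "\<Union>\<W> = topspace X"
  proof
    show "\<Union>\<W> \<subseteq> topspace X" using \<open>\<forall>W\<in>\<W>. openin X W\<close> openin_subset by blast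
    show "topspace X \<subseteq> \<Union>\<W>"
    proof
      fix x assume x: "x \<in> topspace X"
      show "x \<in> \<Union>\<W>"
      proof (cases "x \<in> K")
        case True
        then obtain U where "U \<in> \<U>" "x \<in> U" using x \<U>(3) by blast
        then show ?thesis using O(2)[of U] by (auto simp: \<W>_def)
      qed (use x in \<open>auto simp: \<W>_def\<close>)
    qed
  qed
  ultimately have "\<exists>\<V>. finite \<V> \<and> (\<forall>V\<in>\<V>. openin X V) \<and> \<Union>\<V> = topspace X \<and>
     (\<forall>V\<in>\<V>. \<exists>W\<in>\<W>. V \<subseteq> W) \<and> (\<forall>x\<in>topspace X. card {V\<in>\<V>. x \<in> V} \<le> d + 1)"
    by (intro assms(1)[unfolded covering_dim_le_def, rule_format] conjI)
  then obtain \<V> where \<V>: "finite \<V>" "\<forall>V\<in>\<V>. openin X V" "\<Union>\<V> = topspace X"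
     "\<forall>V\<in>\<V>. \<exists>W\<in>\<W>. V \<subseteq> W" "\<forall>x\<in>topspace X. card {V\<in>\<V>. x \<in> V} \<le> d + 1"
    by (elim exE conjE) (rule that)
  define \<V>' where "\<V>' = (\<lambda>V. V \<inter> K) ` \<V> - {{}}"
  show "\<exists>\<V>. finite \<V> \<and> (\<forall>V\<in>\<V>. openin (subtopology X K) V) \<and> \<Union>\<V> = topspace (subtopology X K) \<and>
           (\<forall>V\<in>\<V>. \<exists>U\<in>\<U>. V \<subseteq> U) \<and>
           (\<forall>x\<in>topspace (subtopology X K). card {V\<in>\<V>. x \<in> V} \<le> d + 1)"
  proof (intro exI[of _ \<V>'] conjI ballI)
    show "finite \<V>'" using \<V>(1) by (simp add: \<V>'_def)
    show "openin (subtopology X K) V" if "V \<in> \<V>'" for V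
      using that \<V>(2) by (auto simp: \<V>'_def openin_subtopology)
    have "\<Union>\<V>' = \<Union>\<V> \<inter> K" unfolding \<V>'_def by blast
    then show "\<Union>\<V>' = topspace (subtopology X K)" using \<V>(3) by simp
    show "\<exists>U\<in>\<U>. V \<subseteq> U" if V: "V \<in> \<V>'" for V
    proof -
      obtain V0 where V0: "V0 \<in> \<V>" "V = V0 \<inter> K" "V \<noteq> {}" using V by (auto simp: \<V>'_def)
      then obtain W where "W \<in> \<W>" "V0 \<subseteq> W" using \<V>(4) by blast
      then obtain U where "U \<in> \<U>" "W = O' U" using V0 by (auto simp: \<W>_def)
      then show ?thesis using O(2) V0 \<open>V0 \<subseteq> W\<close> by blast
    qed
    fix x assume "x \<in> topspace (subtopology X K)"
    then have x: "x \<in> topspace X" "x \<in> K" by auto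
    have "{V\<in>\<V>'. x \<in> V} \<subseteq> (\<lambda>V. V \<inter> K) ` {V\<in>\<V>. x \<in> V}" by (auto simp: \<V>'_def)
    then have "card {V\<in>\<V>'. x \<in> V} \<le> card ((\<lambda>V. V \<inter> K) ` {V\<in>\<V>. x \<in> V})"
      using \<V>(1) by (intro card_mono) auto
    also have "\<dots> \<le> card {V\<in>\<V>. x \<in> V}" using \<V>(1) by (intro card_image_le) auto
    finally show "card {V\<in>\<V>'. x \<in> V} \<le> d + 1" using \<V>(5) x by fastforce
  qed
qed

text \<open>Here \<open>Q Z\<close> says that a construction has been carried out over \<open>Z\<close>. If it can always be continued from
  \<open>Z\<close> to the union with a sufficiently small closed set, then finitely many continuations cover a compact
  space. This is how constructions in locally trivial bundles reduce to trivial ones.\<close>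

lemma closed_patch_induct:
  assumes X: "compact_space X" "Hausdorff_space X"
    and base: "closedin X X0" "Q X0"
    and step: "\<And>x. x \<in> topspace X \<Longrightarrow> \<exists>U. openin X U \<and> x \<in> U \<and>
       (\<forall>Z K. closedin X Z \<and> Q Z \<and> closedin X K \<and> K \<subseteq> U \<longrightarrow> Q (Z \<union> K))"
  shows "Q (topspace X)"
proof -
  have reg: "neighbourhood_base_of (closedin X) X"
    using compact_Hausdorff_imp_regular_space[OF X] neighbourhood_base_of_closedin by blast
  have "\<forall>x\<in>topspace X. \<exists>P. openin X (fst P) \<and> x \<in> fst P \<and> fst P \<subseteq> snd P \<and> closedin X (snd P) \<and>
      (\<forall>Z. closedin X Z \<and> Q Z \<longrightarrow> Q (Z \<union> snd P))"
  proof
    fix x assume x: "x \<in> topspace X"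
    from step[OF x] obtain U where U: "openin X U" "x \<in> U"
       "\<forall>Z K. closedin X Z \<and> Q Z \<and> closedin X K \<and> K \<subseteq> U \<longrightarrow> Q (Z \<union> K)"
      by (elim exE conjE) (rule that)
    have "\<exists>O' K. openin X O' \<and> closedin X K \<and> x \<in> O' \<and> O' \<subseteq> K \<and> K \<subseteq> U"
      by (rule reg[unfolded neighbourhood_base_of, rule_format]) (use U in simp)
    then obtain O' K where "openin X O'" "closedin X K" "x \<in> O'" "O' \<subseteq> K" "K \<subseteq> U" by blast
    then show "\<exists>P. openin X (fst P) \<and> x \<in> fst P \<and> fst P \<subseteq> snd P \<and> closedin X (snd P) \<and>
      (\<forall>Z. closedin X Z \<and> Q Z \<longrightarrow> Q (Z \<union> snd P))" using U(3) by (intro exI[of _ "(O', K)"]) simp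
  qed
  from bchoice[OF this] obtain P where P: "\<forall>x\<in>topspace X. openin X (fst (P x)) \<and> x \<in> fst (P x) \<and>
    fst (P x) \<subseteq> snd (P x) \<and> closedin X (snd (P x)) \<and> (\<forall>Z. closedin X Z \<and> Q Z \<longrightarrow> Q (Z \<union> snd (P x)))" ..
  define O' where "O' x = fst (P x)" for x
  define K where "K x = snd (P x)" for x
  have OK: "\<And>x. x \<in> topspace X \<Longrightarrow> openin X (O' x) \<and> x \<in> O' x"
    "\<And>x. x \<in> topspace X \<Longrightarrow> O' x \<subseteq> K x" "\<And>x. x \<in> topspace X \<Longrightarrow> closedin X (K x)"
    "\<And>x Z. x \<in> topspace X \<Longrightarrow> closedin X Z \<Longrightarrow> Q Z \<Longrightarrow> Q (Z \<union> K x)"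
    using P by (simp_all add: O'_def K_def)
  have "\<forall>x\<in>topspace X. openin X (O' x) \<and> x \<in> O' x" using OK(1) by simp
  then obtain F where F: "finite F" "F \<subseteq> topspace X" "topspace X = (\<Union>x\<in>F. O' x)"
    using compact_space_finite_subcover[OF X(1)] by meson
  have "closedin X (X0 \<union> (\<Union>x\<in>F. K x)) \<and> Q (X0 \<union> (\<Union>x\<in>F. K x))" using F(1,2)
  proof (induction F rule: finite_induct)
    case empty
    then show ?case using base by simp
  next
    case (insert x F)
    have "X0 \<union> (\<Union>x\<in>insert x F. K x) = (X0 \<union> (\<Union>x\<in>F. K x)) \<union> K x" by blast
    moreover have "closedin X (X0 \<union> (\<Union>x\<in>F. K x))" "Q (X0 \<union> (\<Union>x\<in>F. K x))" "x \<in> topspace X"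
      using insert by auto
    ultimately show ?case using OK(3,4)[of x] by (simp add: closedin_Un)
  qed
  moreover have "X0 \<union> (\<Union>x\<in>F. K x) = topspace X"
  proof
    show "X0 \<union> (\<Union>x\<in>F. K x) \<subseteq> topspace X" using calculation closedin_subset by blast
    show "topspace X \<subseteq> X0 \<union> (\<Union>x\<in>F. K x)" using F OK(2) by blast
  qed
  ultimately show ?thesis by simp
qed

section \<open>The normed algebra of finitely supported matrices\<close>

text \<open>The union of all \<open>M\<^sub>N(\<complex>)\<close>, embedded into each other as upper left corners. In this single ring
  matrices of all sizes, vectors (as single columns) and block sums live together, and only the
  predicate \<open>supp\<close> speaks of sizes. There is no unit; a unitary is written \<open>1 + T\<close> with \<open>T\<close>
  in the ring.\<close>

typedef finmat = "{A :: nat \<Rightarrow> nat \<Rightarrow> complex. \<exists>N. \<forall>i j. N \<le> i \<or> N \<le> j \<longrightarrow> A i j = 0}"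
  morphisms ent Finmat
  by (intro exI[of _ "\<lambda>_ _. 0"]) auto

setup_lifting type_definition_finmat

definition supp :: "nat \<Rightarrow> finmat \<Rightarrow> bool" where
  "supp N A \<longleftrightarrow> (\<forall>i j. N \<le> i \<or> N \<le> j \<longrightarrow> ent A i j = 0)"

lemma suppD: "supp N A \<Longrightarrow> ent A i j \<noteq> 0 \<Longrightarrow> i < N \<and> j < N"
  by (meson not_le supp_def)

lemma finmat_eqI: "(\<And>i j. ent A i j = ent B i j) \<Longrightarrow> A = B"
  by (simp add: ent_inject[symmetric] fun_eq_iff)

lemma ex_supp: "\<exists>N. supp N A"
  using ent[of A] by (auto simp: supp_def)

lemma supp_mono: "supp N A \<Longrightarrow> N \<le> N' \<Longrightarrow> supp N' A"
  by (auto simp: supp_def)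

lemma ex_supp2: "\<exists>N. supp N A \<and> supp N B"
proof -
  obtain N N' where "supp N A" "supp N' B" using ex_supp by blast
  then have "supp (max N N') A \<and> supp (max N N') B" using supp_mono by (metis max.cobounded1 max.cobounded2)
  then show ?thesis by blast
qed

lemma ex_supp3: "\<exists>N. supp N A \<and> supp N B \<and> supp N C"
proof -
  obtain N N' where "supp N A \<and> supp N B" "supp N' C" using ex_supp ex_supp2 by blast
  then have "supp (max N N') A \<and> supp (max N N') B \<and> supp (max N N') C"
    using supp_mono by (metis max.cobounded1 max.cobounded2)
  then show ?thesis by blast
qed

instantiation finmat :: "{zero, plus, minus, uminus, times}"
begin

lift_definition zero_finmat :: finmat is "\<lambda>_ _. 0" by auto

lift_definition plus_finmat :: "finmat \<Rightarrow> finmat \<Rightarrow> finmat" is "\<lambda>A B i j. A i j + B i j"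
proof -
  fix A B :: "nat \<Rightarrow> nat \<Rightarrow> complex"
  assume "\<exists>N. \<forall>i j. N \<le> i \<or> N \<le> j \<longrightarrow> A i j = 0" "\<exists>N. \<forall>i j. N \<le> i \<or> N \<le> j \<longrightarrow> B i j = 0"
  then obtain N N' where "\<forall>i j. N \<le> i \<or> N \<le> j \<longrightarrow> A i j = 0" "\<forall>i j. N' \<le> i \<or> N' \<le> j \<longrightarrow> B i j = 0" by blast
  then show "\<exists>N. \<forall>i j. N \<le> i \<or> N \<le> j \<longrightarrow> A i j + B i j = 0"
    by (intro exI[of _ "max N N'"]) auto
qed

lift_definition minus_finmat :: "finmat \<Rightarrow> finmat \<Rightarrow> finmat" is "\<lambda>A B i j. A i j - B i j"
proof -
  fix A B :: "nat \<Rightarrow> nat \<Rightarrow> complex"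
  assume "\<exists>N. \<forall>i j. N \<le> i \<or> N \<le> j \<longrightarrow> A i j = 0" "\<exists>N. \<forall>i j. N \<le> i \<or> N \<le> j \<longrightarrow> B i j = 0"
  then obtain N N' where "\<forall>i j. N \<le> i \<or> N \<le> j \<longrightarrow> A i j = 0" "\<forall>i j. N' \<le> i \<or> N' \<le> j \<longrightarrow> B i j = 0" by blast
  then show "\<exists>N. \<forall>i j. N \<le> i \<or> N \<le> j \<longrightarrow> A i j - B i j = 0"
    by (intro exI[of _ "max N N'"]) auto
qed

lift_definition uminus_finmat :: "finmat \<Rightarrow> finmat" is "\<lambda>A i j. - A i j" by auto

lift_definition times_finmat :: "finmat \<Rightarrow> finmat \<Rightarrow> finmat" is
  "\<lambda>A B i j. \<Sum>k | A i k \<noteq> 0. A i k * B k j"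
proof -
  fix A B :: "nat \<Rightarrow> nat \<Rightarrow> complex"
  assume "\<exists>N. \<forall>i j. N \<le> i \<or> N \<le> j \<longrightarrow> A i j = 0" "\<exists>N. \<forall>i j. N \<le> i \<or> N \<le> j \<longrightarrow> B i j = 0"
  then obtain N N' where "\<forall>i j. N \<le> i \<or> N \<le> j \<longrightarrow> A i j = 0" "\<forall>i j. N' \<le> i \<or> N' \<le> j \<longrightarrow> B i j = 0" by blast
  then show "\<exists>N. \<forall>i j. N \<le> i \<or> N \<le> j \<longrightarrow> (\<Sum>k | A i k \<noteq> 0. A i k * B k j) = 0"
    by (intro exI[of _ "max N N'"]) auto
qed

instance ..

end

lemma ent_0 [simp]: "ent 0 i j = 0" by transfer simp
lemma ent_add [simp]: "ent (A + B) i j = ent A i j + ent B i j" by transfer simp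
lemma ent_diff [simp]: "ent (A - B) i j = ent A i j - ent B i j" by transfer simp
lemma ent_uminus [simp]: "ent (- A) i j = - ent A i j" by transfer simp

lemma ent_mult:
  assumes "supp N A \<or> supp N B"
  shows "ent (A * B) i j = (\<Sum>k<N. ent A i k * ent B k j)"
proof -
  obtain M where M: "supp M A" using ex_supp by blast
  have "ent (A * B) i j = (\<Sum>k | ent A i k \<noteq> 0. ent A i k * ent B k j)" by transfer simp
  also have "\<dots> = (\<Sum>k<max M N. ent A i k * ent B k j)"
    using suppD[OF M] by (intro sum.mono_neutral_left) (auto simp: less_max_iff_disj)
  also have "\<dots> = (\<Sum>k<N. ent A i k * ent B k j)"
    using assms by (intro sum.mono_neutral_right) (auto simp: supp_def)
  finally show ?thesis .
qed

lemma supp_0 [simp]: "supp N 0" by (simp add: supp_def)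
lemma supp_add: "supp N A \<Longrightarrow> supp N B \<Longrightarrow> supp N (A + B)" by (simp add: supp_def)
lemma supp_diff: "supp N A \<Longrightarrow> supp N B \<Longrightarrow> supp N (A - B)" by (simp add: supp_def)
lemma supp_mult: "supp N A \<Longrightarrow> supp N B \<Longrightarrow> supp N (A * B)"
  by (simp add: ent_mult[of N] supp_def)

instance finmat :: ring
proof
  fix a b c :: finmat
  obtain N where N: "supp N a" "supp N b" "supp N c" using ex_supp3 by blast
  show "a * b * c = a * (b * c)"
  proof (rule finmat_eqI)
    fix i j
    have "ent (a * b * c) i j = (\<Sum>k<N. (\<Sum>l<N. ent a i l * ent b l k) * ent c k j)"
      using N by (simp add: ent_mult[of N] supp_mult)
    also have "\<dots> = (\<Sum>l<N. ent a i l * (\<Sum>k<N. ent b l k * ent c k j))"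
      unfolding sum_distrib_left sum_distrib_right by (subst sum.swap) (simp add: mult.assoc)
    also have "\<dots> = ent (a * (b * c)) i j" using N by (simp add: ent_mult[of N] supp_mult)
    finally show "ent (a * b * c) i j = ent (a * (b * c)) i j" .
  qed
  show "(a + b) * c = a * c + b * c" "a * (b + c) = a * b + a * c"
    using N by (auto intro!: finmat_eqI simp: ent_mult[of N] supp_add algebra_simps sum.distrib)
qed (auto intro!: finmat_eqI)

lift_definition csc :: "complex \<Rightarrow> finmat \<Rightarrow> finmat" is "\<lambda>c A i j. c * A i j" by auto

lift_definition adj :: "finmat \<Rightarrow> finmat" is "\<lambda>A i j. cnj (A j i)" by auto

lemma ent_csc [simp]: "ent (csc c A) i j = c * ent A i j" by transfer simp
lemma ent_adj [simp]: "ent (adj A) i j = cnj (ent A j i)" by transfer simp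
lemma supp_csc: "supp N A \<Longrightarrow> supp N (csc c A)" by (simp add: supp_def)
lemma supp_adj: "supp N A \<Longrightarrow> supp N (adj A)" by (simp add: supp_def)

text \<open>The norm is the sum of the absolute values of the entries. It is submultiplicative, and on \<open>M\<^sub>N(\<complex>)\<close>
  its topology is that of entrywise convergence.\<close>

instantiation finmat :: real_normed_algebra
begin

definition scaleR_finmat :: "real \<Rightarrow> finmat \<Rightarrow> finmat" where "scaleR_finmat r A = csc (of_real r) A"

definition norm_finmat :: "finmat \<Rightarrow> real" where
  "norm_finmat A = (let N = (LEAST N. supp N A) in \<Sum>i<N. \<Sum>j<N. cmod (ent A i j))"

definition dist_finmat :: "finmat \<Rightarrow> finmat \<Rightarrow> real" where "dist_finmat A B = norm (A - B)"

definition sgn_finmat :: "finmat \<Rightarrow> finmat" where "sgn_finmat A = inverse (norm A) *\<^sub>R A"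

definition uniformity_finmat :: "(finmat \<times> finmat) filter" where
  "uniformity_finmat = (INF e\<in>{0<..}. principal {(x, y). dist x y < e})"

definition open_finmat :: "finmat set \<Rightarrow> bool" where
  "open_finmat U \<longleftrightarrow> (\<forall>x\<in>U. \<forall>\<^sub>F (x', y) in uniformity. x' = x \<longrightarrow> y \<in> U)"

lemma norm_finmat_eq:
  assumes "supp N A"
  shows "norm A = (\<Sum>i<N. \<Sum>j<N. cmod (ent A i j))"
proof -
  define M where "M = (LEAST N. supp N A)"
  have M: "supp M A" "M \<le> N" unfolding M_def using assms by (auto intro: LeastI Least_le)
  have "(\<Sum>i<N. \<Sum>j<N. cmod (ent A i j)) = (\<Sum>i<N. \<Sum>j<M. cmod (ent A i j))"
    using M by (intro sum.cong refl sum.mono_neutral_right) (auto simp: supp_def)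
  also have "\<dots> = (\<Sum>i<M. \<Sum>j<M. cmod (ent A i j))"
    using M by (intro sum.mono_neutral_right) (auto simp: supp_def)
  finally show ?thesis by (simp add: norm_finmat_def M_def Let_def)
qed

lemma norm_finmat_mult: "norm (a * b) \<le> norm a * norm (b :: finmat)"
proof -
  obtain N where N: "supp N a" "supp N b" using ex_supp2 by blast
  have "norm (a * b) = (\<Sum>i<N. \<Sum>j<N. cmod (\<Sum>k<N. ent a i k * ent b k j))"
    using N by (simp add: norm_finmat_eq[of N] supp_mult ent_mult[of N])
  also have "\<dots> \<le> (\<Sum>i<N. \<Sum>j<N. \<Sum>k<N. cmod (ent a i k) * cmod (ent b k j))"
    by (intro sum_mono order_trans[OF norm_sum]) (simp add: norm_mult)
  also have "\<dots> = (\<Sum>i<N. \<Sum>k<N. cmod (ent a i k) * (\<Sum>j<N. cmod (ent b k j)))"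
    unfolding sum_distrib_left by (intro sum.cong refl sum.swap)
  also have "\<dots> \<le> (\<Sum>i<N. \<Sum>k<N. cmod (ent a i k) * norm b)"
  proof (intro sum_mono mult_left_mono)
    fix k assume "k \<in> {..<N}"
    then show "(\<Sum>j<N. cmod (ent b k j)) \<le> norm b"
      unfolding norm_finmat_eq[OF N(2)] by (intro member_le_sum[of k]) (auto intro: sum_nonneg)
  qed auto
  also have "\<dots> = norm a * norm b"
    using N by (simp add: norm_finmat_eq[of N] sum_distrib_right)
  finally show ?thesis .
qed

instance
proof
  fix a b :: finmat and r s :: real
  obtain N where N: "supp N a" "supp N b" using ex_supp2 by blast
  note [simp] = scaleR_finmat_def
  show "r *\<^sub>R (a + b) = r *\<^sub>R a + r *\<^sub>R b" "(r + s) *\<^sub>R a = r *\<^sub>R a + s *\<^sub>R a" "r *\<^sub>R s *\<^sub>R a = (r * s) *\<^sub>R a" "1 *\<^sub>R a = a"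
    by (auto intro!: finmat_eqI simp: algebra_simps)
  show "r *\<^sub>R a * b = r *\<^sub>R (a * b)" "a * r *\<^sub>R b = r *\<^sub>R (a * b)"
    using N by (auto intro!: finmat_eqI simp: ent_mult[of N] supp_csc sum_distrib_left algebra_simps)
  show "dist a b = norm (a - b)" by (rule dist_finmat_def)
  show "sgn a = inverse (norm a) *\<^sub>R a" by (rule sgn_finmat_def)
  show "uniformity = (INF e\<in>{0<..}. principal {(x::finmat, y). dist x y < e})" by (rule uniformity_finmat_def)
  show "open U \<longleftrightarrow> (\<forall>x\<in>U. \<forall>\<^sub>F (x', y) in uniformity. x' = x \<longrightarrow> y \<in> U)" for U :: "finmat set"
    by (rule open_finmat_def)
  show "norm a = 0 \<longleftrightarrow> a = 0"
  proof
    assume "norm a = 0"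
    then have "\<forall>i<N. \<forall>j<N. ent a i j = 0"
      by (simp add: norm_finmat_eq[OF N(1)] sum_nonneg_eq_0_iff sum_nonneg)
    then show "a = 0" using N(1) unfolding supp_def by (intro finmat_eqI) (metis ent_0 not_le)
  qed (simp add: norm_finmat_eq[of 0])
  show "norm (a + b) \<le> norm a + norm b"
  proof -
    have "(\<Sum>i<N. \<Sum>j<N. cmod (ent a i j + ent b i j)) \<le> (\<Sum>i<N. \<Sum>j<N. cmod (ent a i j) + cmod (ent b i j))"
      by (intro sum_mono norm_triangle_ineq)
    then show ?thesis using N by (simp add: norm_finmat_eq[of N] supp_add sum.distrib)
  qed
  show "norm (r *\<^sub>R a) = \<bar>r\<bar> * norm a"
    using N by (simp add: norm_finmat_eq[of N] supp_csc norm_mult sum_distrib_left)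
  show "norm (a * b) \<le> norm a * norm b" by (rule norm_finmat_mult)
qed

end

lemma scaleR_eq_csc: "r *\<^sub>R A = csc (of_real r) A" for A :: finmat
  by (simp add: scaleR_finmat_def)

lemma ent_scaleR [simp]: "ent (r *\<^sub>R A) i j = of_real r * ent A i j"
  by (simp add: scaleR_eq_csc)

lemma ent_sum [simp]: "ent (\<Sum>i\<in>I. f i) k l = (\<Sum>i\<in>I. ent (f i) k l)"
  by (induction I rule: infinite_finite_induct) auto

lemma supp_sum: "(\<And>i. i \<in> I \<Longrightarrow> supp N (f i)) \<Longrightarrow> supp N (sum f I)"
  by (induction I rule: infinite_finite_induct) (auto intro: supp_add)

lemma csc_mult_left: "csc c A * B = csc c (A * B)" and csc_mult_right: "A * csc c B = csc c (A * B)"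
proof -
  obtain N where N: "supp N A" "supp N B" using ex_supp2 by blast
  then show "csc c A * B = csc c (A * B)" "A * csc c B = csc c (A * B)"
    by (auto intro!: finmat_eqI simp: ent_mult[of N] supp_csc sum_distrib_left algebra_simps)
qed

lemma csc_add: "csc c (A + B) = csc c A + csc c B" and csc_diff: "csc c (A - B) = csc c A - csc c B"
  and csc_uminus: "csc c (- A) = - csc c A" and csc_csc: "csc c (csc d A) = csc (c * d) A"
  and csc_add_left: "csc (c + d) A = csc c A + csc d A" and csc_diff_left: "csc (c - d) A = csc c A - csc d A"
  and csc_1 [simp]: "csc 1 A = A" and csc_0 [simp]: "csc 0 A = 0" and csc_zero [simp]: "csc c 0 = 0"
  and csc_uminus_left: "csc (- c) A = - csc c A"
  by (auto intro!: finmat_eqI simp: algebra_simps)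

lemma adj_mult: "adj (A * B) = adj B * adj A"
proof -
  obtain N where N: "supp N A" "supp N B" using ex_supp2 by blast
  then show ?thesis by (auto intro!: finmat_eqI simp: ent_mult[of N] supp_adj mult.commute)
qed

lemma adj_adj [simp]: "adj (adj A) = A" and adj_0 [simp]: "adj 0 = 0"
  and adj_add: "adj (A + B) = adj A + adj B" and adj_diff: "adj (A - B) = adj A - adj B"
  and adj_uminus: "adj (- A) = - adj A" and adj_csc: "adj (csc c A) = csc (cnj c) (adj A)"
  and adj_scaleR: "adj (r *\<^sub>R A) = r *\<^sub>R adj A"
  by (auto intro!: finmat_eqI)

lemma adj_sum: "adj (sum f I) = (\<Sum>i\<in>I. adj (f i))"
  by (induction I rule: infinite_finite_induct) (auto simp: adj_add)

lemma norm_ent_le: "cmod (ent A i j) \<le> norm A"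
proof -
  obtain N where N: "supp N A" using ex_supp by blast
  show ?thesis
  proof (cases "i < N \<and> j < N")
    case True
    have "cmod (ent A i j) \<le> (\<Sum>j<N. cmod (ent A i j))"
      using True by (intro member_le_sum) auto
    also have "\<dots> \<le> (\<Sum>i<N. \<Sum>j<N. cmod (ent A i j))"
      using True by (intro member_le_sum[of i]) (auto intro: sum_nonneg)
    finally show ?thesis using N by (simp add: norm_finmat_eq)
  next
    case False
    then have "ent A i j = 0" using N by (auto simp: supp_def not_less)
    then show ?thesis by simp
  qed
qed

lemma norm_adj [simp]: "norm (adj A) = norm A"
proof -
  obtain N where N: "supp N A" using ex_supp by blast
  then show ?thesis by (simp add: norm_finmat_eq[of N] supp_adj) (rule sum.swap)
qed

lemma norm_csc: "norm (csc c A) = cmod c * norm A"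
proof -
  obtain N where N: "supp N A" using ex_supp by blast
  then show ?thesis by (simp add: norm_finmat_eq[of N] supp_csc norm_mult sum_distrib_left)
qed

definition tr :: "finmat \<Rightarrow> complex" where
  "tr A = (\<Sum>i | ent A i i \<noteq> 0. ent A i i)"

lemma tr_eq: "supp N A \<Longrightarrow> tr A = (\<Sum>i<N. ent A i i)"
  unfolding tr_def by (intro sum.mono_neutral_left) (auto dest: suppD)

lemma tr_add: "tr (A + B) = tr A + tr B" and tr_diff: "tr (A - B) = tr A - tr B"
  and tr_mult_commute: "tr (A * B) = tr (B * A)" and tr_csc: "tr (csc c A) = c * tr A" and tr_0 [simp]: "tr 0 = 0"
proof -
  obtain N where N: "supp N A" "supp N B" using ex_supp2 by blast
  show "tr (A + B) = tr A + tr B" "tr (A - B) = tr A - tr B" "tr (csc c A) = c * tr A"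
    using N by (simp_all add: tr_eq[of N] supp_add supp_diff supp_csc sum.distrib sum_subtractf sum_distrib_left)
  have "(\<Sum>i<N. \<Sum>k<N. ent A i k * ent B k i) = (\<Sum>k<N. \<Sum>i<N. ent B k i * ent A i k)"
    by (subst sum.swap) (simp add: mult.commute)
  then show "tr (A * B) = tr (B * A)"
    using N by (simp add: tr_eq[of N] supp_mult ent_mult[of N])
  show "tr 0 = 0" by (simp add: tr_def)
qed

lemma norm_tr_le: "cmod (tr A) \<le> norm A"
proof -
  obtain N where N: "supp N A" using ex_supp by blast
  have "cmod (tr A) \<le> (\<Sum>i<N. cmod (ent A i i))" using N by (simp add: tr_eq norm_sum)
  also have "\<dots> \<le> (\<Sum>i<N. \<Sum>j<N. cmod (ent A i j))"
    by (intro sum_mono) (rule member_le_sum, auto)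
  finally show ?thesis using N by (simp add: norm_finmat_eq)
qed

lift_definition munit :: "nat \<Rightarrow> nat \<Rightarrow> finmat" is "\<lambda>(i::nat) (j::nat) k l. if k = i \<and> l = j then 1 else 0"
proof -
  fix i j :: nat
  show "\<exists>N. \<forall>k l. N \<le> k \<or> N \<le> l \<longrightarrow> (if k = i \<and> l = j then 1 else 0) = (0::complex)"
    by (intro exI[of _ "Suc (max i j)"]) auto
qed

lemma ent_munit: "ent (munit i j) k l = (if k = i \<and> l = j then 1 else 0)"
  by transfer simp

lemma supp_munit: "i < N \<Longrightarrow> j < N \<Longrightarrow> supp N (munit i j)"
  by (auto simp: supp_def ent_munit)

lemma finmat_decompose:
  assumes "supp N A"
  shows "A = (\<Sum>i<N. \<Sum>j<N. csc (ent A i j) (munit i j))"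
proof (rule finmat_eqI)
  fix k l
  have "ent (\<Sum>i<N. \<Sum>j<N. csc (ent A i j) (munit i j)) k l
      = (\<Sum>i<N. \<Sum>j<N. if k = i \<and> l = j then ent A k l else 0)"
    by (auto simp: ent_munit intro!: sum.cong)
  also have "\<dots> = (\<Sum>i<N. if k = i then (\<Sum>j<N. if l = j then ent A k l else 0) else 0)"
    by (intro sum.cong refl) auto
  also have "\<dots> = (if k < N \<and> l < N then ent A k l else 0)"
    by simp
  also have "\<dots> = ent A k l" using assms by (auto simp: supp_def not_less)
  finally show "ent A k l = ent (\<Sum>i<N. \<Sum>j<N. csc (ent A i j) (munit i j)) k l" ..
qed

lift_definition block :: "nat \<Rightarrow> (nat \<Rightarrow> nat \<Rightarrow> complex) \<Rightarrow> finmat" is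
  "\<lambda>(N::nat) f i j. if i < N \<and> j < N then f i j else 0"
proof -
  fix N :: nat and f :: "nat \<Rightarrow> nat \<Rightarrow> complex"
  show "\<exists>M. \<forall>i j. M \<le> i \<or> M \<le> j \<longrightarrow> (if i < N \<and> j < N then f i j else 0) = 0"
    by (intro exI[of _ N]) auto
qed

lemma ent_block: "ent (block N f) i j = (if i < N \<and> j < N then f i j else 0)"
  by transfer simp

lemma supp_block [simp]: "supp N (block N f)"
  by (auto simp: supp_def ent_block)

section \<open>Continuous fields of matrices\<close>

lemma continuous_map_into_cont:
  assumes "continuous_map X euclidean f" "continuous_on UNIV g"
  shows "continuous_map X euclidean (\<lambda>x. g (f x))"
  using continuous_map_compose[OF assms(1), of euclidean g] assms(2) by (simp add: o_def)

lemma continuous_map_into_cont2: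
  assumes "continuous_map X euclidean f" "continuous_map X euclidean g"
    and "continuous_on UNIV (\<lambda>p. h (fst p) (snd p))"
  shows "continuous_map X euclidean (\<lambda>x. h (f x) (g x))"
proof -
  have "continuous_map X euclidean (\<lambda>x. (f x, g x))"
    using continuous_map_pairedI[OF assms(1,2)] by (simp add: euclidean_product_topology)
  from continuous_map_into_cont[OF this assms(3)] show ?thesis by simp
qed

lemma continuous_map_alg_mult [continuous_intros]:
  fixes f g :: "'x \<Rightarrow> 'a :: real_normed_algebra"
  assumes "continuous_map X euclidean f" "continuous_map X euclidean g"
  shows "continuous_map X euclidean (\<lambda>x. f x * g x)"
  by (rule continuous_map_into_cont2[OF assms]) (intro continuous_intros)

lemma continuous_map_scaleR' [continuous_intros]:
  fixes g :: "'x \<Rightarrow> 'a :: real_normed_vector"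
  assumes "continuous_map X euclidean f" "continuous_map X euclidean g"
  shows "continuous_map X euclidean (\<lambda>x. f x *\<^sub>R g x)"
  by (rule continuous_map_into_cont2[OF assms]) (intro continuous_intros)

lemma bounded_bilinear_csc: "bounded_bilinear csc"
proof
  show "\<exists>K. \<forall>a b. norm (csc a b) \<le> norm a * norm b * K"
    by (intro exI[of _ 1]) (simp add: norm_csc)
qed (auto intro!: finmat_eqI simp: algebra_simps scaleR_conv_of_real)

lemma continuous_map_csc [continuous_intros]:
  assumes "continuous_map X euclidean f" "continuous_map X euclidean g"
  shows "continuous_map X euclidean (\<lambda>x. csc (f x) (g x))"
  by (rule continuous_map_into_cont2[OF assms])
    (intro bounded_bilinear.continuous_on[OF bounded_bilinear_csc] continuous_intros)

lemma bounded_linear_adj: "bounded_linear adj"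
  by (rule bounded_linear_intro[of _ 1]) (auto simp: adj_add adj_scaleR)

lemma bounded_linear_ent: "bounded_linear (\<lambda>A. ent A i j)"
  by (rule bounded_linear_intro[of _ 1]) (auto simp: norm_ent_le scaleR_conv_of_real)

lemma bounded_linear_tr: "bounded_linear tr"
  by (rule bounded_linear_intro[of _ 1])
    (auto simp: norm_tr_le tr_add tr_csc scaleR_eq_csc scaleR_conv_of_real)

lemma continuous_map_bounded_linear:
  assumes "bounded_linear h" "continuous_map X euclidean f"
  shows "continuous_map X euclidean (\<lambda>x. h (f x))"
  by (rule continuous_map_into_cont[OF assms(2)]) (rule bounded_linear.continuous_on[OF assms(1) continuous_on_id])

lemmas continuous_map_adj [continuous_intros] = continuous_map_bounded_linear[OF bounded_linear_adj]
lemmas continuous_map_ent [continuous_intros] = continuous_map_bounded_linear[OF bounded_linear_ent]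
lemmas continuous_map_tr [continuous_intros] = continuous_map_bounded_linear[OF bounded_linear_tr]
lemmas continuous_map_Re [continuous_intros] = continuous_map_bounded_linear[OF bounded_linear_Re]
lemmas continuous_map_Im [continuous_intros] = continuous_map_bounded_linear[OF bounded_linear_Im]
lemmas continuous_map_of_real [continuous_intros] = continuous_map_bounded_linear[OF bounded_linear_of_real]

lemma continuous_map_finmatI:
  assumes "\<And>x. x \<in> topspace X \<Longrightarrow> supp N (f x)"
    and "\<And>i j. i < N \<Longrightarrow> j < N \<Longrightarrow> continuous_map X euclidean (\<lambda>x. ent (f x) i j)"
  shows "continuous_map X euclidean f"
proof (rule continuous_map_eq)
  show "continuous_map X euclidean (\<lambda>x. \<Sum>i<N. \<Sum>j<N. csc (ent (f x) i j) (munit i j))"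
    using assms(2) by (intro continuous_map_sum continuous_map_csc) auto
qed (simp add: finmat_decompose[OF assms(1), symmetric])

text \<open>The bound on the support is essential: extension is entrywise, and only finitely many entries can
  be treated.\<close>

lemma Tietze_finmat:
  assumes "normal_space X" "closedin X Z" "continuous_map (subtopology X Z) euclidean f"
    and "\<And>x. x \<in> Z \<Longrightarrow> supp N (f x)"
  shows "\<exists>g. continuous_map X euclidean g \<and> (\<forall>x. supp N (g x)) \<and> (\<forall>x\<in>Z. g x = f x)"
proof -
  have ex: "\<exists>g. continuous_map X euclideanreal g \<and> (\<forall>x\<in>Z. g x = h x)"
    if "continuous_map (subtopology X Z) euclideanreal h" for h
    using Tietze_extension_realinterval[OF assms(1,2) is_interval_univ _ that] by (metis UNIV_I UNIV_not_empty image_subset_iff)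
  have "\<forall>ij. \<exists>g. continuous_map X euclideanreal g \<and> (\<forall>x\<in>Z. g x = Re (ent (f x) (fst ij) (snd ij)))"
    using assms(3) by (intro allI ex continuous_intros)
  from choice[OF this] obtain g where g: "\<forall>ij. continuous_map X euclideanreal (g ij) \<and>
    (\<forall>x\<in>Z. g ij x = Re (ent (f x) (fst ij) (snd ij)))" ..
  have "\<forall>ij. \<exists>g. continuous_map X euclideanreal g \<and> (\<forall>x\<in>Z. g x = Im (ent (f x) (fst ij) (snd ij)))"
    using assms(3) by (intro allI ex continuous_intros)
  from choice[OF this] obtain h where h: "\<forall>ij. continuous_map X euclideanreal (h ij) \<and>
    (\<forall>x\<in>Z. h ij x = Im (ent (f x) (fst ij) (snd ij)))" ..
  define F where "F x = (\<Sum>i<N. \<Sum>j<N. csc (of_real (g (i,j) x) + \<i> * of_real (h (i,j) x)) (munit i j))" for x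
  have "continuous_map X euclidean F"
    unfolding F_def using g h by (intro continuous_intros) auto
  moreover have "supp N (F x)" for x
    unfolding F_def by (intro supp_sum supp_csc supp_munit) auto
  moreover have "F x = f x" if "x \<in> Z" for x
  proof -
    have "of_real (g (i,j) x) + \<i> * of_real (h (i,j) x) = ent (f x) i j" for i j
      using g h that by (simp add: complex_eq_iff)
    then show ?thesis unfolding F_def using finmat_decompose[OF assms(4)[OF that]] by simp
  qed
  ultimately show ?thesis by (intro exI[of _ F]) blast
qed

section \<open>Vectors and projections\<close>

text \<open>A vector is a matrix that vanishes outside its first column; then \<open>a * adj b\<close> is the operator of rank
  one usually written \<open>|a\<rangle>\<langle>b|\<close>, and \<open>adj a * b\<close> is a scalar sitting in the corner.\<close>

definition isvec :: "finmat \<Rightarrow> bool" where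
  "isvec a \<longleftrightarrow> (\<forall>i j. j \<noteq> 0 \<longrightarrow> ent a i j = 0)"

definition ip :: "finmat \<Rightarrow> finmat \<Rightarrow> complex" where
  "ip a b = ent (adj a * b) 0 0"

definition proj :: "finmat \<Rightarrow> bool" where
  "proj p \<longleftrightarrow> p * p = p \<and> adj p = p"

lemma ip_eq: "supp N a \<or> supp N b \<Longrightarrow> ip a b = (\<Sum>k<N. cnj (ent a k 0) * ent b k 0)"
  unfolding ip_def by (subst ent_mult[of N]) (auto simp: supp_adj)

lemma isvec_0 [simp]: "isvec 0" by (simp add: isvec_def)
lemma isvec_add: "isvec a \<Longrightarrow> isvec b \<Longrightarrow> isvec (a + b)" by (simp add: isvec_def)
lemma isvec_diff: "isvec a \<Longrightarrow> isvec b \<Longrightarrow> isvec (a - b)" by (simp add: isvec_def)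
lemma isvec_csc: "isvec a \<Longrightarrow> isvec (csc c a)" by (simp add: isvec_def)
lemma isvec_scaleR: "isvec a \<Longrightarrow> isvec (r *\<^sub>R a)" by (simp add: isvec_def)
lemma isvec_sum: "(\<And>i. i \<in> I \<Longrightarrow> isvec (f i)) \<Longrightarrow> isvec (sum f I)" by (simp add: isvec_def)
lemma isvec_mult: "isvec a \<Longrightarrow> isvec (M * a)"
proof -
  assume a: "isvec a"
  obtain N where "supp N M" "supp N a" using ex_supp2 by blast
  then show ?thesis using a by (simp add: isvec_def ent_mult[of N])
qed

lemma ent_mult_munit: "ent (A * munit j k) i l = (if l = k then ent A i j else 0)"
proof -
  obtain N where "supp N A" using ex_supp by blast
  then have N: "supp (max N (Suc j)) A" using supp_mono by (metis max.cobounded1)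
  have "ent (A * munit j k) i l = (\<Sum>m<max N (Suc j). ent A i m * ent (munit j k) m l)"
    using N by (intro ent_mult) simp
  also have "\<dots> = (\<Sum>m<max N (Suc j). if m = j then (if l = k then ent A i j else 0) else 0)"
    by (intro sum.cong refl) (auto simp: ent_munit)
  also have "\<dots> = (if l = k then ent A i j else 0)" by (simp add: less_max_iff_disj)
  finally show ?thesis .
qed

lemma vec_mult_munit [simp]: "isvec a \<Longrightarrow> a * munit 0 0 = a"
  by (rule finmat_eqI) (auto simp: ent_mult_munit isvec_def)

lemma isvec_mult_munit: "isvec (a * munit j 0)"
  by (simp add: isvec_def ent_mult_munit)

lemma adj_vec_mult_vec:
  assumes "isvec a" "isvec b"
  shows "adj a * b = csc (ip a b) (munit 0 0)"
proof (rule finmat_eqI)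
  fix i j
  obtain N where "supp N a" "supp N b" using ex_supp2 by blast
  then show "ent (adj a * b) i j = ent (csc (ip a b) (munit 0 0)) i j"
    using assms by (cases "i = 0 \<and> j = 0") (auto simp: ip_def ent_munit ent_mult[of N] supp_adj isvec_def)
qed

lemma dyad_mult_vec:
  assumes "isvec a" "isvec b" "isvec c"
  shows "a * adj b * c = csc (ip b c) a"
  using assms by (simp add: mult.assoc adj_vec_mult_vec csc_mult_right)

lemma ip_add_right: "ip a (b + c) = ip a b + ip a c" by (simp add: ip_def distrib_left)
lemma ip_diff_right: "ip a (b - c) = ip a b - ip a c" by (simp add: ip_def right_diff_distrib)
lemma ip_csc_right: "ip a (csc c b) = c * ip a b" by (simp add: ip_def csc_mult_right)
lemma ip_scaleR_right: "ip a (r *\<^sub>R b) = of_real r * ip a b" by (simp add: scaleR_eq_csc ip_csc_right)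
lemma ip_cnj: "ip b a = cnj (ip a b)"
proof -
  have "adj (adj a * b) = adj b * a" by (simp add: adj_mult)
  then show ?thesis unfolding ip_def by (metis ent_adj)
qed
lemma ip_diff_left: "ip (a - b) c = ip a c - ip b c" by (simp add: ip_def adj_diff left_diff_distrib)
lemma ip_csc_left: "ip (csc c a) b = cnj c * ip a b" by (simp add: ip_def adj_csc csc_mult_left)
lemma ip_scaleR_left: "ip (r *\<^sub>R a) b = of_real r * ip a b" by (simp add: scaleR_eq_csc ip_csc_left)
lemma ip_0 [simp]: "ip 0 a = 0" "ip a 0 = 0" by (simp_all add: ip_def)
lemma ip_sum_right: "ip a (sum f I) = (\<Sum>i\<in>I. ip a (f i))"
  by (induction I rule: infinite_finite_induct) (auto simp: ip_add_right)
lemma ip_mult_left: "ip (M * a) b = ip a (adj M * b)"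
  by (simp add: ip_def adj_mult mult.assoc)

lemma cnj_mult_self: "cnj z * z = (complex_of_real (cmod z))\<^sup>2"
  using complex_norm_square[of z] by (simp add: mult.commute)

lemma ip_self: "ip a a = of_real (Re (ip a a))" and ip_self_nonneg: "0 \<le> Re (ip a a)"
proof -
  obtain N where N: "supp N a" using ex_supp by blast
  have "ip a a = of_real (\<Sum>k<N. (cmod (ent a k 0))\<^sup>2)"
    using N unfolding of_real_sum by (simp add: ip_eq[of N] cnj_mult_self)
  then show "ip a a = of_real (Re (ip a a))" "0 \<le> Re (ip a a)"
    by (auto simp: sum_nonneg)
qed

text \<open>The C*-property in its weakest form; many identities between partial isometries are proved below by
  computing \<open>adj D * D\<close> for the difference \<open>D\<close> of the two sides.\<close>

lemma adj_mult_self_eq_0: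
  assumes "adj D * D = 0"
  shows "D = 0"
proof (rule finmat_eqI)
  fix i j
  obtain N where N: "supp N D" using ex_supp by blast
  have "0 = ent (adj D * D) j j" using assms by simp
  also have "\<dots> = of_real (\<Sum>k<N. (cmod (ent D k j))\<^sup>2)"
    using N unfolding of_real_sum by (simp add: ent_mult[of N] cnj_mult_self)
  finally have "(\<Sum>k<N. (cmod (ent D k j))\<^sup>2) = 0" by (metis of_real_eq_0_iff)
  then have "\<forall>k<N. ent D k j = 0" by (simp add: sum_nonneg_eq_0_iff)
  then show "ent D i j = ent 0 i j" using N suppD[of N D i j] by auto
qed

lemma ip_self_eq_0: "isvec a \<Longrightarrow> Re (ip a a) = 0 \<longleftrightarrow> a = 0"
  by (metis adj_mult_self_eq_0 adj_vec_mult_vec csc_0 ip_0(1) ip_self of_real_0 zero_complex.simps(1))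

lemma ip_self_pos: "isvec a \<Longrightarrow> a \<noteq> 0 \<Longrightarrow> 0 < Re (ip a a)"
  using ip_self_eq_0 ip_self_nonneg by (metis less_eq_real_def)

definition normalize_vec :: "finmat \<Rightarrow> finmat" where
  "normalize_vec a = (1 / sqrt (Re (ip a a))) *\<^sub>R a"

lemma ip_normalize_vec: "isvec a \<Longrightarrow> a \<noteq> 0 \<Longrightarrow> ip (normalize_vec a) (normalize_vec a) = 1"
proof -
  assume a: "isvec a" "a \<noteq> 0"
  define r where "r = Re (ip a a)"
  have r: "r > 0" "ip a a = of_real r" using ip_self_pos[OF a] ip_self[of a] by (auto simp: r_def)
  have "ip (normalize_vec a) (normalize_vec a) = of_real (1 / sqrt r) * (of_real (1 / sqrt r) * of_real r)"
    unfolding normalize_vec_def r_def[symmetric] by (simp only: ip_scaleR_left ip_scaleR_right r(2))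
  also have "\<dots> = of_real (1 / sqrt r * (1 / sqrt r) * r)" by (simp only: of_real_mult mult.assoc)
  also have "1 / sqrt r * (1 / sqrt r) * r = 1" using r(1) by simp
  finally show ?thesis by simp
qed

lemma isvec_normalize_vec: "isvec a \<Longrightarrow> isvec (normalize_vec a)"
  by (simp add: normalize_vec_def isvec_scaleR)

lemma mult_normalize_vec: "p * a = a \<Longrightarrow> p * normalize_vec a = normalize_vec a"
  by (simp add: normalize_vec_def)

lemma normalize_vec_unit: "ip a a = 1 \<Longrightarrow> normalize_vec a = a"
  by (simp add: normalize_vec_def)

lemma continuous_map_ip [continuous_intros]:
  assumes "continuous_map X euclidean f" "continuous_map X euclidean g"
  shows "continuous_map X euclidean (\<lambda>x. ip (f x) (g x))"
  unfolding ip_def using assms by (intro continuous_intros)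

lemma continuous_map_normalize_vec:
  assumes "continuous_map X euclidean f" "\<And>x. x \<in> topspace X \<Longrightarrow> isvec (f x) \<and> f x \<noteq> 0"
  shows "continuous_map X euclidean (\<lambda>x. normalize_vec (f x))"
proof -
  have "continuous_map X euclideanreal (\<lambda>x. sqrt (Re (ip (f x) (f x))))"
    using assms(1) by (intro continuous_map_into_cont[where g = sqrt] continuous_intros)
  moreover have "sqrt (Re (ip (f x) (f x))) \<noteq> 0" if "x \<in> topspace X" for x
    using assms(2)[OF that] ip_self_pos[of "f x"] by auto
  ultimately show ?thesis
    unfolding normalize_vec_def using assms(1) by (intro continuous_intros) auto
qed

lemma tr_dyad: "isvec a \<Longrightarrow> isvec b \<Longrightarrow> tr (a * adj b) = ip b a"
proof -
  assume "isvec a" "isvec b"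
  then have "tr (a * adj b) = tr (csc (ip b a) (munit 0 0))"
    by (subst tr_mult_commute) (simp add: adj_vec_mult_vec)
  moreover have "tr (munit 0 0) = 1"
    by (subst tr_eq[of 1]) (auto simp: supp_munit ent_munit)
  ultimately show ?thesis by (simp add: tr_csc)
qed

lemma tr_adj_mult_self: "0 \<le> Re (tr (adj D * D))"
proof -
  obtain N where N: "supp N D" using ex_supp by blast
  have "tr (adj D * D) = of_real (\<Sum>j<N. \<Sum>k<N. (cmod (ent D k j))\<^sup>2)"
    using N unfolding of_real_sum
    by (simp add: tr_eq[of N] supp_mult supp_adj ent_mult[of N] cnj_mult_self)
  then show ?thesis by (simp add: sum_nonneg)
qed

lemma proj_tr_nonneg: "proj p \<Longrightarrow> 0 \<le> Re (tr p)"
  using tr_adj_mult_self[of p] by (simp add: proj_def)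

lemma proj_minus_dyad:
  assumes "proj p" "isvec b" "ip b b = 1" "p * b = b"
  shows "proj (p - b * adj b)" "tr (p - b * adj b) = tr p - 1" "(p - b * adj b) * b = 0"
    "p * (p - b * adj b) = p - b * adj b"
proof -
  have bb: "b * adj b * b = b" using assms dyad_mult_vec[of b b b] by simp
  have bp: "adj b * p = adj b" using assms by (metis adj_mult proj_def)
  have pp: "p * p = p" "adj p = p" using assms by (auto simp: proj_def)
  have 1: "b * adj b * p = b * adj b" using bp by (simp add: mult.assoc)
  have 2: "p * (b * adj b) = b * adj b" using assms(4) by (simp flip: mult.assoc)
  have 3: "b * adj b * (b * adj b) = b * adj b" using bb by (simp flip: mult.assoc)
  show "proj (p - b * adj b)"
    unfolding proj_def by (simp add: left_diff_distrib right_diff_distrib 1 2 3 pp adj_diff adj_mult)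
  show "tr (p - b * adj b) = tr p - 1" using assms by (simp add: tr_diff tr_dyad)
  show "(p - b * adj b) * b = 0" using bb assms(4) by (simp add: left_diff_distrib)
  show "p * (p - b * adj b) = p - b * adj b" by (simp add: right_diff_distrib pp 2)
qed

lemma nonzero_column: "p \<noteq> 0 \<Longrightarrow> \<exists>j. p * munit j 0 \<noteq> 0"
proof (rule ccontr)
  assume "p \<noteq> 0" and n: "\<nexists>j. p * munit j 0 \<noteq> 0"
  have "ent p i j = 0" for i j
    using n ent_mult_munit[of p j 0 i 0] by (metis ent_0)
  then have "p = 0" by (intro finmat_eqI) simp
  then show False using \<open>p \<noteq> 0\<close> by simp
qed

text \<open>A nonzero column of \<open>p\<close> spans, after normalization, a subprojection of rank one.\<close>

lemma proj_tr_ge_1: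
  assumes "proj p" "p \<noteq> 0"
  shows "1 \<le> Re (tr p)"
proof -
  obtain j where j: "p * munit j 0 \<noteq> 0" using nonzero_column[OF assms(2)] by blast
  define b where "b = normalize_vec (p * munit j 0)"
  have "isvec b" "ip b b = 1" "p * b = b"
    using j assms(1) unfolding b_def
    by (auto intro!: isvec_normalize_vec isvec_mult_munit ip_normalize_vec mult_normalize_vec
        simp: mult.assoc[symmetric] proj_def)
  from proj_minus_dyad(1,2)[OF assms(1) this] show ?thesis
    using proj_tr_nonneg[of "p - b * adj b"] by simp
qed

section \<open>Frames\<close>

text \<open>An orthonormal basis of the range of \<open>p\<close>.\<close>

definition frame :: "nat \<Rightarrow> (nat \<Rightarrow> finmat) \<Rightarrow> finmat \<Rightarrow> bool" where
  "frame r b p \<longleftrightarrow> (\<forall>j<r. isvec (b j)) \<and> (\<forall>i<r. \<forall>j<r. ip (b i) (b j) = (if i = j then 1 else 0)) \<and>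
     p = (\<Sum>j<r. b j * adj (b j))"

lemma frame_mult_vec:
  assumes "frame r b p" "isvec a"
  shows "p * a = (\<Sum>j<r. csc (ip (b j) a) (b j))"
  using assms by (simp add: frame_def sum_distrib_right dyad_mult_vec)

lemma frame_mult_basis:
  assumes "frame r b p" "j < r"
  shows "p * b j = b j"
proof -
  have "p * b j = (\<Sum>i<r. csc (if i = j then 1 else 0) (b i))"
    using assms by (subst frame_mult_vec[OF assms(1)]) (auto simp: frame_def intro!: sum.cong)
  also have "\<dots> = (\<Sum>i<r. if i = j then b i else 0)" by (intro sum.cong) auto
  also have "\<dots> = b j" using assms(2) by simp
  finally show ?thesis .
qed

lemma frame_proj: "frame r b p \<Longrightarrow> proj p"
proof -
  assume f: "frame r b p"
  have p: "p = (\<Sum>j<r. b j * adj (b j))" using f by (simp add: frame_def)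
  have "p * p = (\<Sum>j<r. (p * b j) * adj (b j))"
    by (subst (2) p) (simp add: sum_distrib_left mult.assoc)
  also have "\<dots> = p" using frame_mult_basis[OF f] p by simp
  finally have "p * p = p" .
  moreover have "adj p = p" by (simp add: p adj_sum adj_mult)
  ultimately show ?thesis by (simp add: proj_def)
qed

lemma frame_tr: "frame r b p \<Longrightarrow> tr p = of_nat r"
proof -
  have tr_sum: "tr (sum f I) = (\<Sum>i\<in>I. tr (f i))" for f :: "nat \<Rightarrow> finmat" and I
    by (induction I rule: infinite_finite_induct) (auto simp: tr_add)
  assume "frame r b p"
  then show ?thesis by (simp add: frame_def tr_sum tr_dyad)
qed

lemma frame_SucD: "frame (Suc r) b p \<Longrightarrow> frame r b (p - b r * adj (b r))"
  by (simp add: frame_def)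

lemma frame_SucI:
  assumes "frame r b (p - a * adj a)" "isvec a" "ip a a = 1" "p * a = a"
  shows "frame (Suc r) (b(r := a)) p"
proof -
  have "(p - a * adj a) * a = 0"
    using assms dyad_mult_vec[of a a a] by (simp add: left_diff_distrib)
  then have 0: "ip a (b j) = 0" if "j < r" for j
    using frame_mult_basis[OF assms(1) that] frame_proj[OF assms(1)]
    by (metis ip_0(1) ip_mult_left proj_def)
  then have "ip (b j) a = 0" if "j < r" for j using that ip_cnj[of a "b j"] by simp
  moreover have "p = (\<Sum>j<r. b j * adj (b j)) + a * adj a"
    using assms(1) by (metis diff_add_cancel frame_def)
  ultimately show ?thesis using assms 0 by (auto simp: frame_def less_Suc_eq)
qed

lemma supp_vec_of_proj:
  assumes "supp N p" "isvec b" "p * b = b"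
  shows "supp N b"
proof -
  have "ent b i j = 0" if "N \<le> i" for i j
    using assms(1) that by (subst assms(3)[symmetric]) (simp add: ent_mult[of N] supp_def)
  moreover have "ent b i j = 0" if "N \<le> j" for i j
    using that assms(2) calculation[of i j] by (cases "j = 0") (auto simp: isvec_def)
  ultimately show ?thesis unfolding supp_def by blast
qed

text \<open>Projection fields are locally trivial: a column of \<open>p\<close> that is nonzero at \<open>x0\<close> stays so nearby, is
  normalized and split off. The rank drops by one in each step, and when \<open>p x0 = 0\<close> is reached, \<open>p\<close>
  vanishes nearby, as the trace of a nonzero projection is at least \<open>1\<close>.\<close>

lemma local_frame:
  assumes "continuous_map X euclidean p" "\<And>x. x \<in> topspace X \<Longrightarrow> proj (p x)" "x0 \<in> topspace X"
  shows "\<exists>U r b. openin X U \<and> x0 \<in> U \<and> (\<forall>j<r. continuous_map (subtopology X U) euclidean (b j)) \<and>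
    (\<forall>x\<in>U. frame r (\<lambda>j. b j x) (p x))"
proof -
  have "Re (tr (p x0)) < n \<Longrightarrow> ?thesis" if "continuous_map X euclidean p"
    "\<forall>x\<in>topspace X. proj (p x)" "x0 \<in> topspace X" for n :: nat
    using that
  proof (induction n arbitrary: X p)
    case 0
    then show ?case using proj_tr_nonneg[of "p x0"] by auto
  next
    case (Suc n)
    show ?case
    proof (cases "p x0 = 0")
      case True
      define U where "U = {x \<in> topspace X. Re (tr (p x)) \<in> {..<1}}"
      have "openin X U" unfolding U_def
        using Suc.prems(2) by (intro openin_continuous_map_preimage[where Y = euclideanreal] continuous_intros) auto
      moreover have "x0 \<in> U" using Suc.prems True by (auto simp: U_def)
      moreover have "frame 0 (\<lambda>_. 0) (p x)" if "x \<in> U" for x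
      proof -
        have "p x = 0" using proj_tr_ge_1[of "p x"] that Suc.prems(3) by (auto simp: U_def)
        then show ?thesis by (simp add: frame_def)
      qed
      ultimately show ?thesis by (intro exI[of _ U] exI[of _ 0] exI[of _ "\<lambda>_ _. 0"]) auto
    next
      case False
      then obtain j where j: "p x0 * munit j 0 \<noteq> 0" using nonzero_column by blast
      define a where "a x = p x * munit j 0" for x
      have a: "isvec (a x)" for x by (simp add: a_def isvec_mult_munit)
      have ac: "continuous_map X euclidean a"
        unfolding a_def using Suc.prems(2) by (intro continuous_intros) auto
      define U where "U = {x \<in> topspace X. Re (ip (a x) (a x)) \<in> {0<..}}"
      have U: "openin X U" unfolding U_def
        using ac by (intro openin_continuous_map_preimage[where Y = euclideanreal] continuous_intros) auto
      have x0: "x0 \<in> U" using ip_self_pos[OF a] j Suc.prems(4) by (auto simp: U_def a_def)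
      define b where "b x = normalize_vec (a x)" for x
      have ane: "a x \<noteq> 0" if "x \<in> U" for x using that by (auto simp: U_def)
      have bc: "continuous_map (subtopology X U) euclidean b"
        unfolding b_def using a ane ac by (intro continuous_map_normalize_vec continuous_map_from_subtopology) auto
      have b: "isvec (b x)" "ip (b x) (b x) = 1" "p x * b x = b x" if "x \<in> U" for x
      proof -
        show "isvec (b x)" "ip (b x) (b x) = 1"
          unfolding b_def using a ane[OF that] by (auto intro: isvec_normalize_vec ip_normalize_vec)
        have "p x * a x = a x" using Suc.prems(3) that by (auto simp: a_def U_def proj_def simp flip: mult.assoc)
        then show "p x * b x = b x" unfolding b_def by (rule mult_normalize_vec)
      qed
      define p' where "p' x = p x - b x * adj (b x)" for x
      have "continuous_map (subtopology X U) euclidean p'"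
        unfolding p'_def using bc continuous_map_from_subtopology[OF Suc.prems(2)] by (intro continuous_intros)
      moreover have p': "proj (p' x)" "tr (p' x) = tr (p x) - 1" if "x \<in> U" for x
        using proj_minus_dyad[OF _ b[OF that]] Suc.prems(3) that by (auto simp: p'_def U_def)
      moreover have "Re (tr (p' x0)) < n" using p'(2)[OF x0] Suc.prems(1) by simp
      moreover have "x0 \<in> topspace (subtopology X U)" using x0 Suc.prems(4) by simp
      ultimately have "\<exists>V r c. openin (subtopology X U) V \<and> x0 \<in> V \<and>
         (\<forall>j<r. continuous_map (subtopology (subtopology X U) V) euclidean (c j)) \<and>
         (\<forall>x\<in>V. frame r (\<lambda>j. c j x) (p' x))"
        by (intro Suc.IH) auto
      then obtain V r c where V: "openin (subtopology X U) V" "x0 \<in> V"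
         "\<forall>j<r. continuous_map (subtopology (subtopology X U) V) euclidean (c j)"
         "\<forall>x\<in>V. frame r (\<lambda>j. c j x) (p' x)" by (elim exE conjE) (rule that)
      have VU: "V \<subseteq> U" using V(1) openin_imp_subset by blast
      have "openin X V" using V(1) U openin_open_subtopology by blast
      moreover have top: "subtopology (subtopology X U) V = subtopology X V"
        using VU by (simp add: subtopology_subtopology Int_absorb1)
      moreover have "continuous_map (subtopology X V) euclidean b"
        using bc VU by (rule continuous_map_from_subtopology_mono)
      moreover have "frame (Suc r) (\<lambda>j. (c(r := b)) j x) (p x)" if "x \<in> V" for x
      proof -
        have "frame (Suc r) ((\<lambda>j. c j x)(r := b x)) (p x)"
          using V(4) b[of x] that VU by (intro frame_SucI) (auto simp: p'_def)
        moreover have "(\<lambda>j. (c(r := b)) j x) = (\<lambda>j. c j x)(r := b x)" by auto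
        ultimately show ?thesis by simp
      qed
      ultimately show ?thesis using V(2,3)
        by (intro exI[of _ V] exI[of _ "Suc r"] exI[of _ "c(r := b)"]) (auto simp: less_Suc_eq)
    qed
  qed
  moreover obtain n :: nat where "Re (tr (p x0)) < n" using reals_Archimedean2 by blast
  ultimately show ?thesis using assms by blast
qed

section \<open>Cayley transforms\<close>

lemma double_cancel: "x + x = y + y \<Longrightarrow> x = y" for x y :: "'a :: real_vector"
  by (metis scaleR_2 scaleR_cancel_left zero_neq_numeral)

text \<open>The eigenvalues of \<open>S\<close> are imaginary, so \<open>1\<close> is not among them: \<open>1 - S\<close> is injective. The proof compares
  \<open>adj D * D = adj D * S * D\<close> with its adjoint, which has the opposite sign.\<close>

lemma skew_no_fixed_vector:
  assumes "adj S = - S" "D = S * D"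
  shows "D = 0"
proof -
  have e: "adj D * D = adj D * (S * D)" using assms(2) by simp
  have "adj (adj D * D) = adj (adj D * (S * D))" using e by simp
  then have "adj D * D = - (adj D * (S * D))"
    by (simp add: adj_mult assms(1) mult.assoc)
  then have "adj D * D + adj D * D = 0 + 0" using e by (metis add.right_inverse add_0)
  then have "adj D * D = 0" by (rule double_cancel)
  then show ?thesis by (rule adj_mult_self_eq_0)
qed

text \<open>\<open>T = 2 (1 - S)\<^sup>-\<^sup>1 S\<close>, with the inverse taken in \<open>M\<^sub>N(\<complex>)\<close>, where \<open>1 - S\<close> is injective.\<close>

lemma cayley_exists:
  assumes "adj S = - S"
  shows "\<exists>T. T = S + S + S * T"
proof -
  obtain N where N: "supp N S" using ex_supp by blast
  define A where "A = Matrix.mat N N (\<lambda>(i, j). (if i = j then 1 else 0) - ent S i j)"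
  have A: "A \<in> carrier_mat N N" by (simp add: A_def)
  have Asum: "(\<Sum>k<N. A $$ (i, k) * f k) = f i - (\<Sum>k<N. ent S i k * f k)" if "i < N" for i f
  proof -
    have "(\<Sum>k<N. A $$ (i, k) * f k) = (\<Sum>k<N. (if k = i then f k else 0) - ent S i k * f k)"
      using that by (intro sum.cong) (auto simp: A_def left_diff_distrib)
    also have "\<dots> = f i - (\<Sum>k<N. ent S i k * f k)" using that by (simp add: sum_subtractf)
    finally show ?thesis .
  qed
  have "det A \<noteq> 0"
  proof
    assume "det A = 0"
    then obtain v where v: "v \<in> carrier_vec N" "v \<noteq> 0\<^sub>v N" "A *\<^sub>v v = 0\<^sub>v N"
      using det_0_iff_vec_prod_zero_field[OF A] by blast
    define D where "D = block N (\<lambda>i j. if j = 0 then vec_index v i else 0)"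
    have "D = S * D"
    proof (rule finmat_eqI)
      fix i j
      show "ent D i j = ent (S * D) i j"
      proof (cases "i < N \<and> j = 0")
        case True
        then have "0 = vec_index (A *\<^sub>v v) i" using v(3) by simp
        also have "\<dots> = (\<Sum>k<N. A $$ (i, k) * vec_index v k)"
          using True A v(1) by (simp add: scalar_prod_def atLeast0LessThan)
        also have "\<dots> = vec_index v i - (\<Sum>k<N. ent S i k * vec_index v k)" using Asum True by blast
        finally have "vec_index v i = (\<Sum>k<N. ent S i k * vec_index v k)" by simp
        moreover have "(\<Sum>k<N. ent S i k * ent D k 0) = (\<Sum>k<N. ent S i k * vec_index v k)"
          by (intro sum.cong) (auto simp: D_def ent_block)
        ultimately show ?thesis using True N by (simp add: ent_mult[of N]) (simp add: D_def ent_block)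
      next
        case False
        have "ent (S * D) i j = (\<Sum>k<N. ent S i k * ent D k j)" using N by (simp add: ent_mult[of N])
        also have "\<dots> = 0" using False N by (intro sum.neutral) (auto simp: D_def ent_block supp_def)
        finally show ?thesis using False by (auto simp: D_def ent_block)
      qed
    qed
    then have "D = 0" by (rule skew_no_fixed_vector[OF assms])
    have "vec_index v i = 0" if "i < N" for i
    proof -
      have "ent D i 0 = vec_index v i" using that by (auto simp: D_def ent_block)
      then show ?thesis using \<open>D = 0\<close> by simp
    qed
    then have "v = 0\<^sub>v N" using v(1) by (intro eq_vecI) auto
    then show False using v(2) by blast
  qed
  then have "A \<in> Units (ring_mat TYPE(complex) N ())" by (rule det_non_zero_imp_unit[OF A])
  then obtain B where B: "B \<in> carrier_mat N N" "A * B = 1\<^sub>m N"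
    by (auto simp: Units_def ring_mat_def)
  have AB: "(\<Sum>k<N. A $$ (i, k) * B $$ (k, l)) = (if i = l then 1 else 0)" if "i < N" "l < N" for i l
  proof -
    have "(A * B) $$ (i, l) = (\<Sum>k<N. A $$ (i, k) * B $$ (k, l))"
      using A B(1) that by (simp add: scalar_prod_def atLeast0LessThan)
    then show ?thesis using B(2) that by simp
  qed
  define T where "T = block N (\<lambda>i j. 2 * (\<Sum>l<N. B $$ (i, l) * ent S l j))"
  have T: "supp N T" by (simp add: T_def)
  have "T = S + S + S * T"
  proof (rule finmat_eqI)
    fix i j
    show "ent T i j = ent (S + S + S * T) i j"
    proof (cases "i < N \<and> j < N")
      case True
      have "(\<Sum>k<N. A $$ (i, k) * ent T k j) = (\<Sum>k<N. \<Sum>l<N. 2 * (A $$ (i, k) * B $$ (k, l) * ent S l j))"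
        using True by (intro sum.cong refl) (simp add: T_def ent_block sum_distrib_left mult_ac)
      also have "\<dots> = (\<Sum>l<N. 2 * ((\<Sum>k<N. A $$ (i, k) * B $$ (k, l)) * ent S l j))"
        by (subst sum.swap) (simp add: sum_distrib_left sum_distrib_right)
      also have "\<dots> = (\<Sum>l<N. if l = i then 2 * ent S l j else 0)"
        using True AB by (intro sum.cong refl) auto
      also have "\<dots> = 2 * ent S i j" using True by simp
      finally have "ent T i j - (\<Sum>k<N. ent S i k * ent T k j) = 2 * ent S i j"
        using Asum[of i "\<lambda>k. ent T k j"] True by simp
      then show ?thesis using N by (simp add: ent_mult[of N] algebra_simps)
    next
      case False
      then have "ent X i j = 0" if "supp N X" for X using that by (auto simp: supp_def not_less)
      then show ?thesis using N T by (metis supp_add supp_mult)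
    qed
  qed
  then show ?thesis by blast
qed

text \<open>For skew-adjoint \<open>S\<close> the unitary \<open>(1 + S) (1 - S)\<^sup>-\<^sup>1\<close> equals \<open>1 + cayley S\<close>. Unitaries of this form are
  used because their parameters form a vector space: unlike a unitary, a skew-adjoint element can be
  lifted through a surjection, and a skew-adjoint field can be extended from a closed subset by
  Tietze's theorem and symmetrization.\<close>

definition cayley :: "finmat \<Rightarrow> finmat" where
  "cayley S = (THE T. T = S + S + S * T)"

lemma cayley_unique:
  assumes "adj S = - S" "T = S + S + S * T"
  shows "cayley S = T"
  unfolding cayley_def
proof (rule the_equality)
  fix Q assume "Q = S + S + S * Q"
  then have "Q - T = S * (Q - T)" using assms(2) by (metis add_diff_cancel_left right_diff_distrib)
  then have "Q - T = 0" by (rule skew_no_fixed_vector[OF assms(1)])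
  then show "Q = T" by simp
qed (rule assms(2))

lemma cayley_left: "adj S = - S \<Longrightarrow> cayley S = S + S + S * cayley S"
proof -
  assume S: "adj S = - S"
  obtain T where T: "T = S + S + S * T" using cayley_exists[OF S] ..
  show ?thesis using T unfolding cayley_unique[OF S T] .
qed

text \<open>\<open>T\<close> commutes with \<open>S\<close>: the defect \<open>Z\<close> of the identity satisfies \<open>S * Z = Z\<close>.\<close>

lemma cayley_right:
  assumes S: "adj S = - S"
  shows "cayley S = S + S + cayley S * S"
proof -
  define T where "T = cayley S"
  have T: "T = S + S + S * T" unfolding T_def by (rule cayley_left[OF S])
  define Z where "Z = T - (S + S + T * S)"
  have ST: "S * T = T - (S + S)" using T by (metis add_diff_cancel_left')
  have "S * Z = S * T - (S * S + S * S + (S * T) * S)"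
    by (simp add: Z_def right_diff_distrib distrib_left mult.assoc)
  also have "\<dots> = Z" unfolding ST by (simp add: Z_def left_diff_distrib distrib_right)
  finally have "Z = 0" using skew_no_fixed_vector[OF S] by metis
  then show ?thesis by (simp add: Z_def T_def)
qed

lemma cayley_0 [simp]: "cayley 0 = 0"
  by (rule cayley_unique) auto

lemma half_sum_zero:
  fixes X a t :: "'a :: real_vector"
  assumes "X = - (a + a) - (t + t) - X"
  shows "X + a + t = 0"
proof -
  have "X + X = - (a + a) - (t + t)" using assms by (metis diff_add_cancel)
  then have "(X + X) + (a + a) + (t + t) = 0" by simp
  then have "(X + a + t) + (X + a + t) = 0 + 0" by (simp add: ac_simps)
  then show ?thesis by (rule double_cancel)
qed

text \<open>Unitarity of \<open>1 + cayley S\<close>, expanded so as to avoid the unit.\<close>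

lemma cayley_isometry:
  assumes S: "adj S = - S"
  shows "adj (cayley S) * cayley S + adj (cayley S) + cayley S = 0"
    and "cayley S * adj (cayley S) + adj (cayley S) + cayley S = 0"
proof -
  define T where "T = cayley S"
  have T1: "S * T = T - (S + S)" using cayley_left[OF S] unfolding T_def by (metis add_diff_cancel_left')
  have T2: "T * S = T - (S + S)" using cayley_right[OF S] unfolding T_def by (metis add_diff_cancel_left')
  have a1: "adj T * S = - adj T - (S + S)"
  proof -
    have "adj (S * T) = adj (T - (S + S))" using T1 by simp
    then have "- (adj T * S) = adj T + (S + S)" by (simp add: adj_mult S adj_diff adj_add)
    then show ?thesis by (metis minus_add_distrib minus_minus diff_conv_add_uminus)
  qed
  have a2: "S * adj T = - adj T - (S + S)"
  proof -
    have "adj (T * S) = adj (T - (S + S))" using T2 by simp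
    then have "- (S * adj T) = adj T + (S + S)" by (simp add: adj_mult S adj_diff adj_add)
    then show ?thesis by (metis minus_add_distrib minus_minus diff_conv_add_uminus)
  qed
  have "adj T * T = adj T * (S + S + S * T)" using cayley_left[OF S] by (simp add: T_def)
  also have "\<dots> = adj T * S + adj T * S + (adj T * S) * T" by (simp add: distrib_left mult.assoc)
  also have "\<dots> = (- adj T - (S + S)) + (- adj T - (S + S)) + ((- adj T) * T - (S * T + S * T))"
    unfolding a1 by (simp add: left_diff_distrib distrib_right)
  also have "\<dots> = - (adj T + adj T) - (T + T) - adj T * T" unfolding T1 by (simp add: algebra_simps)
  finally show "adj (cayley S) * cayley S + adj (cayley S) + cayley S = 0"
    unfolding T_def by (rule half_sum_zero)
  have "T * adj T = (S + S + T * S) * adj T" using cayley_right[OF S] by (simp add: T_def)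
  also have "\<dots> = S * adj T + S * adj T + T * (S * adj T)" by (simp add: distrib_right mult.assoc)
  also have "\<dots> = (- adj T - (S + S)) + (- adj T - (S + S)) + (T * (- adj T) - (T * S + T * S))"
    unfolding a2 by (simp add: right_diff_distrib distrib_left)
  also have "\<dots> = - (adj T + adj T) - (T + T) - T * adj T" unfolding T2 by (simp add: algebra_simps)
  finally show "cayley S * adj (cayley S) + adj (cayley S) + cayley S = 0"
    unfolding T_def by (rule half_sum_zero)
qed

lemma cayley_mult_left: "adj S = - S \<Longrightarrow> F * S = S \<Longrightarrow> F * cayley S = cayley S"
  by (metis cayley_left distrib_left mult.assoc)

lemma cayley_mult_right: "adj S = - S \<Longrightarrow> S * F = S \<Longrightarrow> cayley S * F = cayley S"
  by (metis cayley_right distrib_right mult.assoc)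

lemma supp_mult_left: "supp N A \<Longrightarrow> N \<le> i \<Longrightarrow> ent (A * B) i j = 0"
  by (simp add: ent_mult[of N] supp_def)

lemma supp_mult_right: "supp N B \<Longrightarrow> N \<le> j \<Longrightarrow> ent (A * B) i j = 0"
  by (simp add: ent_mult[of N] supp_def)

lemma supp_cayley:
  assumes "adj S = - S" "supp N S"
  shows "supp N (cayley S)"
  unfolding supp_def
proof (intro allI impI)
  fix i j assume "N \<le> i \<or> N \<le> j"
  then show "ent (cayley S) i j = 0"
  proof
    assume i: "N \<le> i"
    then have "ent (S + S + S * cayley S) i j = 0" using assms(2) by (simp add: supp_mult_left supp_def)
    then show ?thesis using cayley_left[OF assms(1)] by simp
  next
    assume j: "N \<le> j"
    then have "ent (S + S + cayley S * S) i j = 0" using assms(2) by (simp add: supp_mult_right supp_def)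
    then show ?thesis using cayley_right[OF assms(1)] by simp
  qed
qed

text \<open>The columns of the unitary \<open>1 + T\<close> are unit vectors, so the entries of \<open>T\<close> are bounded by \<open>2\<close>.
  The diagonal entries come first: unitarity bounds the square of each entry in column \<open>j\<close> by twice the
  absolute value of the diagonal one.\<close>

lemma norm_cayley_le:
  assumes S: "adj S = - S" "supp N S"
  shows "norm (cayley S) \<le> 2 * real N * real N"
proof -
  define T where "T = cayley S"
  have T: "supp N T" unfolding T_def by (rule supp_cayley[OF S])
  have le: "cmod (ent T i j) \<le> 2" if ij: "i < N" "j < N" for i j
  proof -
    have "ent (adj T * T + adj T + T) j j = 0" using cayley_isometry(1)[OF S(1)] by (simp add: T_def)
    then have "complex_of_real (\<Sum>k<N. (cmod (ent T k j))\<^sup>2) + (cnj (ent T j j) + ent T j j) = 0"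
      using T by (simp add: ent_mult[of N] cnj_mult_self add.assoc)
    then have "of_real (\<Sum>k<N. (cmod (ent T k j))\<^sup>2) = - (cnj (ent T j j) + ent T j j)"
      by (rule eq_neg_iff_add_eq_0[THEN iffD2])
    then have "of_real (\<Sum>k<N. (cmod (ent T k j))\<^sup>2) = complex_of_real (- 2 * Re (ent T j j))"
      by (simp add: complex_eq_iff)
    then have eq: "(\<Sum>k<N. (cmod (ent T k j))\<^sup>2) = - 2 * Re (ent T j j)" by (metis of_real_eq_iff)
    have le: "(cmod (ent T k j))\<^sup>2 \<le> 2 * cmod (ent T j j)" if "k < N" for k
    proof -
      have "(cmod (ent T k j))\<^sup>2 \<le> (\<Sum>k<N. (cmod (ent T k j))\<^sup>2)"
        using that by (intro member_le_sum) auto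
      then show ?thesis using eq abs_Re_le_cmod[of "ent T j j"] by linarith
    qed
    have "cmod (ent T j j) \<le> 2"
    proof (cases "ent T j j = 0")
      case False
      then show ?thesis using le[OF ij(2)] by (simp add: power2_eq_square)
    qed simp
    then have "(cmod (ent T i j))\<^sup>2 \<le> 2\<^sup>2" using le[OF ij(1)] by simp
    then show ?thesis by (rule power2_le_imp_le) simp
  qed
  have "norm T = (\<Sum>i<N. \<Sum>j<N. cmod (ent T i j))" by (rule norm_finmat_eq[OF T])
  also have "\<dots> \<le> (\<Sum>i<N. \<Sum>j<N. 2)" using le by (intro sum_mono) auto
  finally show ?thesis by (simp add: T_def mult_ac)
qed

text \<open>A resolvent identity: \<open>(1 - S) E = D + D + D * cayley R\<close> for the differences \<open>E\<close> of the transforms and \<open>D\<close> of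
  the arguments, and \<open>(1 - S)\<^sup>-\<^sup>1 = 1 + cayley S / 2\<close>.\<close>

lemma cayley_diff:
  assumes S: "adj S = - S" and R: "adj R = - R"
  shows "cayley S - cayley R = ((S - R) + (S - R) + (S - R) * cayley R) +
     (1/2) *\<^sub>R (cayley S * ((S - R) + (S - R) + (S - R) * cayley R))"
proof -
  define T Q D where "T = cayley S" and "Q = cayley R" and "D = S - R"
  define E where "E = T - Q"
  have T: "T = S + S + S * T" and Q: "Q = R + R + R * Q"
    unfolding T_def Q_def by (rule cayley_left[OF S], rule cayley_left[OF R])
  have TS: "T * S = T - (S + S)" unfolding T_def using cayley_right[OF S] by (metis add_diff_cancel_left')
  have "E = (S + S + S * T) - (R + R + R * Q)" using T Q unfolding E_def by metis
  then have "E - S * E = ((S + S + S * T) - (R + R + R * Q)) - S * (T - Q)" unfolding E_def by simp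
  then have ED: "E - S * E = D + D + D * Q"
    by (simp add: D_def left_diff_distrib right_diff_distrib)
  have "T * (E - S * E) = T * E - (T * S) * E" by (simp add: right_diff_distrib mult.assoc)
  also have "\<dots> = S * E + S * E" by (simp add: TS left_diff_distrib distrib_right)
  finally have "(1/2) *\<^sub>R (T * (E - S * E)) = S * E" by (simp flip: scaleR_2)
  then have "E = (E - S * E) + (1/2) *\<^sub>R (T * (E - S * E))" by simp
  then show ?thesis unfolding ED by (simp add: E_def T_def Q_def D_def)
qed

text \<open>The preceding identity and bound give a Lipschitz estimate. The constant depends on \<open>N\<close>, hence the
  restriction to one matrix size.\<close>

lemma continuous_on_cayley: "continuous_on {S. adj S = - S \<and> supp N S} cayley"
proof -
  define c where "c = 2 * real N * real N"
  have c: "c \<ge> 0" by (simp add: c_def)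
  define K where "K = (2 + c) + (1/2) * (c * (2 + c))"
  have K: "K > 0" unfolding K_def using c by (intro add_pos_nonneg) auto
  have "dist (cayley S) (cayley R) \<le> K * dist S R"
    if S: "adj S = - S" "supp N S" and R: "adj R = - R" "supp N R" for S R
  proof -
    define W where "W = (S - R) + (S - R) + (S - R) * cayley R"
    have "norm W \<le> norm (S - R) + norm (S - R) + norm (S - R) * norm (cayley R)"
      unfolding W_def by (intro norm_triangle_le add_mono norm_mult_ineq order_refl)
    also have "\<dots> \<le> norm (S - R) + norm (S - R) + norm (S - R) * c"
      using norm_cayley_le[OF R] by (intro add_left_mono mult_left_mono) (auto simp: c_def)
    finally have W: "norm W \<le> (2 + c) * norm (S - R)" by (simp add: algebra_simps)
    have "norm (cayley S * W) \<le> norm (cayley S) * norm W" by (rule norm_mult_ineq)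
    also have "\<dots> \<le> c * ((2 + c) * norm (S - R))"
      using norm_cayley_le[OF S] W c by (intro mult_mono) (auto simp: c_def)
    finally have TW: "norm (cayley S * W) \<le> c * ((2 + c) * norm (S - R))" .
    have "norm (cayley S - cayley R) \<le> norm W + norm ((1/2) *\<^sub>R (cayley S * W))"
      unfolding cayley_diff[OF S(1) R(1)] W_def by (rule norm_triangle_ineq)
    also have "\<dots> \<le> (2 + c) * norm (S - R) + (1/2) * (c * ((2 + c) * norm (S - R)))"
      using W TW by simp
    also have "\<dots> = K * norm (S - R)" by (simp add: K_def algebra_simps)
    finally show ?thesis by (simp add: dist_norm)
  qed
  then show ?thesis
    using K by (intro lipschitz_on_continuous_on[of K] lipschitz_onI) auto
qed

lemma continuous_map_cayley:
  assumes "continuous_map X euclidean S" "\<And>x. x \<in> topspace X \<Longrightarrow> adj (S x) = - S x \<and> supp N (S x)"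
  shows "continuous_map X euclidean (\<lambda>x. cayley (S x))"
proof -
  have "continuous_map X (top_of_set {S. adj S = - S \<and> supp N S}) S"
    using assms by (intro continuous_map_into_subtopology) auto
  moreover have "continuous_map (top_of_set {S. adj S = - S \<and> supp N S}) euclidean cayley"
    using continuous_on_cayley by simp
  ultimately have "continuous_map X euclidean (cayley \<circ> S)" by (rule continuous_map_compose)
  then show ?thesis by (simp add: o_def)
qed

section \<open>Rotating one unit vector to another\<close>

text \<open>A skew-adjoint \<open>S\<close> with \<open>S (a + b) = b - a\<close>; by the definition of the Cayley transform, \<open>1 + cayley S\<close> then
  maps \<open>a\<close> to \<open>b\<close>. With \<open>m = a + b\<close>, \<open>n = b - a\<close> and \<open>\<mu> = \<parallel>m\<parallel>\<^sup>2\<close> the first summand \<open>(n m\<^sup>* - m n\<^sup>*) / \<mu>\<close> maps \<open>m\<close>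
  to \<open>n - \<langle>n, m\<rangle> m / \<mu>\<close>, and the second one corrects this; it is skew-adjoint since \<open>\<langle>n, m\<rangle>\<close> is
  imaginary for unit vectors. The formula needs \<open>a + b \<noteq> 0\<close>, that is, that \<open>b\<close> is not antipodal to \<open>a\<close>.\<close>

definition rotation :: "finmat \<Rightarrow> finmat \<Rightarrow> finmat" where
  "rotation a b =
     (1 / Re (ip (a + b) (a + b))) *\<^sub>R ((b - a) * adj (a + b) - (a + b) * adj (b - a)) +
     csc (ip (b - a) (a + b) / (of_real (Re (ip (a + b) (a + b))))\<^sup>2) ((a + b) * adj (a + b))"

lemma rotation_skew:
  assumes "ip a a = 1" "ip b b = 1"
  shows "adj (rotation a b) = - rotation a b"
proof -
  have *: "adj (r *\<^sub>R (n * adj m - m * adj n) + csc c (m * adj m)) = - (r *\<^sub>R (n * adj m - m * adj n) + csc c (m * adj m))"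
    if "cnj c = - c" for r c m n
    using that by (simp add: adj_add adj_diff adj_csc adj_scaleR adj_mult csc_uminus_left scaleR_diff_right)
  have "ip (b - a) (a + b) = ip b a - ip a b"
    using assms by (simp add: ip_diff_left ip_add_right)
  moreover have "cnj (ip a b) = ip b a" "cnj (ip b a) = ip a b" by (simp_all only: ip_cnj[symmetric])
  ultimately have "cnj (ip (b - a) (a + b)) = - ip (b - a) (a + b)" by simp
  then show ?thesis unfolding rotation_def by (intro *) simp
qed

lemma rotation_midpoint:
  assumes "isvec a" "isvec b" "a + b \<noteq> 0"
  shows "rotation a b * (a + b) = b - a"
proof -
  define m n \<mu> where "m = a + b" and "n = b - a" and "\<mu> = Re (ip (a + b) (a + b))"
  have v: "isvec m" "isvec n" using assms by (auto simp: m_def n_def isvec_add isvec_diff)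
  have \<mu>: "\<mu> > 0" "ip m m = of_real \<mu>"
    using ip_self_pos[of m] ip_self[of m] v assms by (auto simp: \<mu>_def m_def)
  have "rotation a b * m = (1 / \<mu>) *\<^sub>R (n * adj m * m - m * adj n * m) + csc (ip n m / (of_real \<mu>)\<^sup>2) (m * adj m * m)"
    unfolding rotation_def m_def[symmetric] n_def[symmetric] \<mu>_def[unfolded m_def[symmetric], symmetric]
    by (simp add: distrib_right left_diff_distrib csc_mult_left)
  also have "\<dots> = (1 / \<mu>) *\<^sub>R (csc (of_real \<mu>) n - csc (ip n m) m) + csc (ip n m / (of_real \<mu>)\<^sup>2) (csc (of_real \<mu>) m)"
    using v by (simp add: dyad_mult_vec \<mu>(2))
  also have "\<dots> = n - csc (ip n m / of_real \<mu>) m + csc (ip n m / of_real \<mu>) m"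
    using \<mu>(1) by (simp add: scaleR_eq_csc csc_diff csc_csc power2_eq_square)
  finally show ?thesis by (simp add: m_def n_def)
qed

lemma cayley_rotation:
  assumes "isvec a" "isvec b" "ip a a = 1" "ip b b = 1" "a + b \<noteq> 0"
  shows "a + cayley (rotation a b) * a = b"
proof -
  define S where "S = rotation a b"
  have Sm: "S * (a + b) = b - a" unfolding S_def by (rule rotation_midpoint) (use assms in auto)
  have "cayley S = S + S + cayley S * S"
    unfolding S_def by (rule cayley_right[OF rotation_skew]) (use assms in auto)
  then have "cayley S * (a + b) = (S + S + cayley S * S) * (a + b)" by simp
  also have "\<dots> = (b - a) + (b - a) + cayley S * (b - a)"
    by (simp add: distrib_right mult.assoc Sm)
  finally have "cayley S * a + cayley S * a = (b - a) + (b - a)"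
    by (simp add: distrib_left right_diff_distrib algebra_simps)
  then have "cayley S * a = b - a" by (rule double_cancel)
  then show ?thesis by (simp add: S_def)
qed

lemma rotation_same [simp]: "ip a a = 1 \<Longrightarrow> rotation a a = 0"
  by (simp add: rotation_def)

lemma rotation_in:
  assumes "proj F" "F * a = a" "F * b = b"
  shows "F * rotation a b = rotation a b" "rotation a b * F = rotation a b"
proof -
  have m: "F * (a + b) = a + b" and n: "F * (b - a) = b - a"
    using assms by (simp_all add: distrib_left right_diff_distrib)
  then have m': "adj (a + b) * F = adj (a + b)" and n': "adj (b - a) * F = adj (b - a)"
    using assms(1) by (metis adj_mult proj_def)+
  have *: "F * (r *\<^sub>R (n * adj m - m * adj n) + csc c (m * adj m)) = r *\<^sub>R (n * adj m - m * adj n) + csc c (m * adj m)"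
    if "F * m = m" "F * n = n" for r c m n
    using that by (simp add: distrib_left right_diff_distrib csc_mult_right flip: mult.assoc)
  have **: "(r *\<^sub>R (n * adj m - m * adj n) + csc c (m * adj m)) * F = r *\<^sub>R (n * adj m - m * adj n) + csc c (m * adj m)"
    if "adj m * F = adj m" "adj n * F = adj n" for r c m n
    using that by (simp add: distrib_right left_diff_distrib csc_mult_left mult.assoc)
  show "F * rotation a b = rotation a b" unfolding rotation_def by (rule *[OF m n])
  show "rotation a b * F = rotation a b" unfolding rotation_def by (rule **[OF m' n'])
qed

lemma continuous_map_rotation:
  assumes "continuous_map X euclidean a" "continuous_map X euclidean b"
    and "\<And>x. x \<in> topspace X \<Longrightarrow> isvec (a x) \<and> isvec (b x) \<and> a x + b x \<noteq> 0"
  shows "continuous_map X euclidean (\<lambda>x. rotation (a x) (b x))"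
proof -
  have c: "continuous_map X euclideanreal (\<lambda>x. Re (ip (a x + b x) (a x + b x)))"
    using assms(1,2) by (intro continuous_intros)
  have ne: "Re (ip (a x + b x) (a x + b x)) \<noteq> 0" if "x \<in> topspace X" for x
    using ip_self_eq_0[of "a x + b x"] assms(3)[OF that] isvec_add by blast
  have e: "rotation (a x) (b x) =
     (1 / Re (ip (a x + b x) (a x + b x))) *\<^sub>R ((b x - a x) * adj (a x + b x) - (a x + b x) * adj (b x - a x)) +
     csc (of_real ((1 / Re (ip (a x + b x) (a x + b x))) * (1 / Re (ip (a x + b x) (a x + b x)))) * ip (b x - a x) (a x + b x))
       ((a x + b x) * adj (a x + b x))" for x
    by (simp add: rotation_def power2_eq_square divide_simps)
  show ?thesis unfolding e using assms(1,2) c ne by (intro continuous_intros) auto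
qed

section \<open>Chains of Cayley transforms\<close>

text \<open>The action on \<open>a\<close> of the product of the unitaries \<open>1 + cayley S\<close>, the head of the list acting first.\<close>

definition chain :: "finmat list \<Rightarrow> finmat \<Rightarrow> finmat" where
  "chain Ss a = fold (\<lambda>S a. a + cayley S * a) Ss a"

lemma chain_Nil [simp]: "chain [] a = a" by (simp add: chain_def)
lemma chain_Cons [simp]: "chain (S # Ss) a = chain Ss (a + cayley S * a)" by (simp add: chain_def)
lemma chain_append [simp]: "chain (Ss @ Rs) a = chain Rs (chain Ss a)" by (simp add: chain_def)

lemma chain_mult: "chain Ss (a * c) = chain Ss a * c"
  by (induction Ss arbitrary: a) (auto simp flip: mult.assoc distrib_right)

lemma chain_sum: "chain Ss (sum f I) = (\<Sum>i\<in>I. chain Ss (f i))"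
proof -
  have add: "chain Ss (a + b) = chain Ss a + chain Ss b" for a b
  proof (induction Ss arbitrary: a b)
    case (Cons S Ss)
    have "a + b + cayley S * (a + b) = (a + cayley S * a) + (b + cayley S * b)"
      by (simp add: distrib_left ac_simps)
    then show ?case using Cons by simp
  qed simp
  have "chain Ss 0 = 0" by (induction Ss) auto
  then show ?thesis by (induction I rule: infinite_finite_induct) (auto simp: add)
qed

lemma chain_zero: "\<forall>S\<in>set Ss. S = 0 \<Longrightarrow> chain Ss a = a"
  by (induction Ss arbitrary: a) auto

lemma chain_isometry:
  assumes "\<forall>S\<in>set Ss. adj S = - S"
  shows "adj (chain Ss a) * chain Ss b = adj a * b"
  using assms
proof (induction Ss arbitrary: a b)
  case (Cons S Ss)
  define T where "T = cayley S"
  have "adj T * T + adj T + T = 0" unfolding T_def using Cons.prems by (intro cayley_isometry) auto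
  then have "adj a * ((adj T * T + adj T + T) * b) = 0" by simp
  then have "adj (a + T * a) * (b + T * b) = adj a * b"
    by (simp add: adj_add adj_mult distrib_left distrib_right mult.assoc algebra_simps)
  then show ?case using Cons by (simp add: T_def)
qed simp

lemma ip_chain:
  assumes "\<forall>S\<in>set Ss. adj S = - S"
  shows "ip (chain Ss a) (chain Ss b) = ip a b"
  using chain_isometry[OF assms, of a b] by (simp add: ip_def)

lemma isvec_chain: "isvec a \<Longrightarrow> isvec (chain Ss a)"
  by (induction Ss arbitrary: a) (auto simp: isvec_add isvec_mult)

lemma chain_in:
  assumes "\<forall>S\<in>set Ss. adj S = - S \<and> F * S = S" "F * a = a"
  shows "F * chain Ss a = chain Ss a"
  using assms
  by (induction Ss arbitrary: a) (auto simp: distrib_left cayley_mult_left simp flip: mult.assoc)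

lemma chain_orthogonal:
  assumes "\<forall>S\<in>set Ss. adj S = - S \<and> S * F = S" "F * a = 0"
  shows "chain Ss a = a"
  using assms
proof (induction Ss)
  case (Cons S Ss)
  have "cayley S * a = cayley S * F * a" using Cons.prems cayley_mult_right[of S F] by simp
  also have "\<dots> = 0" using Cons.prems by (simp add: mult.assoc)
  finally show ?case using Cons by simp
qed simp

text \<open>A product of unitaries commuting with \<open>F\<close> keeps the range projection \<open>F\<close> of \<open>w\<close>.\<close>

lemma chain_range:
  assumes "\<forall>S\<in>set Ss. adj S = - S \<and> F * S = S \<and> S * F = S" "w * adj w = F"
  shows "chain Ss w * adj (chain Ss w) = F"
  using assms
proof (induction Ss arbitrary: w)
  case (Cons S Ss)
  define T where "T = cayley S"
  have S: "adj S = - S" "F * S = S" "S * F = S" using Cons.prems by auto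
  have F: "adj F = F" using Cons.prems(2) by (metis adj_adj adj_mult)
  have T: "T * F = T" "F * T = T" unfolding T_def using S cayley_mult_left cayley_mult_right by auto
  then have T': "F * adj T = adj T" using F by (metis adj_mult)
  have "(w + T * w) * adj (w + T * w) = F + F * adj T + T * F + T * (F * adj T)"
    using Cons.prems(2) by (simp add: adj_add adj_mult distrib_left distrib_right mult.assoc[symmetric])
      (simp add: mult.assoc algebra_simps)
  also have "\<dots> = F + (T * adj T + adj T + T)" by (simp add: T T' algebra_simps)
  also have "\<dots> = F" using cayley_isometry(2)[OF S(1)] by (simp add: T_def)
  finally have "(w + T * w) * adj (w + T * w) = F" .
  then show ?case using Cons by (simp add: T_def)
qed simp

lemma continuous_map_chain:
  assumes "\<And>S. S \<in> set Ss \<Longrightarrow> continuous_map X euclidean S"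
    and "\<And>S x. S \<in> set Ss \<Longrightarrow> x \<in> topspace X \<Longrightarrow> adj (S x) = - S x \<and> supp N (S x)"
    and "continuous_map X euclidean a"
  shows "continuous_map X euclidean (\<lambda>x. chain (map (\<lambda>S. S x) Ss) (a x))"
  using assms
proof (induction Ss arbitrary: a)
  case (Cons S Ss)
  have "continuous_map X euclidean (\<lambda>x. cayley (S x))"
    using Cons.prems(1,2) by (intro continuous_map_cayley[where N = N]) auto
  then have "continuous_map X euclidean (\<lambda>x. a x + cayley (S x) * a x)"
    using Cons.prems(3) by (intro continuous_intros)
  then show ?case using Cons by simp
qed simp

section \<open>Projections, sections and isometries over a space\<close>

definition compact_dim :: "'x topology \<Rightarrow> nat \<Rightarrow> bool" where
  "compact_dim X d \<longleftrightarrow> compact_space X \<and> Hausdorff_space X \<and> covering_dim_le X d"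

definition proj_field :: "'x topology \<Rightarrow> nat \<Rightarrow> ('x \<Rightarrow> finmat) \<Rightarrow> bool" where
  "proj_field X N p \<longleftrightarrow> continuous_map X euclidean p \<and> (\<forall>x\<in>topspace X. proj (p x) \<and> supp N (p x))"

definition unit_section :: "'x topology \<Rightarrow> ('x \<Rightarrow> finmat) \<Rightarrow> ('x \<Rightarrow> finmat) \<Rightarrow> bool" where
  "unit_section X p a \<longleftrightarrow> continuous_map X euclidean a \<and>
     (\<forall>x\<in>topspace X. isvec (a x) \<and> p x * a x = a x \<and> ip (a x) (a x) = 1)"

definition isometry_field :: "'x topology \<Rightarrow> ('x \<Rightarrow> finmat) \<Rightarrow> ('x \<Rightarrow> finmat) \<Rightarrow> ('x \<Rightarrow> finmat) \<Rightarrow> bool" where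
  "isometry_field X q p v \<longleftrightarrow> continuous_map X euclidean v \<and>
     (\<forall>x\<in>topspace X. adj (v x) * v x = q x \<and> p x * v x = v x)"

definition frame_field :: "'x topology \<Rightarrow> nat \<Rightarrow> (nat \<Rightarrow> 'x \<Rightarrow> finmat) \<Rightarrow> ('x \<Rightarrow> finmat) \<Rightarrow> bool" where
  "frame_field X r b p \<longleftrightarrow> (\<forall>j<r. continuous_map X euclidean (b j)) \<and>
     (\<forall>x\<in>topspace X. frame r (\<lambda>j. b j x) (p x))"

text \<open>Parameters of unitaries that act inside the range of \<open>F\<close> and do not move anything over \<open>Y\<close>.\<close>

definition skew_fields :: "'x topology \<Rightarrow> 'x set \<Rightarrow> ('x \<Rightarrow> finmat) \<Rightarrow> ('x \<Rightarrow> finmat) list \<Rightarrow> bool" where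
  "skew_fields X Y F Ss \<longleftrightarrow> (\<forall>S\<in>set Ss. continuous_map X euclidean S \<and>
     (\<forall>x\<in>topspace X. adj (S x) = - S x \<and> F x * S x = S x \<and> S x * F x = S x) \<and> (\<forall>x\<in>Y. S x = 0))"

abbreviation chain_at :: "('x \<Rightarrow> finmat) list \<Rightarrow> 'x \<Rightarrow> finmat \<Rightarrow> finmat" where
  "chain_at Ss x a \<equiv> chain (map (\<lambda>S. S x) Ss) a"

lemma compact_dim_sub: "compact_dim X d \<Longrightarrow> closedin X K \<Longrightarrow> compact_dim (subtopology X K) d"
  by (simp add: compact_dim_def closedin_compact_space Hausdorff_space_subtopology covering_dim_le_closedin
      compact_space_subtopology)

lemma topspace_sub_closed: "closedin X K \<Longrightarrow> topspace (subtopology X K) = K"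
  using closedin_subset by fastforce

lemma closedin_sub_Int: "closedin X Y \<Longrightarrow> closedin X K \<Longrightarrow> closedin (subtopology X K) (Y \<inter> K)"
  by (metis closedin_subtopology)

lemma proj_field_sub: "proj_field X N p \<Longrightarrow> proj_field (subtopology X K) N p"
  by (simp add: proj_field_def continuous_map_from_subtopology)

lemma unit_section_sub: "unit_section X p a \<Longrightarrow> unit_section (subtopology X K) p a"
  by (simp add: unit_section_def continuous_map_from_subtopology)

lemma isometry_field_sub: "isometry_field X q p v \<Longrightarrow> isometry_field (subtopology X K) q p v"
  by (simp add: isometry_field_def continuous_map_from_subtopology)

lemma sub_sub: "A \<subseteq> K \<Longrightarrow> subtopology (subtopology X K) A = subtopology X A"
  by (simp add: subtopology_subtopology Int_absorb1)

lemma continuous_map_glue: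
  fixes f g :: "'x \<Rightarrow> 'b :: topological_space"
  assumes "closedin X Y" "closedin X K"
    and f: "continuous_map (subtopology X Y) euclidean f" and g: "continuous_map (subtopology X K) euclidean g"
    and eq: "\<And>x. x \<in> Y \<Longrightarrow> x \<in> K \<Longrightarrow> f x = g x"
  shows "continuous_map (subtopology X (Y \<union> K)) euclidean (\<lambda>x. if x \<in> Y then f x else g x)"
  unfolding continuous_map_closedin
proof (intro conjI allI impI)
  fix C :: "'b set" assume C: "closedin euclidean C"
  have sub: "Y \<subseteq> topspace X" "K \<subseteq> topspace X" using assms(1,2) closedin_subset by blast+
  have "closedin (subtopology X Y) {x \<in> topspace (subtopology X Y). f x \<in> C}"
    using f C unfolding continuous_map_closedin by blast
  then have "closedin X {x \<in> topspace (subtopology X Y). f x \<in> C}"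
    using assms(1) closedin_closed_subtopology by blast
  moreover have "closedin (subtopology X K) {x \<in> topspace (subtopology X K). g x \<in> C}"
    using g C unfolding continuous_map_closedin by blast
  then have "closedin X {x \<in> topspace (subtopology X K). g x \<in> C}"
    using assms(2) closedin_closed_subtopology by blast
  ultimately have "closedin X ({x \<in> topspace (subtopology X Y). f x \<in> C} \<union> {x \<in> topspace (subtopology X K). g x \<in> C})"
    by (rule closedin_Un)
  moreover have "{x \<in> topspace (subtopology X Y). f x \<in> C} \<union> {x \<in> topspace (subtopology X K). g x \<in> C} =
     {x \<in> topspace (subtopology X (Y \<union> K)). (if x \<in> Y then f x else g x) \<in> C}"
    using sub eq by auto
  ultimately have "closedin X {x \<in> topspace (subtopology X (Y \<union> K)). (if x \<in> Y then f x else g x) \<in> C}"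
    by simp
  moreover have "{x \<in> topspace (subtopology X (Y \<union> K)). (if x \<in> Y then f x else g x) \<in> C} \<subseteq> Y \<union> K" by auto
  ultimately show "closedin (subtopology X (Y \<union> K)) {x \<in> topspace (subtopology X (Y \<union> K)). (if x \<in> Y then f x else g x) \<in> C}"
    using closedin_closed_subtopology[OF closedin_Un[OF assms(1,2)]] by blast
qed simp

text \<open>The induction over closed patches, on which \<open>p\<close> may be assumed to have a frame. Patches
  are nonempty, so that the constant rank of \<open>p\<close> on a patch can be read off at a point.\<close>

lemma frame_patch_induct:
  assumes X: "compact_dim X d" and base: "closedin X X0" "Q X0" and p: "proj_field X N p"
    and step: "\<And>Z K r b. closedin X Z \<Longrightarrow> Q Z \<Longrightarrow> closedin X K \<Longrightarrow> K \<noteq> {} \<Longrightarrow>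
       frame_field (subtopology X K) r b p \<Longrightarrow> Q (Z \<union> K)"
  shows "Q (topspace X)"
proof (rule closed_patch_induct[of X X0 Q])
  show "compact_space X" "Hausdorff_space X" using X by (auto simp: compact_dim_def)
  show "closedin X X0" "Q X0" by fact+
  fix x assume x: "x \<in> topspace X"
  have "\<exists>U r b. openin X U \<and> x \<in> U \<and> (\<forall>j<r. continuous_map (subtopology X U) euclidean (b j)) \<and>
    (\<forall>x\<in>U. frame r (\<lambda>j. b j x) (p x))"
    using p x by (intro local_frame) (auto simp: proj_field_def)
  then obtain U r b where U: "openin X U" "x \<in> U" "\<forall>j<r. continuous_map (subtopology X U) euclidean (b j)"
    "\<forall>x\<in>U. frame r (\<lambda>j. b j x) (p x)" by (elim exE conjE) (rule that)
  have "Q (Z \<union> K)" if Z: "closedin X Z" "Q Z" and K: "closedin X K" "K \<subseteq> U" for Z K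
  proof (cases "K = {}")
    case False
    have "frame_field (subtopology X K) r b p"
      unfolding frame_field_def
    proof (intro conjI allI impI ballI)
      show "continuous_map (subtopology X K) euclidean (b j)" if "j < r" for j
        by (rule continuous_map_from_subtopology_mono[OF _ K(2)]) (use U(3) that in blast)
      show "frame r (\<lambda>j. b j x) (p x)" if "x \<in> topspace (subtopology X K)" for x
        using U(4) K(2) that by auto
    qed
    then show ?thesis by (rule step[OF Z K(1) False])
  qed (use Z in simp)
  then show "\<exists>U. openin X U \<and> x \<in> U \<and> (\<forall>Z K. closedin X Z \<and> Q Z \<and> closedin X K \<and> K \<subseteq> U \<longrightarrow> Q (Z \<union> K))"
    using U(1,2) by (intro exI[of _ U]) simp
qed

section \<open>Extending unit sections\<close>

lemma frame_coordinate:
  assumes "frame r b p" "j < r"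
  shows "ip (b j) (\<Sum>i<r. csc (z i) (b i)) = z j"
proof -
  have "ip (b j) (\<Sum>i<r. csc (z i) (b i)) = (\<Sum>i<r. if i = j then z i else 0)"
    unfolding ip_sum_right using assms by (intro sum.cong refl) (auto simp: frame_def ip_csc_right)
  then show ?thesis using assms(2) by simp
qed

lemma frame_combination:
  assumes "frame r b p"
  shows "isvec (\<Sum>i<r. csc (z i) (b i))" "p * (\<Sum>i<r. csc (z i) (b i)) = (\<Sum>i<r. csc (z i) (b i))"
proof -
  show "isvec (\<Sum>i<r. csc (z i) (b i))"
    using assms by (intro isvec_sum isvec_csc) (auto simp: frame_def)
  show "p * (\<Sum>i<r. csc (z i) (b i)) = (\<Sum>i<r. csc (z i) (b i))"
    unfolding sum_distrib_left
    using frame_mult_basis[OF assms] by (intro sum.cong refl) (simp add: csc_mult_right)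
qed

lemma frame_parseval:
  assumes "frame r b p" "isvec a" "p * a = a"
  shows "ip a (\<Sum>j<r. csc (z j) (b j)) = (\<Sum>j<r. z j * cnj (ip (b j) a))"
    and "ip a a = of_real (\<Sum>j<r. (cmod (ip (b j) a))\<^sup>2)"
proof -
  show 1: "ip a (\<Sum>j<r. csc (z j) (b j)) = (\<Sum>j<r. z j * cnj (ip (b j) a))" for z
    unfolding ip_sum_right ip_csc_right by (intro sum.cong refl) (simp only: ip_cnj[of a "b _"])
  have "ip a a = ip a (\<Sum>j<r. csc (ip (b j) a) (b j))"
    using frame_mult_vec[OF assms(1,2)] assms(3) by simp
  then show "ip a a = of_real (\<Sum>j<r. (cmod (ip (b j) a))\<^sup>2)"
    unfolding 1 of_real_sum by (simp add: complex_norm_square del: of_real_power)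
qed

lemma sum_pairs: "(\<Sum>k<2 * r. f k) = (\<Sum>j<r. f (2 * j) + f (Suc (2 * j)))" for f :: "nat \<Rightarrow> 'a :: comm_monoid_add"
  by (induction r) (auto simp: ac_simps)

text \<open>In a frame a unit section becomes a map into the sphere of \<open>\<real>\<^bsup>2r\<^esup>\<close>, the even coordinates being the
  real parts and the odd ones the imaginary parts of the coefficients.\<close>

lemma extend_unit_section_framed:
  assumes X: "compact_dim X d" and Z: "closedin X Z" and b: "frame_field X r b p" and r: "d < 2 * r"
    and a: "unit_section (subtopology X Z) p a"
  shows "\<exists>a'. unit_section X p a' \<and> (\<forall>x\<in>Z. a' x = a x)"
proof -
  have ZX: "Z \<subseteq> topspace X" and topZ: "topspace (subtopology X Z) = Z"
    using closedin_subset[OF Z] topspace_sub_closed[OF Z] by auto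
  have fr: "frame r (\<lambda>j. b j x) (p x)" if "x \<in> topspace X" for x using b that by (simp add: frame_field_def)
  have bc: "continuous_map X euclidean (b j)" if "j < r" for j using b that by (simp add: frame_field_def)
  define c where "c k x = (if even k then Re (ip (b (k div 2) x) (a x)) else Im (ip (b (k div 2) x) (a x)))" for k x
  have cc: "continuous_map (subtopology X Z) euclideanreal (c k)" if "k < 2 * r" for k
  proof -
    have "k div 2 < r" using that by auto
    from continuous_map_from_subtopology[OF bc[OF this]] show ?thesis
      using a unfolding c_def unit_section_def by (cases "even k") (auto intro!: continuous_intros)
  qed
  have "(\<Sum>k<2 * r. (c k x)\<^sup>2) = 1" if x: "x \<in> Z" for x
  proof -
    have "isvec (a x)" "p x * a x = a x" "ip (a x) (a x) = 1" using a x topZ by (auto simp: unit_section_def)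
    then have "complex_of_real (\<Sum>j<r. (cmod (ip (b j x) (a x)))\<^sup>2) = 1"
      using frame_parseval(2)[OF fr, of x "a x"] x ZX by auto
    then have "(\<Sum>j<r. (cmod (ip (b j x) (a x)))\<^sup>2) = 1" using of_real_eq_1_iff by blast
    then show ?thesis unfolding sum_pairs by (simp add: c_def cmod_power2)
  qed
  then have "\<exists>c'. (\<forall>k<2 * r. continuous_map X euclideanreal (c' k)) \<and> (\<forall>k<2 * r. \<forall>x\<in>Z. c' k x = c k x) \<and>
    (\<forall>x\<in>topspace X. \<exists>k<2 * r. c' k x \<noteq> 0)"
    using X cc by (intro sphere_valued_extension[OF _ _ _ r Z]) (auto simp: compact_dim_def)
  then obtain c' where c': "\<forall>k<2 * r. continuous_map X euclideanreal (c' k)" "\<forall>k<2 * r. \<forall>x\<in>Z. c' k x = c k x"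
    "\<forall>x\<in>topspace X. \<exists>k<2 * r. c' k x \<noteq> 0" by (elim exE conjE) (rule that)
  define z where "z j x = complex_of_real (c' (2 * j) x) + \<i> * of_real (c' (Suc (2 * j)) x)" for j x
  define v where "v x = (\<Sum>j<r. csc (z j x) (b j x))" for x
  have vc: "continuous_map X euclidean v"
    unfolding v_def z_def using c'(1) bc by (intro continuous_intros) auto
  have vne: "v x \<noteq> 0" if x: "x \<in> topspace X" for x
  proof -
    obtain k where k: "k < 2 * r" "c' k x \<noteq> 0" using c'(3) x by blast
    then have j: "k div 2 < r" by auto
    have "z (k div 2) x \<noteq> 0"
      using k(2) by (cases "even k") (auto simp: z_def complex_eq_iff)
    then have "ip (b (k div 2) x) (v x) \<noteq> 0"
      unfolding v_def using frame_coordinate[OF fr[OF x] j] by simp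
    then show ?thesis by auto
  qed
  have vv: "isvec (v x)" "p x * v x = v x" if "x \<in> topspace X" for x
    unfolding v_def using frame_combination[OF fr[OF that]] by auto
  have "v x = a x" if x: "x \<in> Z" for x
  proof -
    have "z j x = ip (b j x) (a x)" if "j < r" for j
      using c'(2) x that by (simp add: z_def c_def complex_eq_iff)
    then have "v x = (\<Sum>j<r. csc (ip (b j x) (a x)) (b j x))" unfolding v_def by (intro sum.cong) auto
    also have "\<dots> = a x"
      using frame_mult_vec[OF fr, of x "a x"] x ZX a topZ by (auto simp: unit_section_def)
    finally show ?thesis .
  qed
  moreover have "ip (a x) (a x) = 1" if "x \<in> Z" for x using a that topZ by (auto simp: unit_section_def)
  ultimately have "\<forall>x\<in>Z. normalize_vec (v x) = a x" by (simp add: normalize_vec_unit)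
  moreover have "unit_section X p (\<lambda>x. normalize_vec (v x))"
    unfolding unit_section_def using vc vne vv
    by (auto intro: continuous_map_normalize_vec isvec_normalize_vec mult_normalize_vec ip_normalize_vec)
  ultimately show ?thesis by blast
qed

lemma extend_unit_section:
  assumes X: "compact_dim X d" and Z: "closedin X Z" and p: "proj_field X N p"
    and rank: "\<And>x. x \<in> topspace X \<Longrightarrow> real d + 1 \<le> 2 * Re (tr (p x))"
    and a: "unit_section (subtopology X Z) p a"
  shows "\<exists>a'. unit_section X p a' \<and> (\<forall>x\<in>Z. a' x = a x)"
proof -
  define Q where "Q Y \<longleftrightarrow> Z \<subseteq> Y \<and> (\<exists>a'. unit_section (subtopology X Y) p a' \<and> (\<forall>x\<in>Z. a' x = a x))" for Y
  have "Q (topspace X)"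
  proof (rule frame_patch_induct[OF X Z _ p])
    show "Q Z" unfolding Q_def using a by blast
    fix Y K r b
    assume Y: "closedin X Y" "Q Y" and K: "closedin X K" "K \<noteq> {}" and b: "frame_field (subtopology X K) r b p"
    obtain a' where a': "unit_section (subtopology X Y) p a'" "\<forall>x\<in>Z. a' x = a x" and ZY: "Z \<subseteq> Y"
      using Y(2) unfolding Q_def by blast
    obtain x where x: "x \<in> K" "x \<in> topspace X" using K closedin_subset by blast
    have "tr (p x) = of_nat r"
      using b x by (intro frame_tr) (auto simp: frame_field_def)
    then have "real d + 1 \<le> 2 * real r" using rank[OF x(2)] by simp
    then have r: "d < 2 * r" by linarith
    have top: "subtopology (subtopology X K) (Y \<inter> K) = subtopology X (Y \<inter> K)" by (rule sub_sub) auto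
    have "subtopology (subtopology X Y) K = subtopology X (Y \<inter> K)" by (rule subtopology_subtopology)
    then have "unit_section (subtopology (subtopology X K) (Y \<inter> K)) p a'"
      using unit_section_sub[OF a'(1), of K] top by simp
    from extend_unit_section_framed[OF compact_dim_sub[OF X K(1)] closedin_sub_Int[OF Y(1) K(1)] b r this]
    obtain a'' where a'': "unit_section (subtopology X K) p a''" "\<forall>x\<in>Y \<inter> K. a'' x = a' x" by blast
    define g where "g x = (if x \<in> Y then a' x else a'' x)" for x
    have "continuous_map (subtopology X (Y \<union> K)) euclidean g"
      unfolding g_def using a'(1) a'' by (intro continuous_map_glue Y K) (auto simp: unit_section_def)
    then have "unit_section (subtopology X (Y \<union> K)) p g"
      using a'(1) a''(1) unfolding unit_section_def by (auto simp: g_def)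
    moreover have "\<forall>x\<in>Z. g x = a x" using a'(2) ZY by (auto simp: g_def)
    ultimately show "Q (Y \<union> K)" unfolding Q_def using ZY by blast
  qed
  then show ?thesis unfolding Q_def by simp
qed

section \<open>Extending isometries\<close>

lemma isometry_mult_right:
  assumes "proj q" "adj v * v = q"
  shows "v * q = v"
proof -
  have "adj (v * q - v) * (v * q - v) = q * (adj v * v) * q - q * (adj v * v) - (adj v * v) * q + adj v * v"
    using assms(1) by (simp add: proj_def adj_diff adj_mult left_diff_distrib right_diff_distrib mult.assoc)
  also have "\<dots> = 0" using assms by (simp add: proj_def)
  finally have "v * q - v = 0" by (rule adj_mult_self_eq_0)
  then show ?thesis by simp
qed

lemma supp_isometry:
  assumes "proj q" "adj v * v = q" "p * v = v" "supp N q" "supp N p"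
  shows "supp N v"
  unfolding supp_def
proof (intro allI impI)
  fix i j assume "N \<le> i \<or> N \<le> j"
  then show "ent v i j = 0"
    using supp_mult_left[OF assms(5), of i v j] supp_mult_right[OF assms(4), of j v i]
      isometry_mult_right[OF assms(1,2)] assms(3) by auto
qed

text \<open>The images of the frame of \<open>q\<close> are extended one at a time: the image \<open>a\<close> of its last vector is extended
  as a unit section of \<open>p\<close>, and the others continue in the orthogonal complement of \<open>a\<close>. The rank of the
  complement and that of what remains of \<open>q\<close> drop together, so the hypothesis is preserved.\<close>

lemma extend_isometry_framed:
  assumes X: "compact_dim X d" and Z: "closedin X Z" and p: "proj_field X N p"
    and \<xi>: "frame_field X r \<xi> q"
    and rank: "\<And>x. x \<in> topspace X \<Longrightarrow> r = 0 \<or> 2 * real r + real d \<le> 2 * Re (tr (p x)) + 1"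
    and v: "isometry_field (subtopology X Z) q p v"
  shows "\<exists>v'. isometry_field X q p v' \<and> (\<forall>x\<in>Z. v' x = v x)"
  using p \<xi> rank v
proof (induction r arbitrary: p q v)
  case 0
  have ZX: "Z \<subseteq> topspace X" and topZ: "topspace (subtopology X Z) = Z"
    using closedin_subset[OF Z] topspace_sub_closed[OF Z] by auto
  have q0: "q x = 0" if "x \<in> topspace X" for x using 0(2) that by (simp add: frame_field_def frame_def)
  have "v x = 0" if "x \<in> Z" for x
  proof -
    have "adj (v x) * v x = 0" using 0(4) topZ that q0[of x] ZX by (auto simp: isometry_field_def)
    then show ?thesis by (rule adj_mult_self_eq_0)
  qed
  then show ?case using q0 by (intro exI[of _ "\<lambda>_. 0"]) (simp add: isometry_field_def)
next
  case (Suc r)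
  have ZX: "Z \<subseteq> topspace X" and topZ: "topspace (subtopology X Z) = Z"
    using closedin_subset[OF Z] topspace_sub_closed[OF Z] by auto
  have fr: "frame (Suc r) (\<lambda>j. \<xi> j x) (q x)" if "x \<in> topspace X" for x
    using Suc.prems(2) that by (simp add: frame_field_def)
  have \<xi>c: "continuous_map X euclidean (\<xi> j)" if "j < Suc r" for j
    using Suc.prems(2) that by (simp add: frame_field_def)
  have \<xi>r: "isvec (\<xi> r x)" "ip (\<xi> r x) (\<xi> r x) = 1" "q x * \<xi> r x = \<xi> r x" if "x \<in> topspace X" for x
    using fr[OF that] frame_mult_basis[OF fr[OF that], of r] by (auto simp: frame_def)
  have pp: "proj (p x)" "supp N (p x)" if "x \<in> topspace X" for x
    using Suc.prems(1) that by (auto simp: proj_field_def)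
  have vv: "adj (v x) * v x = q x" "p x * v x = v x" if "x \<in> Z" for x
    using Suc.prems(4) topZ that by (auto simp: isometry_field_def)
  have vc: "continuous_map (subtopology X Z) euclidean v"
    using Suc.prems(4) by (simp add: isometry_field_def)
  have "unit_section (subtopology X Z) p (\<lambda>x. v x * \<xi> r x)"
    unfolding unit_section_def topZ
  proof (intro conjI ballI)
    show "continuous_map (subtopology X Z) euclidean (\<lambda>x. v x * \<xi> r x)"
      using vc continuous_map_from_subtopology[OF \<xi>c[of r]] by (intro continuous_intros) auto
    fix x assume x: "x \<in> Z"
    then have xX: "x \<in> topspace X" using ZX by blast
    show "isvec (v x * \<xi> r x)" by (rule isvec_mult[OF \<xi>r(1)[OF xX]])
    show "p x * (v x * \<xi> r x) = v x * \<xi> r x" using vv[OF x] by (simp flip: mult.assoc)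
    have "ip (v x * \<xi> r x) (v x * \<xi> r x) = ip (\<xi> r x) (adj (v x) * v x * \<xi> r x)"
      by (simp add: ip_mult_left mult.assoc)
    then show "ip (v x * \<xi> r x) (v x * \<xi> r x) = 1" using vv[OF x] \<xi>r[OF xX] by simp
  qed
  moreover have "real d + 1 \<le> 2 * Re (tr (p x))" if "x \<in> topspace X" for x
    using Suc.prems(3)[OF that] by simp
  ultimately obtain a where a: "unit_section X p a" "\<forall>x\<in>Z. a x = v x * \<xi> r x"
    using extend_unit_section[OF X Z Suc.prems(1)] by blast
  have ax: "isvec (a x)" "p x * a x = a x" "ip (a x) (a x) = 1" if "x \<in> topspace X" for x
    using a(1) that by (auto simp: unit_section_def)
  have ac: "continuous_map X euclidean a" using a(1) by (simp add: unit_section_def)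
  define p' where "p' x = p x - a x * adj (a x)" for x
  define q' where "q' x = q x - \<xi> r x * adj (\<xi> r x)" for x
  define w where "w x = v x - a x * adj (\<xi> r x)" for x
  have p'f: "proj (p' x)" "tr (p' x) = tr (p x) - 1" "p' x * a x = 0" "p x * p' x = p' x" if "x \<in> topspace X" for x
    unfolding p'_def using proj_minus_dyad[OF pp(1) ax(1,3,2)] that by auto
  have suppa: "supp N (a x)" if "x \<in> topspace X" for x
    by (rule supp_vec_of_proj[OF pp(2) ax(1,2)]) (use that in auto)
  have "proj_field X N p'"
    unfolding proj_field_def
  proof (intro conjI ballI)
    show "continuous_map X euclidean p'"
      unfolding p'_def using ac Suc.prems(1) by (intro continuous_intros) (auto simp: proj_field_def)
    fix x assume x: "x \<in> topspace X"
    show "proj (p' x)" using p'f x by auto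
    show "supp N (p' x)" unfolding p'_def using pp[OF x] suppa[OF x] by (intro supp_diff supp_mult supp_adj)
  qed
  moreover have "frame_field X r \<xi> q'"
    unfolding frame_field_def q'_def
  proof (intro conjI allI impI ballI)
    show "continuous_map X euclidean (\<xi> j)" if "j < r" for j using \<xi>c that by simp
    show "frame r (\<lambda>j. \<xi> j x) (q x - \<xi> r x * adj (\<xi> r x))" if "x \<in> topspace X" for x
      by (rule frame_SucD[OF fr[OF that]])
  qed
  moreover have "r = 0 \<or> 2 * real r + real d \<le> 2 * Re (tr (p' x)) + 1" if "x \<in> topspace X" for x
    using Suc.prems(3)[OF that] p'f(2)[OF that] by simp
  moreover have "isometry_field (subtopology X Z) q' p' w"
    unfolding isometry_field_def topZ
  proof (intro conjI ballI)
    show "continuous_map (subtopology X Z) euclidean w"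
      unfolding w_def using vc continuous_map_from_subtopology[OF \<xi>c[of r]] continuous_map_from_subtopology[OF ac]
      by (intro continuous_intros) auto
    fix x assume x: "x \<in> Z"
    then have xX: "x \<in> topspace X" using ZX by blast
    have wx: "w x = v x * q' x"
      using isometry_mult_right[OF frame_proj[OF fr[OF xX]] vv(1)[OF x]] a(2) x
      by (simp add: w_def q'_def right_diff_distrib mult.assoc)
    have q': "proj (q' x)" "q' x * \<xi> r x = 0" "q x * q' x = q' x"
      unfolding q'_def using proj_minus_dyad[OF frame_proj[OF fr[OF xX]] \<xi>r[OF xX]] by auto
    have "adj (w x) * w x = adj (q' x) * (adj (v x) * v x) * q' x"
      unfolding wx by (simp add: adj_mult mult.assoc)
    also have "\<dots> = q' x" using q' vv(1)[OF x] by (simp add: proj_def mult.assoc)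
    finally show "adj (w x) * w x = q' x" .
    have "adj (\<xi> r x) * q' x = 0" using q'(1,2) by (metis adj_0 adj_mult proj_def)
    then have "adj (\<xi> r x) * (adj (v x) * v x) * q' x = 0" using q'(3) vv(1)[OF x] by (simp add: mult.assoc)
    then have "adj (a x) * w x = 0" using a(2) x unfolding wx by (simp add: adj_mult mult.assoc)
    then show "p' x * w x = w x"
      using vv(2)[OF x] unfolding p'_def by (simp add: left_diff_distrib mult.assoc) (simp add: wx flip: mult.assoc)
  qed
  ultimately have "\<exists>v'. isometry_field X q' p' v' \<and> (\<forall>x\<in>Z. v' x = w x)" by (intro Suc.IH)
  then obtain u where u: "isometry_field X q' p' u" "\<forall>x\<in>Z. u x = w x" by (elim exE conjE) (rule that)
  have "isometry_field X q p (\<lambda>x. u x + a x * adj (\<xi> r x))"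
    unfolding isometry_field_def
  proof (intro conjI ballI)
    show "continuous_map X euclidean (\<lambda>x. u x + a x * adj (\<xi> r x))"
      using u(1) ac \<xi>c[of r] unfolding isometry_field_def by (intro continuous_intros) auto
    fix x assume x: "x \<in> topspace X"
    have ux: "adj (u x) * u x = q' x" "p' x * u x = u x" using u(1) x by (auto simp: isometry_field_def)
    have "adj (u x) * a x = adj (u x) * (p' x * a x)"
      using ux(2) p'f(1)[OF x] by (metis adj_mult mult.assoc proj_def)
    then have ua: "adj (u x) * a x = 0" using p'f(3)[OF x] by simp
    then have au: "adj (a x) * u x = 0" by (metis adj_0 adj_adj adj_mult)
    have "\<xi> r x * adj (a x) * (a x * adj (\<xi> r x)) = \<xi> r x * (adj (a x) * a x) * adj (\<xi> r x)"
      by (simp add: mult.assoc)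
    also have "\<dots> = \<xi> r x * adj (\<xi> r x)"
      using ax[OF x] \<xi>r[OF x] by (simp add: adj_vec_mult_vec)
    finally have "\<xi> r x * (adj (a x) * (a x * adj (\<xi> r x))) = \<xi> r x * adj (\<xi> r x)" by (simp add: mult.assoc)
    moreover have "adj (u x) * (a x * adj (\<xi> r x)) = 0" using ua by (simp flip: mult.assoc)
    ultimately show "adj (u x + a x * adj (\<xi> r x)) * (u x + a x * adj (\<xi> r x)) = q x"
      using ux(1) ua au by (simp add: adj_add adj_mult distrib_left distrib_right mult.assoc q'_def)
    have "p x * u x = u x" using ux(2) p'f(4)[OF x] by (metis mult.assoc)
    then show "p x * (u x + a x * adj (\<xi> r x)) = u x + a x * adj (\<xi> r x)"
      using ax(2)[OF x] by (simp add: distrib_left flip: mult.assoc)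
  qed
  moreover have "\<forall>x\<in>Z. u x + a x * adj (\<xi> r x) = v x" using u(2) by (simp add: w_def)
  ultimately show ?case by blast
qed

text \<open>This is the extension theorem behind comparison of projections. Its bound on the ranks is the one from
  which the bound of the first assertion comes: the last column to be extended is a unit section of a
  complement of rank at least \<open>rank p - rank q + 1\<close>, which has \<open>2 (rank p - rank q + 1) > d\<close> real
  coordinates.\<close>

theorem extend_isometry:
  assumes X: "compact_dim X d" and Z: "closedin X Z" and p: "proj_field X N p" and q: "proj_field X N q"
    and rank: "\<And>x. x \<in> topspace X \<Longrightarrow> q x = 0 \<or> 2 * Re (tr (q x)) + real d \<le> 2 * Re (tr (p x)) + 1"
    and v: "isometry_field (subtopology X Z) q p v"
  shows "\<exists>v'. isometry_field X q p v' \<and> (\<forall>x\<in>Z. v' x = v x)"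
proof -
  define Q where "Q Y \<longleftrightarrow> Z \<subseteq> Y \<and> (\<exists>v'. isometry_field (subtopology X Y) q p v' \<and> (\<forall>x\<in>Z. v' x = v x))" for Y
  have "Q (topspace X)"
  proof (rule frame_patch_induct[OF X Z _ q])
    show "Q Z" unfolding Q_def using v by blast
    fix Y K r b
    assume Y: "closedin X Y" "Q Y" and K: "closedin X K" "K \<noteq> {}" and b: "frame_field (subtopology X K) r b q"
    obtain v' where v': "isometry_field (subtopology X Y) q p v'" "\<forall>x\<in>Z. v' x = v x" and ZY: "Z \<subseteq> Y"
      using Y(2) unfolding Q_def by blast
    have r: "r = 0 \<or> 2 * real r + real d \<le> 2 * Re (tr (p x)) + 1" if x: "x \<in> topspace (subtopology X K)" for x
    proof -
      have "tr (q x) = of_nat r"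
        using b x by (intro frame_tr) (auto simp: frame_field_def)
      then show ?thesis using rank[of x] x by auto
    qed
    have top: "subtopology (subtopology X K) (Y \<inter> K) = subtopology X (Y \<inter> K)" by (rule sub_sub) auto
    have "subtopology (subtopology X Y) K = subtopology X (Y \<inter> K)" by (rule subtopology_subtopology)
    then have "isometry_field (subtopology (subtopology X K) (Y \<inter> K)) q p v'"
      using isometry_field_sub[OF v'(1), of K] top by simp
    from extend_isometry_framed[OF compact_dim_sub[OF X K(1)] closedin_sub_Int[OF Y(1) K(1)]
        proj_field_sub[OF p] b r this]
    obtain v'' where v'': "isometry_field (subtopology X K) q p v''" "\<forall>x\<in>Y \<inter> K. v'' x = v' x" by blast
    define g where "g x = (if x \<in> Y then v' x else v'' x)" for x
    have "continuous_map (subtopology X (Y \<union> K)) euclidean g"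
      unfolding g_def using v'(1) v'' by (intro continuous_map_glue Y K) (auto simp: isometry_field_def)
    then have "isometry_field (subtopology X (Y \<union> K)) q p g"
      using v'(1) v''(1) unfolding isometry_field_def by (auto simp: g_def)
    moreover have "\<forall>x\<in>Z. g x = v x" using v'(2) ZY by (auto simp: g_def)
    ultimately show "Q (Y \<union> K)" unfolding Q_def using ZY by blast
  qed
  then show ?thesis unfolding Q_def by simp
qed

section \<open>Moving isometries\<close>

lemma supp_of_compressed:
  assumes "supp N F" "F * S = S" "S * F = S"
  shows "supp N S"
  unfolding supp_def
proof (intro allI impI)
  fix i j assume "N \<le> i \<or> N \<le> j"
  then show "ent S i j = 0"
    using supp_mult_left[OF assms(1), of i S j] supp_mult_right[OF assms(1), of j S i] assms(2,3) by auto
qed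

text \<open>Skew-adjoint fields extend: glue with \<open>0\<close> on \<open>Z\<close>, extend by Tietze, compress to \<open>F\<close> and take the
  skew-adjoint part, which does not affect the given values.\<close>

lemma extend_skew:
  assumes X: "compact_dim X d" and Z: "closedin X Z" and K: "closedin X K" and F: "proj_field X N F"
    and S: "skew_fields (subtopology X K) (Z \<inter> K) F [S]"
  shows "\<exists>S'. skew_fields X Z F [S'] \<and> (\<forall>x\<in>K. S' x = S x)"
proof -
  have sub: "Z \<subseteq> topspace X" "K \<subseteq> topspace X" using closedin_subset Z K by blast+
  have topK: "topspace (subtopology X K) = K" by (rule topspace_sub_closed[OF K])
  have Fx: "proj (F x)" "supp N (F x)" if "x \<in> topspace X" for x using F that by (auto simp: proj_field_def)
  have Fc: "continuous_map X euclidean F" using F by (simp add: proj_field_def)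
  have Sx: "adj (S x) = - S x" "F x * S x = S x" "S x * F x = S x" if "x \<in> K" for x
    using S that topK by (auto simp: skew_fields_def)
  have Sc: "continuous_map (subtopology X K) euclidean S" and S0: "\<forall>x\<in>Z \<inter> K. S x = 0"
    using S by (auto simp: skew_fields_def)
  define h where "h x = (if x \<in> Z then 0 else S x)" for x
  have "continuous_map (subtopology X (Z \<union> K)) euclidean h"
    unfolding h_def using S0 Sc by (intro continuous_map_glue Z K) auto
  moreover have suppS: "supp N (S x)" if x: "x \<in> K" for x
    using supp_of_compressed[of N "F x"] Fx[of x] Sx[OF x] x sub by auto
  have "supp N (h x)" if "x \<in> Z \<union> K" for x using that suppS by (auto simp: h_def)
  ultimately obtain g where g: "continuous_map X euclidean g" "\<forall>x. supp N (g x)" "\<forall>x\<in>Z \<union> K. g x = h x"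
    using Tietze_finmat[OF compact_Hausdorff_normal closedin_Un[OF Z K], of h N] X unfolding compact_dim_def by blast
  define R where "R x = F x * g x * F x" for x
  define S' where "S' x = (1/2) *\<^sub>R (R x - adj (R x))" for x
  have R: "S' x = (1/2) *\<^sub>R (h x - adj (h x))" if "x \<in> Z \<union> K" for x
  proof -
    have "F x * h x * F x = h x" using that Sx[of x] by (auto simp: h_def)
    then show ?thesis using g(3) that by (simp add: S'_def R_def)
  qed
  have "S' x = S x" if "x \<in> K" for x
  proof (cases "x \<in> Z")
    case True
    then show ?thesis using R[of x] S0 that by (simp add: h_def)
  next
    case False
    then have "S' x = (1/2) *\<^sub>R (S x + S x)" using R[of x] Sx(1)[OF that] that by (simp add: h_def)
    then show ?thesis by (simp flip: scaleR_2)
  qed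
  moreover have "skew_fields X Z F [S']"
    unfolding skew_fields_def
  proof (intro ballI conjI)
    fix S1 assume "S1 \<in> set [S']"
    then have [simp]: "S1 = S'" by simp
    show "continuous_map X euclidean S1"
      unfolding \<open>S1 = S'\<close> S'_def R_def using g(1) Fc by (intro continuous_intros) auto
    fix x
    show "S1 x = 0" if "x \<in> Z" using R[of x] that by (simp add: h_def)
    assume x: "x \<in> topspace X"
    have FF: "F x * F x = F x" "adj (F x) = F x" using Fx[OF x] by (auto simp: proj_def)
    have FR: "F x * R x = R x" "R x * F x = R x"
      unfolding R_def by (simp_all add: FF mult.assoc) (simp_all add: FF flip: mult.assoc)
    then have FR': "F x * adj (R x) = adj (R x)" "adj (R x) * F x = adj (R x)"
      using FF(2) by (metis adj_mult)+
    show "adj (S1 x) = - S1 x" by (simp add: S'_def adj_scaleR adj_diff scaleR_diff_right)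
    show "F x * S1 x = S1 x" "S1 x * F x = S1 x"
      by (simp_all add: S'_def right_diff_distrib left_diff_distrib FR FR')
  qed
  ultimately show ?thesis by blast
qed

lemma skew_fields_Nil [simp]: "skew_fields X Y F []"
  by (simp add: skew_fields_def)

lemma skew_fields_Cons: "skew_fields X Y F (S # Ss) \<longleftrightarrow> skew_fields X Y F [S] \<and> skew_fields X Y F Ss"
  by (simp add: skew_fields_def)

lemma skew_fields_append: "skew_fields X Y F (Rs @ Ss) \<longleftrightarrow> skew_fields X Y F Rs \<and> skew_fields X Y F Ss"
  by (auto simp: skew_fields_def)

lemma skew_fields_mono: "skew_fields X Y F Ss \<Longrightarrow> Y' \<subseteq> Y \<Longrightarrow> skew_fields X Y' F Ss"
  by (auto simp: skew_fields_def)

lemma extend_skew_list: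
  assumes X: "compact_dim X d" and Z: "closedin X Z" and K: "closedin X K" and F: "proj_field X N F"
    and S: "skew_fields (subtopology X K) (Z \<inter> K) F Ss"
  shows "\<exists>Ss'. skew_fields X Z F Ss' \<and> (\<forall>x\<in>K. map (\<lambda>S. S x) Ss' = map (\<lambda>S. S x) Ss)"
  using S
proof (induction Ss)
  case Nil
  then show ?case by (intro exI[of _ "[]"]) simp
next
  case (Cons S Ss)
  then have S: "skew_fields (subtopology X K) (Z \<inter> K) F [S]" and Ss: "skew_fields (subtopology X K) (Z \<inter> K) F Ss"
    using skew_fields_Cons by blast+
  obtain S' where S': "skew_fields X Z F [S']" "\<forall>x\<in>K. S' x = S x" using extend_skew[OF X Z K F S] by blast
  obtain Ss' where Ss': "skew_fields X Z F Ss'" "\<forall>x\<in>K. map (\<lambda>S. S x) Ss' = map (\<lambda>S. S x) Ss"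
    using Cons.IH[OF Ss] by blast
  have "skew_fields X Z F (S' # Ss')" using S' Ss' skew_fields_Cons by blast
  moreover have "\<forall>x\<in>K. map (\<lambda>S. S x) (S' # Ss') = map (\<lambda>S. S x) (S # Ss)" using S' Ss' by simp
  ultimately show ?case by blast
qed

lemma skew_fields_at:
  assumes "skew_fields X Y F Ss" "x \<in> topspace X"
  shows "\<forall>S\<in>set (map (\<lambda>S. S x) Ss). adj S = - S \<and> F x * S = S \<and> S * F x = S"
  using assms by (auto simp: skew_fields_def)

lemma chain_at_fixed:
  assumes "skew_fields X Y F Ss" "x \<in> Y"
  shows "chain_at Ss x a = a"
  using assms by (intro chain_zero) (auto simp: skew_fields_def)

lemma continuous_map_chain_at:
  assumes S: "skew_fields X Y F Ss" and F: "proj_field X N F" and a: "continuous_map X euclidean a"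
  shows "continuous_map X euclidean (\<lambda>x. chain_at Ss x (a x))"
proof (rule continuous_map_chain[where N = N])
  fix S x assume "S \<in> set Ss" "x \<in> topspace X"
  then show "adj (S x) = - S x \<and> supp N (S x)"
    using S F supp_of_compressed[of N "F x" "S x"] by (auto simp: skew_fields_def proj_field_def)
qed (use S a in \<open>auto simp: skew_fields_def\<close>)

lemma unit_section_chain:
  assumes S: "skew_fields X Y F Ss" and F: "proj_field X N F" and a: "unit_section X F a"
  shows "unit_section X F (\<lambda>x. chain_at Ss x (a x))"
  unfolding unit_section_def
proof (intro conjI ballI)
  show "continuous_map X euclidean (\<lambda>x. chain_at Ss x (a x))"
    using a by (intro continuous_map_chain_at[OF S F]) (simp add: unit_section_def)
  fix x assume x: "x \<in> topspace X"
  have ax: "isvec (a x)" "F x * a x = a x" "ip (a x) (a x) = 1" using a x by (auto simp: unit_section_def)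
  note Sx = skew_fields_at[OF S x]
  show "isvec (chain_at Ss x (a x))" by (rule isvec_chain[OF ax(1)])
  show "F x * chain_at Ss x (a x) = chain_at Ss x (a x)" using Sx ax(2) by (intro chain_in) auto
  show "ip (chain_at Ss x (a x)) (chain_at Ss x (a x)) = 1" using Sx ax(3) by (subst ip_chain) auto
qed

lemma unit_ip_bound:
  assumes "frame r b p" "isvec a" "p * a = a" "ip a a = 1" "j < r"
  shows "cmod (ip (b j) a) \<le> 1"
proof -
  have "complex_of_real (\<Sum>j<r. (cmod (ip (b j) a))\<^sup>2) = 1"
    using frame_parseval(2)[OF assms(1-3)] assms(4) by simp
  then have "(\<Sum>j<r. (cmod (ip (b j) a))\<^sup>2) = 1" using of_real_eq_1_iff by blast
  moreover have "(cmod (ip (b j) a))\<^sup>2 \<le> (\<Sum>j<r. (cmod (ip (b j) a))\<^sup>2)"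
    using assms(5) by (intro member_le_sum) auto
  ultimately have "(cmod (ip (b j) a))\<^sup>2 \<le> 1\<^sup>2" by simp
  then show ?thesis by (rule power2_le_imp_le) simp
qed

text \<open>A section \<open>\<eta>\<close> is rotated to \<open>\<zeta>\<close> via an intermediate section \<open>u\<close>: a rotation exists between unit vectors
  that are not antipodal, and \<open>u\<close> is a perturbation of \<open>\<eta>\<close> which avoids \<open>- \<zeta>\<close>. The set of unit vectors
  whose coordinate along \<open>\<zeta>\<close> has negative real part and whose remaining \<open>2 r + 1\<close> real
  coordinates are \<open>0\<close> consists of \<open>- \<zeta>\<close> alone. As \<open>d < 2 r + 1\<close>, these \<open>2 r + 1\<close> coordinates can
  be made to have no common zero where the real part is not positive. This is why moving a vector needs
  one real dimension more than extending it.\<close>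

lemma move_vector_framed:
  assumes X: "compact_dim X d" and Y: "closedin X Y" and F: "proj_field X N F"
    and b: "frame_field X r b (\<lambda>x. F x - \<zeta> x * adj (\<zeta> x))" and r: "d \<le> 2 * r"
    and \<eta>: "unit_section X F \<eta>" and \<zeta>: "unit_section X F \<zeta>" and eq: "\<forall>x\<in>Y. \<eta> x = \<zeta> x"
  shows "\<exists>Ss. skew_fields X Y F Ss \<and> (\<forall>x\<in>topspace X. chain_at Ss x (\<eta> x) = \<zeta> x)"
proof -
  have YX: "Y \<subseteq> topspace X" using closedin_subset[OF Y] .
  have Fx: "proj (F x)" if "x \<in> topspace X" for x using F that by (auto simp: proj_field_def)
  have \<eta>x: "isvec (\<eta> x)" "F x * \<eta> x = \<eta> x" "ip (\<eta> x) (\<eta> x) = 1" if "x \<in> topspace X" for x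
    using \<eta> that by (auto simp: unit_section_def)
  have \<zeta>x: "isvec (\<zeta> x)" "F x * \<zeta> x = \<zeta> x" "ip (\<zeta> x) (\<zeta> x) = 1" if "x \<in> topspace X" for x
    using \<zeta> that by (auto simp: unit_section_def)
  have \<eta>c: "continuous_map X euclidean \<eta>" and \<zeta>c: "continuous_map X euclidean \<zeta>"
    using \<eta> \<zeta> by (auto simp: unit_section_def)
  \<comment> \<open>the frame of \<open>F\<close> obtained by adding \<open>\<zeta>\<close> as the vector with index \<open>r\<close>\<close>
  define B where "B j x = (if j = r then \<zeta> x else b j x)" for j x
  have Bc: "continuous_map X euclidean (B j)" if "j < Suc r" for j
    using that b \<zeta>c unfolding B_def by (cases "j = r") (auto simp: frame_field_def)
  have fr: "frame (Suc r) (\<lambda>j. B j x) (F x)" if x: "x \<in> topspace X" for x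
  proof -
    have "frame r (\<lambda>j. b j x) (F x - \<zeta> x * adj (\<zeta> x))" using b x by (auto simp: frame_field_def)
    then have "frame (Suc r) ((\<lambda>j. b j x)(r := \<zeta> x)) (F x)" using \<zeta>x[OF x] by (intro frame_SucI) auto
    moreover have "(\<lambda>j. b j x)(r := \<zeta> x) = (\<lambda>j. B j x)" by (auto simp: B_def)
    ultimately show ?thesis by simp
  qed
  define w where "w j x = ip (B j x) (\<eta> x)" for j x
  have wc: "continuous_map X euclidean (w j)" if "j < Suc r" for j
    unfolding w_def using Bc[OF that] \<eta>c by (intro continuous_intros)
  \<comment> \<open>all real coordinates of \<open>\<eta>\<close> except the real part of the last one; index \<open>2 r\<close> is its imaginary part\<close>
  define c where "c k x = (if k < 2 * r \<and> even k then Re (w (k div 2) x) else Im (w (k div 2) x))" for k x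
  have cc: "\<forall>k<2 * r + 1. continuous_map X euclideanreal (c k)"
  proof (intro allI impI)
    fix k assume "k < 2 * r + 1"
    then have "k div 2 < Suc r" by auto
    from wc[OF this] show "continuous_map X euclideanreal (c k)"
      unfolding c_def by (cases "k < 2 * r \<and> even k") (auto intro!: continuous_intros)
  qed
  define W where "W = {x \<in> topspace X. Re (w r x) \<in> {0<..}}"
  have W: "openin X W"
    unfolding W_def using wc[of r]
    by (intro openin_continuous_map_preimage[where Y = euclideanreal] continuous_intros) auto
  have YW: "Y \<subseteq> W"
  proof
    fix x assume x: "x \<in> Y"
    then have "w r x = 1" using eq \<zeta>x(3)[of x] YX by (auto simp: w_def B_def)
    then show "x \<in> W" using x YX by (auto simp: W_def)
  qed
  \<comment> \<open>each of the \<open>r + 1\<close> complex coordinates moves by at most \<open>2 \<epsilon>\<close>, and \<open>(r + 1) \<cdot> 2 \<epsilon> = 1/2\<close> keeps \<open>v\<close>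
     off the antipode of \<open>\<eta>\<close>\<close>
  define \<epsilon> where "\<epsilon> = 1 / (4 * (real r + 1))"
  have \<epsilon>: "\<epsilon> > 0" by (simp add: \<epsilon>_def)
  have "\<exists>c'. (\<forall>k<2 * r + 1. continuous_map X euclideanreal (c' k)) \<and>
    (\<forall>k<2 * r + 1. \<forall>x\<in>topspace X. \<bar>c' k x - c k x\<bar> \<le> \<epsilon>) \<and> (\<forall>k<2 * r + 1. \<forall>x\<in>Y. c' k x = c k x) \<and>
    (\<forall>x\<in>topspace X - W. \<exists>k<2 * r + 1. c' k x \<noteq> 0)"
    using X r by (intro nonvanishing_approximation_rel[OF _ _ _ _ cc \<epsilon> Y W YW, where d = d]) (auto simp: compact_dim_def)
  then obtain c' where c': "\<forall>k<2 * r + 1. continuous_map X euclideanreal (c' k)"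
    "\<forall>k<2 * r + 1. \<forall>x\<in>topspace X. \<bar>c' k x - c k x\<bar> \<le> \<epsilon>" "\<forall>k<2 * r + 1. \<forall>x\<in>Y. c' k x = c k x"
    "\<forall>x\<in>topspace X - W. \<exists>k<2 * r + 1. c' k x \<noteq> 0" by (elim exE conjE) (rule that)
  define z where "z j x = (if j < r then complex_of_real (c' (2 * j) x) + \<i> * of_real (c' (Suc (2 * j)) x)
     else complex_of_real (Re (w r x)) + \<i> * of_real (c' (2 * r) x))" for j x
  define v where "v x = (\<Sum>j<Suc r. csc (z j x) (B j x))" for x
  have zc: "continuous_map X euclidean (z j)" if "j < Suc r" for j
    unfolding z_def using that c'(1) wc[of r] by (cases "j < r") (auto intro!: continuous_intros)
  have vc: "continuous_map X euclidean v"
    unfolding v_def using zc Bc by (intro continuous_intros) auto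
  have vx: "isvec (v x)" "F x * v x = v x" if "x \<in> topspace X" for x
    unfolding v_def using frame_combination[OF fr[OF that]] by auto
  have \<eta>w: "\<eta> x = (\<Sum>j<Suc r. csc (w j x) (B j x))" if x: "x \<in> topspace X" for x
    using frame_mult_vec[OF fr[OF x] \<eta>x(1)[OF x]] \<eta>x(2)[OF x] unfolding w_def by metis
  have vY: "v x = \<eta> x" if x: "x \<in> Y" for x
  proof -
    have "z j x = w j x" if "j < Suc r" for j
      using that c'(3) x by (auto simp: z_def c_def complex_eq_iff less_Suc_eq)
    then have "v x = (\<Sum>j<Suc r. csc (w j x) (B j x))" unfolding v_def by (intro sum.cong) auto
    then show ?thesis using \<eta>w x YX by auto
  qed
  have zw: "cmod (z j x - w j x) \<le> 2 * \<epsilon>" if j: "j < Suc r" and x: "x \<in> topspace X" for j x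
  proof (cases "j < r")
    case True
    have k: "2 * j < 2 * r + 1" "Suc (2 * j) < 2 * r + 1" using True by auto
    have "cmod (z j x - w j x) \<le> \<bar>Re (z j x - w j x)\<bar> + \<bar>Im (z j x - w j x)\<bar>" by (rule cmod_le)
    also have "Re (z j x - w j x) = c' (2 * j) x - c (2 * j) x" using True by (simp add: z_def c_def)
    also have "Im (z j x - w j x) = c' (Suc (2 * j)) x - c (Suc (2 * j)) x" using True by (simp add: z_def c_def)
    also have "\<bar>c' (2 * j) x - c (2 * j) x\<bar> + \<bar>c' (Suc (2 * j)) x - c (Suc (2 * j)) x\<bar> \<le> \<epsilon> + \<epsilon>"
      using c'(2) k x by (intro add_mono) auto
    finally show ?thesis by simp
  next
    case False
    then have [simp]: "j = r" using j by simp
    have k: "2 * r < 2 * r + 1" by simp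
    have "cmod (z j x - w j x) \<le> \<bar>Re (z j x - w j x)\<bar> + \<bar>Im (z j x - w j x)\<bar>" by (rule cmod_le)
    also have "Re (z j x - w j x) = 0" by (simp add: z_def)
    also have "Im (z j x - w j x) = c' (2 * r) x - c (2 * r) x" by (simp add: z_def c_def)
    also have "\<bar>c' (2 * r) x - c (2 * r) x\<bar> \<le> \<epsilon>" using c'(2) k x by blast
    finally show ?thesis using \<epsilon> by simp
  qed
  have near: "Re (ip (\<eta> x) (v x)) > 0" if x: "x \<in> topspace X" for x
  proof -
    have "ip (\<eta> x) (v x) - ip (\<eta> x) (\<eta> x) = (\<Sum>j<Suc r. z j x * cnj (w j x)) - (\<Sum>j<Suc r. w j x * cnj (w j x))"
      unfolding v_def frame_parseval(1)[OF fr[OF x] \<eta>x(1,2)[OF x]]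
      by (subst (2) \<eta>w[OF x]) (simp only: frame_parseval(1)[OF fr[OF x] \<eta>x(1,2)[OF x]] w_def)
    then have d: "ip (\<eta> x) (v x) - 1 = (\<Sum>j<Suc r. (z j x - w j x) * cnj (w j x))"
      using \<eta>x(3)[OF x] by (simp only: sum_subtractf left_diff_distrib)
    have "cmod (ip (\<eta> x) (v x) - 1) \<le> (\<Sum>j<Suc r. cmod ((z j x - w j x) * cnj (w j x)))"
      unfolding d by (rule norm_sum)
    also have "\<dots> \<le> (\<Sum>j<Suc r. 2 * \<epsilon> * 1)"
    proof (rule sum_mono)
      fix j assume "j \<in> {..<Suc r}"
      then have j: "j < Suc r" by simp
      have "cmod (w j x) \<le> 1" unfolding w_def by (rule unit_ip_bound[OF fr[OF x] \<eta>x[OF x] j])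
      then show "cmod ((z j x - w j x) * cnj (w j x)) \<le> 2 * \<epsilon> * 1"
        unfolding norm_mult complex_mod_cnj using zw[OF j x] \<epsilon> by (intro mult_mono) auto
    qed
    also have "\<dots> = 1 / 2" by (simp add: \<epsilon>_def field_simps)
    finally have "cmod (ip (\<eta> x) (v x) - 1) \<le> 1 / 2" .
    then have "\<bar>Re (ip (\<eta> x) (v x) - 1)\<bar> \<le> 1 / 2" using abs_Re_le_cmod order_trans by blast
    then have "\<bar>Re (ip (\<eta> x) (v x)) - 1\<bar> \<le> 1 / 2" by simp
    then show ?thesis by linarith
  qed
  have vne: "v x \<noteq> 0" if "x \<in> topspace X" for x using near[OF that] by auto
  define u where "u x = normalize_vec (v x)" for x
  have u: "unit_section X F u"
    unfolding unit_section_def u_def using vc vne vx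
    by (auto intro: continuous_map_normalize_vec isvec_normalize_vec mult_normalize_vec ip_normalize_vec)
  have ux: "isvec (u x)" "F x * u x = u x" "ip (u x) (u x) = 1" if "x \<in> topspace X" for x
    using u that by (auto simp: unit_section_def)
  have uc: "continuous_map X euclidean u" using u by (simp add: unit_section_def)
  have uv: "\<exists>t>0. u x = t *\<^sub>R v x" if x: "x \<in> topspace X" for x
    unfolding u_def normalize_vec_def using ip_self_pos[OF vx(1)[OF x] vne[OF x]]
    by (intro exI[of _ "1 / sqrt (Re (ip (v x) (v x)))"]) simp
  have ne1: "\<eta> x + u x \<noteq> 0" if x: "x \<in> topspace X" for x
  proof
    assume "\<eta> x + u x = 0"
    then have "u x = - \<eta> x" by (simp add: add_eq_0_iff)
    then have "ip (\<eta> x) (u x) = - 1"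
      using \<eta>x(3)[OF x] ip_diff_right[of "\<eta> x" 0 "\<eta> x"] by simp
    moreover obtain t where "t > 0" "u x = t *\<^sub>R v x" using uv[OF x] by blast
    ultimately have "t * Re (ip (\<eta> x) (v x)) = - 1" by (simp add: ip_scaleR_right complex_eq_iff)
    moreover have "t * Re (ip (\<eta> x) (v x)) > 0" using \<open>t > 0\<close> near[OF x] by simp
    ultimately show False by simp
  qed
  have ne2: "u x + \<zeta> x \<noteq> 0" if x: "x \<in> topspace X" for x
  proof
    assume "u x + \<zeta> x = 0"
    then have "u x = - \<zeta> x" by (simp add: eq_neg_iff_add_eq_0)
    moreover obtain t where t: "t > 0" "u x = t *\<^sub>R v x" using uv[OF x] by blast
    ultimately have tv: "t *\<^sub>R v x = 0 - \<zeta> x" by simp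
    have tz: "of_real t * z j x = - ip (B j x) (\<zeta> x)" if "j < Suc r" for j
    proof -
      have "of_real t * z j x = ip (B j x) (t *\<^sub>R v x)"
        unfolding ip_scaleR_right v_def frame_coordinate[OF fr[OF x] that] ..
      then show ?thesis unfolding tv ip_diff_right by simp
    qed
    have "ip (B j x) (\<zeta> x) = 0" if "j < r" for j
    proof -
      have "ip (B j x) (B r x) = (if j = r then 1 else 0)"
        using fr[OF x] that unfolding frame_def by simp
      then show ?thesis using that by (simp add: B_def)
    qed
    then have z0: "z j x = 0" if "j < r" for j using tz[of j] t(1) that by simp
    have "of_real t * z r x = - 1" using tz[of r] \<zeta>x(3)[OF x] by (simp add: B_def)
    then have tRe: "t * Re (z r x) = - 1" and tIm: "t * Im (z r x) = 0" by (simp_all add: complex_eq_iff)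
    have "\<not> 0 \<le> Re (z r x)" using tRe mult_nonneg_nonneg[of t "Re (z r x)"] t(1) by auto
    then have zr: "Im (z r x) = 0" "Re (z r x) < 0" using tIm t(1) by auto
    then have "x \<notin> W" by (simp add: W_def z_def)
    then obtain k where k: "k < 2 * r + 1" "c' k x \<noteq> 0" using c'(4) x by blast
    show False
    proof (cases "k = 2 * r")
      case True
      then show False using zr(1) k(2) by (simp add: z_def)
    next
      case False
      then have "k div 2 < r" using k(1) by auto
      then have "z (k div 2) x = 0" by (rule z0)
      then show False using k(2) \<open>k div 2 < r\<close>
        by (cases "even k") (auto simp: z_def complex_eq_iff)
    qed
  qed
  define R1 where "R1 x = rotation (\<eta> x) (u x)" for x
  define R2 where "R2 x = rotation (u x) (\<zeta> x)" for x
  have "skew_fields X Y F [R1, R2]"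
    unfolding skew_fields_def
  proof (intro ballI conjI)
    fix S assume S: "S \<in> set [R1, R2]"
    have "continuous_map X euclidean R1"
      unfolding R1_def using \<eta>c uc \<eta>x ux ne1 by (intro continuous_map_rotation) auto
    moreover have "continuous_map X euclidean R2"
      unfolding R2_def using \<zeta>c uc \<zeta>x ux ne2 by (intro continuous_map_rotation) auto
    ultimately show "continuous_map X euclidean S" using S by auto
    fix x
    show "S x = 0" if "x \<in> Y"
    proof -
      have xX: "x \<in> topspace X" using that YX by blast
      have "u x = \<eta> x" unfolding u_def using vY[OF that] normalize_vec_unit \<eta>x(3)[OF xX] by simp
      moreover have "\<zeta> x = \<eta> x" using eq that by simp
      ultimately show ?thesis using S \<eta>x(3)[OF xX] by (auto simp: R1_def R2_def)
    qed
    assume x: "x \<in> topspace X"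
    show "adj (S x) = - S x"
      using S rotation_skew[OF \<eta>x(3)[OF x] ux(3)[OF x]] rotation_skew[OF ux(3)[OF x] \<zeta>x(3)[OF x]]
      by (auto simp: R1_def R2_def)
    show "F x * S x = S x" "S x * F x = S x"
      using S rotation_in[OF Fx[OF x] \<eta>x(2)[OF x] ux(2)[OF x]] rotation_in[OF Fx[OF x] ux(2)[OF x] \<zeta>x(2)[OF x]]
      by (auto simp: R1_def R2_def)
  qed
  moreover have "chain_at [R1, R2] x (\<eta> x) = \<zeta> x" if x: "x \<in> topspace X" for x
    using cayley_rotation[OF \<eta>x(1)[OF x] ux(1)[OF x] \<eta>x(3)[OF x] ux(3)[OF x] ne1[OF x]]
      cayley_rotation[OF ux(1)[OF x] \<zeta>x(1)[OF x] ux(3)[OF x] \<zeta>x(3)[OF x] ne2[OF x]]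
    by (simp add: R1_def R2_def)
  ultimately show ?thesis by blast
qed

text \<open>The framed case is applied on closed patches. Its rotations are extended over \<open>X\<close> so as to be trivial
  over the part \<open>Z\<close> done before, and they are appended to the chain.\<close>

lemma move_vector:
  assumes X: "compact_dim X d" and Y: "closedin X Y" and F: "proj_field X N F"
    and rank: "\<And>x. x \<in> topspace X \<Longrightarrow> real d + 2 \<le> 2 * Re (tr (F x))"
    and \<eta>: "unit_section X F \<eta>" and \<zeta>: "unit_section X F \<zeta>" and eq: "\<forall>x\<in>Y. \<eta> x = \<zeta> x"
  shows "\<exists>Ss. skew_fields X Y F Ss \<and> (\<forall>x\<in>topspace X. chain_at Ss x (\<eta> x) = \<zeta> x)"
proof -
  have \<zeta>x: "isvec (\<zeta> x)" "F x * \<zeta> x = \<zeta> x" "ip (\<zeta> x) (\<zeta> x) = 1" if "x \<in> topspace X" for x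
    using \<zeta> that by (auto simp: unit_section_def)
  have Fx: "proj (F x)" "supp N (F x)" if "x \<in> topspace X" for x using F that by (auto simp: proj_field_def)
  define F' where "F' x = F x - \<zeta> x * adj (\<zeta> x)" for x
  have F'x: "proj (F' x)" "tr (F' x) = tr (F x) - 1" if "x \<in> topspace X" for x
    unfolding F'_def using proj_minus_dyad[OF Fx(1)[OF that] \<zeta>x(1,3,2)[OF that]] by auto
  have F': "proj_field X N F'"
    unfolding proj_field_def
  proof (intro conjI ballI)
    show "continuous_map X euclidean F'"
      unfolding F'_def using \<zeta> F by (intro continuous_intros) (auto simp: proj_field_def unit_section_def)
    fix x assume x: "x \<in> topspace X"
    show "proj (F' x)" by (rule F'x[OF x])
    have "supp N (\<zeta> x)" by (rule supp_vec_of_proj[OF Fx(2)[OF x] \<zeta>x(1,2)[OF x]])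
    then show "supp N (F' x)" unfolding F'_def using Fx(2)[OF x] by (intro supp_diff supp_mult supp_adj)
  qed
  define Q where "Q Z \<longleftrightarrow> Y \<subseteq> Z \<and> (\<exists>Ss. skew_fields X Y F Ss \<and> (\<forall>x\<in>Z. chain_at Ss x (\<eta> x) = \<zeta> x))" for Z
  have "Q (topspace X)"
  proof (rule frame_patch_induct[OF X Y _ F'])
    show "Q Y" unfolding Q_def using eq by (intro conjI exI[of _ "[]"]) auto
    fix Z K r b
    assume Z: "closedin X Z" "Q Z" and K: "closedin X K" "K \<noteq> {}" and b: "frame_field (subtopology X K) r b F'"
    obtain Ss where Ss: "skew_fields X Y F Ss" "\<forall>x\<in>Z. chain_at Ss x (\<eta> x) = \<zeta> x" and YZ: "Y \<subseteq> Z"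
      using Z(2) unfolding Q_def by blast
    have topK: "topspace (subtopology X K) = K" by (rule topspace_sub_closed[OF K(1)])
    obtain x where x: "x \<in> K" "x \<in> topspace X" using K closedin_subset by blast
    have "tr (F' x) = of_nat r"
      using b x by (intro frame_tr) (auto simp: frame_field_def)
    then have "Re (tr (F x)) = real r + 1" using F'x(2)[OF x(2)] by (simp add: complex_eq_iff)
    then have r: "d \<le> 2 * r" using rank[OF x(2)] by simp
    have \<eta>': "unit_section (subtopology X K) F (\<lambda>x. chain_at Ss x (\<eta> x))"
      by (intro unit_section_sub unit_section_chain[OF Ss(1) F \<eta>])
    have "\<exists>Rs. skew_fields (subtopology X K) (Z \<inter> K) F Rs \<and>
       (\<forall>x\<in>topspace (subtopology X K). chain_at Rs x (chain_at Ss x (\<eta> x)) = \<zeta> x)"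
      using b unfolding F'_def
      by (rule move_vector_framed[OF compact_dim_sub[OF X K(1)] closedin_sub_Int[OF Z(1) K(1)] proj_field_sub[OF F]
          _ r \<eta>' unit_section_sub[OF \<zeta>]]) (use Ss(2) in blast)
    then obtain Rs where Rs: "skew_fields (subtopology X K) (Z \<inter> K) F Rs"
      "\<forall>x\<in>K. chain_at Rs x (chain_at Ss x (\<eta> x)) = \<zeta> x" unfolding topK by blast
    obtain Rs' where Rs': "skew_fields X Z F Rs'" "\<forall>x\<in>K. map (\<lambda>S. S x) Rs' = map (\<lambda>S. S x) Rs"
      using extend_skew_list[OF X Z(1) K(1) F Rs(1)] by blast
    have "skew_fields X Y F (Ss @ Rs')"
      using Ss(1) skew_fields_mono[OF Rs'(1) YZ] by (simp add: skew_fields_append)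
    moreover have "chain_at (Ss @ Rs') x (\<eta> x) = \<zeta> x" if "x \<in> Z \<union> K" for x
    proof (cases "x \<in> Z")
      case True
      then show ?thesis using Ss(2) chain_at_fixed[OF Rs'(1)] by simp
    next
      case False
      then have "x \<in> K" using that by blast
      then show ?thesis using Rs(2) Rs'(2) by simp
    qed
    ultimately show "Q (Z \<union> K)" unfolding Q_def using YZ by blast
  qed
  then show ?thesis unfolding Q_def by blast
qed

text \<open>Vectors are moved one after another. Once \<open>\<eta> r\<close> has been moved to \<open>\<zeta> r\<close>, the others are moved inside
  the orthogonal complement of \<open>\<zeta> r\<close>, by rotations that fix \<open>\<zeta> r\<close>.\<close>

lemma move_frame:
  assumes X: "compact_dim X d" and Y: "closedin X Y" and F: "proj_field X N F"
    and rank: "\<And>x. x \<in> topspace X \<Longrightarrow> 2 * real r + real d \<le> 2 * Re (tr (F x))"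
    and \<eta>: "\<And>j. j < r \<Longrightarrow> unit_section X F (\<eta> j)" and \<zeta>: "\<And>j. j < r \<Longrightarrow> unit_section X F (\<zeta> j)"
    and orth: "\<And>i j x. i < j \<Longrightarrow> j < r \<Longrightarrow> x \<in> topspace X \<Longrightarrow> ip (\<eta> j x) (\<eta> i x) = 0 \<and> ip (\<zeta> j x) (\<zeta> i x) = 0"
    and eq: "\<And>j x. j < r \<Longrightarrow> x \<in> Y \<Longrightarrow> \<eta> j x = \<zeta> j x"
  shows "\<exists>Ss. skew_fields X Y F Ss \<and> (\<forall>j<r. \<forall>x\<in>topspace X. chain_at Ss x (\<eta> j x) = \<zeta> j x)"
  using F rank \<eta> \<zeta> orth eq
proof (induction r arbitrary: F \<eta>)
  case 0
  show ?case by (intro exI[of _ "[]"]) simp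
next
  case (Suc r)
  have rank': "real d + 2 \<le> 2 * Re (tr (F x))" if "x \<in> topspace X" for x
    using Suc.prems(2)[OF that] by simp
  have \<eta>r: "unit_section X F (\<eta> r)" and \<zeta>r: "unit_section X F (\<zeta> r)" using Suc.prems(3,4) by auto
  have "\<exists>Ss. skew_fields X Y F Ss \<and> (\<forall>x\<in>topspace X. chain_at Ss x (\<eta> r x) = \<zeta> r x)"
    by (rule move_vector[OF X Y Suc.prems(1) rank' \<eta>r \<zeta>r]) (use Suc.prems(6) in auto)
  then obtain Rs where Rs: "skew_fields X Y F Rs" "\<forall>x\<in>topspace X. chain_at Rs x (\<eta> r x) = \<zeta> r x" by blast
  have YX: "Y \<subseteq> topspace X" using closedin_subset[OF Y] .
  have \<zeta>x: "isvec (\<zeta> r x)" "F x * \<zeta> r x = \<zeta> r x" "ip (\<zeta> r x) (\<zeta> r x) = 1" if "x \<in> topspace X" for x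
    using \<zeta>r that by (auto simp: unit_section_def)
  have Fx: "proj (F x)" "supp N (F x)" if "x \<in> topspace X" for x using Suc.prems(1) that by (auto simp: proj_field_def)
  define F' where "F' x = F x - \<zeta> r x * adj (\<zeta> r x)" for x
  have F'x: "proj (F' x)" "tr (F' x) = tr (F x) - 1" "F' x * \<zeta> r x = 0" "F x * F' x = F' x" if "x \<in> topspace X" for x
    unfolding F'_def using proj_minus_dyad[OF Fx(1)[OF that] \<zeta>x(1,3,2)[OF that]] by auto
  have F'F: "F' x * F x = F' x" if "x \<in> topspace X" for x
    using F'x(1,4)[OF that] Fx(1)[OF that] by (metis adj_mult proj_def)
  have F': "proj_field X N F'"
    unfolding proj_field_def
  proof (intro conjI ballI)
    show "continuous_map X euclidean F'"
      unfolding F'_def using \<zeta>r Suc.prems(1) by (intro continuous_intros) (auto simp: proj_field_def unit_section_def)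
    fix x assume x: "x \<in> topspace X"
    show "proj (F' x)" by (rule F'x[OF x])
    have "supp N (\<zeta> r x)" by (rule supp_vec_of_proj[OF Fx(2)[OF x] \<zeta>x(1,2)[OF x]])
    then show "supp N (F' x)" unfolding F'_def using Fx(2)[OF x] by (intro supp_diff supp_mult supp_adj)
  qed
  define \<eta>' where "\<eta>' j x = chain_at Rs x (\<eta> j x)" for j x
  have in_F': "unit_section X F' a" if a: "unit_section X F a" and 0: "\<And>x. x \<in> topspace X \<Longrightarrow> ip (\<zeta> r x) (a x) = 0" for a
    unfolding unit_section_def
  proof (intro conjI ballI)
    show "continuous_map X euclidean a" using a by (simp add: unit_section_def)
    fix x assume x: "x \<in> topspace X"
    show ax: "isvec (a x)" and "ip (a x) (a x) = 1" using a x by (auto simp: unit_section_def)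
    show "F' x * a x = a x"
      using a x 0[OF x] dyad_mult_vec[OF \<zeta>x(1)[OF x] \<zeta>x(1)[OF x] ax]
      by (simp add: F'_def left_diff_distrib unit_section_def)
  qed
  have chainip: "ip (\<eta>' i x) (\<eta>' j x) = ip (\<eta> i x) (\<eta> j x)" if "x \<in> topspace X" for i j x
    unfolding \<eta>'_def using skew_fields_at[OF Rs(1) that] by (intro ip_chain) blast
  have "\<exists>Ss. skew_fields X Y F' Ss \<and> (\<forall>j<r. \<forall>x\<in>topspace X. chain_at Ss x (\<eta>' j x) = \<zeta> j x)"
  proof (rule Suc.IH[OF F'])
    show "2 * real r + real d \<le> 2 * Re (tr (F' x))" if "x \<in> topspace X" for x
      using Suc.prems(2)[OF that] F'x(2)[OF that] by simp
    show "unit_section X F' (\<eta>' j)" if j: "j < r" for j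
    proof (rule in_F')
      show "unit_section X F (\<eta>' j)"
        unfolding \<eta>'_def using Suc.prems(3)[of j] j by (intro unit_section_chain[OF Rs(1) Suc.prems(1)]) simp
      show "ip (\<zeta> r x) (\<eta>' j x) = 0" if x: "x \<in> topspace X" for x
      proof -
        have "\<zeta> r x = \<eta>' r x" using Rs(2) x by (simp add: \<eta>'_def)
        then have "ip (\<zeta> r x) (\<eta>' j x) = ip (\<eta> r x) (\<eta> j x)" using chainip[OF x] by simp
        then show ?thesis using Suc.prems(5)[OF j _ x] by simp
      qed
    qed
    show "unit_section X F' (\<zeta> j)" if j: "j < r" for j
      using Suc.prems(4)[of j] Suc.prems(5)[OF j] j by (intro in_F') auto
    show "ip (\<eta>' j x) (\<eta>' i x) = 0 \<and> ip (\<zeta> j x) (\<zeta> i x) = 0" if "i < j" "j < r" "x \<in> topspace X" for i j x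
      using Suc.prems(5)[of i j x] that chainip by simp
    show "\<eta>' j x = \<zeta> j x" if "j < r" "x \<in> Y" for j x
      using Suc.prems(6)[of j x] that chain_at_fixed[OF Rs(1)] by (simp add: \<eta>'_def)
  qed
  then obtain Ss where Ss: "skew_fields X Y F' Ss" "\<forall>j<r. \<forall>x\<in>topspace X. chain_at Ss x (\<eta>' j x) = \<zeta> j x" by blast
  have "skew_fields X Y F Ss"
    unfolding skew_fields_def
  proof (intro ballI conjI)
    fix S assume S: "S \<in> set Ss"
    show "continuous_map X euclidean S" using Ss(1) S by (simp add: skew_fields_def)
    fix x
    show "S x = 0" if "x \<in> Y" using Ss(1) S that by (simp add: skew_fields_def)
    assume x: "x \<in> topspace X"
    have Sx: "adj (S x) = - S x" "F' x * S x = S x" "S x * F' x = S x"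
      using Ss(1) S x by (auto simp: skew_fields_def)
    show "adj (S x) = - S x" by fact
    show "F x * S x = S x" using Sx(2) F'x(4)[OF x] by (metis mult.assoc)
    show "S x * F x = S x" using Sx(3) F'F[OF x] by (metis mult.assoc)
  qed
  then have "skew_fields X Y F (Rs @ Ss)" using Rs(1) by (simp add: skew_fields_append)
  moreover have "chain_at (Rs @ Ss) x (\<eta> j x) = \<zeta> j x" if j: "j < Suc r" and x: "x \<in> topspace X" for j x
  proof (cases "j = r")
    case True
    have "chain_at Ss x (\<zeta> r x) = \<zeta> r x"
      using skew_fields_at[OF Ss(1) x] F'x(3)[OF x] by (intro chain_orthogonal) auto
    then show ?thesis using True Rs(2) x by simp
  next
    case False
    then show ?thesis using j x Ss(2) by (simp add: \<eta>'_def)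
  qed
  ultimately show ?case by blast
qed

text \<open>Two isometric embeddings of \<open>q\<close> into \<open>F\<close> differ by a unitary of \<open>F\<close> which is a product of Cayley
  transforms, and the unitary can be chosen trivial where they agree. This is the relative statement
  behind cancellation; its bound on the ranks gives that of the second assertion.\<close>

theorem move_isometry:
  assumes X: "compact_dim X d" and Y: "closedin X Y" and F: "proj_field X N F" and q: "proj_field X N q"
    and rank: "\<And>x. x \<in> topspace X \<Longrightarrow> 2 * Re (tr (q x)) + real d \<le> 2 * Re (tr (F x))"
    and t: "isometry_field X q F t" and s: "isometry_field X q F s" and eq: "\<forall>x\<in>Y. t x = s x"
  shows "\<exists>Ss. skew_fields X Y F Ss \<and> (\<forall>x\<in>topspace X. chain_at Ss x (t x) = s x)"
proof -
  have qx: "proj (q x)" if "x \<in> topspace X" for x using q that by (auto simp: proj_field_def)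
  have tx: "adj (t x) * t x = q x" "F x * t x = t x" if "x \<in> topspace X" for x
    using t that by (auto simp: isometry_field_def)
  have sx: "adj (s x) * s x = q x" "F x * s x = s x" if "x \<in> topspace X" for x
    using s that by (auto simp: isometry_field_def)
  define Q where "Q Z \<longleftrightarrow> Y \<subseteq> Z \<and> (\<exists>Ss. skew_fields X Y F Ss \<and> (\<forall>x\<in>Z. chain_at Ss x (t x) = s x))" for Z
  have "Q (topspace X)"
  proof (rule frame_patch_induct[OF X Y _ q])
    show "Q Y" unfolding Q_def using eq by (intro conjI exI[of _ "[]"]) auto
    fix Z K r \<xi>
    assume Z: "closedin X Z" "Q Z" and K: "closedin X K" "K \<noteq> {}" and \<xi>: "frame_field (subtopology X K) r \<xi> q"
    obtain Ss where Ss: "skew_fields X Y F Ss" "\<forall>x\<in>Z. chain_at Ss x (t x) = s x" and YZ: "Y \<subseteq> Z"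
      using Z(2) unfolding Q_def by blast
    have topK: "topspace (subtopology X K) = K" by (rule topspace_sub_closed[OF K(1)])
    have KX: "K \<subseteq> topspace X" using K closedin_subset by blast
    have fr: "frame r (\<lambda>j. \<xi> j x) (q x)" if "x \<in> K" for x using \<xi> that topK by (auto simp: frame_field_def)
    have \<xi>x: "isvec (\<xi> j x)" "q x * \<xi> j x = \<xi> j x" "ip (\<xi> j x) (\<xi> j x) = 1" if "x \<in> K" "j < r" for x j
      using fr[OF that(1)] frame_mult_basis[OF fr[OF that(1)] that(2)] that(2) by (auto simp: frame_def)
    define t' where "t' x = chain_at Ss x (t x)" for x
    have t': "adj (t' x) * t' x = q x" "F x * t' x = t' x" if "x \<in> topspace X" for x
    proof -
      show "adj (t' x) * t' x = q x"
        unfolding t'_def using skew_fields_at[OF Ss(1) that] tx(1)[OF that] by (subst chain_isometry) auto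
      show "F x * t' x = t' x"
        unfolding t'_def using skew_fields_at[OF Ss(1) that] tx(2)[OF that] by (intro chain_in) auto
    qed
    have t'c: "continuous_map X euclidean t'"
      unfolding t'_def using t by (intro continuous_map_chain_at[OF Ss(1) F]) (simp add: isometry_field_def)
    have sc: "continuous_map X euclidean s" using s by (simp add: isometry_field_def)
    have usec: "unit_section (subtopology X K) F (\<lambda>x. a x * \<xi> j x)"
      if a: "continuous_map X euclidean a" "\<And>x. x \<in> topspace X \<Longrightarrow> adj (a x) * a x = q x \<and> F x * a x = a x" and j: "j < r" for a j
      unfolding unit_section_def topK
    proof (intro conjI ballI)
      show "continuous_map (subtopology X K) euclidean (\<lambda>x. a x * \<xi> j x)"
        using continuous_map_from_subtopology[OF a(1)] \<xi> j by (intro continuous_intros) (auto simp: frame_field_def)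
      fix x assume x: "x \<in> K"
      then have ax: "adj (a x) * a x = q x" "F x * a x = a x" using a(2) KX by auto
      show "isvec (a x * \<xi> j x)" by (rule isvec_mult[OF \<xi>x(1)[OF x j]])
      show "F x * (a x * \<xi> j x) = a x * \<xi> j x" using ax(2) by (simp flip: mult.assoc)
      have "ip (a x * \<xi> j x) (a x * \<xi> j x) = ip (\<xi> j x) (adj (a x) * a x * \<xi> j x)"
        by (simp add: ip_mult_left mult.assoc)
      then show "ip (a x * \<xi> j x) (a x * \<xi> j x) = 1" using ax(1) \<xi>x[OF x j] by simp
    qed
    have orth: "ip (a x * \<xi> j x) (a x * \<xi> i x) = 0"
      if "adj (a x) * a x = q x" "i < j" "j < r" "x \<in> K" for a i j x
    proof -
      have "ip (a x * \<xi> j x) (a x * \<xi> i x) = ip (\<xi> j x) (adj (a x) * a x * \<xi> i x)"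
        by (simp add: ip_mult_left mult.assoc)
      also have "\<dots> = ip (\<xi> j x) (\<xi> i x)" using that \<xi>x(2)[of x i] by simp
      also have "\<dots> = 0" using fr[OF that(4)] that(2,3) by (simp add: frame_def)
      finally show ?thesis .
    qed
    have "\<exists>Rs. skew_fields (subtopology X K) (Z \<inter> K) F Rs \<and>
       (\<forall>j<r. \<forall>x\<in>topspace (subtopology X K). chain_at Rs x (t' x * \<xi> j x) = s x * \<xi> j x)"
    proof (rule move_frame[OF compact_dim_sub[OF X K(1)] closedin_sub_Int[OF Z(1) K(1)] proj_field_sub[OF F]])
      show "2 * real r + real d \<le> 2 * Re (tr (F x))" if "x \<in> topspace (subtopology X K)" for x
        using rank[of x] frame_tr[OF fr, of x] that topK KX by auto
      show "unit_section (subtopology X K) F (\<lambda>x. t' x * \<xi> j x)" if "j < r" for j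
        using t' by (intro usec t'c that) auto
      show "unit_section (subtopology X K) F (\<lambda>x. s x * \<xi> j x)" if "j < r" for j
        using sx by (intro usec sc that) auto
      show "ip (t' x * \<xi> j x) (t' x * \<xi> i x) = 0 \<and> ip (s x * \<xi> j x) (s x * \<xi> i x) = 0"
        if "i < j" "j < r" "x \<in> topspace (subtopology X K)" for i j x
        using orth[of t' x i j] orth[of s x i j] t'(1)[of x] sx(1)[of x] that topK KX by auto
      show "t' x * \<xi> j x = s x * \<xi> j x" if "j < r" "x \<in> Z \<inter> K" for j x
        using Ss(2) that by (simp add: t'_def)
    qed
    then obtain Rs where Rs: "skew_fields (subtopology X K) (Z \<inter> K) F Rs"
      "\<forall>j<r. \<forall>x\<in>K. chain_at Rs x (t' x * \<xi> j x) = s x * \<xi> j x" unfolding topK by blast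
    obtain Rs' where Rs': "skew_fields X Z F Rs'" "\<forall>x\<in>K. map (\<lambda>S. S x) Rs' = map (\<lambda>S. S x) Rs"
      using extend_skew_list[OF X Z(1) K(1) F Rs(1)] by blast
    have moved: "chain_at Rs x (t' x) = s x" if x: "x \<in> K" for x
    proof -
      have xX: "x \<in> topspace X" using x KX by blast
      have qsum: "q x = (\<Sum>j<r. \<xi> j x * adj (\<xi> j x))" using fr[OF x] by (simp add: frame_def)
      have "t' x = t' x * q x" "s x = s x * q x"
        using isometry_mult_right[OF qx[OF xX]] t'(1)[OF xX] sx(1)[OF xX] by simp_all
      then have e: "t' x = (\<Sum>j<r. t' x * \<xi> j x * adj (\<xi> j x))" "s x = (\<Sum>j<r. s x * \<xi> j x * adj (\<xi> j x))"
        unfolding qsum sum_distrib_left by (simp_all only: mult.assoc)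
      have "chain_at Rs x (\<Sum>j<r. t' x * \<xi> j x * adj (\<xi> j x)) = (\<Sum>j<r. s x * \<xi> j x * adj (\<xi> j x))"
        unfolding chain_sum using Rs(2) x by (intro sum.cong refl) (simp add: chain_mult)
      then show ?thesis using e by simp
    qed
    have "skew_fields X Y F (Ss @ Rs')"
      using Ss(1) skew_fields_mono[OF Rs'(1) YZ] by (simp add: skew_fields_append)
    moreover have "chain_at (Ss @ Rs') x (t x) = s x" if "x \<in> Z \<union> K" for x
    proof (cases "x \<in> Z")
      case True
      then show ?thesis using Ss(2) chain_at_fixed[OF Rs'(1)] by simp
    next
      case False
      then have "x \<in> K" using that by blast
      then show ?thesis using moved[of x] Rs'(2) by (simp add: t'_def)
    qed
    ultimately show "Q (Z \<union> K)" unfolding Q_def using YZ by blast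
  qed
  then show ?thesis unfolding Q_def by blast
qed

section \<open>Rank and trace\<close>

definition to_mat :: "nat \<Rightarrow> finmat \<Rightarrow> complex mat" where
  "to_mat N T = Matrix.mat N N (\<lambda>(i, j). ent T i j)"

lemma to_mat_carrier [simp]: "to_mat N T \<in> carrier_mat N N"
  by (simp add: to_mat_def)

lemma rank_to_mat_le:
  assumes "frame r b p"
  shows "vec_space.rank N (to_mat N p) \<le> r"
proof -
  have "vec_space.rank N (to_mat N (\<Sum>j<s. b j * adj (b j))) \<le> s" if "s \<le> r" for s
    using that
  proof (induction s)
    case 0
    have "to_mat N 0 = 0\<^sub>m N N" by (intro eq_matI) (auto simp: to_mat_def)
    then show ?case by (simp add: vec_space.rank_0I)
  next
    case (Suc s)
    have v: "isvec (b s)" using assms Suc.prems by (simp add: frame_def)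
    have e: "to_mat N (\<Sum>j<Suc s. b j * adj (b j)) = to_mat N (\<Sum>j<s. b j * adj (b j)) + to_mat N (b s * adj (b s))"
      by (intro eq_matI) (auto simp: to_mat_def)
    have ent1: "ent (b s * adj (b s)) i j = ent (b s) i 0 * cnj (ent (b s) j 0)" for i j
    proof -
      obtain M where "supp M (b s)" using ex_supp by blast
      then have M: "supp (Suc M) (b s)" by (rule supp_mono) simp
      have "ent (b s * adj (b s)) i j = (\<Sum>k<Suc M. ent (b s) i k * ent (adj (b s)) k j)"
        using M by (intro ent_mult) simp
      also have "\<dots> = (\<Sum>k<Suc M. if k = 0 then ent (b s) i 0 * cnj (ent (b s) j 0) else 0)"
        using v by (intro sum.cong) (auto simp: isvec_def)
      finally show ?thesis by simp
    qed
    have "vec_space.rank N (to_mat N (b s * adj (b s))) \<le> 1"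
      by (rule vec_space.rank_le_1_product_entries[OF to_mat_carrier,
            of _ _ "\<lambda>i. ent (b s) i 0" "\<lambda>j. cnj (ent (b s) j 0)"]) (simp add: to_mat_def ent1)
    moreover have "vec_space.rank N (to_mat N (\<Sum>j<Suc s. b j * adj (b j))) \<le>
        vec_space.rank N (to_mat N (\<Sum>j<s. b j * adj (b j))) + vec_space.rank N (to_mat N (b s * adj (b s)))"
      unfolding e by (rule vec_space.rank_subadditive[OF to_mat_carrier to_mat_carrier])
    ultimately show ?case using Suc by simp
  qed
  from this[of r] show ?thesis using assms by (simp add: frame_def)
qed

text \<open>The one-point case of local triviality: a constant field over any space.\<close>

lemma proj_has_frame: "proj p \<Longrightarrow> \<exists>r b. frame r b p"
proof -
  assume p: "proj p"
  have "\<exists>U r b. openin euclidean U \<and> (0::real) \<in> U \<and> (\<forall>j<r. continuous_map (subtopology euclidean U) euclidean (b j)) \<and>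
    (\<forall>x\<in>U. frame r (\<lambda>j. b j x) p)"
    using p by (intro local_frame) auto
  then show ?thesis by blast
qed

lemma proj_complement:
  assumes "proj p" "supp N p" "proj e" "e * p = p"
  shows "proj (e - p)"
proof -
  have "p * e = p" using assms by (metis adj_mult proj_def)
  then show ?thesis using assms by (simp add: proj_def adj_diff left_diff_distrib right_diff_distrib)
qed

text \<open>A frame of \<open>p\<close> bounds the rank from above by the trace. Applied to the complement as well, subadditivity of
  the rank turns the two bounds into equalities, since the rank and the trace of the unit of \<open>M\<^sub>N(\<complex>)\<close>
  are both \<open>N\<close>.\<close>

lemma rank_eq_tr:
  assumes p: "proj p" and N: "supp N p"
  shows "real (vec_space.rank N (to_mat N p)) = Re (tr p)"
proof -
  define e where "e = block N (\<lambda>i j. if i = j then 1 else 0)"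
  have eN: "supp N e" by (simp add: e_def)
  have ep: "e * a = a" if "supp N a" for a
  proof (rule finmat_eqI)
    fix i j
    have "ent (e * a) i j = (\<Sum>k<N. ent e i k * ent a k j)"
      using that by (intro ent_mult) simp
    also have "\<dots> = (\<Sum>k<N. if k = i then ent a i j else 0)"
      by (intro sum.cong refl) (auto simp: e_def ent_block)
    also have "\<dots> = ent a i j" using that by (auto simp: supp_def)
    finally show "ent (e * a) i j = ent a i j" .
  qed
  have "adj e = e" by (rule finmat_eqI) (auto simp: e_def ent_block)
  then have e: "proj e" using ep[OF eN] by (simp add: proj_def)
  have q: "proj (e - p)" by (rule proj_complement[OF p N e ep[OF N]])
  obtain r b where fr: "frame r b p" using proj_has_frame[OF p] by blast
  obtain s c where fs: "frame s c (e - p)" using proj_has_frame[OF q] by blast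
  have "tr e = of_nat N" unfolding tr_eq[OF eN] by (simp add: e_def ent_block)
  then have "complex_of_nat N - of_nat r = of_nat s"
    using frame_tr[OF fr] frame_tr[OF fs] by (simp add: tr_diff)
  then have "complex_of_nat N = of_nat r + of_nat s" by (simp add: diff_eq_eq)
  then have rs: "N = r + s" by (metis of_nat_add of_nat_eq_iff)
  have "to_mat N e = 1\<^sub>m N" by (intro eq_matI) (auto simp: to_mat_def e_def ent_block)
  moreover have "to_mat N e = to_mat N p + to_mat N (e - p)"
    by (intro eq_matI) (auto simp: to_mat_def)
  moreover have "vec_space.rank N (1\<^sub>m N :: complex mat) = N"
    by (rule vec_space.low_rank_det_zero) auto
  ultimately have "N \<le> vec_space.rank N (to_mat N p) + vec_space.rank N (to_mat N (e - p))"
    using vec_space.rank_subadditive[of "to_mat N p" N N "to_mat N (e - p)"] by simp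
  then have "vec_space.rank N (to_mat N p) = r"
    using rank_to_mat_le[OF fr, of N] rank_to_mat_le[OF fs, of N] rs by linarith
  then show ?thesis using frame_tr[OF fr] by simp
qed

section \<open>Blocks\<close>

text \<open>\<open>M\<^sub>m(M\<^sub>n(\<complex>))\<close> is identified with \<open>M\<^bsub>mn\<^esub>(\<complex>)\<close>: \<open>blk\<close> reads off a block, and \<open>unblk\<close> assembles a matrix from its
  blocks.\<close>

definition blk :: "nat \<Rightarrow> finmat \<Rightarrow> nat \<Rightarrow> nat \<Rightarrow> complex mat" where
  "blk n T i j = Matrix.mat n n (\<lambda>(r, s). ent T (i * n + r) (j * n + s))"

definition unblk :: "nat \<Rightarrow> nat \<Rightarrow> (nat \<Rightarrow> nat \<Rightarrow> complex mat) \<Rightarrow> finmat" where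
  "unblk n m A = block (m * n) (\<lambda>r s. A (r div n) (s div n) $$ (r mod n, s mod n))"

lemma blk_carrier [simp]: "blk n T i j \<in> carrier_mat n n"
  by (simp add: blk_def)

lemma blk_dim [simp]: "dim_row (blk n T i j) = n" "dim_col (blk n T i j) = n"
  by (simp_all add: blk_def)

lemma blk_index: "r < n \<Longrightarrow> s < n \<Longrightarrow> blk n T i j $$ (r, s) = ent T (i * n + r) (j * n + s)"
  by (simp add: blk_def)

lemma supp_unblk [simp]: "supp (m * n) (unblk n m A)"
  by (simp add: unblk_def)

lemma div_less_blocks: "r < m * n \<Longrightarrow> r div n < m" for r m n :: nat
  by (simp add: less_mult_imp_div_less)

lemma ent_unblk:
  "ent (unblk n m A) r s = (if r < m * n \<and> s < m * n then A (r div n) (s div n) $$ (r mod n, s mod n) else 0)"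
  by (simp add: unblk_def ent_block)

lemma block_index_less: "i < m \<Longrightarrow> r < n \<Longrightarrow> i * n + r < m * n" for i m r n :: nat
proof -
  assume "i < m" "r < n"
  then have "i * n + r < Suc i * n" by simp
  also have "\<dots> \<le> m * n" using \<open>i < m\<close> by (intro mult_le_mono1) simp
  finally show ?thesis .
qed

lemma unblk_blk: "supp (m * n) T \<Longrightarrow> unblk n m (blk n T) = T"
proof (rule finmat_eqI)
  fix r s assume T: "supp (m * n) T"
  show "ent (unblk n m (blk n T)) r s = ent T r s"
  proof (cases "r < m * n \<and> s < m * n")
    case True
    then have "n > 0" by (cases n) auto
    then show ?thesis using True by (simp add: ent_unblk blk_index)
  next
    case False
    then show ?thesis using T by (auto simp: ent_unblk supp_def not_less)
  qed
qed

lemma blk_unblk: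
  assumes "A i j \<in> carrier_mat n n" "i < m" "j < m"
  shows "blk n (unblk n m A) i j = A i j"
proof (rule eq_matI)
  fix r s assume "r < dim_row (A i j)" "s < dim_col (A i j)"
  then have rs: "r < n" "s < n" using assms by auto
  then show "blk n (unblk n m A) i j $$ (r, s) = A i j $$ (r, s)"
    using block_index_less[OF assms(2) rs(1)] block_index_less[OF assms(3) rs(2)]
    by (simp add: blk_index ent_unblk)
qed (use assms in auto)

lemma blk_outside:
  assumes "supp (m * n) T" "m \<le> i \<or> m \<le> j"
  shows "blk n T i j = 0\<^sub>m n n"
proof (rule eq_matI)
  fix r s assume "r < dim_row (0\<^sub>m n n :: complex mat)" "s < dim_col (0\<^sub>m n n :: complex mat)"
  then have rs: "r < n" "s < n" by auto
  have "m * n \<le> i * n + r \<or> m * n \<le> j * n + s"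
    using assms(2) by (metis mult_le_mono1 trans_le_add1)
  then show "blk n T i j $$ (r, s) = 0\<^sub>m n n $$ (r, s)" using assms(1) rs by (auto simp: blk_index supp_def)
qed auto

lemma sum_blocks: "(\<Sum>t<m * n. f t) = (\<Sum>r<m. \<Sum>w<n. f (r * n + w))" for f :: "nat \<Rightarrow> 'a :: comm_monoid_add"
proof (induction m)
  case (Suc m)
  have "(\<lambda>w. m * n + w) ` {..<n} = {m * n..<m * n + n}"
    using image_add_atLeastLessThan[of "m * n" 0 n] by (simp add: lessThan_atLeast0 add.commute)
  then have "{..<Suc m * n} = {..<m * n} \<union> (\<lambda>w. m * n + w) ` {..<n}" by auto
  then have "(\<Sum>t<Suc m * n. f t) = (\<Sum>t<m * n. f t) + (\<Sum>t\<in>(\<lambda>w. m * n + w) ` {..<n}. f t)"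
    by (simp only:) (rule sum.union_disjoint, auto)
  also have "(\<Sum>t\<in>(\<lambda>w. m * n + w) ` {..<n}. f t) = (\<Sum>w<n. f (m * n + w))"
    by (subst sum.reindex) (auto simp: inj_on_def)
  finally show ?case using Suc by simp
qed simp

lemma mat_mult_index:
  "A \<in> carrier_mat n n \<Longrightarrow> B \<in> carrier_mat n n \<Longrightarrow> u < n \<Longrightarrow> v < n \<Longrightarrow>
    (A * B) $$ (u, v) = (\<Sum>w<n. A $$ (u, w) * B $$ (w, v))" for A B :: "complex mat"
  by (simp add: scalar_prod_def atLeast0LessThan)

lemma unblk_mult:
  assumes A: "\<And>i j. i < m \<Longrightarrow> j < m \<Longrightarrow> A i j \<in> carrier_mat n n" and B: "\<And>i j. i < m \<Longrightarrow> j < m \<Longrightarrow> B i j \<in> carrier_mat n n"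
    and C: "\<And>i j u v. i < m \<Longrightarrow> j < m \<Longrightarrow> u < n \<Longrightarrow> v < n \<Longrightarrow> C i j $$ (u, v) = (\<Sum>t<m. (A i t * B t j) $$ (u, v))"
  shows "unblk n m C = unblk n m A * unblk n m B"
proof (rule finmat_eqI)
  fix r s
  show "ent (unblk n m C) r s = ent (unblk n m A * unblk n m B) r s"
  proof (cases "r < m * n \<and> s < m * n")
    case True
    then have n: "n > 0" by (cases n) auto
    define i u j v where "i = r div n" and "u = r mod n" and "j = s div n" and "v = s mod n"
    have ij: "i < m" "j < m" "u < n" "v < n" using True n by (auto simp: i_def j_def u_def v_def div_less_blocks)
    have "ent (unblk n m A * unblk n m B) r s = (\<Sum>t<m * n. ent (unblk n m A) r t * ent (unblk n m B) t s)"
      by (intro ent_mult) simp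
    also have "\<dots> = (\<Sum>t<m. \<Sum>w<n. ent (unblk n m A) r (t * n + w) * ent (unblk n m B) (t * n + w) s)"
      by (rule sum_blocks)
    also have "\<dots> = (\<Sum>t<m. (A i t * B t j) $$ (u, v))"
    proof (intro sum.cong refl)
      fix t assume "t \<in> {..<m}"
      then have t: "t < m" by simp
      have "(A i t * B t j) $$ (u, v) = (\<Sum>w<n. A i t $$ (u, w) * B t j $$ (w, v))"
        by (rule mat_mult_index[OF A[OF ij(1) t] B[OF t ij(2)] ij(3,4)])
      also have "\<dots> = (\<Sum>w<n. ent (unblk n m A) r (t * n + w) * ent (unblk n m B) (t * n + w) s)"
        using True block_index_less[OF t, of _ n]
        by (intro sum.cong refl) (auto simp: ent_unblk i_def j_def u_def v_def)
      finally show "(\<Sum>w<n. ent (unblk n m A) r (t * n + w) * ent (unblk n m B) (t * n + w) s) = (A i t * B t j) $$ (u, v)" ..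
    qed
    also have "\<dots> = ent (unblk n m C) r s" using C[OF ij] True by (simp add: ent_unblk i_def j_def u_def v_def)
    finally show ?thesis ..
  next
    case False
    then show ?thesis
      using supp_mult[OF supp_unblk[of m n A] supp_unblk[of m n B]] by (auto simp: ent_unblk supp_def not_less)
  qed
qed

lemma blk_mult:
  assumes "supp (m * n) G" "supp (m * n) H" "u < n" "v < n"
  shows "blk n (G * H) i j $$ (u, v) = (\<Sum>t<m. (blk n G i t * blk n H t j) $$ (u, v))"
proof -
  have "blk n (G * H) i j $$ (u, v) = (\<Sum>t<m * n. ent G (i * n + u) t * ent H t (j * n + v))"
    using assms by (simp add: blk_index ent_mult[of "m * n"])
  also have "\<dots> = (\<Sum>t<m. \<Sum>w<n. ent G (i * n + u) (t * n + w) * ent H (t * n + w) (j * n + v))"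
    by (rule sum_blocks)
  also have "\<dots> = (\<Sum>t<m. (blk n G i t * blk n H t j) $$ (u, v))"
  proof (intro sum.cong refl)
    fix t
    have "(blk n G i t * blk n H t j) $$ (u, v) = (\<Sum>w<n. blk n G i t $$ (u, w) * blk n H t j $$ (w, v))"
      using assms by (intro mat_mult_index) auto
    then show "(\<Sum>w<n. ent G (i * n + u) (t * n + w) * ent H (t * n + w) (j * n + v)) = (blk n G i t * blk n H t j) $$ (u, v)"
      using assms by (simp add: blk_index)
  qed
  finally show ?thesis .
qed

lemma mat_adjoint_index: "A \<in> carrier_mat n n \<Longrightarrow> u < n \<Longrightarrow> v < n \<Longrightarrow> mat_adjoint A $$ (u, v) = cnj (A $$ (v, u))" for A :: "complex mat"
  by (simp add: mat_adjoint_def mat_of_rows_def)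

lemma mat_adjoint_carrier: "A \<in> carrier_mat n n \<Longrightarrow> mat_adjoint A \<in> carrier_mat n n" for A :: "complex mat"
  by (rule carrier_matI) (auto simp: mat_adjoint_def mat_of_rows_def)

section \<open>The stages of a recursive subhomogeneous algebra\<close>

definition cont_entries :: "'x topology \<Rightarrow> nat \<Rightarrow> ('x \<Rightarrow> complex mat) \<Rightarrow> bool" where
  "cont_entries X n f \<longleftrightarrow> (\<forall>x\<in>topspace X. f x \<in> carrier_mat n n) \<and>
     (\<forall>i<n. \<forall>j<n. continuous_map X euclidean (\<lambda>x. f x $$ (i, j)))"

lemma cont_matrix_algebra_carrier:
  "f \<in> carrier (cont_matrix_algebra X n) \<longleftrightarrow> f \<in> extensional (topspace X) \<and> cont_entries X n f"
  by (auto simp: cont_matrix_algebra_def cont_entries_def PiE_iff)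

lemma cont_entries_cong:
  assumes "\<And>x. x \<in> topspace X \<Longrightarrow> f x = g x" "cont_entries X n f"
  shows "cont_entries X n g"
  unfolding cont_entries_def
proof (intro conjI ballI allI impI)
  show "g x \<in> carrier_mat n n" if "x \<in> topspace X" for x
    using assms(1)[OF that] assms(2) that by (auto simp: cont_entries_def)
  show "continuous_map X euclidean (\<lambda>x. g x $$ (i, j))" if "i < n" "j < n" for i j
    by (rule continuous_map_eq[of _ _ "\<lambda>x. f x $$ (i, j)"]) (use assms that in \<open>auto simp: cont_entries_def\<close>)
qed

text \<open>The operations of the algebra are treated uniformly as binary operations on matrices, the unary ones
  ignoring their second argument.\<close>

definition cont_op :: "'x itself \<Rightarrow> (complex mat \<Rightarrow> complex mat \<Rightarrow> complex mat) \<Rightarrow> bool" where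
  "cont_op _ g \<longleftrightarrow> (\<forall>(X :: 'x topology) n f h. cont_entries X n f \<longrightarrow> cont_entries X n h \<longrightarrow>
     cont_entries X n (\<lambda>x. g (f x) (h x)))"

lemma cont_op_add: "cont_op TYPE('x) (+)"
  unfolding cont_op_def
proof (intro allI impI)
  fix X :: "'x topology" and n f h
  assume f: "cont_entries X n f" and h: "cont_entries X n h"
  show "cont_entries X n (\<lambda>x. f x + h x)"
    unfolding cont_entries_def
  proof (intro conjI ballI allI impI)
    show "f x + h x \<in> carrier_mat n n" if "x \<in> topspace X" for x
      using f h that by (simp add: cont_entries_def)
    fix i j assume ij: "i < n" "j < n"
    have "continuous_map X euclidean (\<lambda>x. f x $$ (i, j) + h x $$ (i, j))"
      using f h ij by (intro continuous_intros) (auto simp: cont_entries_def)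
    then show "continuous_map X euclidean (\<lambda>x. (f x + h x) $$ (i, j))"
      by (rule continuous_map_eq) (use f h ij in \<open>auto simp: cont_entries_def\<close>)
  qed
qed

lemma cont_op_mult: "cont_op TYPE('x) (*)"
  unfolding cont_op_def
proof (intro allI impI)
  fix X :: "'x topology" and n f h
  assume f: "cont_entries X n f" and h: "cont_entries X n h"
  have c: "f x \<in> carrier_mat n n" "h x \<in> carrier_mat n n" if "x \<in> topspace X" for x
    using f h that by (auto simp: cont_entries_def)
  show "cont_entries X n (\<lambda>x. f x * h x)"
    unfolding cont_entries_def
  proof (intro conjI ballI allI impI)
    show "f x * h x \<in> carrier_mat n n" if "x \<in> topspace X" for x
      using c[OF that] by (rule mult_carrier_mat)
    fix i j assume ij: "i < n" "j < n"
    have "continuous_map X euclidean (\<lambda>x. \<Sum>w<n. f x $$ (i, w) * h x $$ (w, j))"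
      using f h ij by (intro continuous_intros) (auto simp: cont_entries_def)
    then show "continuous_map X euclidean (\<lambda>x. (f x * h x) $$ (i, j))"
      by (rule continuous_map_eq) (use mat_mult_index[OF c] ij in simp)
  qed
qed

lemma cont_op_smult: "cont_op TYPE('x) (\<lambda>A B. c \<cdot>\<^sub>m A)"
  unfolding cont_op_def
proof (intro allI impI)
  fix X :: "'x topology" and n f h
  assume f: "cont_entries X n f"
  show "cont_entries X n (\<lambda>x. c \<cdot>\<^sub>m f x)"
    unfolding cont_entries_def
  proof (intro conjI ballI allI impI)
    show "c \<cdot>\<^sub>m f x \<in> carrier_mat n n" if "x \<in> topspace X" for x
      using f that by (simp add: cont_entries_def)
    fix i j assume ij: "i < n" "j < n"
    have "continuous_map X euclidean (\<lambda>x. c * f x $$ (i, j))"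
      using f ij by (intro continuous_intros) (auto simp: cont_entries_def)
    then show "continuous_map X euclidean (\<lambda>x. (c \<cdot>\<^sub>m f x) $$ (i, j))"
      by (rule continuous_map_eq) (use f ij in \<open>auto simp: cont_entries_def\<close>)
  qed
qed

lemma cont_op_adjoint: "cont_op TYPE('x) (\<lambda>A B. mat_adjoint A)"
  unfolding cont_op_def
proof (intro allI impI)
  fix X :: "'x topology" and n f h
  assume f: "cont_entries X n f"
  show "cont_entries X n (\<lambda>x. mat_adjoint (f x))"
    unfolding cont_entries_def
  proof (intro conjI ballI allI impI)
    show "mat_adjoint (f x) \<in> carrier_mat n n" if "x \<in> topspace X" for x
      using f that by (intro mat_adjoint_carrier) (simp add: cont_entries_def)
    fix i j assume ij: "i < n" "j < n"
    have "continuous_map X euclidean (\<lambda>x. cnj (f x $$ (j, i)))"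
      using f ij by (intro continuous_map_bounded_linear[OF bounded_linear_cnj]) (auto simp: cont_entries_def)
    then show "continuous_map X euclidean (\<lambda>x. mat_adjoint (f x) $$ (i, j))"
      by (rule continuous_map_eq) (use f ij in \<open>auto simp: cont_entries_def mat_adjoint_index\<close>)
  qed
qed

definition pointwise :: "'x rsh_data \<Rightarrow> nat \<Rightarrow> (complex mat \<Rightarrow> complex mat \<Rightarrow> complex mat) \<Rightarrow>
    (nat \<Rightarrow> 'x \<Rightarrow> complex mat) \<Rightarrow> (nat \<Rightarrow> 'x \<Rightarrow> complex mat) \<Rightarrow> nat \<Rightarrow> 'x \<Rightarrow> complex mat" where
  "pointwise D k g a b = (\<lambda>j\<in>{..k}. \<lambda>x\<in>topspace (rsh_space D j). g (a j x) (b j x))"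

lemma stage_simps:
  "carrier (rsh_stage D k) = rsh_stage_carrier D k"
  "a \<otimes>\<^bsub>rsh_stage D k\<^esub> b = pointwise D k (*) a b"
  "a \<oplus>\<^bsub>rsh_stage D k\<^esub> b = pointwise D k (+) a b"
  "c \<odot>\<^bsub>rsh_stage D k\<^esub> a = pointwise D k (\<lambda>A B. c \<cdot>\<^sub>m A) a a"
  "star (rsh_stage D k) a = pointwise D k (\<lambda>A B. mat_adjoint A) a a"
  "\<zero>\<^bsub>rsh_stage D k\<^esub> = (\<lambda>j\<in>{..k}. \<lambda>x\<in>topspace (rsh_space D j). 0\<^sub>m (rsh_size D j) (rsh_size D j))"
  "\<one>\<^bsub>rsh_stage D k\<^esub> = (\<lambda>j\<in>{..k}. \<lambda>x\<in>topspace (rsh_space D j). 1\<^sub>m (rsh_size D j))"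
  by (auto simp: rsh_stage_def pointwise_def rsh_summand_def cont_matrix_algebra_def fun_eq_iff restrict_def)

lemma pointwise_at: "j \<le> k \<Longrightarrow> x \<in> topspace (rsh_space D j) \<Longrightarrow> pointwise D k g a b j x = g (a j x) (b j x)"
  by (simp add: pointwise_def)

lemma stage_ext: "a \<in> rsh_stage_carrier D k \<Longrightarrow> k < l \<Longrightarrow> a l = undefined"
  by (induction k arbitrary: a) (auto simp: PiE_iff extensional_def)

lemma stage_component: "a \<in> rsh_stage_carrier D k \<Longrightarrow> l \<le> k \<Longrightarrow> a l \<in> carrier (rsh_summand D l)"
proof (induction k arbitrary: a)
  case (Suc k)
  then obtain b f where b: "a = b(Suc k := f)" "b \<in> rsh_stage_carrier D k" "f \<in> carrier (rsh_summand D (Suc k))"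
    by auto
  then show ?case using Suc by (cases "l = Suc k") auto
qed (auto simp: PiE_iff)

text \<open>The pullback as a condition on the components of \<open>b\<close>.\<close>

lemma stage_Suc_iff:
  "b \<in> rsh_stage_carrier D (Suc k) \<longleftrightarrow> b (Suc k) \<in> carrier (rsh_summand D (Suc k)) \<and>
     restrict b {..k} \<in> rsh_stage_carrier D k \<and> (\<forall>l>Suc k. b l = undefined) \<and>
     rsh_attach D (Suc k) (restrict b {..k}) = restrict (b (Suc k)) (rsh_bdry D (Suc k))"
proof
  assume b: "b \<in> rsh_stage_carrier D (Suc k)"
  then obtain a f where a: "b = a(Suc k := f)" "a \<in> rsh_stage_carrier D k" "f \<in> carrier (rsh_summand D (Suc k))"
    "rsh_attach D (Suc k) a = restrict f (rsh_bdry D (Suc k))" by auto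
  have "restrict b {..k} = a"
    using stage_ext[OF a(2)] by (auto simp: a(1) fun_eq_iff restrict_def)
  then show "b (Suc k) \<in> carrier (rsh_summand D (Suc k)) \<and>
     restrict b {..k} \<in> rsh_stage_carrier D k \<and> (\<forall>l>Suc k. b l = undefined) \<and>
     rsh_attach D (Suc k) (restrict b {..k}) = restrict (b (Suc k)) (rsh_bdry D (Suc k))"
    using a stage_ext[OF b] by auto
next
  assume b: "b (Suc k) \<in> carrier (rsh_summand D (Suc k)) \<and>
     restrict b {..k} \<in> rsh_stage_carrier D k \<and> (\<forall>l>Suc k. b l = undefined) \<and>
     rsh_attach D (Suc k) (restrict b {..k}) = restrict (b (Suc k)) (rsh_bdry D (Suc k))"
  then have "b = (restrict b {..k})(Suc k := b (Suc k))"
    by (auto simp: fun_eq_iff restrict_def not_le)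
  then show "b \<in> rsh_stage_carrier D (Suc k)" using b unfolding rsh_stage_carrier.simps by blast
qed

locale rsh =
  fixes D :: "'x rsh_data"
  assumes decomposition: "rsh_decomposition D"
begin

lemma space: "k \<le> rsh_length D \<Longrightarrow> compact_space (rsh_space D k)"
  "k \<le> rsh_length D \<Longrightarrow> Hausdorff_space (rsh_space D k)" "k \<le> rsh_length D \<Longrightarrow> 1 \<le> rsh_size D k"
  using decomposition by (auto simp: rsh_decomposition_def)

lemma bdry_closed: "k < rsh_length D \<Longrightarrow> closedin (rsh_space D (Suc k)) (rsh_bdry D (Suc k))"
  using decomposition by (auto simp: rsh_decomposition_def)

lemma bdry_subset: "k < rsh_length D \<Longrightarrow> x \<in> rsh_bdry D (Suc k) \<Longrightarrow> x \<in> topspace (rsh_space D (Suc k))"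
  using bdry_closed closedin_subset by blast

lemma attach_hom: "k < rsh_length D \<Longrightarrow>
    unital_star_hom (rsh_stage D k) (rsh_bdry_algebra D (Suc k)) (rsh_attach D (Suc k))"
  using decomposition by (auto simp: rsh_decomposition_def)

lemma topspace_bdry: "k < rsh_length D \<Longrightarrow>
    topspace (subtopology (rsh_space D (Suc k)) (rsh_bdry D (Suc k))) = rsh_bdry D (Suc k)"
  using topspace_sub_closed[OF bdry_closed] .

lemma attach_carrier:
  assumes "k < rsh_length D" "a \<in> rsh_stage_carrier D k"
  shows "rsh_attach D (Suc k) a \<in> extensional (rsh_bdry D (Suc k))"
    "cont_entries (subtopology (rsh_space D (Suc k)) (rsh_bdry D (Suc k))) (rsh_size D (Suc k)) (rsh_attach D (Suc k) a)"
proof -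
  have "rsh_attach D (Suc k) a \<in> carrier (rsh_bdry_algebra D (Suc k))"
    using attach_hom[OF assms(1)] assms(2) ring_hom_closed[of "rsh_attach D (Suc k)" "rsh_stage D k" _ a]
    unfolding unital_star_hom_def stage_simps(1) by blast
  then show "rsh_attach D (Suc k) a \<in> extensional (rsh_bdry D (Suc k))"
    "cont_entries (subtopology (rsh_space D (Suc k)) (rsh_bdry D (Suc k))) (rsh_size D (Suc k)) (rsh_attach D (Suc k) a)"
    unfolding rsh_bdry_algebra_def cont_matrix_algebra_carrier topspace_bdry[OF assms(1)] by auto
qed

lemma attach_mat:
  assumes "k < rsh_length D" "a \<in> rsh_stage_carrier D k" "x \<in> rsh_bdry D (Suc k)"
  shows "rsh_attach D (Suc k) a x \<in> carrier_mat (rsh_size D (Suc k)) (rsh_size D (Suc k))"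
  using attach_carrier(2)[OF assms(1,2)] assms(3) unfolding cont_entries_def topspace_bdry[OF assms(1)] by blast

lemma attach_ops:
  assumes k: "k < rsh_length D" and a: "a \<in> rsh_stage_carrier D k" and b: "b \<in> rsh_stage_carrier D k"
    and x: "x \<in> rsh_bdry D (Suc k)"
  shows "rsh_attach D (Suc k) (pointwise D k (*) a b) x = rsh_attach D (Suc k) a x * rsh_attach D (Suc k) b x"
    "rsh_attach D (Suc k) (pointwise D k (+) a b) x = rsh_attach D (Suc k) a x + rsh_attach D (Suc k) b x"
    "rsh_attach D (Suc k) (pointwise D k (\<lambda>A B. c \<cdot>\<^sub>m A) a a) x = c \<cdot>\<^sub>m rsh_attach D (Suc k) a x"
    "rsh_attach D (Suc k) (pointwise D k (\<lambda>A B. mat_adjoint A) a a) x = mat_adjoint (rsh_attach D (Suc k) a x)"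
    "rsh_attach D (Suc k) \<one>\<^bsub>rsh_stage D k\<^esub> x = 1\<^sub>m (rsh_size D (Suc k))"
proof -
  have h: "rsh_attach D (Suc k) \<in> Ring.ring_hom (rsh_stage D k) (rsh_bdry_algebra D (Suc k))"
    and hs: "\<And>c a. a \<in> rsh_stage_carrier D k \<Longrightarrow> rsh_attach D (Suc k) (c \<odot>\<^bsub>rsh_stage D k\<^esub> a) = c \<odot>\<^bsub>rsh_bdry_algebra D (Suc k)\<^esub> rsh_attach D (Suc k) a"
    and hst: "\<And>a. a \<in> rsh_stage_carrier D k \<Longrightarrow> rsh_attach D (Suc k) (star (rsh_stage D k) a) = star (rsh_bdry_algebra D (Suc k)) (rsh_attach D (Suc k) a)"
    using attach_hom[OF k] by (auto simp: unital_star_hom_def stage_simps(1))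
  note t = bdry_subset[OF k x]
  show "rsh_attach D (Suc k) (pointwise D k (*) a b) x = rsh_attach D (Suc k) a x * rsh_attach D (Suc k) b x"
    using ring_hom_mult[OF h, of a b] a b x by (simp add: stage_simps rsh_bdry_algebra_def cont_matrix_algebra_def t)
  show "rsh_attach D (Suc k) (pointwise D k (+) a b) x = rsh_attach D (Suc k) a x + rsh_attach D (Suc k) b x"
    using ring_hom_add[OF h, of a b] a b x by (simp add: stage_simps rsh_bdry_algebra_def cont_matrix_algebra_def t)
  show "rsh_attach D (Suc k) (pointwise D k (\<lambda>A B. c \<cdot>\<^sub>m A) a a) x = c \<cdot>\<^sub>m rsh_attach D (Suc k) a x"
    using hs[OF a, of c] x by (simp add: stage_simps rsh_bdry_algebra_def cont_matrix_algebra_def t)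
  show "rsh_attach D (Suc k) (pointwise D k (\<lambda>A B. mat_adjoint A) a a) x = mat_adjoint (rsh_attach D (Suc k) a x)"
    using hst[OF a] x by (simp add: stage_simps rsh_bdry_algebra_def cont_matrix_algebra_def t)
  show "rsh_attach D (Suc k) \<one>\<^bsub>rsh_stage D k\<^esub> x = 1\<^sub>m (rsh_size D (Suc k))"
    using ring_hom_one[OF h] x by (simp add: rsh_bdry_algebra_def cont_matrix_algebra_def t)
qed

lemma summand_pointwise:
  assumes "cont_op TYPE('x) g" "a \<in> carrier (rsh_summand D l)" "b \<in> carrier (rsh_summand D l)"
  shows "(\<lambda>x\<in>topspace (rsh_space D l). g (a x) (b x)) \<in> carrier (rsh_summand D l)"
proof -
  have "cont_entries (rsh_space D l) (rsh_size D l) (\<lambda>x. g (a x) (b x))"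
    using assms unfolding cont_op_def rsh_summand_def cont_matrix_algebra_carrier by blast
  then have "cont_entries (rsh_space D l) (rsh_size D l) (\<lambda>x\<in>topspace (rsh_space D l). g (a x) (b x))"
    by (rule cont_entries_cong[rotated]) simp
  then show ?thesis unfolding rsh_summand_def cont_matrix_algebra_carrier by simp
qed

text \<open>An operation with which the attaching maps commute preserves the pullback conditions.\<close>

lemma pointwise_closed:
  assumes g: "cont_op TYPE('x) g"
    and hom: "\<And>k a b x. k < rsh_length D \<Longrightarrow> a \<in> rsh_stage_carrier D k \<Longrightarrow> b \<in> rsh_stage_carrier D k \<Longrightarrow>
       x \<in> rsh_bdry D (Suc k) \<Longrightarrow>
       rsh_attach D (Suc k) (pointwise D k g a b) x = g (rsh_attach D (Suc k) a x) (rsh_attach D (Suc k) b x)"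
    and k: "k \<le> rsh_length D" and a: "a \<in> rsh_stage_carrier D k" and b: "b \<in> rsh_stage_carrier D k"
  shows "pointwise D k g a b \<in> rsh_stage_carrier D k"
  using k a b
proof (induction k arbitrary: a b)
  case 0
  have "a 0 \<in> carrier (rsh_summand D 0)" "b 0 \<in> carrier (rsh_summand D 0)"
    using stage_component[OF 0(2)] stage_component[OF 0(3)] by auto
  from summand_pointwise[OF g this] have "pointwise D 0 g a b j \<in> carrier (rsh_summand D j)" if "j \<in> {..0}" for j
    using that by (simp add: pointwise_def)
  moreover have "pointwise D 0 g a b \<in> extensional {..0}" by (simp add: pointwise_def)
  ultimately show ?case unfolding rsh_stage_carrier.simps PiE_iff by blast
next
  case (Suc k)
  define a' b' where "a' = restrict a {..k}" and "b' = restrict b {..k}"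
  have a: "a (Suc k) \<in> carrier (rsh_summand D (Suc k))" "a' \<in> rsh_stage_carrier D k"
    "rsh_attach D (Suc k) a' = restrict (a (Suc k)) (rsh_bdry D (Suc k))"
    using Suc.prems(2) unfolding stage_Suc_iff a'_def by auto
  have b: "b (Suc k) \<in> carrier (rsh_summand D (Suc k))" "b' \<in> rsh_stage_carrier D k"
    "rsh_attach D (Suc k) b' = restrict (b (Suc k)) (rsh_bdry D (Suc k))"
    using Suc.prems(3) unfolding stage_Suc_iff b'_def by auto
  have k: "k < rsh_length D" using Suc.prems by simp
  have ih: "pointwise D k g a' b' \<in> rsh_stage_carrier D k" using Suc.IH a b k by simp
  have e: "restrict (pointwise D (Suc k) g a b) {..k} = pointwise D k g a' b'"
    by (auto simp: pointwise_def a'_def b'_def fun_eq_iff restrict_def)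
  show ?case unfolding stage_Suc_iff e
  proof (intro conjI allI impI)
    show "pointwise D (Suc k) g a b (Suc k) \<in> carrier (rsh_summand D (Suc k))"
      using summand_pointwise[OF g a(1) b(1)] by (simp add: pointwise_def)
    show "pointwise D k g a' b' \<in> rsh_stage_carrier D k" by (rule ih)
    show "pointwise D (Suc k) g a b l = undefined" if "Suc k < l" for l using that by (simp add: pointwise_def)
    show "rsh_attach D (Suc k) (pointwise D k g a' b') = restrict (pointwise D (Suc k) g a b (Suc k)) (rsh_bdry D (Suc k))"
    proof (rule extensionalityI[of _ "rsh_bdry D (Suc k)"])
      show "rsh_attach D (Suc k) (pointwise D k g a' b') \<in> extensional (rsh_bdry D (Suc k))"
        by (rule attach_carrier(1)[OF k ih])
      show "restrict (pointwise D (Suc k) g a b (Suc k)) (rsh_bdry D (Suc k)) \<in> extensional (rsh_bdry D (Suc k))" by simp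
      fix x assume x: "x \<in> rsh_bdry D (Suc k)"
      then show "rsh_attach D (Suc k) (pointwise D k g a' b') x = restrict (pointwise D (Suc k) g a b (Suc k)) (rsh_bdry D (Suc k)) x"
        using hom[OF k a(2) b(2) x] bdry_subset[OF k x] by (simp add: a(3) b(3) pointwise_def)
    qed
  qed
qed

lemma mult_closed:
  "k \<le> rsh_length D \<Longrightarrow> a \<in> rsh_stage_carrier D k \<Longrightarrow> b \<in> rsh_stage_carrier D k \<Longrightarrow>
    pointwise D k (*) a b \<in> rsh_stage_carrier D k"
  by (rule pointwise_closed[OF cont_op_mult]) (rule attach_ops(1))

lemma add_closed:
  "k \<le> rsh_length D \<Longrightarrow> a \<in> rsh_stage_carrier D k \<Longrightarrow> b \<in> rsh_stage_carrier D k \<Longrightarrow>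
    pointwise D k (+) a b \<in> rsh_stage_carrier D k"
  by (rule pointwise_closed[OF cont_op_add]) (rule attach_ops(2))

lemma smult_closed:
  "k \<le> rsh_length D \<Longrightarrow> a \<in> rsh_stage_carrier D k \<Longrightarrow> pointwise D k (\<lambda>A B. c \<cdot>\<^sub>m A) a a \<in> rsh_stage_carrier D k"
proof (rule pointwise_closed[OF cont_op_smult])
  fix k a b x
  assume *: "k < rsh_length D" "a \<in> rsh_stage_carrier D k" "b \<in> rsh_stage_carrier D k" "x \<in> rsh_bdry D (Suc k)"
  have "pointwise D k (\<lambda>A B. c \<cdot>\<^sub>m A) a b = pointwise D k (\<lambda>A B. c \<cdot>\<^sub>m A) a a" by (simp add: pointwise_def)
  then show "rsh_attach D (Suc k) (pointwise D k (\<lambda>A B. c \<cdot>\<^sub>m A) a b) x = c \<cdot>\<^sub>m rsh_attach D (Suc k) a x"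
    using attach_ops(3)[OF *(1,2,2,4)] by simp
qed

lemma star_closed:
  "k \<le> rsh_length D \<Longrightarrow> a \<in> rsh_stage_carrier D k \<Longrightarrow> pointwise D k (\<lambda>A B. mat_adjoint A) a a \<in> rsh_stage_carrier D k"
proof (rule pointwise_closed[OF cont_op_adjoint])
  fix k a b x
  assume *: "k < rsh_length D" "a \<in> rsh_stage_carrier D k" "b \<in> rsh_stage_carrier D k" "x \<in> rsh_bdry D (Suc k)"
  have "pointwise D k (\<lambda>A B. mat_adjoint A) a b = pointwise D k (\<lambda>A B. mat_adjoint A) a a" by (simp add: pointwise_def)
  then show "rsh_attach D (Suc k) (pointwise D k (\<lambda>A B. mat_adjoint A) a b) x = mat_adjoint (rsh_attach D (Suc k) a x)"
    using attach_ops(4)[OF *(1,2,2,4)] by simp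
qed

text \<open>The unit satisfies the pullback conditions because the attaching maps are unital.\<close>

lemma one_closed: "k \<le> rsh_length D \<Longrightarrow> \<one>\<^bsub>rsh_stage D k\<^esub> \<in> rsh_stage_carrier D k"
proof (induction k)
  have s: "(\<lambda>x\<in>topspace (rsh_space D j). 1\<^sub>m (rsh_size D j)) \<in> carrier (rsh_summand D j)" for j
  proof -
    have "cont_entries (rsh_space D j) (rsh_size D j) (\<lambda>x. 1\<^sub>m (rsh_size D j))"
      by (simp add: cont_entries_def)
    then have "cont_entries (rsh_space D j) (rsh_size D j) (\<lambda>x\<in>topspace (rsh_space D j). 1\<^sub>m (rsh_size D j))"
      by (rule cont_entries_cong[rotated]) simp
    then show ?thesis unfolding rsh_summand_def cont_matrix_algebra_carrier by simp
  qed
  {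
    case 0
    show ?case using s[of 0] by (simp add: stage_simps PiE_iff extensional_def)
  next
    case (Suc k)
    have k: "k < rsh_length D" using Suc.prems by simp
    have ih: "\<one>\<^bsub>rsh_stage D k\<^esub> \<in> rsh_stage_carrier D k" using Suc by simp
    have e: "restrict \<one>\<^bsub>rsh_stage D (Suc k)\<^esub> {..k} = \<one>\<^bsub>rsh_stage D k\<^esub>"
      by (auto simp: stage_simps fun_eq_iff restrict_def)
    show ?case unfolding stage_Suc_iff e
    proof (intro conjI allI impI)
      show "\<one>\<^bsub>rsh_stage D (Suc k)\<^esub> (Suc k) \<in> carrier (rsh_summand D (Suc k))" using s by (simp add: stage_simps)
      show "\<one>\<^bsub>rsh_stage D k\<^esub> \<in> rsh_stage_carrier D k" by (rule ih)
      show "\<one>\<^bsub>rsh_stage D (Suc k)\<^esub> l = undefined" if "Suc k < l" for l using that by (simp add: stage_simps)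
      show "rsh_attach D (Suc k) \<one>\<^bsub>rsh_stage D k\<^esub> = restrict (\<one>\<^bsub>rsh_stage D (Suc k)\<^esub> (Suc k)) (rsh_bdry D (Suc k))"
      proof (rule extensionalityI[of _ "rsh_bdry D (Suc k)"])
        show "rsh_attach D (Suc k) \<one>\<^bsub>rsh_stage D k\<^esub> \<in> extensional (rsh_bdry D (Suc k))"
          by (rule attach_carrier(1)[OF k ih])
        fix x assume x: "x \<in> rsh_bdry D (Suc k)"
        then show "rsh_attach D (Suc k) \<one>\<^bsub>rsh_stage D k\<^esub> x =
            restrict (\<one>\<^bsub>rsh_stage D (Suc k)\<^esub> (Suc k)) (rsh_bdry D (Suc k)) x"
          using attach_ops(5)[OF k ih ih x] bdry_subset[OF k x] by (simp add: stage_simps)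
      qed simp
    qed
  }
qed

lemma zero_eq: "\<zero>\<^bsub>rsh_stage D k\<^esub> = pointwise D k (\<lambda>A B. 0 \<cdot>\<^sub>m A) \<one>\<^bsub>rsh_stage D k\<^esub> \<one>\<^bsub>rsh_stage D k\<^esub>"
  by (auto simp: stage_simps pointwise_def fun_eq_iff restrict_def)

lemma stage_zero_closed: "k \<le> rsh_length D \<Longrightarrow> \<zero>\<^bsub>rsh_stage D k\<^esub> \<in> rsh_stage_carrier D k"
  unfolding zero_eq by (intro smult_closed one_closed)

lemma attach_zero:
  assumes "k < rsh_length D" "x \<in> rsh_bdry D (Suc k)"
  shows "rsh_attach D (Suc k) \<zero>\<^bsub>rsh_stage D k\<^esub> x = 0\<^sub>m (rsh_size D (Suc k)) (rsh_size D (Suc k))"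
proof -
  have one: "\<one>\<^bsub>rsh_stage D k\<^esub> \<in> rsh_stage_carrier D k" using assms by (intro one_closed) simp
  show ?thesis
    unfolding zero_eq attach_ops(3)[OF assms(1) one one assms(2)] attach_ops(5)[OF assms(1) one one assms(2)] by auto
qed

lemma stage_mat:
  "a \<in> rsh_stage_carrier D k \<Longrightarrow> l \<le> k \<Longrightarrow> x \<in> topspace (rsh_space D l) \<Longrightarrow>
    a l x \<in> carrier_mat (rsh_size D l) (rsh_size D l)"
  using stage_component[of a D k l] by (auto simp: rsh_summand_def cont_matrix_algebra_carrier cont_entries_def)

lemma stage_eqI:
  assumes "a \<in> rsh_stage_carrier D k" "b \<in> rsh_stage_carrier D k"
    and "\<And>l x. l \<le> k \<Longrightarrow> x \<in> topspace (rsh_space D l) \<Longrightarrow> a l x = b l x"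
  shows "a = b"
proof (intro ext)
  fix l x
  show "a l x = b l x"
  proof (cases "l \<le> k")
    case True
    then have "a l \<in> extensional (topspace (rsh_space D l))" "b l \<in> extensional (topspace (rsh_space D l))"
      using stage_component[OF assms(1)] stage_component[OF assms(2)]
      by (auto simp: rsh_summand_def cont_matrix_algebra_carrier)
    then show ?thesis using assms(3)[OF True, of x] by (cases "x \<in> topspace (rsh_space D l)") (auto simp: extensional_def)
  next
    case False
    then show ?thesis using stage_ext[OF assms(1)] stage_ext[OF assms(2)] by simp
  qed
qed

lemma stage_abelian_monoid:
  assumes k: "k \<le> rsh_length D"
  shows "abelian_monoid (rsh_stage D k)"
proof (rule abelian_monoidI)
  fix a b c
  assume a: "a \<in> carrier (rsh_stage D k)" and b: "b \<in> carrier (rsh_stage D k)"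
  then have ab: "a \<in> rsh_stage_carrier D k" "b \<in> rsh_stage_carrier D k" by (auto simp: stage_simps)
  show "a \<oplus>\<^bsub>rsh_stage D k\<^esub> b \<in> carrier (rsh_stage D k)" unfolding stage_simps by (rule add_closed[OF k ab])
  show "a \<oplus>\<^bsub>rsh_stage D k\<^esub> b = b \<oplus>\<^bsub>rsh_stage D k\<^esub> a"
    unfolding stage_simps
    by (rule stage_eqI[OF add_closed[OF k ab] add_closed[OF k ab(2,1)]])
      (simp add: pointwise_at comm_add_mat[OF stage_mat[OF ab(1)] stage_mat[OF ab(2)]])
  assume "c \<in> carrier (rsh_stage D k)"
  then have c: "c \<in> rsh_stage_carrier D k" by (simp add: stage_simps)
  show "a \<oplus>\<^bsub>rsh_stage D k\<^esub> b \<oplus>\<^bsub>rsh_stage D k\<^esub> c = a \<oplus>\<^bsub>rsh_stage D k\<^esub> (b \<oplus>\<^bsub>rsh_stage D k\<^esub> c)"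
    unfolding stage_simps
    by (rule stage_eqI[OF add_closed[OF k add_closed[OF k ab] c] add_closed[OF k ab(1) add_closed[OF k ab(2) c]]])
      (simp add: pointwise_at assoc_add_mat[OF stage_mat[OF ab(1)] stage_mat[OF ab(2)] stage_mat[OF c]])
next
  show "\<zero>\<^bsub>rsh_stage D k\<^esub> \<in> carrier (rsh_stage D k)" unfolding stage_simps(1) by (rule stage_zero_closed[OF k])
  fix a assume "a \<in> carrier (rsh_stage D k)"
  then have a: "a \<in> rsh_stage_carrier D k" by (simp add: stage_simps)
  show "\<zero>\<^bsub>rsh_stage D k\<^esub> \<oplus>\<^bsub>rsh_stage D k\<^esub> a = a"
    unfolding stage_simps(3)
    by (rule stage_eqI[OF add_closed[OF k stage_zero_closed[OF k] a] a])
      (simp add: pointwise_at stage_simps(6) left_add_zero_mat[OF stage_mat[OF a]])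
qed

text \<open>Sums in a stage are compared with sums of matrix entries, both for the components and for the images under
  the next attaching map.\<close>

lemma stage_finsum:
  assumes k: "k \<le> rsh_length D" and "finite I" and f: "\<And>i. i \<in> I \<Longrightarrow> f i \<in> rsh_stage_carrier D k"
  shows "finsum (rsh_stage D k) f I \<in> rsh_stage_carrier D k \<and>
    (\<forall>l\<le>k. \<forall>x\<in>topspace (rsh_space D l). \<forall>u<rsh_size D l. \<forall>v<rsh_size D l.
       finsum (rsh_stage D k) f I l x $$ (u, v) = (\<Sum>i\<in>I. f i l x $$ (u, v))) \<and>
    (k < rsh_length D \<longrightarrow> (\<forall>x\<in>rsh_bdry D (Suc k). \<forall>u<rsh_size D (Suc k). \<forall>v<rsh_size D (Suc k).
       rsh_attach D (Suc k) (finsum (rsh_stage D k) f I) x $$ (u, v) = (\<Sum>i\<in>I. rsh_attach D (Suc k) (f i) x $$ (u, v))))"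
  using assms(2) f
proof (induction I rule: finite_induct)
  case empty
  interpret abelian_monoid "rsh_stage D k" by (rule stage_abelian_monoid[OF k])
  show ?case using stage_zero_closed[OF k] attach_zero by (simp add: finsum_empty) (simp add: stage_simps(6))
next
  case (insert i I)
  interpret abelian_monoid "rsh_stage D k" by (rule stage_abelian_monoid[OF k])
  define s where "s = finsum (rsh_stage D k) f I"
  have fi: "f i \<in> rsh_stage_carrier D k" using insert.prems by simp
  have s: "s \<in> rsh_stage_carrier D k" using insert unfolding s_def by blast
  have e: "finsum (rsh_stage D k) f (insert i I) = pointwise D k (+) (f i) s"
    unfolding s_def stage_simps(3)[symmetric]
    by (rule finsum_insert[OF insert.hyps]) (use insert.prems in \<open>auto simp: stage_simps(1)\<close>)
  show ?case unfolding e
  proof (intro conjI allI impI ballI)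
    show "pointwise D k (+) (f i) s \<in> rsh_stage_carrier D k" by (rule add_closed[OF k fi s])
    fix l x u v assume *: "l \<le> k" "x \<in> topspace (rsh_space D l)" "u < rsh_size D l" "v < rsh_size D l"
    have "s l x $$ (u, v) = (\<Sum>i\<in>I. f i l x $$ (u, v))" unfolding s_def using insert * by blast
    then show "pointwise D k (+) (f i) s l x $$ (u, v) = (\<Sum>i\<in>insert i I. f i l x $$ (u, v))"
      using * stage_mat[OF s *(1,2)] stage_mat[OF fi *(1,2)] insert.hyps by (simp add: pointwise_at)
  next
    fix x u v assume *: "k < rsh_length D" "x \<in> rsh_bdry D (Suc k)" "u < rsh_size D (Suc k)" "v < rsh_size D (Suc k)"
    have "rsh_attach D (Suc k) s x $$ (u, v) = (\<Sum>i\<in>I. rsh_attach D (Suc k) (f i) x $$ (u, v))"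
      unfolding s_def using insert * by blast
    then show "rsh_attach D (Suc k) (pointwise D k (+) (f i) s) x $$ (u, v) = (\<Sum>i\<in>insert i I. rsh_attach D (Suc k) (f i) x $$ (u, v))"
      using * attach_mat[OF *(1) s *(2)] attach_mat[OF *(1) fi *(2)] insert.hyps
      by (simp add: attach_ops(2)[OF *(1) fi s *(2)])
  qed
qed

section \<open>Matrices over a stage as fields\<close>

text \<open>An \<open>m \<times> m\<close> matrix over a stage is given by a field \<open>G\<close>, whose value \<open>G l x\<close> is the image of the matrix under
  evaluation at the point \<open>x\<close> of the \<open>l\<close>-th space. Here \<open>entries k G i j\<close> is its entry in the stage. All work is done
  with such fields, which form an algebra under pointwise operations; matrices over
  the algebra are translated into fields once and for all.\<close>

definition entries :: "nat \<Rightarrow> (nat \<Rightarrow> 'x \<Rightarrow> finmat) \<Rightarrow> nat \<Rightarrow> nat \<Rightarrow> nat \<Rightarrow> 'x \<Rightarrow> complex mat" where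
  "entries k G i j = (\<lambda>l\<in>{..k}. \<lambda>x\<in>topspace (rsh_space D l). blk (rsh_size D l) (G l x) i j)"

definition mstage :: "nat \<Rightarrow> nat \<Rightarrow> (nat \<Rightarrow> 'x \<Rightarrow> finmat) \<Rightarrow> bool" where
  "mstage k m G \<longleftrightarrow> (\<forall>l\<le>k. \<forall>x\<in>topspace (rsh_space D l). supp (m * rsh_size D l) (G l x)) \<and>
     (\<forall>i j. entries k G i j \<in> rsh_stage_carrier D k)"

text \<open>The attaching map applied entrywise to the matrix with field \<open>G\<close>: the prescribed values on the boundary
  in the next space. The point of the lemmas that follow is that this is a \<open>*\<close>-homomorphism.\<close>

definition bdry_val :: "nat \<Rightarrow> nat \<Rightarrow> (nat \<Rightarrow> 'x \<Rightarrow> finmat) \<Rightarrow> 'x \<Rightarrow> finmat" where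
  "bdry_val k m G x = unblk (rsh_size D (Suc k)) m (\<lambda>i j. rsh_attach D (Suc k) (entries k G i j) x)"

lemma entries_at: "l \<le> k \<Longrightarrow> x \<in> topspace (rsh_space D l) \<Longrightarrow> entries k G i j l x = blk (rsh_size D l) (G l x) i j"
  by (simp add: entries_def)

lemma entries_cong:
  assumes "\<And>l x. l \<le> k \<Longrightarrow> x \<in> topspace (rsh_space D l) \<Longrightarrow> G l x = H l x"
  shows "entries k G = entries k H"
  using assms by (auto simp: entries_def fun_eq_iff restrict_def)

lemma bdry_val_cong:
  assumes "\<And>l x. l \<le> k \<Longrightarrow> x \<in> topspace (rsh_space D l) \<Longrightarrow> G l x = H l x"
  shows "bdry_val k m G x = bdry_val k m H x"
  using entries_cong[of k G H] assms by (simp add: bdry_val_def)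

lemma mstage_cong:
  assumes "\<And>l x. l \<le> k \<Longrightarrow> x \<in> topspace (rsh_space D l) \<Longrightarrow> G l x = H l x" "mstage k m G"
  shows "mstage k m H"
  using entries_cong[of k G H] assms by (simp add: mstage_def)

lemma mstage_carrier: "mstage k m G \<Longrightarrow> entries k G i j \<in> rsh_stage_carrier D k"
  by (simp add: mstage_def)

lemma mstage_supp: "mstage k m G \<Longrightarrow> l \<le> k \<Longrightarrow> x \<in> topspace (rsh_space D l) \<Longrightarrow> supp (m * rsh_size D l) (G l x)"
  by (simp add: mstage_def)

lemma stage_eq_entries:
  assumes a: "a \<in> rsh_stage_carrier D k"
    and eq: "\<And>l x. l \<le> k \<Longrightarrow> x \<in> topspace (rsh_space D l) \<Longrightarrow> a l x = blk (rsh_size D l) (G l x) i j"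
  shows "a = entries k G i j"
proof (intro ext)
  fix l x
  show "a l x = entries k G i j l x"
  proof (cases "l \<le> k")
    case True
    then have "a l \<in> extensional (topspace (rsh_space D l))"
      using stage_component[OF a] by (auto simp: rsh_summand_def cont_matrix_algebra_carrier)
    then show ?thesis using True eq[OF True, of x]
      by (cases "x \<in> topspace (rsh_space D l)") (auto simp: extensional_def entries_def)
  next
    case False
    then show ?thesis using stage_ext[OF a] by (simp add: entries_def)
  qed
qed

lemma entries_add: "entries k (\<lambda>l x. G l x + H l x) i j = pointwise D k (+) (entries k G i j) (entries k H i j)"
proof -
  have "blk n (A + B) i j = blk n A i j + blk n B i j" for n A B
    by (rule eq_matI) (auto simp: blk_index)
  then show ?thesis by (auto simp: entries_def pointwise_def fun_eq_iff restrict_def)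
qed

lemma entries_csc: "entries k (\<lambda>l x. csc c (G l x)) i j = pointwise D k (\<lambda>A B. c \<cdot>\<^sub>m A) (entries k G i j) (entries k G i j)"
proof -
  have "blk n (csc c A) i j = c \<cdot>\<^sub>m blk n A i j" for n A
    by (rule eq_matI) (auto simp: blk_index)
  then show ?thesis by (auto simp: entries_def pointwise_def fun_eq_iff restrict_def)
qed

lemma entries_adj: "entries k (\<lambda>l x. adj (G l x)) i j = pointwise D k (\<lambda>A B. mat_adjoint A) (entries k G j i) (entries k G j i)"
proof -
  have "blk n (adj A) i j = mat_adjoint (blk n A j i)" for n A
  proof (rule eq_matI)
    have c: "mat_adjoint (blk n A j i) \<in> carrier_mat n n" by (rule mat_adjoint_carrier) simp
    fix u v assume "u < dim_row (mat_adjoint (blk n A j i))" "v < dim_col (mat_adjoint (blk n A j i))"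
    then have "u < n" "v < n" using c by auto
    then show "blk n (adj A) i j $$ (u, v) = mat_adjoint (blk n A j i) $$ (u, v)"
      by (simp add: mat_adjoint_index[of _ n] blk_index)
  qed (use mat_adjoint_carrier[of "blk n A j i" n] in auto)
  then show ?thesis by (auto simp: entries_def pointwise_def fun_eq_iff restrict_def)
qed

lemma entries_0: "entries k (\<lambda>l x. 0) i j = \<zero>\<^bsub>rsh_stage D k\<^esub>"
proof -
  have "blk n 0 i j = 0\<^sub>m n n" for n by (rule eq_matI) (auto simp: blk_index)
  then show ?thesis by (auto simp: entries_def stage_simps fun_eq_iff restrict_def)
qed

text \<open>The index set \<open>I\<close> is arbitrary as the matrix product over a star algebra sums over the indices with
  nonzero term only.\<close>

lemma entries_mult_finsum:
  assumes k: "k \<le> rsh_length D" and G: "mstage k m G" and H: "mstage k m H" and I: "I \<subseteq> {..<m}"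
    and zero: "\<And>t. t < m \<Longrightarrow> t \<notin> I \<Longrightarrow> pointwise D k (*) (entries k G i t) (entries k H t j) = \<zero>\<^bsub>rsh_stage D k\<^esub>"
  shows "finsum (rsh_stage D k) (\<lambda>t. pointwise D k (*) (entries k G i t) (entries k H t j)) I = entries k (\<lambda>l x. G l x * H l x) i j"
proof (rule stage_eq_entries)
  have fin: "finite I" using I finite_subset by blast
  have c: "pointwise D k (*) (entries k G i t) (entries k H t j) \<in> rsh_stage_carrier D k" for t
    by (intro mult_closed k mstage_carrier[OF G] mstage_carrier[OF H])
  note fs = stage_finsum[OF k fin, of "\<lambda>t. pointwise D k (*) (entries k G i t) (entries k H t j)", OF c]
  define s where "s = finsum (rsh_stage D k) (\<lambda>t. pointwise D k (*) (entries k G i t) (entries k H t j)) I"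
  show s: "s \<in> rsh_stage_carrier D k" unfolding s_def using fs by blast
  fix l x assume l: "l \<le> k" and x: "x \<in> topspace (rsh_space D l)"
  let ?n = "rsh_size D l"
  show "s l x = blk ?n (G l x * H l x) i j"
  proof (rule eq_matI)
    fix u v assume "u < dim_row (blk ?n (G l x * H l x) i j)" "v < dim_col (blk ?n (G l x * H l x) i j)"
    then have uv: "u < ?n" "v < ?n" by auto
    have "s l x $$ (u, v) = (\<Sum>t\<in>I. pointwise D k (*) (entries k G i t) (entries k H t j) l x $$ (u, v))"
      unfolding s_def using fs l x uv by blast
    also have "\<dots> = (\<Sum>t<m. pointwise D k (*) (entries k G i t) (entries k H t j) l x $$ (u, v))"
      using I zero l x uv by (intro sum.mono_neutral_left) (auto simp: stage_simps(6))
    also have "\<dots> = (\<Sum>t<m. (blk ?n (G l x) i t * blk ?n (H l x) t j) $$ (u, v))"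
      using l x by (simp add: pointwise_at entries_at)
    also have "\<dots> = blk ?n (G l x * H l x) i j $$ (u, v)"
      using blk_mult[OF mstage_supp[OF G l x] mstage_supp[OF H l x] uv] by simp
    finally show "s l x $$ (u, v) = blk ?n (G l x * H l x) i j $$ (u, v)" .
  qed (use stage_mat[OF s l x] in auto)
qed

lemma mstage_add:
  assumes "k \<le> rsh_length D" "mstage k m G" "mstage k m H"
  shows "mstage k m (\<lambda>l x. G l x + H l x)"
  using assms add_closed[OF assms(1)] unfolding mstage_def entries_add by (auto intro: supp_add)

lemma mstage_adj:
  assumes "k \<le> rsh_length D" "mstage k m G"
  shows "mstage k m (\<lambda>l x. adj (G l x))"
  using assms star_closed[OF assms(1)] unfolding mstage_def entries_adj by (auto intro: supp_adj)

lemma mstage_zero: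
  assumes "k \<le> rsh_length D"
  shows "mstage k m (\<lambda>l x. 0)"
  using stage_zero_closed[OF assms] unfolding mstage_def entries_0 by simp

lemma mstage_mult:
  assumes "k \<le> rsh_length D" "mstage k m G" "mstage k m H"
  shows "mstage k m (\<lambda>l x. G l x * H l x)"
  unfolding mstage_def
proof (intro conjI allI impI ballI)
  show "supp (m * rsh_size D l) (G l x * H l x)" if "l \<le> k" "x \<in> topspace (rsh_space D l)" for l x
    using that mstage_supp[OF assms(2)] mstage_supp[OF assms(3)] by (intro supp_mult)
  fix i j
  have c: "pointwise D k (*) (entries k G i t) (entries k H t j) \<in> rsh_stage_carrier D k" for t
    by (intro mult_closed assms(1) mstage_carrier[OF assms(2)] mstage_carrier[OF assms(3)])
  have "entries k (\<lambda>l x. G l x * H l x) i j = finsum (rsh_stage D k) (\<lambda>t. pointwise D k (*) (entries k G i t) (entries k H t j)) {..<m}"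
    by (rule entries_mult_finsum[OF assms, symmetric]) auto
  then show "entries k (\<lambda>l x. G l x * H l x) i j \<in> rsh_stage_carrier D k"
    using stage_finsum[OF assms(1) finite_lessThan, of m "\<lambda>t. pointwise D k (*) (entries k G i t) (entries k H t j)", OF c] by metis
qed

lemma bdry_val_add:
  assumes k: "k < rsh_length D" and x: "x \<in> rsh_bdry D (Suc k)" and G: "mstage k m G" and H: "mstage k m H"
  shows "bdry_val k m (\<lambda>l x. G l x + H l x) x = bdry_val k m G x + bdry_val k m H x"
proof -
  have n: "0 < rsh_size D (Suc k)" using space(3)[of "Suc k"] k by simp
  have "rsh_attach D (Suc k) (entries k (\<lambda>l x. G l x + H l x) i j) x =
      rsh_attach D (Suc k) (entries k G i j) x + rsh_attach D (Suc k) (entries k H i j) x" for i j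
    unfolding entries_add by (rule attach_ops(2)[OF k mstage_carrier[OF G] mstage_carrier[OF H] x])
  moreover have "(A + rsh_attach D (Suc k) (entries k H i j) x) $$ (u mod rsh_size D (Suc k), v mod rsh_size D (Suc k)) =
      A $$ (u mod rsh_size D (Suc k), v mod rsh_size D (Suc k)) +
      rsh_attach D (Suc k) (entries k H i j) x $$ (u mod rsh_size D (Suc k), v mod rsh_size D (Suc k))" for A i j u v
    using attach_mat[OF k mstage_carrier[OF H, of i j] x] n by (intro index_add_mat(1)) auto
  ultimately show ?thesis by (intro finmat_eqI) (simp add: bdry_val_def ent_unblk)
qed

lemma bdry_val_csc:
  assumes k: "k < rsh_length D" and x: "x \<in> rsh_bdry D (Suc k)" and G: "mstage k m G"
  shows "bdry_val k m (\<lambda>l x. csc c (G l x)) x = csc c (bdry_val k m G x)"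
proof -
  have n: "0 < rsh_size D (Suc k)" using space(3)[of "Suc k"] k by simp
  have "rsh_attach D (Suc k) (entries k (\<lambda>l x. csc c (G l x)) i j) x = c \<cdot>\<^sub>m rsh_attach D (Suc k) (entries k G i j) x" for i j
    unfolding entries_csc by (rule attach_ops(3)[OF k mstage_carrier[OF G] mstage_carrier[OF G] x])
  moreover have "(c \<cdot>\<^sub>m rsh_attach D (Suc k) (entries k G i j) x) $$ (u mod rsh_size D (Suc k), v mod rsh_size D (Suc k)) =
      c * rsh_attach D (Suc k) (entries k G i j) x $$ (u mod rsh_size D (Suc k), v mod rsh_size D (Suc k))" for i j u v
    using attach_mat[OF k mstage_carrier[OF G, of i j] x] n by (intro index_smult_mat(1)) auto
  ultimately show ?thesis by (intro finmat_eqI) (simp add: bdry_val_def ent_unblk)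
qed

lemma bdry_val_adj:
  assumes k: "k < rsh_length D" and x: "x \<in> rsh_bdry D (Suc k)" and G: "mstage k m G"
  shows "bdry_val k m (\<lambda>l x. adj (G l x)) x = adj (bdry_val k m G x)"
proof -
  have n: "0 < rsh_size D (Suc k)" using space(3)[of "Suc k"] k by simp
  have "rsh_attach D (Suc k) (entries k (\<lambda>l x. adj (G l x)) i j) x = mat_adjoint (rsh_attach D (Suc k) (entries k G j i) x)" for i j
    unfolding entries_adj by (rule attach_ops(4)[OF k mstage_carrier[OF G] mstage_carrier[OF G] x])
  moreover have "mat_adjoint (rsh_attach D (Suc k) (entries k G i j) x) $$ (u mod rsh_size D (Suc k), v mod rsh_size D (Suc k)) =
      cnj (rsh_attach D (Suc k) (entries k G i j) x $$ (v mod rsh_size D (Suc k), u mod rsh_size D (Suc k)))" for i j u v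
    using attach_mat[OF k mstage_carrier[OF G, of i j] x] n by (intro mat_adjoint_index) auto
  ultimately show ?thesis by (intro finmat_eqI) (auto simp: bdry_val_def ent_unblk)
qed

lemma bdry_val_mult:
  assumes k: "k < rsh_length D" and x: "x \<in> rsh_bdry D (Suc k)" and G: "mstage k m G" and H: "mstage k m H"
  shows "bdry_val k m (\<lambda>l x. G l x * H l x) x = bdry_val k m G x * bdry_val k m H x"
  unfolding bdry_val_def
proof (rule unblk_mult)
  have k': "k \<le> rsh_length D" using k by simp
  show "rsh_attach D (Suc k) (entries k G i j) x \<in> carrier_mat (rsh_size D (Suc k)) (rsh_size D (Suc k))" for i j
    by (rule attach_mat[OF k mstage_carrier[OF G] x])
  show "rsh_attach D (Suc k) (entries k H i j) x \<in> carrier_mat (rsh_size D (Suc k)) (rsh_size D (Suc k))" for i j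
    by (rule attach_mat[OF k mstage_carrier[OF H] x])
  fix i j u v assume uv: "u < rsh_size D (Suc k)" "v < rsh_size D (Suc k)"
  have c: "pointwise D k (*) (entries k G i t) (entries k H t j) \<in> rsh_stage_carrier D k" for t
    by (intro mult_closed k' mstage_carrier[OF G] mstage_carrier[OF H])
  have e: "entries k (\<lambda>l x. G l x * H l x) i j = finsum (rsh_stage D k) (\<lambda>t. pointwise D k (*) (entries k G i t) (entries k H t j)) {..<m}"
    by (rule entries_mult_finsum[OF k' G H, symmetric]) auto
  have "rsh_attach D (Suc k) (entries k (\<lambda>l x. G l x * H l x) i j) x $$ (u, v) =
     (\<Sum>t<m. rsh_attach D (Suc k) (pointwise D k (*) (entries k G i t) (entries k H t j)) x $$ (u, v))"
    unfolding e using stage_finsum[OF k' finite_lessThan, of m "\<lambda>t. pointwise D k (*) (entries k G i t) (entries k H t j)", OF c] k x uv by blast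
  then show "rsh_attach D (Suc k) (entries k (\<lambda>l x. G l x * H l x) i j) x $$ (u, v) =
     (\<Sum>t<m. (rsh_attach D (Suc k) (entries k G i t) x * rsh_attach D (Suc k) (entries k H t j) x) $$ (u, v))"
    using attach_ops(1)[OF k mstage_carrier[OF G] mstage_carrier[OF H] x] by simp
qed

lemma bdry_val_zero:
  assumes k: "k < rsh_length D" and x: "x \<in> rsh_bdry D (Suc k)"
  shows "bdry_val k m (\<lambda>l x. 0) x = 0"
  using space(3)[of "Suc k"] k by (intro finmat_eqI) (auto simp: bdry_val_def entries_0 attach_zero[OF k x] ent_unblk)

lemma bdry_val_supp: "supp (m * rsh_size D (Suc k)) (bdry_val k m G x)"
  by (simp add: bdry_val_def)

lemma bdry_val_continuous:
  assumes k: "k < rsh_length D" and G: "mstage k m G"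
  shows "continuous_map (subtopology (rsh_space D (Suc k)) (rsh_bdry D (Suc k))) euclidean (bdry_val k m G)"
proof (rule continuous_map_finmatI[OF bdry_val_supp])
  fix r s assume rs: "r < m * rsh_size D (Suc k)" "s < m * rsh_size D (Suc k)"
  have n: "0 < rsh_size D (Suc k)" using space(3)[of "Suc k"] k by simp
  show "continuous_map (subtopology (rsh_space D (Suc k)) (rsh_bdry D (Suc k))) euclidean (\<lambda>x. ent (bdry_val k m G x) r s)"
    using attach_carrier(2)[OF k mstage_carrier[OF G]] n rs by (simp add: bdry_val_def ent_unblk cont_entries_def)
qed

lemma summand_blk:
  assumes "continuous_map (rsh_space D l) euclidean g"
  shows "(\<lambda>x\<in>topspace (rsh_space D l). blk (rsh_size D l) (g x) i j) \<in> carrier (rsh_summand D l)"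
proof -
  have "cont_entries (rsh_space D l) (rsh_size D l) (\<lambda>x. blk (rsh_size D l) (g x) i j)"
    using assms by (auto simp: cont_entries_def blk_index intro: continuous_map_ent)
  then have "cont_entries (rsh_space D l) (rsh_size D l) (\<lambda>x\<in>topspace (rsh_space D l). blk (rsh_size D l) (g x) i j)"
    by (rule cont_entries_cong[rotated]) simp
  then show ?thesis unfolding rsh_summand_def cont_matrix_algebra_carrier by simp
qed

lemma continuous_of_blk:
  assumes "1 \<le> rsh_size D l" and s: "\<And>x. x \<in> topspace (rsh_space D l) \<Longrightarrow> supp (m * rsh_size D l) (g x)"
    and c: "\<And>i j. (\<lambda>x\<in>topspace (rsh_space D l). blk (rsh_size D l) (g x) i j) \<in> carrier (rsh_summand D l)"
  shows "continuous_map (rsh_space D l) euclidean g"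
proof (rule continuous_map_finmatI[OF s])
  fix r t
  let ?n = "rsh_size D l"
  have u: "r mod ?n < ?n" "t mod ?n < ?n" using assms(1) by auto
  then have "continuous_map (rsh_space D l) euclidean
     (\<lambda>x. (\<lambda>x\<in>topspace (rsh_space D l). blk ?n (g x) (r div ?n) (t div ?n)) x $$ (r mod ?n, t mod ?n))"
    using c[of "r div ?n" "t div ?n"] unfolding rsh_summand_def cont_matrix_algebra_carrier cont_entries_def by blast
  then show "continuous_map (rsh_space D l) euclidean (\<lambda>x. ent (g x) r t)"
    by (rule continuous_map_eq) (use u in \<open>simp add: blk_index div_mult_mod_eq\<close>)
qed

lemma mstage_0_iff:
  "mstage 0 m G \<longleftrightarrow> continuous_map (rsh_space D 0) euclidean (G 0) \<and>
     (\<forall>x\<in>topspace (rsh_space D 0). supp (m * rsh_size D 0) (G 0 x))"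
proof -
  have e: "entries 0 G i j \<in> rsh_stage_carrier D 0 \<longleftrightarrow>
     (\<lambda>x\<in>topspace (rsh_space D 0). blk (rsh_size D 0) (G 0 x) i j) \<in> carrier (rsh_summand D 0)" for i j
    by (auto simp: entries_def PiE_iff extensional_def)
  show ?thesis
    unfolding mstage_def e using summand_blk[of 0 "G 0"] continuous_of_blk[of 0 m "G 0"] space(3)[of 0] by auto
qed

text \<open>The recursion by which fields are constructed: a field over the stage \<open>k\<close> extends to the next stage by a
  continuous field on the next space with the right boundary values. The extension theorems of the
  preceding sections solve such boundary value problems.\<close>

lemma mstage_Suc_iff:
  assumes k: "k < rsh_length D"
  shows "mstage (Suc k) m G \<longleftrightarrow> mstage k m G \<and> continuous_map (rsh_space D (Suc k)) euclidean (G (Suc k)) \<and>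
     (\<forall>x\<in>topspace (rsh_space D (Suc k)). supp (m * rsh_size D (Suc k)) (G (Suc k) x)) \<and>
     (\<forall>x\<in>rsh_bdry D (Suc k). bdry_val k m G x = G (Suc k) x)"
proof -
  let ?n = "rsh_size D (Suc k)" and ?X = "rsh_space D (Suc k)" and ?B = "rsh_bdry D (Suc k)"
  have n: "1 \<le> ?n" using space(3)[of "Suc k"] k by simp
  have r: "restrict (entries (Suc k) G i j) {..k} = entries k G i j" for i j
    by (auto simp: entries_def fun_eq_iff restrict_def)
  have e: "entries (Suc k) G i j \<in> rsh_stage_carrier D (Suc k) \<longleftrightarrow>
      (\<lambda>x\<in>topspace ?X. blk ?n (G (Suc k) x) i j) \<in> carrier (rsh_summand D (Suc k)) \<and>
      entries k G i j \<in> rsh_stage_carrier D k \<and>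
      rsh_attach D (Suc k) (entries k G i j) = restrict (\<lambda>x\<in>topspace ?X. blk ?n (G (Suc k) x) i j) ?B" for i j
    unfolding stage_Suc_iff r by (auto simp: entries_def)
  show ?thesis
  proof
    assume G: "mstage (Suc k) m G"
    have supp: "supp (m * rsh_size D l) (G l x)" if "l \<le> Suc k" "x \<in> topspace (rsh_space D l)" for l x
      using mstage_supp[OF G that] .
    have c: "(\<lambda>x\<in>topspace ?X. blk ?n (G (Suc k) x) i j) \<in> carrier (rsh_summand D (Suc k))"
      and el: "entries k G i j \<in> rsh_stage_carrier D k"
      and at: "rsh_attach D (Suc k) (entries k G i j) = restrict (\<lambda>x\<in>topspace ?X. blk ?n (G (Suc k) x) i j) ?B" for i j
      using mstage_carrier[OF G, of i j] unfolding e by auto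
    have "mstage k m G" unfolding mstage_def using supp el by simp
    moreover have "continuous_map ?X euclidean (G (Suc k))"
      by (rule continuous_of_blk[OF n _ c, of m]) (use supp in simp)
    moreover have "bdry_val k m G x = G (Suc k) x" if x: "x \<in> ?B" for x
    proof -
      have xX: "x \<in> topspace ?X" by (rule bdry_subset[OF k x])
      have "bdry_val k m G x = unblk ?n m (blk ?n (G (Suc k) x))"
        unfolding bdry_val_def at using x xX by simp
      then show ?thesis using unblk_blk[OF supp[of "Suc k" x]] xX by simp
    qed
    ultimately show "mstage k m G \<and> continuous_map ?X euclidean (G (Suc k)) \<and>
     (\<forall>x\<in>topspace ?X. supp (m * ?n) (G (Suc k) x)) \<and> (\<forall>x\<in>?B. bdry_val k m G x = G (Suc k) x)" using supp by auto
  next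
    assume R: "mstage k m G \<and> continuous_map ?X euclidean (G (Suc k)) \<and>
     (\<forall>x\<in>topspace ?X. supp (m * ?n) (G (Suc k) x)) \<and> (\<forall>x\<in>?B. bdry_val k m G x = G (Suc k) x)"
    then have G: "mstage k m G" and s: "\<And>x. x \<in> topspace ?X \<Longrightarrow> supp (m * ?n) (G (Suc k) x)"
      and b: "\<And>x. x \<in> ?B \<Longrightarrow> bdry_val k m G x = G (Suc k) x" by auto
    have "entries (Suc k) G i j \<in> rsh_stage_carrier D (Suc k)" for i j
      unfolding e
    proof (intro conjI)
      show "(\<lambda>x\<in>topspace ?X. blk ?n (G (Suc k) x) i j) \<in> carrier (rsh_summand D (Suc k))"
        using R by (intro summand_blk) blast
      show el: "entries k G i j \<in> rsh_stage_carrier D k" by (rule mstage_carrier[OF G])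
      show "rsh_attach D (Suc k) (entries k G i j) = restrict (\<lambda>x\<in>topspace ?X. blk ?n (G (Suc k) x) i j) ?B"
      proof (rule extensionalityI[OF attach_carrier(1)[OF k el]])
        show "restrict (\<lambda>x\<in>topspace ?X. blk ?n (G (Suc k) x) i j) ?B \<in> extensional ?B" by (rule restrict_extensional)
        fix x assume x: "x \<in> ?B"
        have xX: "x \<in> topspace ?X" by (rule bdry_subset[OF k x])
        have "rsh_attach D (Suc k) (entries k G i j) x = blk ?n (G (Suc k) x) i j"
        proof (cases "i < m \<and> j < m")
          case True
          then have "rsh_attach D (Suc k) (entries k G i j) x = blk ?n (bdry_val k m G x) i j"
            unfolding bdry_val_def using attach_mat[OF k el x] by (subst blk_unblk) auto
          then show ?thesis using b[OF x] by simp
        next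
          case False
          have "entries k G i j = \<zero>\<^bsub>rsh_stage D k\<^esub>"
          proof -
            have "blk (rsh_size D l) (G l x) i j = 0\<^sub>m (rsh_size D l) (rsh_size D l)"
              if "l \<le> k" "x \<in> topspace (rsh_space D l)" for l x
              using False by (intro blk_outside[OF mstage_supp[OF G that]]) auto
            then show ?thesis by (auto simp: entries_def stage_simps(6) fun_eq_iff restrict_def)
          qed
          moreover have "blk ?n (G (Suc k) x) i j = 0\<^sub>m ?n ?n"
            using False by (intro blk_outside[OF s[OF xX]]) auto
          ultimately show ?thesis using attach_zero[OF k x] by simp
        qed
        then show "rsh_attach D (Suc k) (entries k G i j) x = restrict (\<lambda>x\<in>topspace ?X. blk ?n (G (Suc k) x) i j) ?B x"
          using x xX by simp
      qed
    qed
    moreover have "supp (m * rsh_size D l) (G l x)" if "l \<le> Suc k" "x \<in> topspace (rsh_space D l)" for l x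
      using that s mstage_supp[OF G] by (cases "l = Suc k") auto
    ultimately show "mstage (Suc k) m G" unfolding mstage_def by blast
  qed
qed

lemma mstage_down:
  assumes "mstage k m G" "k \<le> rsh_length D" "l \<le> k"
  shows "mstage l m G"
  using assms
proof (induction k)
  case (Suc k)
  then show ?case using mstage_Suc_iff[of k m G] by (cases "l = Suc k") auto
qed simp

lemma mstage_continuous:
  assumes "mstage k m G" "k \<le> rsh_length D" "l \<le> k"
  shows "continuous_map (rsh_space D l) euclidean (G l)"
proof -
  have "mstage l m G" by (rule mstage_down[OF assms])
  then show ?thesis
    using assms mstage_0_iff mstage_Suc_iff[of "l - 1" m G] by (cases l) auto
qed

lemma bdry_val_eq:
  assumes "mstage j m G" "j \<le> rsh_length D" "Suc k \<le> j" "x \<in> rsh_bdry D (Suc k)"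
  shows "bdry_val k m G x = G (Suc k) x"
proof -
  have "mstage (Suc k) m G" by (rule mstage_down[OF assms(1-3)])
  then show ?thesis using mstage_Suc_iff[of k m G] assms by auto
qed

lemma bdry_val_skew:
  assumes k: "k < rsh_length D" and x: "x \<in> rsh_bdry D (Suc k)" and S: "mstage k m S"
    and skew: "\<And>l x. l \<le> k \<Longrightarrow> x \<in> topspace (rsh_space D l) \<Longrightarrow> adj (S l x) = - S l x"
  shows "adj (bdry_val k m S x) = - bdry_val k m S x"
proof -
  have "adj (bdry_val k m S x) = bdry_val k m (\<lambda>l x. adj (S l x)) x" by (rule bdry_val_adj[OF k x S, symmetric])
  also have "\<dots> = bdry_val k m (\<lambda>l x. csc (- 1) (S l x)) x"
    using skew by (intro bdry_val_cong) (simp add: csc_uminus_left)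
  also have "\<dots> = csc (- 1) (bdry_val k m S x)" by (rule bdry_val_csc[OF k x S])
  also have "\<dots> = - bdry_val k m S x" by (simp add: csc_uminus_left)
  finally show ?thesis .
qed

text \<open>A \<open>*\<close>-homomorphism commutes with the Cayley transform, because the latter is characterized by an
  algebraic equation. The analogous statement for the inverse of \<open>1 - S\<close> would involve units, which
  the quasi-inverse form of the transform avoids.\<close>

lemma bdry_val_cayley:
  assumes k: "k < rsh_length D" and x: "x \<in> rsh_bdry D (Suc k)" and S: "mstage k m S"
    and skew: "\<And>l x. l \<le> k \<Longrightarrow> x \<in> topspace (rsh_space D l) \<Longrightarrow> adj (S l x) = - S l x"
    and T: "mstage k m (\<lambda>l x. cayley (S l x))"
  shows "bdry_val k m (\<lambda>l x. cayley (S l x)) x = cayley (bdry_val k m S x)"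
proof (rule cayley_unique[symmetric, OF bdry_val_skew[OF k x S skew]])
  have k': "k \<le> rsh_length D" using k by simp
  have "bdry_val k m (\<lambda>l x. cayley (S l x)) x = bdry_val k m (\<lambda>l x. S l x + S l x + S l x * cayley (S l x)) x"
    by (intro bdry_val_cong cayley_left skew)
  also have "\<dots> = bdry_val k m S x + bdry_val k m S x + bdry_val k m S x * bdry_val k m (\<lambda>l x. cayley (S l x)) x"
    using bdry_val_add[OF k x mstage_add[OF k' S S] mstage_mult[OF k' S T]] bdry_val_add[OF k x S S] bdry_val_mult[OF k x S T] by simp
  finally show "bdry_val k m (\<lambda>l x. cayley (S l x)) x =
      bdry_val k m S x + bdry_val k m S x + bdry_val k m S x * bdry_val k m (\<lambda>l x. cayley (S l x)) x" .
qed

lemma mstage_cayley: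
  assumes "k \<le> rsh_length D" "mstage k m S"
    and "\<And>l x. l \<le> k \<Longrightarrow> x \<in> topspace (rsh_space D l) \<Longrightarrow> adj (S l x) = - S l x"
  shows "mstage k m (\<lambda>l x. cayley (S l x))"
  using assms
proof (induction k)
  case 0
  then show ?case unfolding mstage_0_iff
    by (auto intro!: supp_cayley continuous_map_cayley[where N = "m * rsh_size D 0"])
next
  case (Suc k)
  have k: "k < rsh_length D" using Suc.prems(1) by simp
  have S: "mstage k m S" and c: "continuous_map (rsh_space D (Suc k)) euclidean (S (Suc k))"
    and b: "\<And>x. x \<in> rsh_bdry D (Suc k) \<Longrightarrow> bdry_val k m S x = S (Suc k) x"
    using Suc.prems(2) unfolding mstage_Suc_iff[OF k] by auto
  have s: "adj (S (Suc k) x) = - S (Suc k) x \<and> supp (m * rsh_size D (Suc k)) (S (Suc k) x)"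
    if "x \<in> topspace (rsh_space D (Suc k))" for x
    using Suc.prems(3)[of "Suc k" x] mstage_supp[OF Suc.prems(2), of "Suc k" x] that by simp
  have T: "mstage k m (\<lambda>l x. cayley (S l x))" using Suc.IH S Suc.prems(3) k by simp
  show ?case unfolding mstage_Suc_iff[OF k]
  proof (intro conjI ballI)
    show "mstage k m (\<lambda>l x. cayley (S l x))" by (rule T)
    show "continuous_map (rsh_space D (Suc k)) euclidean (\<lambda>x. cayley (S (Suc k) x))"
      by (rule continuous_map_cayley[OF c s])
    show "supp (m * rsh_size D (Suc k)) (cayley (S (Suc k) x))" if "x \<in> topspace (rsh_space D (Suc k))" for x
      using s[OF that] by (intro supp_cayley) auto
    show "bdry_val k m (\<lambda>l x. cayley (S l x)) x = cayley (S (Suc k) x)" if x: "x \<in> rsh_bdry D (Suc k)" for x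
      using bdry_val_cayley[OF k x S _ T] Suc.prems(3) b[OF x] by simp
  qed
qed

lemma mstage_chain:
  assumes k: "k \<le> rsh_length D" and a: "mstage k m a"
    and S: "\<And>S. S \<in> set Ss \<Longrightarrow> mstage k m S"
    and skew: "\<And>S l x. S \<in> set Ss \<Longrightarrow> l \<le> k \<Longrightarrow> x \<in> topspace (rsh_space D l) \<Longrightarrow> adj (S l x) = - S l x"
  shows "mstage k m (\<lambda>l x. chain (map (\<lambda>S. S l x) Ss) (a l x)) \<and>
    (k < rsh_length D \<longrightarrow> (\<forall>x\<in>rsh_bdry D (Suc k).
       bdry_val k m (\<lambda>l x. chain (map (\<lambda>S. S l x) Ss) (a l x)) x = chain (map (\<lambda>S. bdry_val k m S x) Ss) (bdry_val k m a x)))"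
  using a S skew
proof (induction Ss arbitrary: a)
  case (Cons S Ss)
  have SS: "mstage k m S" using Cons.prems(2) by simp
  have T: "mstage k m (\<lambda>l x. cayley (S l x))"
    by (rule mstage_cayley[OF k SS]) (use Cons.prems(3) in simp)
  define a' where "a' l x = a l x + cayley (S l x) * a l x" for l x
  have a': "mstage k m a'"
    unfolding a'_def by (intro mstage_add mstage_mult k T Cons.prems(1))
  have "bdry_val k m a' x = bdry_val k m a x + cayley (bdry_val k m S x) * bdry_val k m a x" if "k < rsh_length D" "x \<in> rsh_bdry D (Suc k)" for x
  proof -
    have "bdry_val k m (\<lambda>l x. cayley (S l x)) x = cayley (bdry_val k m S x)"
      by (rule bdry_val_cayley[OF that SS _ T]) (use Cons.prems(3) in simp)
    then show ?thesis
      unfolding a'_def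
      using bdry_val_add[OF that Cons.prems(1) mstage_mult[OF k T Cons.prems(1)]] bdry_val_mult[OF that T Cons.prems(1)] by simp
  qed
  moreover have "mstage k m (\<lambda>l x. chain (map (\<lambda>S. S l x) Ss) (a' l x)) \<and>
    (k < rsh_length D \<longrightarrow> (\<forall>x\<in>rsh_bdry D (Suc k).
       bdry_val k m (\<lambda>l x. chain (map (\<lambda>S. S l x) Ss) (a' l x)) x = chain (map (\<lambda>S. bdry_val k m S x) Ss) (bdry_val k m a' x)))"
    by (rule Cons.IH[OF a']) (use Cons.prems in simp_all)
  ultimately show ?case by (simp add: a'_def)
qed simp

section \<open>Induction over the stages\<close>

definition mproj :: "nat \<Rightarrow> (nat \<Rightarrow> 'x \<Rightarrow> finmat) \<Rightarrow> bool" where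
  "mproj m p \<longleftrightarrow> mstage (rsh_length D) m p \<and>
     (\<forall>l\<le>rsh_length D. \<forall>x\<in>topspace (rsh_space D l). proj (p l x))"

lemma mproj_field:
  assumes "mproj m p" "l \<le> rsh_length D"
  shows "proj_field (rsh_space D l) (m * rsh_size D l) (p l)"
  using assms mstage_continuous[of "rsh_length D" m p l] mstage_supp[of "rsh_length D" m p l]
  by (auto simp: mproj_def proj_field_def)

text \<open>An isometry over the stage \<open>k\<close> has boundary values that form an isometry into \<open>p\<close>, and these are extended over
  the next space.\<close>

lemma stage_isometry:
  assumes p: "mproj m p" and q: "mproj m q"
    and dim: "\<And>l. l \<le> rsh_length D \<Longrightarrow> compact_dim (rsh_space D l) (d l)"
    and rank: "\<And>l x. l \<le> rsh_length D \<Longrightarrow> x \<in> topspace (rsh_space D l) \<Longrightarrow>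
       q l x = 0 \<or> 2 * Re (tr (q l x)) + real (d l) \<le> 2 * Re (tr (p l x)) + 1"
    and k: "k \<le> rsh_length D"
  shows "\<exists>v. mstage k m v \<and>
     (\<forall>l\<le>k. \<forall>x\<in>topspace (rsh_space D l). adj (v l x) * v l x = q l x \<and> p l x * v l x = v l x)"
  using k
proof (induction k)
  case 0
  have 0: "0 \<le> rsh_length D" by simp
  have "isometry_field (subtopology (rsh_space D 0) {}) (q 0) (p 0) (\<lambda>_. 0)"
    by (simp add: isometry_field_def)
  from extend_isometry[OF dim[OF 0] closedin_empty mproj_field[OF p 0] mproj_field[OF q 0] rank[OF 0] this]
  obtain v where v: "isometry_field (rsh_space D 0) (q 0) (p 0) v" by blast
  have "mstage 0 m (\<lambda>_. v)"
    unfolding mstage_0_iff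
  proof (intro conjI ballI)
    show "continuous_map (rsh_space D 0) euclidean v" using v by (simp add: isometry_field_def)
    fix x assume x: "x \<in> topspace (rsh_space D 0)"
    show "supp (m * rsh_size D 0) (v x)"
      using v x mproj_field[OF p 0] mproj_field[OF q 0] supp_isometry[of "q 0 x" "v x" "p 0 x"]
      by (auto simp: isometry_field_def proj_field_def)
  qed
  then show ?case using v by (intro exI[of _ "\<lambda>_. v"]) (simp add: isometry_field_def)
next
  case (Suc k)
  have k: "k < rsh_length D" "k \<le> rsh_length D" "Suc k \<le> rsh_length D" using Suc.prems by auto
  let ?X = "rsh_space D (Suc k)" and ?B = "rsh_bdry D (Suc k)"
  obtain v where v: "mstage k m v"
     "\<And>l x. l \<le> k \<Longrightarrow> x \<in> topspace (rsh_space D l) \<Longrightarrow> adj (v l x) * v l x = q l x \<and> p l x * v l x = v l x"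
    using Suc.IH k by blast
  have ps: "mstage (rsh_length D) m p" and qs: "mstage (rsh_length D) m q" using p q by (auto simp: mproj_def)
  have pk: "mstage k m p" and qk: "mstage k m q" using mstage_down[OF ps] mstage_down[OF qs] k by auto
  have bp: "bdry_val k m p x = p (Suc k) x" and bq: "bdry_val k m q x = q (Suc k) x" if "x \<in> ?B" for x
    using bdry_val_eq[OF ps _ k(3) that] bdry_val_eq[OF qs _ k(3) that] by auto
  have "isometry_field (subtopology ?X ?B) (q (Suc k)) (p (Suc k)) (bdry_val k m v)"
    unfolding isometry_field_def topspace_bdry[OF k(1)]
  proof (intro conjI ballI)
    show "continuous_map (subtopology ?X ?B) euclidean (bdry_val k m v)" by (rule bdry_val_continuous[OF k(1) v(1)])
    fix x assume x: "x \<in> ?B"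
    have "adj (bdry_val k m v x) * bdry_val k m v x = bdry_val k m (\<lambda>l x. adj (v l x) * v l x) x"
      using bdry_val_mult[OF k(1) x mstage_adj[OF k(2) v(1)] v(1)] bdry_val_adj[OF k(1) x v(1)] by simp
    also have "\<dots> = bdry_val k m q x" using v(2) by (intro bdry_val_cong) simp
    finally show "adj (bdry_val k m v x) * bdry_val k m v x = q (Suc k) x" using bq[OF x] by simp
    have "p (Suc k) x * bdry_val k m v x = bdry_val k m (\<lambda>l x. p l x * v l x) x"
      using bdry_val_mult[OF k(1) x pk v(1)] bp[OF x] by simp
    also have "\<dots> = bdry_val k m v x" using v(2) by (intro bdry_val_cong) simp
    finally show "p (Suc k) x * bdry_val k m v x = bdry_val k m v x" .
  qed
  from extend_isometry[OF dim[OF k(3)] bdry_closed[OF k(1)] mproj_field[OF p k(3)] mproj_field[OF q k(3)] rank[OF k(3)] this]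
  obtain u where u: "isometry_field ?X (q (Suc k)) (p (Suc k)) u" "\<forall>x\<in>?B. u x = bdry_val k m v x" by blast
  define w where "w = v(Suc k := u)"
  have wv: "w l x = v l x" if "l \<le> k" for l x using that by (simp add: w_def)
  have "mstage (Suc k) m w"
    unfolding mstage_Suc_iff[OF k(1)]
  proof (intro conjI ballI)
    show "mstage k m w" by (rule mstage_cong[OF _ v(1)]) (simp add: wv)
    show "continuous_map ?X euclidean (w (Suc k))" using u(1) by (simp add: w_def isometry_field_def)
    show "supp (m * rsh_size D (Suc k)) (w (Suc k) x)" if x: "x \<in> topspace ?X" for x
      using u(1) x mproj_field[OF p k(3)] mproj_field[OF q k(3)] supp_isometry[of "q (Suc k) x" "u x" "p (Suc k) x"]
      by (auto simp: isometry_field_def proj_field_def w_def)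
    show "bdry_val k m w x = w (Suc k) x" if x: "x \<in> ?B" for x
    proof -
      have "bdry_val k m w x = bdry_val k m v x" by (rule bdry_val_cong) (simp add: wv)
      then show ?thesis using u(2) x by (simp add: w_def)
    qed
  qed
  moreover have "adj (w l x) * w l x = q l x \<and> p l x * w l x = w l x"
    if "l \<le> Suc k" "x \<in> topspace (rsh_space D l)" for l x
    using that v(2)[of l x] u(1) by (cases "l = Suc k") (auto simp: w_def isometry_field_def)
  ultimately show ?case by blast
qed

definition skew_in :: "nat \<Rightarrow> nat \<Rightarrow> (nat \<Rightarrow> 'x \<Rightarrow> finmat) \<Rightarrow> (nat \<Rightarrow> 'x \<Rightarrow> finmat) \<Rightarrow> bool" where
  "skew_in k m F S \<longleftrightarrow> mstage k m S \<and> (\<forall>l\<le>k. \<forall>x\<in>topspace (rsh_space D l).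
     adj (S l x) = - S l x \<and> F l x * S l x = S l x \<and> S l x * F l x = S l x)"

text \<open>The chain found over the stage \<open>k\<close> is carried to the next space by extending the boundary values of its
  parameters, which is possible since these are skew-adjoint rather than unitary. It moves \<open>t\<close> to a field
  that agrees with \<open>s\<close> on the boundary, and a second chain, trivial on the boundary, moves this to \<open>s\<close>;
  being trivial on the boundary, its parameters extend by \<open>0\<close> to the earlier spaces.\<close>

lemma stage_move:
  assumes F: "mproj m F" and q: "mproj m q"
    and dim: "\<And>l. l \<le> rsh_length D \<Longrightarrow> compact_dim (rsh_space D l) (d l)"
    and rank: "\<And>l x. l \<le> rsh_length D \<Longrightarrow> x \<in> topspace (rsh_space D l) \<Longrightarrow>
       2 * Re (tr (q l x)) + real (d l) \<le> 2 * Re (tr (F l x))"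
    and t: "mstage (rsh_length D) m t" and s: "mstage (rsh_length D) m s"
    and iso: "\<And>l x. l \<le> rsh_length D \<Longrightarrow> x \<in> topspace (rsh_space D l) \<Longrightarrow>
       adj (t l x) * t l x = q l x \<and> F l x * t l x = t l x \<and> adj (s l x) * s l x = q l x \<and> F l x * s l x = s l x"
    and k: "k \<le> rsh_length D"
  shows "\<exists>Ss. (\<forall>S\<in>set Ss. skew_in k m F S) \<and>
     (\<forall>l\<le>k. \<forall>x\<in>topspace (rsh_space D l). chain (map (\<lambda>S. S l x) Ss) (t l x) = s l x)"
  using k
proof (induction k)
  case 0
  have 0: "0 \<le> rsh_length D" by simp
  have "isometry_field (rsh_space D 0) (q 0) (F 0) (t 0)" "isometry_field (rsh_space D 0) (q 0) (F 0) (s 0)"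
    using mstage_continuous[OF t _ 0] mstage_continuous[OF s _ 0] iso[OF 0] by (auto simp: isometry_field_def)
  from move_isometry[OF dim[OF 0] closedin_empty mproj_field[OF F 0] mproj_field[OF q 0] rank[OF 0] this]
  obtain Rs where Rs: "skew_fields (rsh_space D 0) {} (F 0) Rs"
     "\<forall>x\<in>topspace (rsh_space D 0). chain_at Rs x (t 0 x) = s 0 x" by blast
  define Ss :: "(nat \<Rightarrow> 'x \<Rightarrow> finmat) list" where "Ss = map (\<lambda>R l. R) Rs"
  have "skew_in 0 m F S" if S: "S \<in> set Ss" for S
  proof -
    obtain R where R: "R \<in> set Rs" "S = (\<lambda>l. R)" using S by (auto simp: Ss_def)
    have Rx: "adj (R x) = - R x \<and> F 0 x * R x = R x \<and> R x * F 0 x = R x" if "x \<in> topspace (rsh_space D 0)" for x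
      using Rs(1) R(1) that by (auto simp: skew_fields_def)
    have "mstage 0 m S"
      unfolding mstage_0_iff R(2)
    proof (intro conjI ballI)
      show "continuous_map (rsh_space D 0) euclidean R" using Rs(1) R(1) by (auto simp: skew_fields_def)
      show "supp (m * rsh_size D 0) (R x)" if "x \<in> topspace (rsh_space D 0)" for x
      proof -
        have "supp (m * rsh_size D 0) (F 0 x)" using mproj_field[OF F 0] that by (simp add: proj_field_def)
        then show ?thesis using Rx[OF that] supp_of_compressed by blast
      qed
    qed
    then show ?thesis using Rx by (simp add: skew_in_def R(2))
  qed
  moreover have "map (\<lambda>S. S 0 x) Ss = map (\<lambda>S. S x) Rs" for x by (simp add: Ss_def)
  ultimately show ?case using Rs(2) by (intro exI[of _ Ss]) simp
next
  case (Suc k)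
  have k: "k < rsh_length D" "k \<le> rsh_length D" "Suc k \<le> rsh_length D" using Suc.prems by auto
  let ?X = "rsh_space D (Suc k)" and ?B = "rsh_bdry D (Suc k)"
  note X = dim[OF k(3)] and B = bdry_closed[OF k(1)] and FX = mproj_field[OF F k(3)] and qX = mproj_field[OF q k(3)]
  obtain Ss where Ss: "\<forall>S\<in>set Ss. skew_in k m F S"
     "\<forall>l\<le>k. \<forall>x\<in>topspace (rsh_space D l). chain (map (\<lambda>S. S l x) Ss) (t l x) = s l x"
    using Suc.IH k by blast
  have Fs: "mstage (rsh_length D) m F" using F by (auto simp: mproj_def)
  have Fk: "mstage k m F" and tk: "mstage k m t" using mstage_down[OF Fs] mstage_down[OF t] k by auto
  have bF: "bdry_val k m F x = F (Suc k) x" and bt: "bdry_val k m t x = t (Suc k) x" and bs: "bdry_val k m s x = s (Suc k) x" if "x \<in> ?B" for x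
    using bdry_val_eq[OF Fs _ k(3) that] bdry_val_eq[OF t _ k(3) that] bdry_val_eq[OF s _ k(3) that] by auto
  have "\<forall>S\<in>set Ss. \<exists>S'. skew_fields ?X {} (F (Suc k)) [S'] \<and> (\<forall>x\<in>?B. S' x = bdry_val k m S x)"
  proof
    fix S assume "S \<in> set Ss"
    then have S: "mstage k m S" and Sx: "\<And>l x. l \<le> k \<Longrightarrow> x \<in> topspace (rsh_space D l) \<Longrightarrow>
       adj (S l x) = - S l x \<and> F l x * S l x = S l x \<and> S l x * F l x = S l x"
      using Ss(1) by (auto simp: skew_in_def)
    have "skew_fields (subtopology ?X ?B) ({} \<inter> ?B) (F (Suc k)) [bdry_val k m S]"
      unfolding skew_fields_def topspace_bdry[OF k(1)]
    proof (intro ballI conjI)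
      fix S1 assume "S1 \<in> set [bdry_val k m S]"
      then have S1: "S1 = bdry_val k m S" by simp
      show "continuous_map (subtopology ?X ?B) euclidean S1" unfolding S1 by (rule bdry_val_continuous[OF k(1) S])
      show "S1 x = 0" if "x \<in> {} \<inter> ?B" for x using that by simp
      fix x assume x: "x \<in> ?B"
      show "adj (S1 x) = - S1 x" unfolding S1 by (rule bdry_val_skew[OF k(1) x S]) (use Sx in simp)
      have "F (Suc k) x * bdry_val k m S x = bdry_val k m (\<lambda>l x. F l x * S l x) x"
        using bdry_val_mult[OF k(1) x Fk S] bF[OF x] by simp
      also have "\<dots> = bdry_val k m S x" using Sx by (intro bdry_val_cong) simp
      finally show "F (Suc k) x * S1 x = S1 x" unfolding S1 .
      have "bdry_val k m S x * F (Suc k) x = bdry_val k m (\<lambda>l x. S l x * F l x) x"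
        using bdry_val_mult[OF k(1) x S Fk] bF[OF x] by simp
      also have "\<dots> = bdry_val k m S x" using Sx by (intro bdry_val_cong) simp
      finally show "S1 x * F (Suc k) x = S1 x" unfolding S1 .
    qed
    from extend_skew[OF X closedin_empty B FX this]
    show "\<exists>S'. skew_fields ?X {} (F (Suc k)) [S'] \<and> (\<forall>x\<in>?B. S' x = bdry_val k m S x)" .
  qed
  from bchoice[OF this] obtain h where
    h: "\<forall>S\<in>set Ss. skew_fields ?X {} (F (Suc k)) [h S] \<and> (\<forall>x\<in>?B. h S x = bdry_val k m S x)" ..
  have hs: "skew_fields ?X {} (F (Suc k)) (map h Ss)" using h by (auto simp: skew_fields_def)
  define t1 where "t1 x = chain_at (map h Ss) x (t (Suc k) x)" for x
  have t1: "isometry_field ?X (q (Suc k)) (F (Suc k)) t1"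
    unfolding isometry_field_def
  proof (intro conjI ballI)
    show "continuous_map ?X euclidean t1"
      unfolding t1_def by (rule continuous_map_chain_at[OF hs FX mstage_continuous[OF t _ k(3)]]) simp
    fix x assume x: "x \<in> topspace ?X"
    note hx = skew_fields_at[OF hs x]
    show "adj (t1 x) * t1 x = q (Suc k) x"
      unfolding t1_def using hx iso[OF k(3) x] by (subst chain_isometry) auto
    show "F (Suc k) x * t1 x = t1 x"
      unfolding t1_def using hx iso[OF k(3) x] by (intro chain_in) auto
  qed
  have s1: "isometry_field ?X (q (Suc k)) (F (Suc k)) (s (Suc k))"
    using mstage_continuous[OF s _ k(3)] iso[OF k(3)] by (auto simp: isometry_field_def)
  have eq: "\<forall>x\<in>?B. t1 x = s (Suc k) x"
  proof
    fix x assume x: "x \<in> ?B"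
    have "map (\<lambda>S. S x) (map h Ss) = map (\<lambda>S. bdry_val k m S x) Ss" using h x by simp
    then have "t1 x = chain (map (\<lambda>S. bdry_val k m S x) Ss) (bdry_val k m t x)" unfolding t1_def bt[OF x] by (rule arg_cong)
    also have "\<dots> = bdry_val k m (\<lambda>l x. chain (map (\<lambda>S. S l x) Ss) (t l x)) x"
      using mstage_chain[OF k(2) tk, of Ss] Ss(1) k(1) x by (simp add: skew_in_def)
    also have "\<dots> = bdry_val k m s x" using Ss(2) by (intro bdry_val_cong) simp
    finally show "t1 x = s (Suc k) x" using bs[OF x] by simp
  qed
  obtain Rs where Rs: "skew_fields ?X ?B (F (Suc k)) Rs" "\<forall>x\<in>topspace ?X. chain_at Rs x (t1 x) = s (Suc k) x"
    using move_isometry[OF X B FX qX rank[OF k(3)] t1 s1 eq] by blast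
  \<comment> \<open>parameters of the first kind come from the stage \<open>k\<close> and are continued by \<open>h\<close>; those of the second kind
     live on the next space and are continued by \<open>0\<close>\<close>
  define e1 where "e1 S = S(Suc k := h S)" for S
  define e2 where "e2 R l = (if l = Suc k then R else (\<lambda>x. 0))" for R :: "'x \<Rightarrow> finmat" and l
  define Ts where "Ts = map e1 Ss @ map e2 Rs"
  have inX: "skew_in (Suc k) m F T"
    if Tk: "skew_in k m F T" and TX: "skew_fields ?X {} (F (Suc k)) [T (Suc k)]" and Tb: "\<forall>x\<in>?B. T (Suc k) x = bdry_val k m T x" for T
  proof -
    have Tx: "adj (T (Suc k) x) = - T (Suc k) x \<and> F (Suc k) x * T (Suc k) x = T (Suc k) x \<and> T (Suc k) x * F (Suc k) x = T (Suc k) x"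
      if "x \<in> topspace ?X" for x using TX that by (simp add: skew_fields_def)
    have "mstage (Suc k) m T"
      unfolding mstage_Suc_iff[OF k(1)]
    proof (intro conjI ballI)
      show "mstage k m T" using Tk by (simp add: skew_in_def)
      show "continuous_map ?X euclidean (T (Suc k))" using TX by (simp add: skew_fields_def)
      show "supp (m * rsh_size D (Suc k)) (T (Suc k) x)" if "x \<in> topspace ?X" for x
      proof -
        have "supp (m * rsh_size D (Suc k)) (F (Suc k) x)" using FX that by (simp add: proj_field_def)
        then show ?thesis using Tx[OF that] supp_of_compressed by blast
      qed
      show "bdry_val k m T x = T (Suc k) x" if "x \<in> ?B" for x using Tb that by simp
    qed
    moreover have "adj (T l x) = - T l x \<and> F l x * T l x = T l x \<and> T l x * F l x = T l x"
      if "l \<le> Suc k" "x \<in> topspace (rsh_space D l)" for l x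
      using that Tx Tk by (cases "l = Suc k") (auto simp: skew_in_def)
    ultimately show ?thesis unfolding skew_in_def by blast
  qed
  have skew_cong: "skew_in k m F T" if "\<And>l x. l \<le> k \<Longrightarrow> S l x = T l x" "skew_in k m F S" for S T
    using that mstage_cong[of k S T m] by (simp add: skew_in_def)
  have "skew_in (Suc k) m F T" if T: "T \<in> set Ts" for T
  proof -
    from T consider S where "S \<in> set Ss" "T = e1 S" | R where "R \<in> set Rs" "T = e2 R" by (auto simp: Ts_def)
    then show ?thesis
    proof cases
      case (1 S)
      show ?thesis
      proof (rule inX)
        show "skew_in k m F T" by (rule skew_cong[of S]) (use 1 Ss(1) in \<open>auto simp: e1_def\<close>)
        show "skew_fields ?X {} (F (Suc k)) [T (Suc k)]" using h 1 by (simp add: e1_def)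
        have "bdry_val k m T x = bdry_val k m S x" for x by (rule bdry_val_cong) (use 1 in \<open>simp add: e1_def\<close>)
        then show "\<forall>x\<in>?B. T (Suc k) x = bdry_val k m T x" using h 1 by (simp add: e1_def)
      qed
    next
      case (2 R)
      show ?thesis
      proof (rule inX)
        have "skew_in k m F (\<lambda>l x. 0)" using mstage_zero[OF k(2)] by (simp add: skew_in_def)
        then show "skew_in k m F T" by (rule skew_cong[rotated]) (use 2 in \<open>auto simp: e2_def\<close>)
        show "skew_fields ?X {} (F (Suc k)) [T (Suc k)]" using Rs(1) 2 by (simp add: e2_def skew_fields_def)
        have "bdry_val k m T x = bdry_val k m (\<lambda>l x. 0) x" for x by (rule bdry_val_cong) (use 2 in \<open>simp add: e2_def\<close>)
        then show "\<forall>x\<in>?B. T (Suc k) x = bdry_val k m T x"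
          using bdry_val_zero[OF k(1)] Rs(1) 2 by (auto simp: e2_def skew_fields_def)
      qed
    qed
  qed
  moreover have "chain (map (\<lambda>S. S l x) Ts) (t l x) = s l x" if l: "l \<le> Suc k" and x: "x \<in> topspace (rsh_space D l)" for l x
  proof (cases "l = Suc k")
    case True
    have "map (\<lambda>S. S l x) Ts = map (\<lambda>S. S x) (map h Ss) @ map (\<lambda>S. S x) Rs"
      using True by (simp add: Ts_def e1_def e2_def)
    then show ?thesis using Rs(2) x True by (simp add: t1_def)
  next
    case False
    have "map (\<lambda>S. S l x) Ts = map (\<lambda>S. S l x) Ss @ map (\<lambda>S. 0) Rs"
      using False by (simp add: Ts_def e1_def e2_def)
    moreover have "chain (map (\<lambda>S. 0) Rs) a = a" for a by (rule chain_zero) auto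
    ultimately show ?thesis using Ss(2) x l False by simp
  qed
  ultimately show ?case by blast
qed

end

section \<open>Matrices over the algebra\<close>

lift_definition shift :: "nat \<Rightarrow> nat \<Rightarrow> finmat \<Rightarrow> finmat" is
  "\<lambda>(a::nat) (b::nat) A i j. if a \<le> i \<and> b \<le> j then A (i - a) (j - b) else 0"
proof -
  fix a b :: nat and A :: "nat \<Rightarrow> nat \<Rightarrow> complex"
  assume "\<exists>N. \<forall>i j. N \<le> i \<or> N \<le> j \<longrightarrow> A i j = 0"
  then obtain N where N: "\<forall>i j. N \<le> i \<or> N \<le> j \<longrightarrow> A i j = 0" ..
  have "A (i - a) (j - b) = 0" if "N + a + b \<le> i \<or> N + a + b \<le> j" for i j
    by (rule N[rule_format]) (use that in linarith)
  then show "\<exists>N. \<forall>i j. N \<le> i \<or> N \<le> j \<longrightarrow> (if a \<le> i \<and> b \<le> j then A (i - a) (j - b) else 0) = 0"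
    by (intro exI[of _ "N + a + b"]) simp
qed

lemma ent_shift: "ent (shift a b A) i j = (if a \<le> i \<and> b \<le> j then ent A (i - a) (j - b) else 0)"
  by transfer simp

lemma adj_shift: "adj (shift a b A) = shift b a (adj A)"
  by (rule finmat_eqI) (auto simp: ent_shift)

lemma mult_shift_zero: "supp a e \<Longrightarrow> e * shift a b A = 0"
  by (rule finmat_eqI) (simp add: ent_mult[of a] ent_shift)

lemma shift_mult_shift: "shift a b A * shift b c B = shift a c (A * B)"
proof (rule finmat_eqI)
  fix i j
  obtain N where N: "supp N A" using ex_supp by blast
  have s: "supp (b + (a + N)) (shift a b A)"
    using N by (auto simp: supp_def ent_shift)
  have s': "supp (a + N) A" using supp_mono[OF N] by simp
  have "ent (shift a b A * shift b c B) i j = (\<Sum>k<b + (a + N). ent (shift a b A) i k * ent (shift b c B) k j)"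
    by (rule ent_mult[OF disjI1[OF s]])
  also have "\<dots> = (\<Sum>k\<in>{b..<b + (a + N)}. ent (shift a b A) i k * ent (shift b c B) k j)"
    by (rule sum.mono_neutral_right) (auto simp: ent_shift)
  also have "\<dots> = (\<Sum>k<a + N. ent (shift a b A) i (k + b) * ent (shift b c B) (k + b) j)"
    using sum.shift_bounds_nat_ivl[of "\<lambda>k. ent (shift a b A) i k * ent (shift b c B) k j" 0 b "a + N"]
    by (simp add: add.commute[of b] lessThan_atLeast0)
  also have "\<dots> = ent (shift a c (A * B)) i j"
    by (simp add: ent_shift ent_mult[OF disjI1[OF s']])
  finally show "ent (shift a b A * shift b c B) i j = ent (shift a c (A * B)) i j" .
qed

lemma matrices_mono: "a \<in> matrices A m \<Longrightarrow> m \<le> m' \<Longrightarrow> a \<in> matrices A m'"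
  by (auto simp: matrices_def)

context rsh
begin

abbreviation len :: nat where "len \<equiv> rsh_length D"

text \<open>The field of a matrix over the algebra, inverse to \<open>entries\<close>.\<close>

definition mat_field :: "nat \<Rightarrow> (nat \<Rightarrow> nat \<Rightarrow> nat \<Rightarrow> 'x \<Rightarrow> complex mat) \<Rightarrow> nat \<Rightarrow> 'x \<Rightarrow> finmat" where
  "mat_field m a l x = unblk (rsh_size D l) m (\<lambda>i j. a i j l x)"

lemma matrices_carrier: "a \<in> matrices (rsh_algebra D) m \<Longrightarrow> a i j \<in> rsh_stage_carrier D len"
  by (auto simp: matrices_def rsh_algebra_def stage_simps)

lemma matrices_outside: "a \<in> matrices (rsh_algebra D) m \<Longrightarrow> m \<le> i \<or> m \<le> j \<Longrightarrow> a i j = \<zero>\<^bsub>rsh_stage D len\<^esub>"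
  by (auto simp: matrices_def rsh_algebra_def)

lemma zero_at: "l \<le> len \<Longrightarrow> x \<in> topspace (rsh_space D l) \<Longrightarrow>
    \<zero>\<^bsub>rsh_stage D len\<^esub> l x = 0\<^sub>m (rsh_size D l) (rsh_size D l)"
  by (simp add: stage_simps(6))

lemma entries_mat_field:
  assumes a: "a \<in> matrices (rsh_algebra D) m"
  shows "entries len (mat_field m a) = a"
proof (intro ext[of "entries len (mat_field m a)"] ext)
  fix i j l x
  have "a i j = entries len (mat_field m a) i j"
  proof (rule stage_eq_entries[OF matrices_carrier[OF a]])
    fix l x assume l: "l \<le> len" and x: "x \<in> topspace (rsh_space D l)"
    have s: "supp (m * rsh_size D l) (mat_field m a l x)" by (simp add: mat_field_def)
    show "a i j l x = blk (rsh_size D l) (mat_field m a l x) i j"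
    proof (cases "i < m \<and> j < m")
      case True
      then show ?thesis
        unfolding mat_field_def using stage_mat[OF matrices_carrier[OF a] l x] by (subst blk_unblk) auto
    next
      case False
      then have "m \<le> i \<or> m \<le> j" by auto
      then show ?thesis using blk_outside[OF s] matrices_outside[OF a] zero_at[OF l x] by simp
    qed
  qed
  then show "entries len (mat_field m a) i j l x = a i j l x" by simp
qed

lemma mstage_mat_field:
  assumes a: "a \<in> matrices (rsh_algebra D) m"
  shows "mstage len m (mat_field m a)"
  unfolding mstage_def entries_mat_field[OF a] using matrices_carrier[OF a] by (simp add: mat_field_def)

lemma entries_outside:
  assumes G: "mstage len m G" and ij: "m \<le> i \<or> m \<le> j"
  shows "entries len G i j = \<zero>\<^bsub>rsh_stage D len\<^esub>"
proof -
  have "blk (rsh_size D l) (G l x) i j = 0\<^sub>m (rsh_size D l) (rsh_size D l)"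
    if "l \<le> len" "x \<in> topspace (rsh_space D l)" for l x
    by (rule blk_outside[OF mstage_supp[OF G that] ij])
  then show ?thesis by (auto simp: entries_def stage_simps(6) fun_eq_iff restrict_def)
qed

lemma entries_matrices:
  assumes G: "mstage len m G"
  shows "entries len G \<in> matrices (rsh_algebra D) m"
  using mstage_carrier[OF G] entries_outside[OF G] by (simp add: matrices_def rsh_algebra_def stage_simps(1))

lemma entries_matrices_inf: "mstage len m G \<Longrightarrow> entries len G \<in> matrices_inf (rsh_algebra D)"
  using entries_matrices by (auto simp: matrices_inf_def)

lemma minf_mult_entries:
  assumes G: "mstage len m G" and H: "mstage len m H"
  shows "minf_mult (rsh_algebra D) (entries len G) (entries len H) = entries len (\<lambda>l x. G l x * H l x)"
proof (intro ext)
  fix i j l x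
  let ?I = "{r. pointwise D len (*) (entries len G i r) (entries len H r j) \<noteq> \<zero>\<^bsub>rsh_stage D len\<^esub>}"
  have "?I \<subseteq> {..<m}"
  proof
    fix r assume r: "r \<in> ?I"
    show "r \<in> {..<m}"
    proof (rule ccontr)
      assume "r \<notin> {..<m}"
      then have 0: "entries len G i r = \<zero>\<^bsub>rsh_stage D len\<^esub>" by (intro entries_outside[OF G]) auto
      have "\<zero>\<^bsub>rsh_stage D len\<^esub> l x * entries len H r j l x = \<zero>\<^bsub>rsh_stage D len\<^esub> l x"
        if l: "l \<le> len" and x: "x \<in> topspace (rsh_space D l)" for l x
        unfolding zero_at[OF l x] by (rule left_mult_zero_mat[OF stage_mat[OF mstage_carrier[OF H] l x]])
      then have "pointwise D len (*) (entries len G i r) (entries len H r j) = \<zero>\<^bsub>rsh_stage D len\<^esub>"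
        unfolding 0 by (auto simp: pointwise_def stage_simps(6) fun_eq_iff restrict_def)
      then show False using r by simp
    qed
  qed
  then have "finsum (rsh_stage D len) (\<lambda>r. pointwise D len (*) (entries len G i r) (entries len H r j)) ?I =
      entries len (\<lambda>l x. G l x * H l x) i j"
    by (intro entries_mult_finsum[OF order_refl G H]) auto
  then show "minf_mult (rsh_algebra D) (entries len G) (entries len H) i j l x = entries len (\<lambda>l x. G l x * H l x) i j l x"
    unfolding minf_mult_def rsh_algebra_def stage_simps(2) by simp
qed

lemma minf_star_entries: "minf_star (rsh_algebra D) (entries len G) = entries len (\<lambda>l x. adj (G l x))"
  by (intro ext) (simp only: minf_star_def rsh_algebra_def stage_simps(5) entries_adj)

lemma entries_inject:
  assumes G: "mstage len m G" and H: "mstage len m H" and eq: "entries len G = entries len H"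
    and l: "l \<le> len" and x: "x \<in> topspace (rsh_space D l)"
  shows "G l x = H l x"
proof -
  have "blk (rsh_size D l) (G l x) = blk (rsh_size D l) (H l x)"
  proof (intro ext)
    fix i j
    have "entries len G i j l x = entries len H i j l x" using eq by simp
    then show "blk (rsh_size D l) (G l x) i j = blk (rsh_size D l) (H l x) i j" by (simp add: entries_at l x)
  qed
  then show ?thesis
    using unblk_blk[OF mstage_supp[OF G l x]] unblk_blk[OF mstage_supp[OF H l x]] by metis
qed

lemma mproj_mat_field:
  assumes p: "is_projection (rsh_algebra D) p" and m: "p \<in> matrices (rsh_algebra D) m"
  shows "mproj m (mat_field m p)"
proof -
  have P: "mstage len m (mat_field m p)" by (rule mstage_mat_field[OF m])
  note e = entries_mat_field[OF m]
  have "entries len (\<lambda>l x. mat_field m p l x * mat_field m p l x) = entries len (mat_field m p)"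
    using p minf_mult_entries[OF P P] by (simp add: e is_projection_def)
  then have 1: "mat_field m p l x * mat_field m p l x = mat_field m p l x" if "l \<le> len" "x \<in> topspace (rsh_space D l)" for l x
    by (rule entries_inject[OF mstage_mult[OF order_refl P P] P _ that])
  have "entries len (\<lambda>l x. adj (mat_field m p l x)) = entries len (mat_field m p)"
    using p minf_star_entries[of "mat_field m p"] by (simp add: e is_projection_def)
  then have 2: "adj (mat_field m p l x) = mat_field m p l x" if "l \<le> len" "x \<in> topspace (rsh_space D l)" for l x
    by (rule entries_inject[OF mstage_adj[OF order_refl P] P _ that])
  show ?thesis using P 1 2 by (simp add: mproj_def proj_def)
qed

lemma is_projection_entries:
  assumes p: "mproj m p"
  shows "is_projection (rsh_algebra D) (entries len p)"
proof -
  have P: "mstage len m p" using p by (simp add: mproj_def)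
  have "entries len (\<lambda>l x. p l x * p l x) = entries len p" "entries len (\<lambda>l x. adj (p l x)) = entries len p"
    using p by (auto intro!: entries_cong simp: mproj_def proj_def)
  then show ?thesis
    unfolding is_projection_def minf_mult_entries[OF P P] minf_star_entries using entries_matrices_inf[OF P] by simp
qed

text \<open>From here on ranks are traces, which add up over orthogonal sums and agree for equivalent projections.\<close>

lemma rsh_rank_eq:
  assumes p: "is_projection (rsh_algebra D) p" and m: "p \<in> matrices (rsh_algebra D) m"
    and l: "l \<le> len" and x: "x \<in> topspace (rsh_space D l)"
  shows "real (rsh_rank D (l, x) p) = Re (tr (mat_field m p l x))"
proof -
  let ?n = "rsh_size D l"
  define b where "b = (\<lambda>i j. p i j l x)"
  define M where "M = (LEAST m. \<forall>i j. m \<le> i \<or> m \<le> j \<longrightarrow> b i j = 0\<^sub>m ?n ?n)"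
  have bm: "\<forall>i j. m \<le> i \<or> m \<le> j \<longrightarrow> b i j = 0\<^sub>m ?n ?n"
    using matrices_outside[OF m] zero_at[OF l x] by (simp add: b_def)
  have bM: "\<forall>i j. M \<le> i \<or> M \<le> j \<longrightarrow> b i j = 0\<^sub>m ?n ?n" unfolding M_def by (rule LeastI[of "\<lambda>m. \<forall>i j. m \<le> i \<or> m \<le> j \<longrightarrow> b i j = 0\<^sub>m ?n ?n", OF bm])
  have Mm: "M \<le> m" unfolding M_def by (rule Least_le[of "\<lambda>m. \<forall>i j. m \<le> i \<or> m \<le> j \<longrightarrow> b i j = 0\<^sub>m ?n ?n", OF bm])
  have n: "0 < ?n" using space(3)[OF l] by simp
  have un: "unblk ?n M b = unblk ?n m b"
  proof (rule finmat_eqI)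
    fix r s
    have "b (r div ?n) (s div ?n) $$ (r mod ?n, s mod ?n) = 0" if "\<not> (r < M * ?n \<and> s < M * ?n)"
    proof -
      have "M \<le> r div ?n \<or> M \<le> s div ?n" using that n by (auto simp: less_eq_div_iff_mult_less_eq not_less)
      then have "b (r div ?n) (s div ?n) = 0\<^sub>m ?n ?n" by (rule bM[rule_format])
      then show ?thesis using n by simp
    qed
    moreover have "M * ?n \<le> m * ?n" using Mm by (rule mult_le_mono1)
    then have "r < M * ?n \<Longrightarrow> r < m * ?n" "s < M * ?n \<Longrightarrow> s < m * ?n" by linarith+
    ultimately show "ent (unblk ?n M b) r s = ent (unblk ?n m b) r s" by (auto simp: ent_unblk)
  qed
  have mat: "Matrix.mat (M * ?n) (M * ?n) (\<lambda>(r, s). b (r div ?n) (s div ?n) $$ (r mod ?n, s mod ?n)) =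
      to_mat (M * ?n) (unblk ?n M b)"
    by (rule eq_matI) (auto simp: to_mat_def ent_unblk)
  have "rsh_ev_inf (l, x) p = b" by (simp add: rsh_ev_inf_def rsh_ev_def b_def)
  then have "rsh_rank D (l, x) p = vec_space.rank (M * ?n) (to_mat (M * ?n) (unblk ?n M b))"
    by (simp only: rsh_rank_def minf_rank_def Let_def fst_conv M_def[symmetric] mat)
  moreover have "proj (unblk ?n M b)"
    using mproj_mat_field[OF p m] l x unfolding un by (simp add: mproj_def mat_field_def b_def)
  ultimately show ?thesis using rank_eq_tr[of "unblk ?n M b" "M * ?n"] un by (simp add: mat_field_def b_def)
qed

section \<open>Comparison and cancellation\<close>

text \<open>The range projection of an isometry \<open>v\<close> from \<open>q\<close> into \<open>p\<close> is the required subprojection of \<open>p\<close>.\<close>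

lemma comparison:
  assumes p: "is_projection (rsh_algebra D) p" and q: "is_projection (rsh_algebra D) q"
    and dim: "\<And>l. l \<le> len \<Longrightarrow> compact_dim (rsh_space D l) (d l)"
    and rank: "\<And>l x. l \<le> len \<Longrightarrow> x \<in> topspace (rsh_space D l) \<Longrightarrow>
       rsh_ev_zero D (l, x) q \<or> 2 * real (rsh_rank D (l, x) q) + real (d l) \<le> 2 * real (rsh_rank D (l, x) p) + 1"
  shows "mvn_subequiv (rsh_algebra D) q p"
proof -
  obtain m1 m2 where "p \<in> matrices (rsh_algebra D) m1" "q \<in> matrices (rsh_algebra D) m2"
    using p q by (auto simp: is_projection_def matrices_inf_def)
  then obtain m where m: "p \<in> matrices (rsh_algebra D) m" "q \<in> matrices (rsh_algebra D) m"
    using matrices_mono[of p _ m1 "max m1 m2"] matrices_mono[of q _ m2 "max m1 m2"] by fastforce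
  define P Q where "P = mat_field m p" and "Q = mat_field m q"
  have P: "mproj m P" and Q: "mproj m Q" unfolding P_def Q_def by (rule mproj_mat_field[OF p m(1)], rule mproj_mat_field[OF q m(2)])
  have r: "Q l x = 0 \<or> 2 * Re (tr (Q l x)) + real (d l) \<le> 2 * Re (tr (P l x)) + 1"
    if l: "l \<le> len" and x: "x \<in> topspace (rsh_space D l)" for l x
  proof (cases "rsh_ev_zero D (l, x) q")
    case True
    have n: "0 < rsh_size D l" using space(3)[OF l] by simp
    have "q i j l x = 0\<^sub>m (rsh_size D l) (rsh_size D l)" for i j
      using fun_cong[OF fun_cong[OF True[unfolded rsh_ev_zero_def]], of i j] by (simp add: rsh_ev_inf_def rsh_ev_def)
    then have "Q l x = 0" using n by (intro finmat_eqI) (simp add: Q_def mat_field_def ent_unblk)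
    then show ?thesis by simp
  next
    case False
    then show ?thesis using rank[OF l x] rsh_rank_eq[OF p m(1) l x] rsh_rank_eq[OF q m(2) l x] by (simp add: P_def Q_def)
  qed
  obtain v where v: "mstage len m v"
    "\<And>l x. l \<le> len \<Longrightarrow> x \<in> topspace (rsh_space D l) \<Longrightarrow> adj (v l x) * v l x = Q l x \<and> P l x * v l x = v l x"
    using stage_isometry[OF P Q dim r order_refl] by blast
  have v': "mstage len m (\<lambda>l x. adj (v l x))" by (rule mstage_adj[OF order_refl v(1)])
  define R where "R l x = v l x * adj (v l x)" for l x
  have Rm: "mstage len m R" unfolding R_def by (rule mstage_mult[OF order_refl v(1) v'])
  have R: "mproj m R"
    unfolding mproj_def
  proof (intro conjI allI impI ballI Rm)
    fix l x assume l: "l \<le> len" and x: "x \<in> topspace (rsh_space D l)"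
    have vQ: "v l x * Q l x = v l x"
      using Q v(2)[OF l x] l x by (intro isometry_mult_right) (auto simp: mproj_def)
    have "R l x * R l x = v l x * (adj (v l x) * v l x) * adj (v l x)" by (simp add: R_def mult.assoc)
    also have "\<dots> = R l x" using v(2)[OF l x] vQ by (simp add: R_def)
    finally show "proj (R l x)" by (simp add: proj_def R_def adj_mult)
  qed
  have Pm: "mstage len m P" using P by (simp add: mproj_def)
  have "entries len (\<lambda>l x. P l x * R l x) = entries len R"
    using v(2) by (intro entries_cong) (simp add: R_def flip: mult.assoc)
  then have "subprojection (rsh_algebra D) (entries len R) p"
    unfolding subprojection_def using is_projection_entries[OF R] minf_mult_entries[OF Pm Rm] entries_mat_field[OF m(1)] by (simp add: P_def)
  moreover have "entries len (\<lambda>l x. adj (v l x) * v l x) = q"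
    using entries_cong[of len "\<lambda>l x. adj (v l x) * v l x" Q] v(2) entries_mat_field[OF m(2)] by (simp add: Q_def)
  then have "mvn_equiv (rsh_algebra D) q (entries len R)"
    unfolding mvn_equiv_def
    using entries_matrices_inf[OF v(1)] minf_mult_entries[OF v' v(1)] minf_mult_entries[OF v(1) v'] minf_star_entries[of v]
    by (intro bexI[of _ "entries len v"]) (auto simp: R_def[abs_def])
  ultimately show ?thesis unfolding mvn_subequiv_def by blast
qed

text \<open>The copy of \<open>q\<close> that is shifted by \<open>a\<close> rows and \<open>b\<close> columns: with \<open>a = b\<close> it is a summand of a block sum, and
  with \<open>a \<noteq> b\<close> the canonical partial isometry between two such summands.\<close>

definition shift_blocks :: "nat \<Rightarrow> nat \<Rightarrow> (nat \<Rightarrow> nat \<Rightarrow> nat \<Rightarrow> 'x \<Rightarrow> complex mat) \<Rightarrow> nat \<Rightarrow> nat \<Rightarrow> nat \<Rightarrow> 'x \<Rightarrow> complex mat" where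
  "shift_blocks a b q = (\<lambda>i j. if a \<le> i \<and> b \<le> j then q (i - a) (j - b) else \<zero>\<^bsub>rsh_algebra D\<^esub>)"

lemma shift_blocks_matrices:
  assumes q: "q \<in> matrices (rsh_algebra D) mq" and M: "a + mq \<le> M" "b + mq \<le> M"
  shows "shift_blocks a b q \<in> matrices (rsh_algebra D) M"
  unfolding matrices_def
proof (intro CollectI conjI allI impI)
  fix i j
  have "\<zero>\<^bsub>rsh_algebra D\<^esub> \<in> carrier (rsh_algebra D)"
    unfolding rsh_algebra_def stage_simps(1) by (rule stage_zero_closed) simp
  then show "shift_blocks a b q i j \<in> carrier (rsh_algebra D)" using q by (simp add: shift_blocks_def matrices_def)
  assume "M \<le> i \<or> M \<le> j"
  then have "mq \<le> i - a \<or> mq \<le> j - b" using M by linarith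
  then show "shift_blocks a b q i j = \<zero>\<^bsub>rsh_algebra D\<^esub>" using q by (auto simp: shift_blocks_def matrices_def)
qed

lemma block_sum_matrices:
  assumes e: "e \<in> matrices (rsh_algebra D) m" and q: "q \<in> matrices (rsh_algebra D) mq" and M: "m + mq \<le> M"
  shows "block_sum (rsh_algebra D) m e q \<in> matrices (rsh_algebra D) M"
  unfolding matrices_def
proof (intro CollectI conjI allI impI)
  fix i j
  have "\<zero>\<^bsub>rsh_algebra D\<^esub> \<in> carrier (rsh_algebra D)"
    unfolding rsh_algebra_def stage_simps(1) by (rule stage_zero_closed) simp
  then show "block_sum (rsh_algebra D) m e q i j \<in> carrier (rsh_algebra D)"
    using e q by (simp add: block_sum_def matrices_def)
  assume "M \<le> i \<or> M \<le> j"
  then have "mq \<le> i - m \<or> mq \<le> j - m" "\<not> (i < m \<and> j < m)" using M by linarith+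
  then show "block_sum (rsh_algebra D) m e q i j = \<zero>\<^bsub>rsh_algebra D\<^esub>"
    using q by (auto simp: block_sum_def matrices_def)
qed

lemma mat_field_shift_blocks:
  assumes q: "q \<in> matrices (rsh_algebra D) mq" and M: "a + mq \<le> M" "b + mq \<le> M"
    and l: "l \<le> len" and x: "x \<in> topspace (rsh_space D l)"
  shows "mat_field M (shift_blocks a b q) l x = shift (a * rsh_size D l) (b * rsh_size D l) (mat_field mq q l x)"
proof (rule finmat_eqI)
  fix r s
  let ?n = "rsh_size D l"
  have n: "0 < ?n" using space(3)[OF l] by simp
  have z: "\<zero>\<^bsub>rsh_algebra D\<^esub> l x = 0\<^sub>m ?n ?n" using zero_at[OF l x] by (simp add: rsh_algebra_def)
  have iff: "a * ?n \<le> r \<longleftrightarrow> a \<le> r div ?n" "b * ?n \<le> s \<longleftrightarrow> b \<le> s div ?n"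
    using n by (simp_all add: less_eq_div_iff_mult_less_eq)
  show "ent (mat_field M (shift_blocks a b q) l x) r s = ent (shift (a * ?n) (b * ?n) (mat_field mq q l x)) r s"
  proof (cases "a * ?n \<le> r \<and> b * ?n \<le> s")
    case False
    then have "shift_blocks a b q (r div ?n) (s div ?n) l x = 0\<^sub>m ?n ?n" using iff z by (auto simp: shift_blocks_def)
    then show ?thesis using False n by (auto simp: mat_field_def ent_unblk ent_shift)
  next
    case True
    then obtain r' s' where rs: "r = a * ?n + r'" "s = b * ?n + s'" by (metis le_iff_add)
    have sb: "shift_blocks a b q (r div ?n) (s div ?n) l x = q (r' div ?n) (s' div ?n) l x"
      using n by (simp add: shift_blocks_def rs)
    have out: "q (r' div ?n) (s' div ?n) l x $$ (r' mod ?n, s' mod ?n) = 0" if "\<not> (r' < mq * ?n \<and> s' < mq * ?n)"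
    proof -
      have "mq \<le> r' div ?n \<or> mq \<le> s' div ?n" using that n by (auto simp: less_eq_div_iff_mult_less_eq not_less)
      then show ?thesis using matrices_outside[OF q] zero_at[OF l x] n by simp
    qed
    have "(a + mq) * ?n \<le> M * ?n" "(b + mq) * ?n \<le> M * ?n" using M by (intro mult_le_mono1; simp)+
    then have lt: "r' < mq * ?n \<Longrightarrow> r < M * ?n" "s' < mq * ?n \<Longrightarrow> s < M * ?n"
      unfolding rs distrib_right by linarith+
    have md: "r mod ?n = r' mod ?n" "s mod ?n = s' mod ?n" unfolding rs by simp_all
    have L: "ent (mat_field M (shift_blocks a b q) l x) r s =
        (if r < M * ?n \<and> s < M * ?n then q (r' div ?n) (s' div ?n) l x $$ (r' mod ?n, s' mod ?n) else 0)"
      by (simp add: mat_field_def ent_unblk sb md)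
    have R: "ent (shift (a * ?n) (b * ?n) (mat_field mq q l x)) r s =
        (if r' < mq * ?n \<and> s' < mq * ?n then q (r' div ?n) (s' div ?n) l x $$ (r' mod ?n, s' mod ?n) else 0)"
      by (simp add: ent_shift mat_field_def ent_unblk rs)
    show ?thesis
    proof (cases "r' < mq * ?n \<and> s' < mq * ?n")
      case True
      then show ?thesis unfolding L R using lt by simp
    next
      case False
      then show ?thesis unfolding L R using out by simp
    qed
  qed
qed

lemma mat_field_block_sum:
  assumes e: "e \<in> matrices (rsh_algebra D) m"
    and l: "l \<le> len" and x: "x \<in> topspace (rsh_space D l)"
  shows "mat_field M (block_sum (rsh_algebra D) m e q) l x = mat_field M e l x + mat_field M (shift_blocks m m q) l x"
proof (rule finmat_eqI)
  fix r s
  let ?n = "rsh_size D l"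
  have n: "0 < ?n" using space(3)[OF l] by simp
  have z: "\<zero>\<^bsub>rsh_algebra D\<^esub> l x = 0\<^sub>m ?n ?n" using zero_at[OF l x] by (simp add: rsh_algebra_def)
  have eo: "e i j l x = 0\<^sub>m ?n ?n" if "m \<le> i \<or> m \<le> j" for i j
    using matrices_outside[OF e that] zero_at[OF l x] by simp
  have "block_sum (rsh_algebra D) m e q i j l x $$ (u, v) = e i j l x $$ (u, v) + shift_blocks m m q i j l x $$ (u, v)"
    if "u < ?n" "v < ?n" for i j u v
    using that z eo by (auto simp: block_sum_def shift_blocks_def not_less)
  then show "ent (mat_field M (block_sum (rsh_algebra D) m e q) l x) r s = ent (mat_field M e l x + mat_field M (shift_blocks m m q) l x) r s"
    using n by (simp add: mat_field_def ent_unblk)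
qed

lemma supp_mat_field:
  assumes e: "e \<in> matrices (rsh_algebra D) m" and l: "l \<le> len" and x: "x \<in> topspace (rsh_space D l)"
  shows "supp (m * rsh_size D l) (mat_field M e l x)"
  unfolding supp_def
proof (intro allI impI)
  fix r s
  let ?n = "rsh_size D l"
  have n: "0 < ?n" using space(3)[OF l] by simp
  assume "m * ?n \<le> r \<or> m * ?n \<le> s"
  then have "m \<le> r div ?n \<or> m \<le> s div ?n" using n by (auto simp: less_eq_div_iff_mult_less_eq)
  then have "e (r div ?n) (s div ?n) l x = 0\<^sub>m ?n ?n" using matrices_outside[OF e] zero_at[OF l x] by simp
  then show "ent (mat_field M e l x) r s = 0" using n by (simp add: mat_field_def ent_unblk)
qed

text \<open>Let \<open>w\<close> implement \<open>e \<oplus> q \<sim> f \<oplus> q\<close>, and let \<open>q1\<close>, \<open>q2\<close> be the two copies of \<open>q\<close> and \<open>s\<close> the shift from \<open>q1\<close> to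
  \<open>q2\<close>. Then \<open>w q1\<close> and \<open>s\<close> are isometries from \<open>q1\<close> into \<open>f \<oplus> q\<close>, and the hypothesis on the rank of \<open>e\<close> is what is
  needed to move the first to the second by unitaries of \<open>f \<oplus> q\<close>. After these have been applied
  to \<open>w\<close>, it maps \<open>q1\<close> onto \<open>q2\<close> and hence \<open>e\<close> onto \<open>f\<close>.\<close>

lemma cancellation:
  assumes e: "is_projection (rsh_algebra D) e" "e \<in> matrices (rsh_algebra D) m"
    and f: "is_projection (rsh_algebra D) f" "f \<in> matrices (rsh_algebra D) m'"
    and q: "is_projection (rsh_algebra D) q"
    and eqv: "mvn_equiv (rsh_algebra D) (block_sum (rsh_algebra D) m e q) (block_sum (rsh_algebra D) m' f q)"
    and dim: "\<And>l. l \<le> len \<Longrightarrow> compact_dim (rsh_space D l) (d l)"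
    and rank: "\<And>l x. l \<le> len \<Longrightarrow> x \<in> topspace (rsh_space D l) \<Longrightarrow> real (d l) \<le> 2 * real (rsh_rank D (l, x) e)"
  shows "mvn_equiv (rsh_algebra D) e f"
proof -
  let ?A = "rsh_algebra D"
  obtain mq where mq: "q \<in> matrices ?A mq" using q by (auto simp: is_projection_def matrices_inf_def)
  obtain w mw where w: "w \<in> matrices ?A mw" "minf_mult ?A (minf_star ?A w) w = block_sum ?A m e q"
     "minf_mult ?A w (minf_star ?A w) = block_sum ?A m' f q"
    using eqv by (auto simp: mvn_equiv_def matrices_inf_def)
  define M where "M = m + m' + mq + mw"
  have eM: "e \<in> matrices ?A M" and fM: "f \<in> matrices ?A M" and wM: "w \<in> matrices ?A M"
    using matrices_mono[OF e(2), of M] matrices_mono[OF f(2), of M] matrices_mono[OF w(1), of M] by (auto simp: M_def)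
  have bE: "block_sum ?A m e q \<in> matrices ?A M" and bF: "block_sum ?A m' f q \<in> matrices ?A M"
    using block_sum_matrices[OF e(2) mq, of M] block_sum_matrices[OF f(2) mq, of M] by (auto simp: M_def)
  have sM: "shift_blocks a b q \<in> matrices ?A M" if "a \<in> {m, m'}" "b \<in> {m, m'}" for a b
    using shift_blocks_matrices[OF mq, of a M b] that by (auto simp: M_def)
  define E F W where "E = mat_field M e" and "F = mat_field M f" and "W = mat_field M w"
  define sh where "sh a b = mat_field M (shift_blocks a b q)" for a b
  define BE BF where "BE = mat_field M (block_sum ?A m e q)" and "BF = mat_field M (block_sum ?A m' f q)"
  have EM: "mstage len M E" and FM: "mstage len M F" and WM: "mstage len M W" and BFM: "mstage len M BF" and BEM: "mstage len M BE"
    unfolding E_def F_def W_def BF_def BE_def by (rule mstage_mat_field; fact)+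
  have shM: "mstage len M (sh a b)" if "a \<in> {m, m'}" "b \<in> {m, m'}" for a b
    unfolding sh_def by (rule mstage_mat_field[OF sM[OF that]])
  have Wa: "mstage len M (\<lambda>l x. adj (W l x))" by (rule mstage_adj[OF order_refl WM])
  have Ep: "mproj M E" and Fp: "mproj M F"
    unfolding E_def F_def by (rule mproj_mat_field[OF e(1) eM], rule mproj_mat_field[OF f(1) fM])
  have Qp: "mproj mq (mat_field mq q)" by (rule mproj_mat_field[OF q mq])
  have "entries len (\<lambda>l x. adj (W l x) * W l x) = entries len BE"
    using w(2) minf_mult_entries[OF Wa WM] minf_star_entries[of W] entries_mat_field[OF wM] entries_mat_field[OF bE] by (simp add: W_def BE_def)
  then have WW: "adj (W l x) * W l x = BE l x" if "l \<le> len" "x \<in> topspace (rsh_space D l)" for l x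
    by (rule entries_inject[OF mstage_mult[OF order_refl Wa WM] BEM _ that])
  have "entries len (\<lambda>l x. W l x * adj (W l x)) = entries len BF"
    using w(3) minf_mult_entries[OF WM Wa] minf_star_entries[of W] entries_mat_field[OF wM] entries_mat_field[OF bF] by (simp add: W_def BF_def)
  then have WW': "W l x * adj (W l x) = BF l x" if "l \<le> len" "x \<in> topspace (rsh_space D l)" for l x
    by (rule entries_inject[OF mstage_mult[OF order_refl WM Wa] BFM _ that])
  define q1 q2 s where "q1 = sh m m" and "q2 = sh m' m'" and "s = sh m' m"
  have pt: "BE l x = E l x + q1 l x" "BF l x = F l x + q2 l x" "adj (s l x) * s l x = q1 l x" "s l x * adj (s l x) = q2 l x"
    "proj (q1 l x)" "proj (q2 l x)" "E l x * q1 l x = 0" "q1 l x * E l x = 0" "F l x * s l x = 0"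
    "F l x * q2 l x = 0" "q2 l x * F l x = 0" "q2 l x * s l x = s l x" "proj (E l x)" "proj (F l x)"
    if l: "l \<le> len" and x: "x \<in> topspace (rsh_space D l)" for l x
  proof -
    define Q where "Q = mat_field mq q l x"
    have Q: "proj Q" using Qp l x by (simp add: mproj_def Q_def)
    then have QQ: "Q * Q = Q" "adj Q = Q" by (auto simp: proj_def)
    have sh: "sh a b l x = shift (a * rsh_size D l) (b * rsh_size D l) Q" if "a \<in> {m, m'}" "b \<in> {m, m'}" for a b
      unfolding sh_def Q_def using that by (intro mat_field_shift_blocks[OF mq _ _ l x]) (auto simp: M_def)
    have q1: "q1 l x = shift (m * rsh_size D l) (m * rsh_size D l) Q"
      and q2: "q2 l x = shift (m' * rsh_size D l) (m' * rsh_size D l) Q"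
      and s: "s l x = shift (m' * rsh_size D l) (m * rsh_size D l) Q"
      unfolding q1_def q2_def s_def by (rule sh; simp)+
    show "BE l x = E l x + q1 l x" unfolding BE_def E_def q1_def sh_def by (rule mat_field_block_sum[OF e(2) l x])
    show "BF l x = F l x + q2 l x" unfolding BF_def F_def q2_def sh_def by (rule mat_field_block_sum[OF f(2) l x])
    show "adj (s l x) * s l x = q1 l x" "s l x * adj (s l x) = q2 l x" "q2 l x * s l x = s l x"
      unfolding s q1 q2 by (simp_all add: adj_shift shift_mult_shift QQ)
    show "proj (q1 l x)" "proj (q2 l x)" unfolding q1 q2 by (simp_all add: proj_def adj_shift shift_mult_shift QQ)
    show pE: "proj (E l x)" and pF: "proj (F l x)" using Ep Fp l x by (simp_all add: mproj_def)
    have Es: "supp (m * rsh_size D l) (E l x)" unfolding E_def by (rule supp_mat_field[OF e(2) l x])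
    have Fs: "supp (m' * rsh_size D l) (F l x)" unfolding F_def by (rule supp_mat_field[OF f(2) l x])
    show Eq: "E l x * q1 l x = 0" unfolding q1 by (rule mult_shift_zero[OF Es])
    show Fq: "F l x * q2 l x = 0" unfolding q2 by (rule mult_shift_zero[OF Fs])
    show "F l x * s l x = 0" unfolding s by (rule mult_shift_zero[OF Fs])
    have "adj (E l x * q1 l x) = 0" using Eq by simp
    then show "q1 l x * E l x = 0" using pE \<open>proj (q1 l x)\<close> by (simp add: adj_mult proj_def)
    have "adj (F l x * q2 l x) = 0" using Fq by simp
    then show "q2 l x * F l x = 0" using pF \<open>proj (q2 l x)\<close> by (simp add: adj_mult proj_def)
  qed
  have pBE: "proj (BE l x)" and pBF: "proj (BF l x)" if l: "l \<le> len" and x: "x \<in> topspace (rsh_space D l)" for l x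
    using pt[OF l x] by (simp_all add: proj_def adj_add distrib_left distrib_right)
  have BFp: "mproj M BF" using BFM pBF by (simp add: mproj_def)
  have q1p: "mproj M q1" using shM[of m m] pt(5) by (simp add: mproj_def q1_def)
  have WBE: "W l x * BE l x = W l x" if l: "l \<le> len" and x: "x \<in> topspace (rsh_space D l)" for l x
    by (rule isometry_mult_right[OF pBE[OF l x] WW[OF l x]])
  have BFW: "BF l x * W l x = W l x" if l: "l \<le> len" and x: "x \<in> topspace (rsh_space D l)" for l x
    using WBE[OF l x] WW[OF l x] WW'[OF l x] by (metis mult.assoc)
  define t where "t l x = W l x * q1 l x" for l x
  have tM: "mstage len M t" unfolding t_def by (intro mstage_mult[OF order_refl WM]) (simp add: q1_def shM)
  have sM': "mstage len M s" by (simp add: s_def shM)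
  have iso: "adj (t l x) * t l x = q1 l x \<and> BF l x * t l x = t l x \<and> adj (s l x) * s l x = q1 l x \<and> BF l x * s l x = s l x"
    if l: "l \<le> len" and x: "x \<in> topspace (rsh_space D l)" for l x
  proof (intro conjI)
    note p = pt[OF l x]
    have "adj (t l x) * t l x = q1 l x * (adj (W l x) * W l x) * q1 l x"
      using p(5) by (simp add: t_def adj_mult proj_def mult.assoc)
    also have "\<dots> = q1 l x" using p by (simp add: WW[OF l x] distrib_left proj_def)
    finally show "adj (t l x) * t l x = q1 l x" .
    show "BF l x * t l x = t l x" using BFW[OF l x] by (simp add: t_def flip: mult.assoc)
    show "adj (s l x) * s l x = q1 l x" by (rule p(3))
    show "BF l x * s l x = s l x" using p(2,9,12) by (simp add: distrib_right)
  qed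
  have rk: "2 * Re (tr (q1 l x)) + real (d l) \<le> 2 * Re (tr (BF l x))"
    if l: "l \<le> len" and x: "x \<in> topspace (rsh_space D l)" for l x
  proof -
    have "tr (BF l x) = tr (BE l x)"
      unfolding WW[OF l x, symmetric] WW'[OF l x, symmetric] by (rule tr_mult_commute)
    also have "\<dots> = tr (E l x) + tr (q1 l x)" using pt(1)[OF l x] by (simp add: tr_add)
    finally show ?thesis using rank[OF l x] rsh_rank_eq[OF e(1) eM l x] by (simp add: E_def)
  qed
  obtain Ss where Ss: "\<forall>S\<in>set Ss. skew_in len M BF S"
    "\<forall>l\<le>len. \<forall>x\<in>topspace (rsh_space D l). chain (map (\<lambda>S. S l x) Ss) (t l x) = s l x"
    using stage_move[OF BFp q1p dim rk tM sM' iso order_refl] by blast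
  \<comment> \<open>\<open>w\<close> followed by the unitaries that move \<open>w q1\<close> to \<open>s\<close>\<close>
  define W' where "W' l x = chain (map (\<lambda>S. S l x) Ss) (W l x)" for l x
  have W'M: "mstage len M W'"
    unfolding W'_def using mstage_chain[OF order_refl WM, of Ss] Ss(1) by (auto simp: skew_in_def)
  define V where "V l x = W' l x * E l x" for l x
  have VM: "mstage len M V" unfolding V_def by (rule mstage_mult[OF order_refl W'M EM])
  have VV: "adj (V l x) * V l x = E l x \<and> V l x * adj (V l x) = F l x"
    if l: "l \<le> len" and x: "x \<in> topspace (rsh_space D l)" for l x
  proof -
    note p = pt[OF l x]
    have Sx: "\<forall>S\<in>set (map (\<lambda>S. S l x) Ss). adj S = - S \<and> BF l x * S = S \<and> S * BF l x = S"
      using Ss(1) l x by (auto simp: skew_in_def)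
    have W'W': "adj (W' l x) * W' l x = BE l x"
      unfolding W'_def using Sx WW[OF l x] by (subst chain_isometry) auto
    have W'BF: "W' l x * adj (W' l x) = BF l x"
      unfolding W'_def using chain_range[OF Sx WW'[OF l x]] .
    have W'q: "W' l x * q1 l x = s l x"
      using Ss(2) l x unfolding W'_def t_def by (simp add: chain_mult)
    have E: "E l x * E l x = E l x" "adj (E l x) = E l x" and q1: "q1 l x * q1 l x = q1 l x" "adj (q1 l x) = q1 l x"
      using p(13,5) by (auto simp: proj_def)
    have "adj (V l x) * V l x = E l x * (adj (W' l x) * W' l x) * E l x"
      by (simp add: V_def adj_mult E mult.assoc)
    also have "\<dots> = E l x" using p by (simp add: W'W' distrib_left E)
    finally have 1: "adj (V l x) * V l x = E l x" .
    have W'BE: "W' l x * BE l x = W' l x" by (rule isometry_mult_right[OF pBE[OF l x] W'W'])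
    have "(W' l x * q1 l x) * adj (W' l x * q1 l x) = W' l x * (q1 l x * q1 l x) * adj (W' l x)"
      unfolding adj_mult q1(2) by (simp only: mult.assoc)
    then have "W' l x * q1 l x * adj (W' l x) = (W' l x * q1 l x) * adj (W' l x * q1 l x)"
      unfolding q1(1) by simp
    then have qq: "W' l x * q1 l x * adj (W' l x) = q2 l x" using W'q p(4) by simp
    have "V l x * adj (V l x) = W' l x * (E l x * E l x) * adj (W' l x)"
      unfolding V_def adj_mult E(2) by (simp only: mult.assoc)
    also have "\<dots> = W' l x * (BE l x - q1 l x) * adj (W' l x)" using p(1) by (simp add: E)
    also have "\<dots> = W' l x * BE l x * adj (W' l x) - W' l x * q1 l x * adj (W' l x)"
      by (simp add: right_diff_distrib left_diff_distrib)
    also have "\<dots> = F l x" unfolding W'BE W'BF qq p(2) by simp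
    finally show ?thesis using 1 by simp
  qed
  have Va: "mstage len M (\<lambda>l x. adj (V l x))" by (rule mstage_adj[OF order_refl VM])
  have "entries len (\<lambda>l x. adj (V l x) * V l x) = e"
    using entries_cong[of len "\<lambda>l x. adj (V l x) * V l x" E] VV entries_mat_field[OF eM] by (simp add: E_def)
  moreover have "entries len (\<lambda>l x. V l x * adj (V l x)) = f"
    using entries_cong[of len "\<lambda>l x. V l x * adj (V l x)" F] VV entries_mat_field[OF fM] by (simp add: F_def)
  ultimately show ?thesis
    unfolding mvn_equiv_def
    using entries_matrices_inf[OF VM] minf_mult_entries[OF Va VM] minf_mult_entries[OF VM Va] minf_star_entries[of V]
    by (intro bexI[of _ "entries len V"]) auto
qed

end

theorem proposition4p3:
  fixes D :: "'x rsh_data"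
    and p e f q :: "nat \<Rightarrow> nat \<Rightarrow> nat \<Rightarrow> 'x \<Rightarrow> complex mat"
  assumes "rsh_decomposition D"
    and "\<forall>k\<le>rsh_length D. finite_covering_dim (rsh_space D k)"
    and "is_projection (rsh_algebra D) p"
    and "is_projection (rsh_algebra D) e"
    and "is_projection (rsh_algebra D) f"
    and "is_projection (rsh_algebra D) q"
  shows "((\<forall>x\<in>rsh_total_space D.
              rsh_ev_zero D x q \<or>
              real (rsh_rank D x p) - real (rsh_rank D x q) \<ge> 1/2 * (real (rsh_topdim D x) - 1))
            \<longrightarrow> mvn_subequiv (rsh_algebra D) q p)
       \<and> (\<forall>m m'. e \<in> matrices (rsh_algebra D) m \<and> f \<in> matrices (rsh_algebra D) m' \<and>
            mvn_equiv (rsh_algebra D) (block_sum (rsh_algebra D) m e q)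
                                      (block_sum (rsh_algebra D) m' f q) \<and>
            (\<forall>x\<in>rsh_total_space D. real (rsh_rank D x e) \<ge> 1/2 * real (rsh_topdim D x))
            \<longrightarrow> mvn_equiv (rsh_algebra D) e f)"
proof -
  interpret rsh D by unfold_locales (rule assms(1))
  have dim: "compact_dim (rsh_space D l) (covering_dim (rsh_space D l))" if "l \<le> rsh_length D" for l
  proof -
    have "\<exists>d. covering_dim_le (rsh_space D l) d" using assms(2) that by (simp add: finite_covering_dim_def)
    then have "covering_dim_le (rsh_space D l) (covering_dim (rsh_space D l))"
      unfolding covering_dim_def by (rule LeastI_ex)
    then show ?thesis using space[OF that] by (simp add: compact_dim_def)
  qed
  show ?thesis
  proof (intro conjI impI allI)
    assume r: "\<forall>x\<in>rsh_total_space D. rsh_ev_zero D x q \<or>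
        real (rsh_rank D x p) - real (rsh_rank D x q) \<ge> 1/2 * (real (rsh_topdim D x) - 1)"
    show "mvn_subequiv (rsh_algebra D) q p"
    proof (rule comparison[OF assms(3,6) dim])
      fix l x assume "l \<le> rsh_length D" "x \<in> topspace (rsh_space D l)"
      then have "(l, x) \<in> rsh_total_space D" by (simp add: rsh_total_space_def)
      then show "rsh_ev_zero D (l, x) q \<or>
          2 * real (rsh_rank D (l, x) q) + real (covering_dim (rsh_space D l)) \<le> 2 * real (rsh_rank D (l, x) p) + 1"
        using r by (fastforce simp: rsh_topdim_def)
    qed
  next
    fix m m'
    assume h: "e \<in> matrices (rsh_algebra D) m \<and> f \<in> matrices (rsh_algebra D) m' \<and>
        mvn_equiv (rsh_algebra D) (block_sum (rsh_algebra D) m e q) (block_sum (rsh_algebra D) m' f q) \<and>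
        (\<forall>x\<in>rsh_total_space D. real (rsh_rank D x e) \<ge> 1/2 * real (rsh_topdim D x))"
    show "mvn_equiv (rsh_algebra D) e f"
    proof (rule cancellation[OF assms(4) _ assms(5) _ assms(6) _ dim])
      fix l x assume "l \<le> rsh_length D" "x \<in> topspace (rsh_space D l)"
      then have "(l, x) \<in> rsh_total_space D" by (simp add: rsh_total_space_def)
      then show "real (covering_dim (rsh_space D l)) \<le> 2 * real (rsh_rank D (l, x) e)"
        using h by (fastforce simp: rsh_topdim_def)
    qed (use h in auto)
  qed
qed

end
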